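(* Let $p$ be a prime, $m\ge 1$ an integer, and $F_0$ a field whose characteristic is either $0$ or $\geq p$; if $\operatorname{char}(F_0)\neq p$, assume that $F_0$ contains a primitive $p$th root of unity $\rho$. Let $\alpha_1,\beta_1,\dots,\alpha_m,\beta_m$ be independent transcendental elements over $F_0$, and let $F$ be either the rational function field $F_0(\alpha_1,\beta_1,\dots,\alpha_m,\beta_m)$ or the field of iterated Laurent series $F_0(\!(\alpha_1^{-1})\!)(\!(\beta_1^{-1})\!)\dots(\!(\alpha_m^{-1})\!)(\!(\beta_m^{-1})\!)$. Let $A=(\alpha_1,\beta_1)_{p,F}\otimes_F\dots\otimes_F(\alpha_m,\beta_m)_{p,F}$ if $\operatorname{char}(F_0)\neq p$, and $A=[\alpha_1,\beta_1)_{p,F}\otimes_F\dots\otimes_F[\alpha_m,\beta_m)_{p,F}$ if $\operatorname{char}(F_0)=p$. Then every $F$-subspace $V$ of $A$ satisfying $\operatorname{Tr}(v^{p-1})=0$ for all $v\in V$ has dimension over $F$ at most $\frac{p^{2m}-1}{p-1}$.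
   Context: Symbol algebras of degree $p$ over a field $F$: if $\operatorname{char}(F)\neq p$ and $F$ contains a primitive $p$th root of unity $\rho$, then for $\alpha,\beta\in F^\times$, $(\alpha,\beta)_{p,F}=F\langle x,y : x^p=\alpha,\ y^p=\beta,\ yxy^{-1}=\rho x\rangle$. If $\operatorname{char}(F)=p$, then for $\alpha\in F$ and $\beta\in F^\times$, $[\alpha,\beta)_{p,F}=F\langle x,y : x^p-x=\alpha,\ y^p=\beta,\ yxy^{-1}=x+1\rangle$. These are central simple $F$-algebras of degree $p$. $\operatorname{Tr}:A\to F$ denotes the reduced trace of the central simple $F$-algebra $A$. *)

theory Defs
  imports
    "HOL-Algebra.Algebraic_Closure_Type"
    "HOL-Algebra.Generated_Fields"
    "HOL-Algebra.Product_Groups"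
    "HOL-Computational_Algebra.Formal_Laurent_Series"
    "HOL-Library.Poly_Mapping"
    "Jordan_Normal_Form.VS_Connect"
begin

text \<open>
  The field \<open>F\<close> is the type \<open>'f\<close> (as a record: \<open>class_ring\<close>), and \<open>F\<^sub>0\<close> is a subfield of it,
  so that \<open>CHAR('f)\<close> is also the characteristic of \<open>F\<^sub>0\<close>.
\<close>

definition primitive_root_of_unity :: "nat \<Rightarrow> 'f::field \<Rightarrow> bool" where
  "primitive_root_of_unity n r \<longleftrightarrow> r ^ n = 1 \<and> (\<forall>k. 0 < k \<and> k < n \<longrightarrow> r ^ k \<noteq> 1)"

text \<open>
  Polynomials over \<open>K\<close> in the indeterminates \<open>I\<close> are finitely supported functions from exponent
  vectors to coefficients.
\<close>

definition algebraically_independent :: "'f::field set \<Rightarrow> 'i set \<Rightarrow> ('i \<Rightarrow> 'f) \<Rightarrow> bool" where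
  "algebraically_independent K I t \<longleftrightarrow>
     (\<forall>P :: ('i \<Rightarrow>\<^sub>0 nat) \<Rightarrow>\<^sub>0 'f.
        (\<forall>e. Poly_Mapping.lookup P e \<in> K) \<and>
        (\<forall>e\<in>Poly_Mapping.keys P. Poly_Mapping.keys e \<subseteq> I) \<and>
        (\<Sum>e\<in>Poly_Mapping.keys P. Poly_Mapping.lookup P e *
           (\<Prod>i\<in>Poly_Mapping.keys e. t i ^ Poly_Mapping.lookup e i)) = 0
        \<longrightarrow> P = 0)"

text \<open>
  \<open>L = K((t))\<close> for subfields \<open>K\<close>, \<open>L\<close> of \<open>'f\<close>: there is an isomorphism onto \<open>L\<close> from the field of
  formal Laurent series with coefficients in \<open>K\<close> that fixes \<open>K\<close> and maps the indeterminate to \<open>t\<close>.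
\<close>

definition laurent_series_field :: "'f::field set \<Rightarrow> 'f \<Rightarrow> 'f set \<Rightarrow> bool" where
  "laurent_series_field K t L \<longleftrightarrow>
     (\<exists>\<phi> :: 'f fls \<Rightarrow> 'f.
        bij_betw \<phi> {g. \<forall>n. fls_nth g n \<in> K} L \<and>
        (\<forall>g h. (\<forall>n. fls_nth g n \<in> K) \<longrightarrow> (\<forall>n. fls_nth h n \<in> K) \<longrightarrow>
           \<phi> (g + h) = \<phi> g + \<phi> h \<and> \<phi> (g * h) = \<phi> g * \<phi> h) \<and>
        (\<forall>c\<in>K. \<phi> (fls_const c) = c) \<and>
        \<phi> fls_X = t)"

text \<open>\<open>L = K((t\<^sub>1))((t\<^sub>2))\<dots>((t\<^sub>n))\<close>, the innermost variable coming first in the list.\<close>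

fun iterated_laurent_series_field :: "'f::field set \<Rightarrow> 'f list \<Rightarrow> 'f set \<Rightarrow> bool" where
  "iterated_laurent_series_field K [] L \<longleftrightarrow> L = K"
| "iterated_laurent_series_field K (t # ts) L \<longleftrightarrow>
     (\<exists>M. laurent_series_field K t M \<and> iterated_laurent_series_field M ts L)"

text \<open>
  Algebras over \<open>'f\<close>, not necessarily commutative, are records of type \<open>('f, 'a) module\<close>, whose
  \<open>mult\<close> and \<open>one\<close> fields are in use.
\<close>

definition monoid_algebra :: "('m, 'b) monoid_scheme \<Rightarrow> ('f::field, 'm \<Rightarrow> 'f) module" where
  "monoid_algebra M =
     \<lparr>carrier = {f. finite {u. f u \<noteq> 0} \<and> {u. f u \<noteq> 0} \<subseteq> carrier M},
      monoid.mult = (\<lambda>f g w. \<Sum>(u, v)\<in>{(u, v). f u \<noteq> 0 \<and> g v \<noteq> 0 \<and> u \<otimes>\<^bsub>M\<^esub> v = w}. f u * g v),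
      one = (\<lambda>u. if u = \<one>\<^bsub>M\<^esub> then 1 else 0),
      zero = (\<lambda>_. 0),
      add = (\<lambda>f g u. f u + g u),
      module.smult = (\<lambda>c f u. c * f u)\<rparr>"

definition monomial :: "'m \<Rightarrow> ('m \<Rightarrow> 'f::field)" where
  "monomial u = (\<lambda>v. if v = u then 1 else 0)"

definition quotient_algebra :: "('f::field, 'a) module \<Rightarrow> 'a set \<Rightarrow> ('f, 'a set) module" where
  "quotient_algebra A I =
     \<lparr>carrier = carrier (A Quot I),
      monoid.mult = (\<otimes>\<^bsub>A Quot I\<^esub>),
      one = \<one>\<^bsub>A Quot I\<^esub>,
      zero = \<zero>\<^bsub>A Quot I\<^esub>,
      add = (\<oplus>\<^bsub>A Quot I\<^esub>),
      module.smult = (\<lambda>c S. \<Union>x\<in>S. I +>\<^bsub>A\<^esub> (c \<odot>\<^bsub>A\<^esub> x))\<rparr>"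

datatype symbol_generator = Gen_x | Gen_y

definition free_algebra :: "('f::field, 's list \<Rightarrow> 'f) module" where
  "free_algebra = monoid_algebra \<lparr>carrier = UNIV, monoid.mult = (@), one = []\<rparr>"

text \<open>
  In both symbol algebras \<open>y\<close> is invertible because \<open>y\<^sup>p = b \<noteq> 0\<close>, so that the relations
  \<open>y x y\<^sup>-\<^sup>1 = \<rho> x\<close> and \<open>y x y\<^sup>-\<^sup>1 = x + 1\<close> can be written as \<open>y x = \<rho> x y\<close> and \<open>y x = (x + 1) y\<close>.
\<close>

definition symbol_algebra ::
  "nat \<Rightarrow> 'f::field \<Rightarrow> 'f \<Rightarrow> 'f \<Rightarrow> ('f, (symbol_generator list \<Rightarrow> 'f) set) module" where
  "symbol_algebra p \<rho> a b =
     (let R = free_algebra; x = monomial [Gen_x]; y = monomial [Gen_y] in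
      quotient_algebra R (Idl\<^bsub>R\<^esub>
        {x [^]\<^bsub>R\<^esub> p \<ominus>\<^bsub>R\<^esub> a \<odot>\<^bsub>R\<^esub> \<one>\<^bsub>R\<^esub>,
         y [^]\<^bsub>R\<^esub> p \<ominus>\<^bsub>R\<^esub> b \<odot>\<^bsub>R\<^esub> \<one>\<^bsub>R\<^esub>,
         y \<otimes>\<^bsub>R\<^esub> x \<ominus>\<^bsub>R\<^esub> \<rho> \<odot>\<^bsub>R\<^esub> (x \<otimes>\<^bsub>R\<^esub> y)}))"

definition symbol_algebra_char_p ::
  "nat \<Rightarrow> 'f::field \<Rightarrow> 'f \<Rightarrow> ('f, (symbol_generator list \<Rightarrow> 'f) set) module" where
  "symbol_algebra_char_p p a b =
     (let R = free_algebra; x = monomial [Gen_x]; y = monomial [Gen_y] in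
      quotient_algebra R (Idl\<^bsub>R\<^esub>
        {(x [^]\<^bsub>R\<^esub> p \<ominus>\<^bsub>R\<^esub> x) \<ominus>\<^bsub>R\<^esub> a \<odot>\<^bsub>R\<^esub> \<one>\<^bsub>R\<^esub>,
         y [^]\<^bsub>R\<^esub> p \<ominus>\<^bsub>R\<^esub> b \<odot>\<^bsub>R\<^esub> \<one>\<^bsub>R\<^esub>,
         y \<otimes>\<^bsub>R\<^esub> x \<ominus>\<^bsub>R\<^esub> (x \<oplus>\<^bsub>R\<^esub> \<one>\<^bsub>R\<^esub>) \<otimes>\<^bsub>R\<^esub> y}))"

text \<open>
  The tensor product of the algebras \<open>A i\<close>, \<open>i \<in> I\<close>, over \<open>'f\<close> is the free vector space on
  \<open>\<Pi> i\<in>I. A i\<close>, multiplied factor by factor, modulo the relations that make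
  \<open>f \<mapsto> \<Otimes>i. f i\<close> multilinear.  The linear span of these relations is already a two-sided ideal.
\<close>

definition multilinear_relations ::
  "'i set \<Rightarrow> ('i \<Rightarrow> ('f::field, 'a) module) \<Rightarrow> (('i \<Rightarrow> 'a) \<Rightarrow> 'f) set" where
  "multilinear_relations I A =
     (let R = monoid_algebra (product_group I A) in
      {(monomial (f(i := a \<oplus>\<^bsub>A i\<^esub> b)) \<ominus>\<^bsub>R\<^esub> monomial (f(i := a))) \<ominus>\<^bsub>R\<^esub> monomial (f(i := b))
         | f i a b. f \<in> carrier (product_group I A) \<and> i \<in> I \<and> a \<in> carrier (A i) \<and> b \<in> carrier (A i)} \<union>
      {monomial (f(i := c \<odot>\<^bsub>A i\<^esub> a)) \<ominus>\<^bsub>R\<^esub> c \<odot>\<^bsub>R\<^esub> monomial (f(i := a))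
         | f i a c. f \<in> carrier (product_group I A) \<and> i \<in> I \<and> a \<in> carrier (A i)})"

definition tensor_product ::
  "'i set \<Rightarrow> ('i \<Rightarrow> ('f::field, 'a) module) \<Rightarrow> ('f, (('i \<Rightarrow> 'a) \<Rightarrow> 'f) set) module" where
  "tensor_product I A =
     (let R = monoid_algebra (product_group I A) in
      quotient_algebra R (Idl\<^bsub>R\<^esub> (multilinear_relations I A)))"

definition tensor_of_symbols ::
  "nat \<Rightarrow> 'f::field \<Rightarrow> nat \<Rightarrow> (nat \<Rightarrow> 'f) \<Rightarrow> (nat \<Rightarrow> 'f) \<Rightarrow>
   ('f, ((nat \<Rightarrow> (symbol_generator list \<Rightarrow> 'f) set) \<Rightarrow> 'f) set) module" where
  "tensor_of_symbols p \<rho> m \<alpha> \<beta> =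
     (if CHAR('f) = p then tensor_product {1..m} (\<lambda>i. symbol_algebra_char_p p (\<alpha> i) (\<beta> i))
      else tensor_product {1..m} (\<lambda>i. symbol_algebra p \<rho> (\<alpha> i) (\<beta> i)))"

definition mat_trace :: "'a::comm_monoid_add mat \<Rightarrow> 'a" where
  "mat_trace Z = (\<Sum>i<dim_row Z. Z $$ (i, i))"

text \<open>
  \<open>\<phi>\<close> is an algebra homomorphism from \<open>A\<close> to the \<open>n \<times> n\<close> matrices over the algebraic closure \<open>E\<close>
  of the base field whose \<open>E\<close>-linear extension \<open>A \<otimes> E \<rightarrow> M\<^sub>n(E)\<close> is an isomorphism; that is, the
  \<open>E\<close>-basis of all \<open>b \<otimes> 1\<close>, with \<open>b\<close> in a basis of \<open>A\<close>, is mapped bijectively to an \<open>E\<close>-basis.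
\<close>

definition splitting :: "('f::field, 'a) module \<Rightarrow> nat \<Rightarrow> ('a \<Rightarrow> 'f alg_closure mat) \<Rightarrow> bool" where
  "splitting A n \<phi> \<longleftrightarrow>
     \<phi> \<in> Ring.ring_hom A (ring_mat TYPE('f alg_closure) n ()) \<and>
     (\<forall>c. \<forall>a\<in>carrier A. \<phi> (c \<odot>\<^bsub>A\<^esub> a) = to_ac c \<cdot>\<^sub>m \<phi> a) \<and>
     (\<exists>B. vectorspace.basis class_ring A B \<and> inj_on \<phi> B \<and>
          vectorspace.basis class_ring (module_mat TYPE('f alg_closure) n n) (\<phi> ` B))"

text \<open>
  For a central simple algebra \<open>A\<close> a splitting exists, the trace does not depend on its choice
  (Skolem--Noether) and lies in the base field.
\<close>

definition reduced_trace :: "('f::field, 'a) module \<Rightarrow> 'a \<Rightarrow> 'f" where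
  "reduced_trace A a = of_ac (mat_trace ((SOME \<phi>. \<exists>n. splitting A n \<phi>) a))"

end

theory Submission
  imports Defs "HOL-Number_Theory.Cong"
begin

text \<open>
  Let \<open>v\<close> be the degree in the \<open>\<alpha>\<^sub>k, \<beta>\<^sub>k\<close>, with values in the lexicographically ordered group \<open>\<int>\<^sup>2\<^sup>m\<close>.
  It extends to the monomials \<open>b\<^sub>w = \<Otimes> x\<^sub>k\<^sup>i y\<^sub>k\<^sup>j\<close>, \<open>w \<in> (\<int>/p)\<^sup>2\<^sup>m\<close>, whose values lie in \<open>(1/p) \<int>\<^sup>2\<^sup>m\<close> and
  are distinct modulo \<open>\<int>\<^sup>2\<^sup>m\<close>.  Hence every nonzero element of \<open>A\<close> has a leading term \<open>c b\<^sub>w\<close>, and the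
  class \<open>w\<close> of a product is the sum of the classes of the factors.  Since a subspace \<open>V\<close> embeds into
  the coordinates at the classes of its elements, it suffices to count these classes.  The trace is
  a nonzero multiple of the coordinate at one class \<open>e\<close>: it is \<open>0\<close>, or all of its components are
  \<open>(p - 1, 0)\<close> if the characteristic is \<open>p\<close>.

  For \<open>v\<^sub>1, v\<^sub>2 \<in> V\<close> of distinct classes \<open>w\<^sub>1, w\<^sub>2\<close>, every coefficient of the polynomial
  \<open>Tr ((v\<^sub>1 + t v\<^sub>2)\<^sup>p\<^sup>-\<^sup>1)\<close> in \<open>t\<close> vanishes.  If \<open>w\<^sub>1 + e\<close> and \<open>w\<^sub>2 + e\<close> spanned the same line, then
  \<open>(p - 1 - k) w\<^sub>1 + k w\<^sub>2 = e\<close> for some \<open>k\<close>, and the leading terms of \<open>v\<^sub>1\<close> and \<open>v\<^sub>2\<close> would commute, as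
  \<open>\<rho> = 1\<close> or \<open>e = 0\<close>.  So the coefficient of \<open>t\<^sup>k\<close> in \<open>(v\<^sub>1 + t v\<^sub>2)\<^sup>p\<^sup>-\<^sup>1\<close> would have the class \<open>e\<close>, because
  the binomial coefficient \<open>p - 1\<close> over \<open>k\<close> is nonzero in \<open>F\<close>, and its trace would not vanish.
  Similarly \<open>w\<^sub>1 + e = 0\<close> gives \<open>(p - 1) w\<^sub>1 = e\<close>, so that \<open>Tr (v\<^sub>1\<^sup>p\<^sup>-\<^sup>1) \<noteq> 0\<close>.  Therefore \<open>w \<mapsto> w + e\<close> maps
  the classes of \<open>V\<close> injectively to the \<open>(p\<^sup>2\<^sup>m - 1)/(p - 1)\<close> lines of \<open>(\<int>/p)\<^sup>2\<^sup>m\<close>.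
\<close>

section \<open>Valuations and leading terms\<close>

text \<open>The values of \<open>A\<close> lie in a group larger than that of \<open>F\<close> by
  the factor \<open>1/p\<close>. All comparisons are therefore made after taking \<open>p\<close>-th
  powers, in the form \<open>v (c ^ p * mon w)\<close>, and stay in the value group of
  \<open>F\<close>. The degree is used, and not an order of vanishing, because \<alpha> must have
  positive value: then \<open>x\<close> has the value of a \<open>p\<close>-th root of \<alpha> also
  if \<open>x^p - x = \<alpha>\<close>, and in \<open>y x = x y + y\<close> the last summand is of
  lower value. So leading terms commute in characteristic \<open>p\<close>, which makes up for the
  nonzero class \<open>e\<close>. Otherwise \<open>e = 0\<close>, and leading terms with classes on
  one line commute anyway. Laurent series in the inverse variables fit the same convention. The
  algebras are given by generators and relations, and the reduced trace by an arbitrary splitting.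
  One family of explicit matrices over the algebraic closure shows that the monomials are
  independent, yields the structure constants and computes the trace. Two splittings are compared
  only up to a sign of the trace, which is enough because the hypothesis concerns its
  vanishing.\<close>

locale valuation =
  fixes v :: "'f::field \<Rightarrow> 'g::linordered_ab_group_add"
  assumes val_mult: "x \<noteq> 0 \<Longrightarrow> y \<noteq> 0 \<Longrightarrow> v (x * y) = v x + v y"
    and val_add: "x \<noteq> 0 \<Longrightarrow> y \<noteq> 0 \<Longrightarrow> x + y \<noteq> 0 \<Longrightarrow> v (x + y) \<le> max (v x) (v y)"
begin

lemma val_1 [simp]: "v 1 = 0"
  using val_mult[of 1 1] by simp

lemma val_minus_1 [simp]: "v (- 1) = 0"
  using val_mult[of "- 1" "- 1"] by (simp add: double_zero)

lemma val_minus [simp]: "v (- x) = v x"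
proof (cases "x = 0")
  case False
  then show ?thesis using val_mult[of "- 1" x] by simp
qed simp

lemma val_power_mono:
  assumes "x \<noteq> 0" "y \<noteq> 0" "v x \<le> v y"
  shows "v (x ^ n) \<le> v (y ^ n)"
  using assms by (induction n) (auto simp: val_mult intro: add_mono)

lemma val_power_eq:
  assumes "x \<noteq> 0" "y \<noteq> 0" "v x = v y"
  shows "v (x ^ n) = v (y ^ n)"
  using assms by (induction n) (auto simp: val_mult)

lemma val_power_0:
  assumes "x \<noteq> 0" "v x = 0"
  shows "v (x ^ n) = 0"
  using val_power_eq[of x 1 n] assms by simp

text \<open>In use \<open>n\<close> is \<open>p\<close> and \<open>u\<close> is
  \<open>mon w\<close>: the ultrametric inequality for multiples of one basis element. The premises
  are implications because \<open>v 0\<close> is arbitrary.\<close>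

lemma val_add_less:
  assumes "x \<noteq> 0 \<longrightarrow> v (x ^ n * u) < k" "y \<noteq> 0 \<longrightarrow> v (y ^ n * u) < k" "x + y \<noteq> 0" "u \<noteq> 0"
  shows "v ((x + y) ^ n * u) < k"
proof (cases "x = 0 \<or> y = 0")
  case False
  then have "v (x + y) \<le> v x \<or> v (x + y) \<le> v y"
    using val_add[of x y] assms(3) by (auto simp: max_def split: if_splits)
  then have "v ((x + y) ^ n) \<le> v (x ^ n) \<or> v ((x + y) ^ n) \<le> v (y ^ n)"
    using val_power_mono False assms(3) by blast
  then have "v ((x + y) ^ n * u) \<le> v (x ^ n * u) \<or> v ((x + y) ^ n * u) \<le> v (y ^ n * u)"
    using False assms(3,4) by (auto simp: val_mult)
  with assms(1,2) False show ?thesis by auto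
qed (use assms in auto)

lemma val_add_le:
  assumes "x \<noteq> 0 \<longrightarrow> v (x ^ n * u) \<le> k" "y \<noteq> 0 \<longrightarrow> v (y ^ n * u) \<le> k" "x + y \<noteq> 0" "u \<noteq> 0"
  shows "v ((x + y) ^ n * u) \<le> k"
proof (cases "x = 0 \<or> y = 0")
  case False
  then have "v (x + y) \<le> v x \<or> v (x + y) \<le> v y"
    using val_add[of x y] assms(3) by (auto simp: max_def split: if_splits)
  then have "v ((x + y) ^ n) \<le> v (x ^ n) \<or> v ((x + y) ^ n) \<le> v (y ^ n)"
    using val_power_mono False assms(3) by blast
  then have "v ((x + y) ^ n * u) \<le> v (x ^ n * u) \<or> v ((x + y) ^ n * u) \<le> v (y ^ n * u)"
    using False assms(3,4) by (auto simp: val_mult)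
  with assms(1,2) False show ?thesis by auto
qed (use assms in auto)

lemma val_sum_less:
  assumes "finite S" "u \<noteq> 0" "\<And>s. s \<in> S \<Longrightarrow> t s \<noteq> 0 \<longrightarrow> v (t s ^ n * u) < k"
  shows "(\<Sum>s\<in>S. t s) \<noteq> 0 \<longrightarrow> v ((\<Sum>s\<in>S. t s) ^ n * u) < k"
  using assms(1,3)
proof (induction S)
  case (insert s S)
  then show ?case
    using val_add_less[of "t s" n u k "\<Sum>s\<in>S. t s"] assms(2) by auto
qed auto

end

definition unit_vec_at :: "'w \<Rightarrow> 'w \<Rightarrow> 'f::field" where
  "unit_vec_at w u = (if u = w then 1 else 0)"

text \<open>
  An algebra with basis \<open>W\<close> and structure constants \<open>\<gamma>\<close>.  The basis element \<open>w\<close> behaves like a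
  \<open>p\<close>-th root of \<open>mon w \<in> F\<close>, so that \<open>v (c\<^sup>p mon w)\<close> is \<open>p\<close> times the value of \<open>c\<close> times the
  basis element.  The product of basis elements \<open>w\<close> and \<open>w'\<close> has the leading term
  \<open>lam w w'\<close> times \<open>opr w w'\<close>.
\<close>

locale leading_algebra = valuation v for v :: "'f::field \<Rightarrow> 'g::linordered_ab_group_add" +
  fixes p :: nat and W :: "'w set" and mon :: "'w \<Rightarrow> 'f" and \<gamma> :: "'w \<Rightarrow> 'w \<Rightarrow> 'w \<Rightarrow> 'f"
    and opr :: "'w \<Rightarrow> 'w \<Rightarrow> 'w" and lam :: "'w \<Rightarrow> 'w \<Rightarrow> 'f" and u :: 'w
  assumes finite_W: "finite W"
    and mon_nz: "w \<in> W \<Longrightarrow> mon w \<noteq> 0"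
    and opr_closed: "w \<in> W \<Longrightarrow> w' \<in> W \<Longrightarrow> opr w w' \<in> W"
    and lam_nz: "w \<in> W \<Longrightarrow> w' \<in> W \<Longrightarrow> lam w w' \<noteq> 0"
    and lam_mon: "w \<in> W \<Longrightarrow> w' \<in> W \<Longrightarrow> lam w w' ^ p * mon (opr w w') = mon w * mon w'"
    and gamma_lower: "w \<in> W \<Longrightarrow> w' \<in> W \<Longrightarrow> w'' \<in> W \<Longrightarrow>
        \<gamma> w w' w'' - (if w'' = opr w w' then lam w w' else 0) \<noteq> 0 \<Longrightarrow>
        v ((\<gamma> w w' w'' - (if w'' = opr w w' then lam w w' else 0)) ^ p * mon w'') < v (mon w * mon w')"
    and val_inj: "c \<noteq> 0 \<Longrightarrow> c' \<noteq> 0 \<Longrightarrow> w \<in> W \<Longrightarrow> w' \<in> W \<Longrightarrow>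
        v (c ^ p * mon w) = v (c' ^ p * mon w') \<Longrightarrow> w = w'"
    and unit_in: "u \<in> W" and mon_unit: "mon u = 1"
begin

definition star :: "('w \<Rightarrow> 'f) \<Rightarrow> ('w \<Rightarrow> 'f) \<Rightarrow> ('w \<Rightarrow> 'f)" where
  "star f g = (\<lambda>w''. \<Sum>w\<in>W. \<Sum>w'\<in>W. f w * g w' * \<gamma> w w' w'')"

text \<open>The threshold is given by a field element \<open>z\<close>, standing for the
  \<open>p\<close>-th power of a leading term, so that the thresholds of factors multiply.\<close>

definition below :: "'f \<Rightarrow> ('w \<Rightarrow> 'f) \<Rightarrow> bool" where
  "below z f \<longleftrightarrow> (\<forall>w\<in>W. f w \<noteq> 0 \<longrightarrow> v (f w ^ p * mon w) < v z)"

definition upto :: "'f \<Rightarrow> ('w \<Rightarrow> 'f) \<Rightarrow> bool" where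
  "upto z f \<longleftrightarrow> (\<forall>w\<in>W. f w \<noteq> 0 \<longrightarrow> v (f w ^ p * mon w) \<le> v z)"

text \<open>The coefficient \<open>c\<close> may be zero, and its term may lie below the threshold.
  Hence approximations with the same \<open>z\<close> and \<open>w\<close> can be added even if
  their coefficients cancel.\<close>

definition approx :: "'f \<Rightarrow> 'w \<Rightarrow> 'f \<Rightarrow> ('w \<Rightarrow> 'f) \<Rightarrow> bool" where
  "approx z w c f \<longleftrightarrow> (c \<noteq> 0 \<longrightarrow> v (c ^ p * mon w) \<le> v z) \<and>
     below z (\<lambda>x. f x - c * unit_vec_at w x)"

lemma below_add: "below z f \<Longrightarrow> below z g \<Longrightarrow> below z (\<lambda>x. f x + g x)"
  unfolding below_def using val_add_less mon_nz by meson

text \<open>The leading coefficient attains the bound by \<open>lam_mon\<close>, and the difference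
  from it stays below by \<open>gamma_lower\<close>.\<close>

lemma gamma_le:
  assumes "w \<in> W" "w' \<in> W" "w'' \<in> W" "\<gamma> w w' w'' \<noteq> 0"
  shows "v (\<gamma> w w' w'' ^ p * mon w'') \<le> v (mon w * mon w')"
proof -
  define l where "l = (if w'' = opr w w' then lam w w' else 0)"
  have "l \<noteq> 0 \<longrightarrow> v (l ^ p * mon w'') \<le> v (mon w * mon w')"
    using lam_mon[OF assms(1,2)] by (auto simp: l_def)
  moreover have "\<gamma> w w' w'' - l \<noteq> 0 \<longrightarrow> v ((\<gamma> w w' w'' - l) ^ p * mon w'') \<le> v (mon w * mon w')"
    using gamma_lower[OF assms(1-3)] by (auto simp: l_def)
  ultimately show ?thesis
    using val_add_le[of l p "mon w''" _ "\<gamma> w w' w'' - l"] mon_nz[OF assms(3)] assms(4) by simp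
qed

lemma term_val:
  assumes "w \<in> W" "w' \<in> W" "w'' \<in> W" "a * b * c \<noteq> 0"
  shows "v ((a * b * c) ^ p * mon w'') + v (mon w * mon w') =
    v (a ^ p * mon w) + v (b ^ p * mon w') + v (c ^ p * mon w'')"
  using assms mon_nz[of w] mon_nz[of w'] mon_nz[of w'']
  by (simp add: val_mult power_mult_distrib algebra_simps)

text \<open>By \<open>gamma_le\<close> a product of basis elements never exceeds the sum of their
  values, so one strictly smaller factor suffices. The summand \<open>v (mon w * mon w')\<close>
  from \<open>term_val\<close> is carried on both sides and cancelled at the end.\<close>

lemma star_below1:
  assumes "below z f" "upto z' g" "z \<noteq> 0" "z' \<noteq> 0"
  shows "below (z * z') (star f g)"
  unfolding below_def star_def sum.cartesian_product
proof (intro ballI, rule val_sum_less; (intro impI)?)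
  fix w'' s assume w'': "w'' \<in> W" and s: "s \<in> W \<times> W"
  obtain w w' where [simp]: "s = (w, w')" and w: "w \<in> W" "w' \<in> W" using s by auto
  assume "(case s of (w, w') \<Rightarrow> f w * g w' * \<gamma> w w' w'') \<noteq> 0"
  then have nz: "f w * g w' * \<gamma> w w' w'' \<noteq> 0" by simp
  have "v (f w ^ p * mon w) + v (g w' ^ p * mon w') + v (\<gamma> w w' w'' ^ p * mon w'')
    < v z + v z' + v (mon w * mon w')"
    using assms nz w gamma_le[OF w w''] unfolding below_def upto_def
    by (intro add_less_le_mono) auto
  then show "v ((case s of (w, w') \<Rightarrow> f w * g w' * \<gamma> w w' w'') ^ p * mon w'') < v (z * z')"
    unfolding term_val[OF w w'' nz, symmetric] using assms(3,4) by (simp add: val_mult)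
qed (use finite_W mon_nz in auto)

lemma star_below2:
  assumes "upto z f" "below z' g" "z \<noteq> 0" "z' \<noteq> 0"
  shows "below (z * z') (star f g)"
  unfolding below_def star_def sum.cartesian_product
proof (intro ballI, rule val_sum_less; (intro impI)?)
  fix w'' s assume w'': "w'' \<in> W" and s: "s \<in> W \<times> W"
  obtain w w' where [simp]: "s = (w, w')" and w: "w \<in> W" "w' \<in> W" using s by auto
  assume "(case s of (w, w') \<Rightarrow> f w * g w' * \<gamma> w w' w'') \<noteq> 0"
  then have nz: "f w * g w' * \<gamma> w w' w'' \<noteq> 0" by simp
  have "v (f w ^ p * mon w) + v (g w' ^ p * mon w') + v (\<gamma> w w' w'' ^ p * mon w'')
    < v z + v z' + v (mon w * mon w')"
    using assms nz w gamma_le[OF w w''] unfolding below_def upto_def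
    by (intro add_less_le_mono add_le_less_mono) auto
  then show "v ((case s of (w, w') \<Rightarrow> f w * g w' * \<gamma> w w' w'') ^ p * mon w'') < v (z * z')"
    unfolding term_val[OF w w'' nz, symmetric] using assms(3,4) by (simp add: val_mult)
qed (use finite_W mon_nz in auto)

lemma star_add_left: "star (\<lambda>x. f x + g x) h = (\<lambda>x. star f h x + star g h x)"
  by (simp add: star_def fun_eq_iff algebra_simps sum.distrib)

lemma star_add_right: "star h (\<lambda>x. f x + g x) = (\<lambda>x. star h f x + star h g x)"
  by (simp add: star_def fun_eq_iff algebra_simps sum.distrib)

lemma star_scale_left: "star (\<lambda>x. c * f x) g = (\<lambda>x. c * star f g x)"
  by (simp add: star_def fun_eq_iff algebra_simps sum_distrib_left)

lemma star_scale_right: "star f (\<lambda>x. c * g x) = (\<lambda>x. c * star f g x)"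
  by (simp add: star_def fun_eq_iff algebra_simps sum_distrib_left)

lemma star_sum_left: "star (\<lambda>x. \<Sum>b\<in>B. F b x) g = (\<lambda>x. \<Sum>b\<in>B. star (F b) g x)"
proof (induction B rule: infinite_finite_induct)
  case (insert b B)
  then show ?case by (simp add: star_add_left)
qed (simp_all add: star_def fun_eq_iff)

lemma star_unit_vecs:
  assumes "w \<in> W" "w' \<in> W"
  shows "star (unit_vec_at w) (unit_vec_at w') = \<gamma> w w'"
proof
  fix x
  have "star (unit_vec_at w) (unit_vec_at w') x
    = (\<Sum>y\<in>W. \<Sum>y'\<in>W. if y = w then if y' = w' then \<gamma> w w' x else 0 else 0)"
    unfolding star_def unit_vec_at_def by (intro sum.cong) auto
  also have "\<dots> = (\<Sum>y\<in>W. if y = w then \<gamma> w w' x else 0)"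
    by (intro sum.cong refl) (use finite_W assms in simp)
  finally show "star (unit_vec_at w) (unit_vec_at w') x = \<gamma> w w' x"
    using finite_W assms by simp
qed

lemma upto_single:
  assumes "c \<noteq> 0 \<longrightarrow> v (c ^ p * mon w) \<le> v z"
  shows "upto z (\<lambda>x. c * unit_vec_at w x)"
  using assms by (auto simp: upto_def unit_vec_at_def)

text \<open>Each factor is split into its leading term and a remainder. Products with a remainder
  are below the threshold, and the product of the two leading terms is a multiple of
  \<open>\<gamma> w w'\<close>, which differs from its own leading term by something below the
  threshold.\<close>

lemma approx_star:
  assumes f: "approx z w c f" and g: "approx z' w' c' g" and w: "w \<in> W" "w' \<in> W"
    and z: "z \<noteq> 0" "z' \<noteq> 0"
  shows "approx (z * z') (opr w w') (c * c' * lam w w') (star f g)"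
proof -
  let ?f = "\<lambda>x. c * unit_vec_at w x" and ?g = "\<lambda>x. c' * unit_vec_at w' x"
  have lead: "v ((c * c' * l) ^ p * y) + v (mon w * mon w') =
      v (c ^ p * mon w) + v (c' ^ p * mon w') + v (l ^ p * y)"
    if "c * c' * l \<noteq> 0" "y \<noteq> 0" for y l
    using that w mon_nz[of w] mon_nz[of w']
    by (simp add: val_mult power_mult_distrib algebra_simps)
  have zz: "c \<noteq> 0 \<Longrightarrow> c' \<noteq> 0 \<Longrightarrow> v (c ^ p * mon w) + v (c' ^ p * mon w') \<le> v (z * z')"
    using f g z by (auto simp: approx_def val_mult intro: add_mono)
  have eq: "star f g = (\<lambda>x. star (\<lambda>x. f x - ?f x) g x + star ?f (\<lambda>x. g x - ?g x) x + star ?f ?g x)"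
  proof -
    have "star f g = star (\<lambda>x. (f x - ?f x) + ?f x) (\<lambda>x. g x)" by simp
    also have "\<dots> = (\<lambda>x. star (\<lambda>x. f x - ?f x) g x + star ?f (\<lambda>x. (g x - ?g x) + ?g x) x)"
      by (subst star_add_left) simp
    also have "\<dots> = (\<lambda>x. star (\<lambda>x. f x - ?f x) g x + star ?f (\<lambda>x. g x - ?g x) x + star ?f ?g x)"
      by (subst star_add_right) (simp add: add.assoc)
    finally show ?thesis .
  qed
  have fg: "star ?f ?g = (\<lambda>x. c * c' * \<gamma> w w' x)"
    by (simp add: star_scale_left star_scale_right star_unit_vecs[OF w] mult.assoc)
  have g_upto: "upto z' g"
  proof -
    have "upto z' (\<lambda>x. (g x - ?g x) + ?g x)"
      using g upto_single[of c' w' z'] unfolding approx_def below_def upto_def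
      by (intro ballI impI val_add_le) (use mon_nz in \<open>force+\<close>)
    then show ?thesis by simp
  qed
  have 1: "below (z * z') (star (\<lambda>x. f x - ?f x) g)"
    using f z g_upto by (intro star_below1) (auto simp: approx_def)
  have 2: "below (z * z') (star ?f (\<lambda>x. g x - ?g x))"
    using f g z by (intro star_below2 upto_single) (auto simp: approx_def)
  have 3: "below (z * z') (\<lambda>x. star ?f ?g x - (c * c' * lam w w') * unit_vec_at (opr w w') x)"
    unfolding below_def
  proof (intro ballI impI)
    fix x assume x: "x \<in> W" and nz: "star ?f ?g x - (c * c' * lam w w') * unit_vec_at (opr w w') x \<noteq> 0"
    define d where "d = \<gamma> w w' x - (if x = opr w w' then lam w w' else 0)"
    have eq: "star ?f ?g x - (c * c' * lam w w') * unit_vec_at (opr w w') x = c * c' * d"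
      unfolding fg by (simp add: d_def unit_vec_at_def algebra_simps)
    then have d: "c * c' * d \<noteq> 0" using nz by simp
    have "v (d ^ p * mon x) < v (mon w * mon w')"
      using gamma_lower[OF w x] d by (auto simp: d_def)
    then have "v ((c * c' * d) ^ p * mon x) + v (mon w * mon w') < v (z * z') + v (mon w * mon w')"
      unfolding lead[OF d mon_nz[OF x]] using zz d by (intro add_le_less_mono) auto
    then show "v ((star ?f ?g x - (c * c' * lam w w') * unit_vec_at (opr w w') x) ^ p * mon x) < v (z * z')"
      by (simp add: eq)
  qed
  have "below (z * z') (\<lambda>x. star f g x - (c * c' * lam w w') * unit_vec_at (opr w w') x)"
    using below_add[OF below_add[OF 1 2] 3] by (subst eq) (simp add: add_diff_eq)
  moreover have "v ((c * c' * lam w w') ^ p * mon (opr w w')) \<le> v (z * z')" if "c * c' * lam w w' \<noteq> 0"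
    using lead[OF that mon_nz[OF opr_closed[OF w]]] lam_mon[OF w] zz that by simp
  ultimately show ?thesis by (auto simp: approx_def)
qed

lemma approx_add:
  assumes "approx z w c f" "approx z w c' g" "w \<in> W"
  shows "approx z w (c + c') (\<lambda>x. f x + g x)"
proof -
  have "below z (\<lambda>x. (f x - c * unit_vec_at w x) + (g x - c' * unit_vec_at w x))"
    using assms by (intro below_add) (auto simp: approx_def)
  then show ?thesis
    using assms val_add_le[of c p "mon w" "v z" c'] mon_nz
    by (auto simp: approx_def algebra_simps)
qed

text \<open>If the coordinate were zero, the remainder at \<open>w\<close> would be
  \<open>- c\<close>, whose term attains the threshold instead of staying below it.\<close>

lemma approx_nonzero:
  assumes "approx z w c f" "c \<noteq> 0" "v (c ^ p * mon w) = v z" "w \<in> W"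
  shows "f w \<noteq> 0"
proof
  assume "f w = 0"
  then have "v ((- c) ^ p * mon w) < v z"
    using assms by (auto simp: approx_def below_def unit_vec_at_def)
  moreover have "v ((- c) ^ p) = v (c ^ p)"
    using assms by (intro val_power_eq) auto
  ultimately show False
    using assms mon_nz by (simp add: val_mult)
qed

section \<open>Leading classes and polarised powers\<close>

definition lead :: "('w \<Rightarrow> 'f) \<Rightarrow> 'w" where
  "lead f = (SOME w. w \<in> W \<and> f w \<noteq> 0 \<and> approx (f w ^ p * mon w) w (f w) f)"

text \<open>By \<open>val_inj\<close> terms at different classes have different values, so the
  maximum over the support is attained only once.\<close>

lemma lead:
  assumes "x \<in> W" "f x \<noteq> 0"
  shows "lead f \<in> W" "f (lead f) \<noteq> 0" "approx (f (lead f) ^ p * mon (lead f)) (lead f) (f (lead f)) f"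
proof -
  define S where "S = {w\<in>W. f w \<noteq> 0}"
  define m where "m = Max ((\<lambda>w. v (f w ^ p * mon w)) ` S)"
  have S: "finite S" "S \<noteq> {}" using assms finite_W by (auto simp: S_def)
  then have "m \<in> (\<lambda>w. v (f w ^ p * mon w)) ` S" unfolding m_def by (intro Max_in) auto
  then obtain w where w: "w \<in> W" "f w \<noteq> 0" "m = v (f w ^ p * mon w)" by (auto simp: S_def)
  have "v (f y ^ p * mon y) < v (f w ^ p * mon w)" if "y \<in> W" "f y \<noteq> 0" "y \<noteq> w" for y
  proof -
    have "v (f y ^ p * mon y) \<le> m"
      unfolding m_def using S that by (intro Max_ge) (auto simp: S_def)
    then show ?thesis using val_inj[OF that(2) w(2) that(1) w(1)] that(3) w(3)
      by (metis order.not_eq_order_implies_strict)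
  qed
  then have "approx (f w ^ p * mon w) w (f w) f"
    by (auto simp: approx_def below_def unit_vec_at_def)
  then have "\<exists>w. w \<in> W \<and> f w \<noteq> 0 \<and> approx (f w ^ p * mon w) w (f w) f"
    using w by blast
  from someI_ex[OF this] show "lead f \<in> W" "f (lead f) \<noteq> 0"
    "approx (f (lead f) ^ p * mon (lead f)) (lead f) (f (lead f)) f"
    by (auto simp: lead_def)
qed

primrec pw :: "('w \<Rightarrow> 'f) \<Rightarrow> nat \<Rightarrow> ('w \<Rightarrow> 'f)" where
  "pw f 0 = unit_vec_at u"
| "pw f (Suc n) = star (pw f n) f"

text \<open>The coefficient of \<open>t\<^sup>b\<close> in \<open>(f + t g)\<^sup>n\<close>.\<close>

primrec pol :: "('w \<Rightarrow> 'f) \<Rightarrow> ('w \<Rightarrow> 'f) \<Rightarrow> nat \<Rightarrow> nat \<Rightarrow> ('w \<Rightarrow> 'f)" where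
  "pol f g 0 b = (\<lambda>x. if b = 0 then unit_vec_at u x else 0)"
| "pol f g (Suc n) b =
     (\<lambda>x. star (pol f g n b) f x + (if b = 0 then 0 else star (pol f g n (b - 1)) g x))"

lemma star_zero_left: "star (\<lambda>_. 0) g = (\<lambda>_. 0)"
  by (simp add: star_def)

lemma pol_0: "n < b \<Longrightarrow> pol f g n b = (\<lambda>_. 0)"
  by (induction n arbitrary: b) (auto simp: star_zero_left)

text \<open>The scalar \<open>t\<close> can be pulled out of every product although \<open>f\<close>
  and \<open>g\<close> need not commute.\<close>

lemma pw_pol: "pw (\<lambda>x. f x + t * g x) n = (\<lambda>x. \<Sum>b\<le>n. t ^ b * pol f g n b x)"
proof (induction n)
  case (Suc n)
  have "pw (\<lambda>x. f x + t * g x) (Suc n) =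
    (\<lambda>x. (\<Sum>b\<le>n. t ^ b * star (pol f g n b) f x) + t * (\<Sum>b\<le>n. t ^ b * star (pol f g n b) g x))"
    by (simp add: Suc star_add_right star_scale_right star_sum_left star_scale_left)
  moreover have "(\<Sum>b\<le>Suc n. t ^ b * pol f g (Suc n) b x) =
     (\<Sum>b\<le>n. t ^ b * star (pol f g n b) f x) + t * (\<Sum>b\<le>n. t ^ b * star (pol f g n b) g x)" for x
  proof -
    have "(\<Sum>b\<le>Suc n. t ^ b * pol f g (Suc n) b x) =
      (\<Sum>b\<le>Suc n. t ^ b * star (pol f g n b) f x) +
      (\<Sum>b\<le>Suc n. if b = 0 then 0 else t ^ b * star (pol f g n (b - 1)) g x)"
      by (simp only: sum.distrib[symmetric] pol.simps) (intro sum.cong, auto simp: algebra_simps)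
    also have "(\<Sum>b\<le>Suc n. t ^ b * star (pol f g n b) f x) = (\<Sum>b\<le>n. t ^ b * star (pol f g n b) f x)"
      by (simp add: pol_0 star_zero_left)
    also have "(\<Sum>b\<le>Suc n. if b = 0 then 0 else t ^ b * star (pol f g n (b - 1)) g x) =
      t * (\<Sum>b\<le>n. t ^ b * star (pol f g n b) g x)"
      by (subst sum.atMost_Suc_shift) (simp add: sum_distrib_left mult.assoc)
    finally show ?thesis .
  qed
  ultimately show ?case by (simp only: fun_eq_iff) simp
qed (auto simp: fun_eq_iff)

text \<open>\<open>cl a b\<close> and \<open>ka a b\<close> are the class and the scalar of a
  product of \<open>a\<close> leading factors of \<open>f\<close> and \<open>b\<close> of
  \<open>g\<close>. The hypotheses make them independent of the order of the factors, so all
  products with the same \<open>b\<close> share a leading term, and Pascal's rule counts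
  them.\<close>

lemma approx_pol:
  assumes f: "approx z1 w1 c1 f" and g: "approx z2 w2 c2 g" and w: "w1 \<in> W" "w2 \<in> W"
    and z: "z1 \<noteq> 0" "z2 \<noteq> 0"
    and cl: "\<And>a b. cl a b \<in> W" "cl 0 0 = u" "\<And>a b. opr (cl a b) w1 = cl (Suc a) b"
      "\<And>a b. opr (cl a b) w2 = cl a (Suc b)"
    and ka: "ka 0 0 = 1" "\<And>a b. ka a b * lam (cl a b) w1 = ka (Suc a) b"
      "\<And>a b. ka a b * lam (cl a b) w2 = ka a (Suc b)"
    and "b \<le> n"
  shows "approx (z1 ^ (n - b) * z2 ^ b) (cl (n - b) b)
     (of_nat (n choose b) * (c1 ^ (n - b) * c2 ^ b * ka (n - b) b)) (pol f g n b)"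
  using \<open>b \<le> n\<close>
proof (induction n arbitrary: b)
  case 0
  then show ?case using cl ka mon_unit by (simp add: approx_def below_def)
next
  case (Suc n)
  have L: "approx (z1 ^ (Suc n - b) * z2 ^ b) (cl (Suc n - b) b)
     (of_nat (n choose b) * (c1 ^ (Suc n - b) * c2 ^ b * ka (Suc n - b) b)) (star (pol f g n b) f)"
  proof (cases "b \<le> n")
    case True
    then have e: "Suc n - b = Suc (n - b)" by simp
    show ?thesis
      using approx_star[OF Suc.IH[OF True] f cl(1) w(1)] z unfolding e
      by (simp add: cl(3) ka(2)[symmetric] mult_ac)
  next
    \<comment> \<open>Here \<open>b = Suc n\<close>: the summand is zero, and so is its binomial
      coefficient.\<close>
    case False
    then show ?thesis by (simp add: pol_0 star_zero_left approx_def below_def binomial_eq_0)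
  qed
  show ?case
  proof (cases b)
    case 0
    then show ?thesis using L by simp
  next
    case (Suc b')
    have R: "approx (z1 ^ (Suc n - b) * z2 ^ b) (cl (Suc n - b) b)
     (of_nat (n choose b') * (c1 ^ (Suc n - b) * c2 ^ b * ka (Suc n - b) b)) (star (pol f g n b') g)"
      using approx_star[OF Suc.IH g cl(1) w(2), of b'] Suc.prems z unfolding Suc
      by (simp add: cl(4) ka(3)[symmetric] mult_ac)
    show ?thesis
      using approx_add[OF L R cl(1)] by (simp add: Suc algebra_simps)
  qed
qed

text \<open>Otherwise the coordinate in question would be a polynomial in \<open>t\<close> of degree
  at most \<open>n\<close> that vanishes at the \<open>n + 1\<close> points 0, ...,
  \<open>n\<close>, which are distinct by \<open>inj\<close>. But its coefficient at
  \<open>t ^ b\<close> is nonzero because of its leading term.\<close>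

lemma polarised_power_nonzero:
  assumes f: "approx (c1 ^ p * mon w1) w1 c1 f" and g: "approx (c2 ^ p * mon w2) w2 c2 g"
    and w: "w1 \<in> W" "w2 \<in> W" and c: "c1 \<noteq> 0" "c2 \<noteq> 0"
    and cl: "\<And>a b. cl a b \<in> W" "cl 0 0 = u" "\<And>a b. opr (cl a b) w1 = cl (Suc a) b"
      "\<And>a b. opr (cl a b) w2 = cl a (Suc b)"
    and ka: "ka 0 0 = 1" "\<And>a b. ka a b * lam (cl a b) w1 = ka (Suc a) b"
      "\<And>a b. ka a b * lam (cl a b) w2 = ka a (Suc b)"
    and b: "b \<le> n" and ch: "of_nat (n choose b) \<noteq> (0 :: 'f)" "v (of_nat (n choose b)) = 0"
    and inj: "inj_on (of_nat :: nat \<Rightarrow> 'f) {..n}"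
  shows "\<exists>t. pw (\<lambda>x. f x + t * g x) n (cl (n - b) b) \<noteq> 0"
proof (rule ccontr)
  let ?e = "cl (n - b) b"
  assume "\<not> ?thesis"
  then have zero: "(\<Sum>b\<le>n. t ^ b * pol f g n b ?e) = 0" for t
    by (simp add: pw_pol)
  define P where "P = (\<Sum>b\<le>n. monom (pol f g n b ?e) b)"
  have deg: "degree P \<le> n" unfolding P_def
    by (intro degree_sum_le) (auto intro: order_trans[OF degree_monom_le])
  have "poly P t = 0" for t
    using zero[of t] by (simp add: P_def poly_sum poly_monom mult.commute)
  then have "P = 0"
    using poly_eqI_degree[of "of_nat ` {..n}" P 0] inj deg by (simp add: card_image)
  then have "coeff P b = 0" by simp
  then have "pol f g n b ?e = 0"
    using b by (simp add: P_def coeff_sum if_distrib cong: if_cong)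
  moreover have mn: "mon w1 \<noteq> 0" "mon w2 \<noteq> 0" "mon (cl a b) \<noteq> 0" for a b
    using mon_nz w cl by auto
  moreover have lamp: "lam (cl a b) w1 ^ p * mon (cl (Suc a) b) = mon (cl a b) * mon w1"
    "lam (cl a b) w2 ^ p * mon (cl a (Suc b)) = mon (cl a b) * mon w2" for a b
    using lam_mon[OF cl(1) w(1), of a b] lam_mon[OF cl(1) w(2), of a b] by (auto simp: cl)
  \<comment> \<open>The induction follows a path in the grid of pairs, first along \<open>b\<close>
    and then along \<open>a\<close>. Each step multiplies by one \<open>lam\<close>, whose
    \<open>p\<close>-th power makes up for the reduction of the class.\<close>
  have kan: "ka a b \<noteq> 0 \<and> ka a b ^ p * mon (cl a b) = mon w1 ^ a * mon w2 ^ b" for a b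
  proof (induction a)
    case 0
    show ?case
    proof (induction b)
      case (Suc b)
      then show ?case
        using lamp(2)[of 0 b] lam_nz[OF cl(1) w(2), of 0 b]
        by (simp add: ka(3)[symmetric] power_mult_distrib mult_ac)
    qed (simp add: ka cl mon_unit)
  next
    case (Suc a)
    then show ?case
      using lamp(1)[of a b] lam_nz[OF cl(1) w(1), of a b]
      by (simp add: ka(2)[symmetric] power_mult_distrib mult_ac)
  qed
  let ?a = "n - b"
  let ?c = "c1 ^ ?a * c2 ^ b * ka ?a b"
  have cp: "?c ^ p * mon ?e = (c1 ^ p * mon w1) ^ ?a * (c2 ^ p * mon w2) ^ b"
  proof -
    have "?c ^ p * mon ?e = (c1 ^ p) ^ ?a * (c2 ^ p) ^ b * (ka ?a b ^ p * mon ?e)"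
      by (simp add: power_mult_distrib power_mult[symmetric] mult.commute[of p] mult.assoc)
    also have "\<dots> = (c1 ^ p) ^ ?a * (c2 ^ p) ^ b * (mon w1 ^ ?a * mon w2 ^ b)"
      using kan[of ?a b] by simp
    finally show ?thesis by (simp add: power_mult_distrib mult_ac)
  qed
  \<comment> \<open>The leading term attains the threshold exactly, as \<open>approx_nonzero\<close>
    demands, since the binomial coefficient has value 0.\<close>
  have "v ((of_nat (n choose b) * ?c) ^ p * mon ?e) = v ((c1 ^ p * mon w1) ^ ?a * (c2 ^ p * mon w2) ^ b)"
  proof -
    have "(of_nat (n choose b) * ?c) ^ p * mon ?e = of_nat (n choose b) ^ p * (?c ^ p * mon ?e)"
      by (simp only: power_mult_distrib mult.assoc)
    moreover have "?c ^ p * mon ?e \<noteq> 0" using kan[of ?a b] c mn by simp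
    ultimately show ?thesis
      using val_mult[of "of_nat (n choose b) ^ p" "?c ^ p * mon ?e"] val_power_0[OF ch] ch
      by (simp only: cp) simp
  qed
  then have "pol f g n b ?e \<noteq> 0"
    using approx_nonzero[OF approx_pol[where cl = cl and ka = ka, OF f g w _ _ cl ka b]] c mn kan[of ?a b] ch cl(1) by auto
  ultimately show False by simp
qed

end

section \<open>Exponent vectors modulo a prime\<close>

lemma power_cong_exponent:
  fixes r :: "'f::field"
  assumes "r ^ p = 1" "[n = n'] (mod p)"
  shows "r ^ n = r ^ n'"
proof -
  have "r ^ k = r ^ (k mod p)" for k
  proof -
    have "r ^ k = r ^ (p * (k div p) + k mod p)" by simp
    then show ?thesis using assms(1) by (simp only: power_add power_mult) simp
  qed
  then show ?thesis using assms(2) unfolding cong_def by metis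
qed

definition exp_set :: "nat \<Rightarrow> 'i set \<Rightarrow> ('i \<Rightarrow> nat \<times> nat) set" where
  "exp_set p I = (\<Pi>\<^sub>E k\<in>I. {..<p} \<times> {..<p})"

definition exp_add :: "nat \<Rightarrow> 'i set \<Rightarrow> ('i \<Rightarrow> nat \<times> nat) \<Rightarrow> ('i \<Rightarrow> nat \<times> nat) \<Rightarrow> ('i \<Rightarrow> nat \<times> nat)" where
  "exp_add p I w w' = (\<lambda>k\<in>I. ((fst (w k) + fst (w' k)) mod p, (snd (w k) + snd (w' k)) mod p))"

definition exp_zero :: "'i set \<Rightarrow> ('i \<Rightarrow> nat \<times> nat)" where
  "exp_zero I = (\<lambda>k\<in>I. (0, 0))"

definition exp_comb :: "nat \<Rightarrow> 'i set \<Rightarrow> ('i \<Rightarrow> nat \<times> nat) \<Rightarrow> ('i \<Rightarrow> nat \<times> nat) \<Rightarrow> nat \<Rightarrow> nat \<Rightarrow> ('i \<Rightarrow> nat \<times> nat)" where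
  "exp_comb p I w w' a b =
     (\<lambda>k\<in>I. ((a * fst (w k) + b * fst (w' k)) mod p, (a * snd (w k) + b * snd (w' k)) mod p))"

text \<open>The exponent of \<rho> that arises when the \<open>y\<close>-powers of \<open>w\<close>
  are moved past the \<open>x\<close>-powers of \<open>w'\<close>. Its failure to be symmetric
  modulo \<open>p\<close> measures the commutator of the two monomials.\<close>

definition exp_form :: "'i set \<Rightarrow> ('i \<Rightarrow> nat \<times> nat) \<Rightarrow> ('i \<Rightarrow> nat \<times> nat) \<Rightarrow> nat" where
  "exp_form I w w' = (\<Sum>k\<in>I. snd (w k) * fst (w' k))"

definition exp_mon :: "'i set \<Rightarrow> ('i \<Rightarrow> 'f::field) \<Rightarrow> ('i \<Rightarrow> 'f) \<Rightarrow> ('i \<Rightarrow> nat \<times> nat) \<Rightarrow> 'f" where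
  "exp_mon I \<alpha> \<beta> w = (\<Prod>k\<in>I. \<alpha> k ^ fst (w k) * \<beta> k ^ snd (w k))"

text \<open>The scalar of the leading term of a product of two monomials: \<rho> comes from
  reordering, and an exponent that reaches \<open>p\<close> trades \<open>x^p\<close> for \<alpha>
  or \<open>y^p\<close> for \<beta>.\<close>

definition carry :: "nat \<Rightarrow> 'f::field \<Rightarrow> 'i set \<Rightarrow> ('i \<Rightarrow> 'f) \<Rightarrow> ('i \<Rightarrow> 'f) \<Rightarrow>
    ('i \<Rightarrow> nat \<times> nat) \<Rightarrow> ('i \<Rightarrow> nat \<times> nat) \<Rightarrow> 'f" where
  "carry p \<rho> I \<alpha> \<beta> w w' = \<rho> ^ exp_form I w w' *
     (\<Prod>k\<in>I. \<alpha> k ^ ((fst (w k) + fst (w' k)) div p) * \<beta> k ^ ((snd (w k) + snd (w' k)) div p))"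

lemma carry_mon:
  fixes \<rho> :: "'f::field" and \<alpha> \<beta> :: "'i \<Rightarrow> 'f"
  assumes "\<rho> ^ p = 1"
  shows "carry p \<rho> I \<alpha> \<beta> w w' ^ p * exp_mon I \<alpha> \<beta> (exp_add p I w w') = exp_mon I \<alpha> \<beta> w * exp_mon I \<alpha> \<beta> w'"
proof -
  have pw: "(a ^ (n div p)) ^ p * a ^ (n mod p) = a ^ n" for a :: 'f and n
    by (simp flip: power_mult power_add)
  have 1: "carry p \<rho> I \<alpha> \<beta> w w' ^ p = (\<rho> ^ p) ^ exp_form I w w' *
    (\<Prod>k\<in>I. (\<alpha> k ^ ((fst (w k) + fst (w' k)) div p)) ^ p * (\<beta> k ^ ((snd (w k) + snd (w' k)) div p)) ^ p)"
    by (simp only: carry_def power_mult_distrib prod_power_distrib power_mult[symmetric] mult.commute[of p])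
  have "carry p \<rho> I \<alpha> \<beta> w w' ^ p * exp_mon I \<alpha> \<beta> (exp_add p I w w') =
    (\<Prod>k\<in>I. (\<alpha> k ^ ((fst (w k) + fst (w' k)) div p)) ^ p * \<alpha> k ^ ((fst (w k) + fst (w' k)) mod p) *
      ((\<beta> k ^ ((snd (w k) + snd (w' k)) div p)) ^ p * \<beta> k ^ ((snd (w k) + snd (w' k)) mod p)))"
    unfolding 1 exp_mon_def assms power_one mult_1 prod.distrib[symmetric]
    by (intro prod.cong refl) (simp add: exp_add_def)
  also have "\<dots> = exp_mon I \<alpha> \<beta> w * exp_mon I \<alpha> \<beta> w'"
    unfolding pw exp_mon_def prod.distrib[symmetric] power_add by (intro prod.cong refl) (simp only: mult_ac)
  finally show ?thesis .
qed

lemma cong_form_left: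
  assumes "\<And>k. k \<in> I \<Longrightarrow> [snd (w k) = x * snd (w1 k) + y * snd (w2 k)] (mod p)"
  shows "[exp_form I w w' = x * exp_form I w1 w' + y * exp_form I w2 w'] (mod p)"
proof -
  have "[exp_form I w w' = (\<Sum>k\<in>I. (x * snd (w1 k) + y * snd (w2 k)) * fst (w' k))] (mod p)"
    unfolding exp_form_def by (intro cong_sum cong_mult assms) auto
  then show ?thesis
    by (simp add: exp_form_def sum_distrib_left algebra_simps sum.distrib)
qed

lemma exp_ext:
  assumes "w \<in> exp_set p I" "w' \<in> exp_set p I"
    "\<And>k. k \<in> I \<Longrightarrow> [fst (w k) = fst (w' k)] (mod p)" "\<And>k. k \<in> I \<Longrightarrow> [snd (w k) = snd (w' k)] (mod p)"
  shows "w = w'"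
proof (rule PiE_ext[of w I "\<lambda>_. {..<p} \<times> {..<p}" w'])
  fix k assume k: "k \<in> I"
  then have "w k \<in> {..<p} \<times> {..<p}" "w' k \<in> {..<p} \<times> {..<p}"
    using assms(1,2) unfolding exp_set_def by (blast dest: PiE_mem)+
  then show "w k = w' k"
    using assms(3,4)[OF k] by (auto simp: cong_def mem_Times_iff prod_eq_iff)
qed (use assms in \<open>auto simp: exp_set_def\<close>)

text \<open>The scalar of \<open>b\<close> factors \<open>w'\<close> followed by \<open>a\<close>
  factors \<open>w\<close>. Each pair of factors contributes the form of the earlier with the later
  one, which accounts for the binomial coefficients and the product \<open>a * b\<close>.\<close>

definition carry_pow :: "nat \<Rightarrow> 'f::field \<Rightarrow> 'i set \<Rightarrow> ('i \<Rightarrow> 'f) \<Rightarrow> ('i \<Rightarrow> 'f) \<Rightarrow>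
    ('i \<Rightarrow> nat \<times> nat) \<Rightarrow> ('i \<Rightarrow> nat \<times> nat) \<Rightarrow> nat \<Rightarrow> nat \<Rightarrow> 'f" where
  "carry_pow p \<rho> I \<alpha> \<beta> w w' a b =
     \<rho> ^ (exp_form I w w * (a choose 2) + exp_form I w' w' * (b choose 2) + a * b * exp_form I w' w) *
     (\<Prod>k\<in>I. \<alpha> k ^ ((a * fst (w k) + b * fst (w' k)) div p) * \<beta> k ^ ((a * snd (w k) + b * snd (w' k)) div p))"

text \<open>\<open>comm\<close> is what lets an appended \<open>w'\<close> pass the factors
  \<open>w\<close>. Both claims together are the hypotheses on \<open>ka\<close> in
  \<open>approx_pol\<close>.\<close>

lemma carry_path:
  fixes \<rho> :: "'f::field" and \<alpha> \<beta> :: "'i \<Rightarrow> 'f"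
  assumes p: "\<rho> ^ p = 1" and comm: "\<rho> ^ exp_form I w w' = \<rho> ^ exp_form I w' w"
  shows "carry_pow p \<rho> I \<alpha> \<beta> w w' a b * carry p \<rho> I \<alpha> \<beta> (exp_comb p I w w' a b) w = carry_pow p \<rho> I \<alpha> \<beta> w w' (Suc a) b"
    and "carry_pow p \<rho> I \<alpha> \<beta> w w' a b * carry p \<rho> I \<alpha> \<beta> (exp_comb p I w w' a b) w' = carry_pow p \<rho> I \<alpha> \<beta> w w' a (Suc b)"
proof -
  \<comment> \<open>Reducing after each factor loses nothing: the successive carries add up to one
    integer quotient.\<close>
  have div: "x div p + (x mod p + y) div p = (x + y) div p" for x y
  proof (cases "p = 0")
    case False
    have "x + y = (x mod p + y) + x div p * p" by (simp add: algebra_simps)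
    then have "(x + y) div p = ((x mod p + y) + x div p * p) div p" by simp
    also have "\<dots> = x div p + (x mod p + y) div p" using False by (rule div_mult_self1)
    finally show ?thesis by simp
  qed simp
  have form: "\<rho> ^ exp_form I (exp_comb p I w w' a b) z = \<rho> ^ (a * exp_form I w z + b * exp_form I w' z)" for z
    by (intro power_cong_exponent[OF p] cong_form_left) (simp add: exp_comb_def cong_def)
  define Q where "Q a b = exp_form I w w * (a choose 2) + exp_form I w' w' * (b choose 2) + a * b * exp_form I w' w" for a b
  have Q1: "Q (Suc a) b = Q a b + (a * exp_form I w w + b * exp_form I w' w)"
    by (simp add: Q_def numeral_2_eq_2 algebra_simps)
  have Q2: "Q a (Suc b) = Q a b + (a * exp_form I w' w + b * exp_form I w' w')"
    by (simp add: Q_def numeral_2_eq_2 algebra_simps)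
  have comm': "\<rho> ^ (a * exp_form I w w' + b * exp_form I w' w') = \<rho> ^ (a * exp_form I w' w + b * exp_form I w' w')"
  proof -
    have "\<rho> ^ (a * n) = (\<rho> ^ n) ^ a" for n
      by (simp only: power_mult[symmetric] mult.commute)
    then show ?thesis using comm by (simp only: power_add)
  qed
  have powdiv: "c ^ ((x + y) div p) = c ^ (x div p) * c ^ ((x mod p + y) div p)" for c :: 'f and x y
    by (simp only: power_add[symmetric] div)
  have pr: "(\<Prod>k\<in>I. \<alpha> k ^ (a1 k div p) * \<beta> k ^ (b1 k div p)) *
      (\<Prod>k\<in>I. \<alpha> k ^ ((a1 k mod p + a2 k) div p) * \<beta> k ^ ((b1 k mod p + b2 k) div p)) =
      (\<Prod>k\<in>I. \<alpha> k ^ ((a1 k + a2 k) div p) * \<beta> k ^ ((b1 k + b2 k) div p))" for a1 a2 b1 b2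
    unfolding prod.distrib[symmetric]
    by (intro prod.cong refl) (simp only: powdiv[of _ "a1 _" "a2 _"] powdiv[of _ "b1 _" "b2 _"] mult_ac)
  have step: "(\<Prod>k\<in>I. \<alpha> k ^ ((a * fst (w k) + b * fst (w' k)) div p) * \<beta> k ^ ((a * snd (w k) + b * snd (w' k)) div p)) *
     (\<Prod>k\<in>I. \<alpha> k ^ ((fst (exp_comb p I w w' a b k) + fst (z k)) div p) *
        \<beta> k ^ ((snd (exp_comb p I w w' a b k) + snd (z k)) div p)) =
     (\<Prod>k\<in>I. \<alpha> k ^ ((a * fst (w k) + b * fst (w' k) + fst (z k)) div p) *
        \<beta> k ^ ((a * snd (w k) + b * snd (w' k) + snd (z k)) div p))" for z
  proof -
    have "(\<Prod>k\<in>I. \<alpha> k ^ ((fst (exp_comb p I w w' a b k) + fst (z k)) div p) *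
        \<beta> k ^ ((snd (exp_comb p I w w' a b k) + snd (z k)) div p)) =
      (\<Prod>k\<in>I. \<alpha> k ^ (((a * fst (w k) + b * fst (w' k)) mod p + fst (z k)) div p) *
        \<beta> k ^ (((a * snd (w k) + b * snd (w' k)) mod p + snd (z k)) div p))"
      by (intro prod.cong refl) (simp add: exp_comb_def)
    then show ?thesis
      by (simp only: pr[of "\<lambda>k. a * fst (w k) + b * fst (w' k)" "\<lambda>k. a * snd (w k) + b * snd (w' k)"
        "\<lambda>k. fst (z k)" "\<lambda>k. snd (z k)"])
  qed
  have mult4: "x * y * (x' * y') = x * x' * (y * y')" for x y x' y' :: 'f
    by (simp add: mult_ac)
  show "carry_pow p \<rho> I \<alpha> \<beta> w w' a b * carry p \<rho> I \<alpha> \<beta> (exp_comb p I w w' a b) w = carry_pow p \<rho> I \<alpha> \<beta> w w' (Suc a) b"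
    unfolding carry_pow_def carry_def form Q_def[symmetric] Q1 power_add[of _ "Q a b"] mult4 step
    by (simp only: mult_Suc add_ac)
  show "carry_pow p \<rho> I \<alpha> \<beta> w w' a b * carry p \<rho> I \<alpha> \<beta> (exp_comb p I w w' a b) w' = carry_pow p \<rho> I \<alpha> \<beta> w w' a (Suc b)"
    unfolding carry_pow_def carry_def form Q_def[symmetric] Q2 power_add[of _ "Q a b"] comm' mult4 step
    by (simp only: mult_Suc add_ac)
qed

text \<open>
  The exponent \<open>b\<close> that solves \<open>a w\<^sub>1 + b w\<^sub>2 = e\<close> with \<open>a + b = p - 1\<close>, for \<open>w\<^sub>1 + e\<close> and
  \<open>w\<^sub>2 + e\<close> on the same line.
\<close>

lemma line_exponent:
  fixes p k1 k2 :: nat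
  assumes p: "prime p" and k: "0 < k1" "k1 < p" "0 < k2" "k2 < p" "k1 \<noteq> k2"
  obtains b where "b \<le> p - 1"
    and "\<And>x y e. [k1 * (x + e) = k2 * (y + e)] (mod p) \<Longrightarrow> [(p - 1 - b) * x + b * y = e] (mod p)"
proof -
  have "\<not> int p dvd int k1 - int k2"
    using k zdvd_imp_le[of "int p" "int k1 - int k2"] zdvd_imp_le[of "int p" "int k2 - int k1"]
    by (cases "k1 < k2") (auto simp: dvd_diff_commute)
  then have "coprime (int k1 - int k2) (int p)"
    using p by (simp add: coprime_commute prime_imp_coprime)
  then obtain c where c: "[(int k1 - int k2) * c = 1] (mod int p)"
    using cong_solve_coprime_int by blast
  \<comment> \<open>With \<open>X = x + e\<close> and \<open>Y = y + e\<close> the equation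
    \<open>(p - 1 - b) x + b y = e\<close> reads \<open>b (Y - X) = X\<close> modulo
    \<open>p\<close>, and \<open>k1 X = k2 Y\<close> turns it into \<open>b (k1 - k2) = k2\<close>.
    The solution does not depend on \<open>x\<close>, \<open>y\<close>, \<open>e\<close> and so
    serves all components at once.\<close>
  define b where "b = nat ((int k2 * c) mod int p)"
  have p1: "p > 1" using p by (rule prime_gt_1_nat)
  have bp: "b < p" unfolding b_def using p1 by (simp add: nat_less_iff)
  have b: "[int b * (int k1 - int k2) = int k2] (mod int p)"
  proof -
    have "int b = (int k2 * c) mod int p" using p1 by (simp add: b_def)
    then have "[int b = int k2 * c] (mod int p)" by (simp add: cong_def)
    then have "[int b * (int k1 - int k2) = int k2 * c * (int k1 - int k2)] (mod int p)"
      by (intro cong_mult) auto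
    also have "int k2 * c * (int k1 - int k2) = int k2 * ((int k1 - int k2) * c)" by simp
    also have "[\<dots> = int k2 * 1] (mod int p)" using c by (intro cong_mult) auto
    finally show ?thesis by simp
  qed
  have k2p: "coprime (int k2) (int p)"
    using p k by (metis coprime_commute coprime_int_iff nat_dvd_not_less prime_imp_coprime)
  show thesis
  proof
    show "b \<le> p - 1" using bp by simp
    fix x y e assume xy: "[k1 * (x + e) = k2 * (y + e)] (mod p)"
    then have xy: "[int k1 * (int x + int e) = int k2 * (int y + int e)] (mod int p)"
      by (metis cong_int_iff of_nat_add of_nat_mult)
    have "int p dvd (int k1 * (int x + int e) - int k2 * (int y + int e)) * int b"
      "int p dvd (int b * (int k1 - int k2) - int k2) * (int x + int e)" "int p dvd int k2 * int p * (int x + int e)"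
      using xy b by (auto simp: cong_iff_dvd_diff)
    then have "int p dvd int k2 * int p * (int x + int e)
      - int k2 * int p * int e
      + (int b * (int k1 - int k2) - int k2) * (int x + int e) -
      (int k1 * (int x + int e) - int k2 * (int y + int e)) * int b"
      by (intro dvd_diff dvd_add) auto
    also have "\<dots> = int k2 * ((int p - 1 - int b) * int x + int b * int y - int e)"
      by (simp add: algebra_simps)
    finally have "int p dvd (int p - 1 - int b) * int x + int b * int y - int e"
      using k2p by (simp add: coprime_dvd_mult_right_iff coprime_commute)
    moreover have "int (p - 1 - b) = int p - 1 - int b" using bp by simp
    ultimately have "[int ((p - 1 - b) * x + b * y) = int e] (mod int p)"
      by (simp add: cong_iff_dvd_diff)
    then show "[(p - 1 - b) * x + b * y = e] (mod p)" by (simp only: cong_int_iff)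
  qed
qed

lemma card_exp_set: "finite I \<Longrightarrow> card (exp_set p I) = p ^ (2 * card I)"
  by (simp add: exp_set_def card_PiE card_cartesian_product power_mult power2_eq_square)

text \<open>
  If \<open>w \<mapsto> w + e\<close> maps \<open>C\<close> injectively to the points of a projective space, then the nonzero
  multiples of the \<open>w + e\<close> are distinct nonzero vectors.
\<close>

lemma card_lines_bound:
  assumes p: "prime p" and I: "finite I" and C: "C \<subseteq> exp_set p I" and e: "e \<in> exp_set p I"
    and nz: "\<And>w. w \<in> C \<Longrightarrow> exp_add p I w e \<noteq> exp_zero I"
    and line: "\<And>w w' k k'. w \<in> C \<Longrightarrow> w' \<in> C \<Longrightarrow> 0 < k \<Longrightarrow> k < p \<Longrightarrow> 0 < k' \<Longrightarrow> k' < p \<Longrightarrow> k \<noteq> k' \<Longrightarrow>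
       (\<And>i. i \<in> I \<Longrightarrow> [k * (fst (w i) + fst (e i)) = k' * (fst (w' i) + fst (e i))] (mod p) \<and>
             [k * (snd (w i) + snd (e i)) = k' * (snd (w' i) + snd (e i))] (mod p)) \<Longrightarrow> False"
  shows "card C \<le> (p ^ (2 * card I) - 1) div (p - 1)"
proof -
  have p1: "p > 1" using p by (rule prime_gt_1_nat)
  define h where "h = (\<lambda>(w, k). \<lambda>i\<in>I. ((k * (fst (w i) + fst (e i))) mod p, (k * (snd (w i) + snd (e i))) mod p))"
  have cop: "coprime k p" if "0 < k" "k < p" for k
    using that p by (metis coprime_commute nat_dvd_not_less prime_imp_coprime)
  have inj: "inj_on h (C \<times> {0<..<p})"
  proof (rule inj_onI, clarify)
    fix w k w' k'
    assume wk: "w \<in> C" "k \<in> {0<..<p}" "w' \<in> C" "k' \<in> {0<..<p}" and eq: "h (w, k) = h (w', k')"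
    have c: "[k * (fst (w i) + fst (e i)) = k' * (fst (w' i) + fst (e i))] (mod p) \<and>
             [k * (snd (w i) + snd (e i)) = k' * (snd (w' i) + snd (e i))] (mod p)" if "i \<in> I" for i
      using fun_cong[OF eq, of i] that by (simp add: h_def cong_def)
    have k: "k = k'" using line[OF wk(1,3) _ _ _ _ _ c] wk by auto
    have "w = w'"
    proof (rule exp_ext)
      fix i assume i: "i \<in> I"
      show "[fst (w i) = fst (w' i)] (mod p)" "[snd (w i) = snd (w' i)] (mod p)"
        using c[OF i] cop[of k] wk k cong_mult_lcancel_nat cong_add_rcancel_nat by auto
    qed (use wk C in auto)
    with k show "w = w' \<and> k = k'" by simp
  qed
  have fin: "finite (exp_set p I)" using I by (simp add: exp_set_def finite_PiE)
  have "h (w, k) \<in> exp_set p I - {exp_zero I}" if "w \<in> C" "0 < k" "k < p" for w k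
  proof
    show "h (w, k) \<in> exp_set p I" using p1 by (auto simp: h_def exp_set_def)
    have "h (w, k) \<noteq> exp_zero I"
    proof
      assume eq: "h (w, k) = exp_zero I"
      have "exp_add p I w e = exp_zero I"
        unfolding exp_add_def exp_zero_def
      proof (rule restrict_ext)
        fix i assume i: "i \<in> I"
        have "p dvd k * (fst (w i) + fst (e i))" "p dvd k * (snd (w i) + snd (e i))"
          using fun_cong[OF eq, of i] i by (auto simp: h_def exp_zero_def)
        then show "((fst (w i) + fst (e i)) mod p, (snd (w i) + snd (e i)) mod p) = (0, 0)"
          using cop[OF that(2,3)] coprime_dvd_mult_right_iff[of p k]
          by (auto simp: coprime_commute)
      qed
      with nz that show False by blast
    qed
    then show "h (w, k) \<notin> {exp_zero I}" by simp
  qed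
  then have "h ` (C \<times> {0<..<p}) \<subseteq> exp_set p I - {exp_zero I}" by auto
  then have "card (C \<times> {0<..<p}) \<le> card (exp_set p I - {exp_zero I})"
    using inj fin by (metis card_image card_mono finite_Diff)
  moreover have "exp_zero I \<in> exp_set p I" using p1 by (auto simp: exp_zero_def exp_set_def)
  ultimately have "card C * (p - 1) \<le> p ^ (2 * card I) - 1"
    using fin by (simp add: card_cartesian_product card_Diff_singleton card_exp_set[OF I])
  then show ?thesis using p1 by (simp add: less_eq_div_iff_mult_less_eq)
qed

text \<open>\<open>C\<close> consists of the leading classes of the elements of \<open>V\<close>. A
  function that is zero on \<open>C\<close> cannot have a leading class, hence vanishes on
  \<open>exp_set p I\<close>; its values elsewhere are ignored.\<close>

theorem leading_class_bound:
  fixes v :: "'f::field \<Rightarrow> 'g::linordered_ab_group_add" and I :: "'i set"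
  assumes alg: "leading_algebra v p (exp_set p I) (exp_mon I \<alpha> \<beta>) \<gamma> (exp_add p I) (carry p \<rho> I \<alpha> \<beta>) (exp_zero I)"
    and p: "prime p" and I: "finite I" and e: "e \<in> exp_set p I" and \<rho>: "\<rho> ^ p = 1"
    and comm: "\<rho> = 1 \<or> e = exp_zero I"
    and int_nz: "\<And>n. 0 < n \<Longrightarrow> n < p \<Longrightarrow> of_nat n \<noteq> (0 :: 'f)"
    and int_val: "\<And>n. of_nat n \<noteq> (0 :: 'f) \<Longrightarrow> v (of_nat n) = 0"
    and V: "\<And>f g. f \<in> V \<Longrightarrow> g \<in> V \<Longrightarrow> (\<lambda>x. f x + g x) \<in> V" "\<And>c f. f \<in> V \<Longrightarrow> (\<lambda>x. c * f x) \<in> V"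
    and tr: "\<And>f. f \<in> V \<Longrightarrow> leading_algebra.pw (exp_set p I) \<gamma> (exp_zero I) f (p - 1) e = 0"
  obtains C where "C \<subseteq> exp_set p I" "card C \<le> (p ^ (2 * card I) - 1) div (p - 1)"
    and "\<And>f w. f \<in> V \<Longrightarrow> (\<And>w. w \<in> C \<Longrightarrow> f w = 0) \<Longrightarrow> w \<in> exp_set p I \<Longrightarrow> f w = 0"
proof -
  interpret leading_algebra v p "exp_set p I" "exp_mon I \<alpha> \<beta>" \<gamma> "exp_add p I" "carry p \<rho> I \<alpha> \<beta>" "exp_zero I"
    by (rule alg)
  have p1: "p > 1" using p by (rule prime_gt_1_nat)
  define nonz where "nonz = (\<lambda>f :: ('i \<Rightarrow> nat \<times> nat) \<Rightarrow> 'f. \<exists>w\<in>exp_set p I. f w \<noteq> 0)"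
  define C where "C = lead ` {f\<in>V. nonz f}"
  have fact_nz: "of_nat (fact n) \<noteq> (0 :: 'f)" if "n < p" for n
    using that
  proof (induction n)
    case (Suc n)
    have "of_nat (fact (Suc n)) = (of_nat (Suc n) * of_nat (fact n) :: 'f)"
      by (simp only: fact_Suc of_nat_mult of_nat_id)
    then show ?case using Suc int_nz[of "Suc n"] by simp
  qed simp
  \<comment> \<open>The binomial coefficient divides \<open>fact (p - 1)\<close>, a product of
    integers below \<open>p\<close>.\<close>
  have ch: "of_nat (p - 1 choose b) \<noteq> (0 :: 'f)" if "b \<le> p - 1" for b
  proof
    assume "of_nat (p - 1 choose b) = (0 :: 'f)"
    then have "of_nat (fact b * fact (p - 1 - b) * (p - 1 choose b)) = (0 :: 'f)" by simp
    then show False using binomial_fact_lemma[OF that] fact_nz[of "p - 1"] p1 by (simp del: of_nat_mult)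
  qed
  have inj: "inj_on (of_nat :: nat \<Rightarrow> 'f) {..p - 1}"
  proof (rule linorder_inj_onI')
    fix i j :: nat assume "i \<in> {..p - 1}" "j \<in> {..p - 1}" "i < j"
    moreover from this have "j - i < p" using p1 by auto
    ultimately show "of_nat i \<noteq> (of_nat j :: 'f)"
      using int_nz[of "j - i"] p1 by (auto simp: of_nat_diff)
  qed
  have key: False if f: "f \<in> V" "nonz f" and g: "g \<in> V" "nonz g"
    and cm: "\<rho> ^ exp_form I (lead f) (lead g) = \<rho> ^ exp_form I (lead g) (lead f)"
    and b: "b \<le> p - 1"
    and sol: "\<And>k. k \<in> I \<Longrightarrow> [(p - 1 - b) * fst (lead f k) + b * fst (lead g k) = fst (e k)] (mod p) \<and>
       [(p - 1 - b) * snd (lead f k) + b * snd (lead g k) = snd (e k)] (mod p)" for f g b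
  proof -
    let ?w = "lead f" and ?w' = "lead g"
    obtain x y where xy: "x \<in> exp_set p I" "f x \<noteq> 0" "y \<in> exp_set p I" "g y \<noteq> 0"
      using f g by (auto simp: nonz_def)
    note lf = lead[of x f, OF xy(1,2)] and lg = lead[of y g, OF xy(3,4)]
    have cl: "exp_comb p I ?w ?w' a b \<in> exp_set p I" for a b
      using p1 by (auto simp: exp_comb_def exp_set_def)
    have ce: "exp_comb p I ?w ?w' (p - 1 - b) b = e"
      using sol by (intro exp_ext[OF cl e]) (auto simp: exp_comb_def)
    have "\<exists>t. pw (\<lambda>x. f x + t * g x) (p - 1) (exp_comb p I ?w ?w' (p - 1 - b) b) \<noteq> 0"
      by (rule polarised_power_nonzero[where cl = "exp_comb p I ?w ?w'"
          and ka = "carry_pow p \<rho> I \<alpha> \<beta> ?w ?w'", OF lf(3) lg(3) lf(1) lg(1) lf(2) lg(2) cl _ _ _ _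
          carry_path[OF \<rho> cm] b ch[OF b] int_val[OF ch[OF b]] inj])
        (simp_all add: carry_pow_def exp_comb_def exp_zero_def exp_add_def mod_add_left_eq mod_add_right_eq add_ac numeral_2_eq_2 cong: restrict_cong)
    then show False using tr[OF V(1)[OF f(1) V(2)[OF g(1)]]] unfolding ce by blast
  qed
  have C_card: "card C \<le> (p ^ (2 * card I) - 1) div (p - 1)"
  proof (rule card_lines_bound[OF p I _ e])
    show "C \<subseteq> exp_set p I" using lead unfolding C_def nonz_def by blast
    show "exp_add p I w e \<noteq> exp_zero I" if w: "w \<in> C" for w
    proof
      assume eq: "exp_add p I w e = exp_zero I"
      obtain f where f: "f \<in> V" "nonz f" "w = lead f" using w unfolding C_def by blast
      have aux: "[(p - 1) * x = y] (mod p)" if "p dvd x + y" for x y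
      proof -
        have "(p - 1) * x + x = p * x" using p1 by (cases p) auto
        then have "[(p - 1) * x + x = y + x] (mod p)"
          using that by (simp add: cong_def add.commute)
        then show ?thesis by (simp add: cong_add_rcancel_nat)
      qed
      show False
      \<comment> \<open>With \<open>g = f\<close> and \<open>b = 0\<close> the coefficient in
        question is the power of \<open>f\<close> itself.\<close>
      proof (rule key[OF f(1,2) f(1,2), of 0])
        fix k assume k: "k \<in> I"
        have "p dvd fst (w k) + fst (e k)" "p dvd snd (w k) + snd (e k)"
          using fun_cong[OF eq, of k] k by (auto simp: exp_add_def exp_zero_def)
        then show "[(p - 1 - 0) * fst (lead f k) + 0 * fst (lead f k) = fst (e k)] (mod p) \<and>
         [(p - 1 - 0) * snd (lead f k) + 0 * snd (lead f k) = snd (e k)] (mod p)"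
          using aux f(3) by simp
      qed auto
    qed
    fix w w' k k'
    assume w: "w \<in> C" "w' \<in> C" and k: "0 < k" "k < p" "0 < k'" "k' < p" "k \<noteq> k'"
      and eq: "\<And>i. i \<in> I \<Longrightarrow> [k * (fst (w i) + fst (e i)) = k' * (fst (w' i) + fst (e i))] (mod p) \<and>
             [k * (snd (w i) + snd (e i)) = k' * (snd (w' i) + snd (e i))] (mod p)"
    obtain f g where f: "f \<in> V" "nonz f" "w = lead f" and g: "g \<in> V" "nonz g" "w' = lead g"
      using w unfolding C_def by blast
    obtain b where b: "b \<le> p - 1"
      "\<And>x y e. [k * (x + e) = k' * (y + e)] (mod p) \<Longrightarrow> [(p - 1 - b) * x + b * y = e] (mod p)"
      using line_exponent[OF p k] by blast
    \<comment> \<open>For \<open>e = 0\<close> the classes are proportional,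
      \<open>k w = k' w'\<close>, and a bilinear form is symmetric on a line.\<close>
    have cm: "\<rho> ^ exp_form I w w' = \<rho> ^ exp_form I w' w"
      using comm
    proof
      assume "e = exp_zero I"
      then have eq: "[k * fst (w i) = k' * fst (w' i)] (mod p)" "[k * snd (w i) = k' * snd (w' i)] (mod p)"
        if "i \<in> I" for i using eq[OF that] that by (auto simp: exp_zero_def)
      have "[k' * exp_form I w w' = (\<Sum>i\<in>I. snd (w i) * (k' * fst (w' i)))] (mod p)"
        by (simp add: exp_form_def sum_distrib_left mult_ac)
      also have "[(\<Sum>i\<in>I. snd (w i) * (k' * fst (w' i))) = (\<Sum>i\<in>I. snd (w i) * (k * fst (w i)))] (mod p)"
        using eq by (intro cong_sum cong_mult[OF cong_refl]) (auto simp: cong_sym_eq)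
      also have "(\<Sum>i\<in>I. snd (w i) * (k * fst (w i))) = (\<Sum>i\<in>I. (k * snd (w i)) * fst (w i))"
        by (simp add: mult_ac)
      also have "[\<dots> = (\<Sum>i\<in>I. (k' * snd (w' i)) * fst (w i))] (mod p)"
        using eq by (intro cong_sum cong_mult[OF _ cong_refl]) auto
      also have "(\<Sum>i\<in>I. (k' * snd (w' i)) * fst (w i)) = k' * exp_form I w' w"
        by (simp add: exp_form_def sum_distrib_left mult_ac)
      finally have c: "[k' * exp_form I w w' = k' * exp_form I w' w] (mod p)" .
      have "coprime p k'" using k p by (intro prime_imp_coprime) (auto dest: dvd_imp_le)
      then have "[exp_form I w w' = exp_form I w' w] (mod p)"
        using c by (simp add: cong_mult_lcancel_nat coprime_commute)
      then show ?thesis by (rule power_cong_exponent[OF \<rho>])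
    qed simp
    show False
    proof (rule key[OF f(1,2) g(1,2) _ b(1)])
      show "\<rho> ^ exp_form I (lead f) (lead g) = \<rho> ^ exp_form I (lead g) (lead f)"
        using cm by (simp only: f(3) g(3))
      fix i assume "i \<in> I"
      then show "[(p - 1 - b) * fst (lead f i) + b * fst (lead g i) = fst (e i)] (mod p) \<and>
         [(p - 1 - b) * snd (lead f i) + b * snd (lead g i) = snd (e i)] (mod p)"
        using eq b(2) unfolding f(3) g(3) by blast
    qed
  qed
  show thesis
  proof (rule that[OF _ C_card])
    show "C \<subseteq> exp_set p I" using lead unfolding C_def nonz_def by blast
    fix f w assume f: "f \<in> V" "\<And>w. w \<in> C \<Longrightarrow> f w = 0" "w \<in> exp_set p I"
    show "f w = 0"
    proof (rule ccontr)
      assume nz: "f w \<noteq> 0"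
      then have "lead f \<in> C" using f unfolding C_def nonz_def by blast
      with lead(2)[of w f] f nz show False by blast
    qed
  qed
qed

section \<open>The valuation of the base field\<close>

text \<open>\<open>ix\<close> numbers the variables because the order on
  \<open>nat \<Rightarrow>\<^sub>0 int\<close> is lexicographic, the smallest index deciding. The
  entries are integers so that degrees of fractions can be formed.\<close>

definition exp_int :: "('i \<Rightarrow> nat) \<Rightarrow> ('i \<Rightarrow>\<^sub>0 nat) \<Rightarrow> (nat \<Rightarrow>\<^sub>0 int)" where
  "exp_int ix e = (\<Sum>i\<in>Poly_Mapping.keys e. Poly_Mapping.single (ix i) (int (Poly_Mapping.lookup e i)))"

lemma exp_int_add: "exp_int ix (a + b) = exp_int ix a + exp_int ix b"
  unfolding exp_int_def
  by (rule setsum_keys_plus_distrib) (auto simp: single_add)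

lemma exp_int_inj:
  assumes "inj_on ix I" "Poly_Mapping.keys a \<subseteq> I" "Poly_Mapping.keys b \<subseteq> I" "exp_int ix a = exp_int ix b"
  shows "a = b"
proof (rule poly_mapping_eqI)
  have lk: "Poly_Mapping.lookup (exp_int ix e) (ix i) = int (Poly_Mapping.lookup e i)"
    if "i \<in> I" "Poly_Mapping.keys e \<subseteq> I" for e i
  proof -
    have "Poly_Mapping.lookup (exp_int ix e) (ix i) =
      (\<Sum>j\<in>Poly_Mapping.keys e. if j = i then int (Poly_Mapping.lookup e i) else 0)"
      unfolding exp_int_def lookup_sum using that assms(1)
      by (intro sum.cong) (auto simp: lookup_single when_def inj_on_def)
    then show ?thesis by (simp add: in_keys_iff)
  qed
  fix i
  show "Poly_Mapping.lookup a i = Poly_Mapping.lookup b i"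
  proof (cases "i \<in> I")
    case True
    then show ?thesis using lk[OF True assms(2)] lk[OF True assms(3)] assms(4) by simp
  next
    case False
    then show ?thesis using assms(2,3) by (metis in_keys_iff subset_iff)
  qed
qed

definition mon_eval :: "('i \<Rightarrow> 'f::field) \<Rightarrow> ('i \<Rightarrow>\<^sub>0 nat) \<Rightarrow> 'f" where
  "mon_eval t e = (\<Prod>i\<in>Poly_Mapping.keys e. t i ^ Poly_Mapping.lookup e i)"

definition mpoly_eval :: "('i \<Rightarrow> 'f::field) \<Rightarrow> (('i \<Rightarrow>\<^sub>0 nat) \<Rightarrow>\<^sub>0 'f) \<Rightarrow> 'f" where
  "mpoly_eval t P = (\<Sum>e\<in>Poly_Mapping.keys P. Poly_Mapping.lookup P e * mon_eval t e)"

lemma mon_eval_add: "mon_eval t (a + b) = mon_eval t a * mon_eval t b"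
proof -
  have sup: "mon_eval t e = (\<Prod>i\<in>Poly_Mapping.keys a \<union> Poly_Mapping.keys b. t i ^ Poly_Mapping.lookup e i)"
    if "Poly_Mapping.keys e \<subseteq> Poly_Mapping.keys a \<union> Poly_Mapping.keys b" for e
    unfolding mon_eval_def by (rule prod.mono_neutral_left) (use that in \<open>auto simp: in_keys_iff\<close>)
  show ?thesis
    by (subst (1 2 3) sup) (use keys_add[of a b] in \<open>auto simp: lookup_add power_add prod.distrib\<close>)
qed

lemma mpoly_eval_add: "mpoly_eval t (P + Q) = mpoly_eval t P + mpoly_eval t Q"
  unfolding mpoly_eval_def
  by (rule setsum_keys_plus_distrib) (auto simp: algebra_simps)

lemma mpoly_eval_0 [simp]: "mpoly_eval t 0 = 0"
  by (simp add: mpoly_eval_def)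

lemma mpoly_eval_sum: "mpoly_eval t (\<Sum>s\<in>S. P s) = (\<Sum>s\<in>S. mpoly_eval t (P s))"
  by (induction S rule: infinite_finite_induct) (auto simp: mpoly_eval_add)

lemma mpoly_eval_single: "mpoly_eval t (Poly_Mapping.single e c) = c * mon_eval t e"
  by (cases "c = 0") (auto simp: mpoly_eval_def)

lemma poly_mapping_sum_single: "P = (\<Sum>e\<in>Poly_Mapping.keys P. Poly_Mapping.single e (Poly_Mapping.lookup P e))"
  by (rule poly_mapping_eqI)
    (simp add: lookup_sum lookup_single when_def in_keys_iff)

lemma mult_sum_single: "P * Q = (\<Sum>a\<in>Poly_Mapping.keys P. \<Sum>b\<in>Poly_Mapping.keys Q.
    Poly_Mapping.single (a + b) (Poly_Mapping.lookup P a * Poly_Mapping.lookup Q b))"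
  by (subst poly_mapping_sum_single[of P], subst poly_mapping_sum_single[of Q])
    (simp add: sum_product mult_single)

lemma mpoly_eval_mult: "mpoly_eval t (P * Q) = mpoly_eval t P * mpoly_eval t Q"
  by (subst mult_sum_single)
    (simp add: mpoly_eval_sum mpoly_eval_single mon_eval_add mpoly_eval_def[of t P] mpoly_eval_def[of t Q]
      sum_product mult_ac)

definition mpolys :: "'f::field set \<Rightarrow> 'i set \<Rightarrow> (('i \<Rightarrow>\<^sub>0 nat) \<Rightarrow>\<^sub>0 'f) set" where
  "mpolys K I = {P. (\<forall>e. Poly_Mapping.lookup P e \<in> K) \<and> (\<forall>e\<in>Poly_Mapping.keys P. Poly_Mapping.keys e \<subseteq> I)}"

definition mtop :: "('i \<Rightarrow> nat) \<Rightarrow> (('i \<Rightarrow>\<^sub>0 nat) \<Rightarrow>\<^sub>0 'f::field) \<Rightarrow> (nat \<Rightarrow>\<^sub>0 int)" where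
  "mtop ix P = Max (exp_int ix ` Poly_Mapping.keys P)"

lemma mtop_attained:
  assumes "P \<noteq> 0"
  shows "\<exists>e\<in>Poly_Mapping.keys P. mtop ix P = exp_int ix e \<and> (\<forall>e'\<in>Poly_Mapping.keys P. exp_int ix e' \<le> exp_int ix e)"
proof -
  have "mtop ix P \<in> exp_int ix ` Poly_Mapping.keys P"
    unfolding mtop_def using assms by (intro Max_in) auto
  then obtain e where e: "e \<in> Poly_Mapping.keys P" "mtop ix P = exp_int ix e" by auto
  have "\<forall>e'\<in>Poly_Mapping.keys P. exp_int ix e' \<le> exp_int ix e"
    unfolding e(2)[symmetric] by (simp add: mtop_def)
  with e show ?thesis by blast
qed

lemma mtop_add:
  assumes "P \<noteq> 0" "Q \<noteq> 0" "P + Q \<noteq> 0"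
  shows "mtop ix (P + Q) \<le> max (mtop ix P) (mtop ix Q)"
proof -
  obtain e where e: "e \<in> Poly_Mapping.keys (P + Q)" "mtop ix (P + Q) = exp_int ix e"
    using mtop_attained[OF assms(3)] by blast
  then have "e \<in> Poly_Mapping.keys P \<or> e \<in> Poly_Mapping.keys Q"
    using keys_add[of P Q] by auto
  then show ?thesis
    unfolding e(2) by (auto simp: mtop_def le_max_iff_disj)
qed

text \<open>The maximal exponents of the two factors form the only pair with maximal sum, so their
  coefficients are multiplied without cancellation. Injectivity of \<open>ix\<close> keeps different
  exponents apart.\<close>

lemma mtop_mult:
  assumes ix: "inj_on ix I" and P: "P \<in> mpolys K I" "P \<noteq> 0" and Q: "Q \<in> mpolys K I" "Q \<noteq> 0"
  shows "P * Q \<noteq> 0" "mtop ix (P * Q) = mtop ix P + mtop ix Q"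
proof -
  obtain a where a: "a \<in> Poly_Mapping.keys P" "mtop ix P = exp_int ix a"
    "\<And>e'. e' \<in> Poly_Mapping.keys P \<Longrightarrow> exp_int ix e' \<le> exp_int ix a" using mtop_attained[OF P(2), of ix] by metis
  obtain b where b: "b \<in> Poly_Mapping.keys Q" "mtop ix Q = exp_int ix b"
    "\<And>e'. e' \<in> Poly_Mapping.keys Q \<Longrightarrow> exp_int ix e' \<le> exp_int ix b" using mtop_attained[OF Q(2), of ix] by metis
  have uniq: "x = a \<and> y = b" if "x \<in> Poly_Mapping.keys P" "y \<in> Poly_Mapping.keys Q" "x + y = a + b" for x y
  proof -
    have "exp_int ix x + exp_int ix y = exp_int ix a + exp_int ix b"
      using that(3) by (metis exp_int_add)
    then have "exp_int ix x = exp_int ix a \<and> exp_int ix y = exp_int ix b"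
      using a(3)[OF that(1)] b(3)[OF that(2)] by (metis add_left_cancel add_le_cancel_left add_mono_thms_linordered_semiring(3) add_right_cancel antisym_conv order_antisym add_right_mono)
    then show ?thesis
      using exp_int_inj[OF ix] P(1) Q(1) that a(1) b(1) unfolding mpolys_def by auto
  qed
  have "Poly_Mapping.lookup (P * Q) (a + b) =
    (\<Sum>x\<in>Poly_Mapping.keys P. \<Sum>y\<in>Poly_Mapping.keys Q.
       if x = a then if y = b then Poly_Mapping.lookup P a * Poly_Mapping.lookup Q b else 0 else 0)"
    unfolding mult_sum_single lookup_sum
    by (intro sum.cong refl) (auto simp: lookup_single when_def dest: uniq)
  also have "\<dots> = (\<Sum>x\<in>Poly_Mapping.keys P. if x = a then Poly_Mapping.lookup P a * Poly_Mapping.lookup Q b else 0)"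
    by (intro sum.cong refl) (use b(1) in auto)
  also have "\<dots> = Poly_Mapping.lookup P a * Poly_Mapping.lookup Q b" using a(1) by auto
  finally have ab: "a + b \<in> Poly_Mapping.keys (P * Q)"
    using a(1) b(1) by (auto simp: in_keys_iff)
  then show PQ: "P * Q \<noteq> 0" by auto
  obtain c where c: "c \<in> Poly_Mapping.keys (P * Q)" "mtop ix (P * Q) = exp_int ix c"
    "\<And>e'. e' \<in> Poly_Mapping.keys (P * Q) \<Longrightarrow> exp_int ix e' \<le> exp_int ix c" using mtop_attained[OF PQ, of ix] by metis
  obtain x y where xy: "x \<in> Poly_Mapping.keys P" "y \<in> Poly_Mapping.keys Q" "c = x + y"
    using c(1) keys_mult[of P Q] by auto
  show "mtop ix (P * Q) = mtop ix P + mtop ix Q"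
    using c(3)[OF ab] a(3)[OF xy(1)] b(3)[OF xy(2)] unfolding a(2) b(2) c(2) xy(3) exp_int_add
    by (meson add_mono order_antisym)
qed

lemma subfield_class_ringD:
  fixes K :: "'f::field set"
  assumes "subfield K class_ring"
  shows "0 \<in> K" "1 \<in> K" "\<And>x y. x \<in> K \<Longrightarrow> y \<in> K \<Longrightarrow> x + y \<in> K" "\<And>x y. x \<in> K \<Longrightarrow> y \<in> K \<Longrightarrow> x * y \<in> K"
    "\<And>x. x \<in> K \<Longrightarrow> - x \<in> K"
proof -
  have sr: "subring K (class_ring :: 'f ring)" using assms by (rule subfieldE(1))
  show "0 \<in> K" "1 \<in> K" using subringE(2,3)[OF sr] by auto
  show "\<And>x y. x \<in> K \<Longrightarrow> y \<in> K \<Longrightarrow> x + y \<in> K" "\<And>x y. x \<in> K \<Longrightarrow> y \<in> K \<Longrightarrow> x * y \<in> K"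
    using subringE(6,7)[OF sr] by auto
  show "\<And>x. x \<in> K \<Longrightarrow> - x \<in> K"
    using subringE(5)[OF sr] by (auto simp: class_ring_simps)
qed

lemma class_ring_inv:
  fixes x :: "'f::field"
  assumes "x \<noteq> 0"
  shows "inv\<^bsub>class_ring\<^esub> x = inverse x"
  using assms by (simp add: class_ring_simps)

lemma sum_mem: "0 \<in> K \<Longrightarrow> (\<And>x y. x \<in> K \<Longrightarrow> y \<in> K \<Longrightarrow> x + y \<in> K) \<Longrightarrow> (\<And>s. s \<in> S \<Longrightarrow> f s \<in> K) \<Longrightarrow> sum f S \<in> K"
  by (induction S rule: infinite_finite_induct) auto

lemma mpolys_closed:
  assumes K: "subfield K class_ring" and P: "P \<in> mpolys K I" and Q: "Q \<in> mpolys K I"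
  shows "P + Q \<in> mpolys K I" "P * Q \<in> mpolys K I" "- P \<in> mpolys K I" "P - Q \<in> mpolys K I"
proof -
  note K' = subfield_class_ringD[OF K]
  have *: "P + Q \<in> mpolys K I" if "P \<in> mpolys K I" "Q \<in> mpolys K I" for P Q
    using that K' keys_add[of P Q] by (fastforce simp: mpolys_def lookup_add)
  have **: "- Q \<in> mpolys K I" if "Q \<in> mpolys K I" for Q
    using that K' by (auto simp: mpolys_def)
  show "P + Q \<in> mpolys K I" "- P \<in> mpolys K I" "P - Q \<in> mpolys K I"
    using *[OF P Q] **[OF P] *[OF P **[OF Q]] by simp_all
  have "Poly_Mapping.lookup (P * Q) e \<in> K" for e
    unfolding mult_sum_single lookup_sum using K' P Q
    by (intro sum_mem) (auto simp: lookup_single when_def mpolys_def)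
  moreover have "Poly_Mapping.keys e \<subseteq> I" if e: "e \<in> Poly_Mapping.keys (P * Q)" for e
  proof -
    obtain x y where xy: "x \<in> Poly_Mapping.keys P" "y \<in> Poly_Mapping.keys Q" "e = x + y"
      using e keys_mult[of P Q] by blast
    then show ?thesis using keys_add[of x y] P Q by (force simp: mpolys_def)
  qed
  ultimately show "P * Q \<in> mpolys K I" by (auto simp: mpolys_def)
qed

lemma mpolys_single: "subfield K class_ring \<Longrightarrow> c \<in> K \<Longrightarrow> Poly_Mapping.keys e \<subseteq> I \<Longrightarrow> Poly_Mapping.single e c \<in> mpolys K I"
  using subfield_class_ringD[of K] by (auto simp: mpolys_def lookup_single when_def)

text \<open>\<open>v\<close> is the lexicographic degree of a numerator minus that of a denominator.
  Algebraic independence makes evaluation injective on polynomials, so that the difference depends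
  only on the fraction.\<close>

theorem rational_valuation:
  fixes t :: "'i \<Rightarrow> 'f::field" and ix :: "'i \<Rightarrow> nat"
  assumes K: "subfield K class_ring" and ind: "algebraically_independent K I t"
    and gen: "generate_field class_ring (K \<union> t ` I) = (UNIV :: 'f set)" and ix: "inj_on ix I"
  obtains v :: "'f \<Rightarrow> (nat \<Rightarrow>\<^sub>0 int)" where "valuation v" "\<And>c. c \<in> K \<Longrightarrow> c \<noteq> 0 \<Longrightarrow> v c = 0"
    "\<And>i. i \<in> I \<Longrightarrow> t i \<noteq> 0 \<and> v (t i) = Poly_Mapping.single (ix i) 1"
proof -
  note K' = subfield_class_ringD[OF K]
  let ?M = "mpolys K I" and ?ev = "mpoly_eval t"
  have ev_neg: "?ev (- P) = - ?ev P" for P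
    using mpoly_eval_add[of t P "- P"] by (simp add: eq_neg_iff_add_eq_0 add.commute)
  have ev0: "P = 0" if "P \<in> ?M" "?ev P = 0" for P
    using ind that unfolding algebraically_independent_def mpolys_def mpoly_eval_def mon_eval_def by blast
  have ev_eq: "P = Q" if "P \<in> ?M" "Q \<in> ?M" "?ev P = ?ev Q" for P Q
    using ev0[of "P - Q"] mpolys_closed(4)[OF K that(1,2)] that(3) mpoly_eval_add[of t P "- Q"] by (simp add: ev_neg)
  have one: "1 \<in> ?M" "?ev 1 = 1"
    using mpolys_single[OF K K'(2), of 0 I] mpoly_eval_single[of t 0 1] by (auto simp: mon_eval_def)
  have frac: "\<exists>P\<in>?M. \<exists>Q\<in>?M. Q \<noteq> 0 \<and> x = ?ev P / ?ev Q" for x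
  proof -
    have "x \<in> generate_field class_ring (K \<union> t ` I)" using gen by simp
    then show ?thesis
    proof induction
      case one
      then show ?case using \<open>1 \<in> ?M\<close> \<open>?ev 1 = 1\<close> by (intro bexI[of _ 1]) auto
    next
      case (incl h)
      have "\<exists>P\<in>?M. h = ?ev P"
      proof (cases "h \<in> K")
        case True
        then show ?thesis using mpolys_single[OF K True, of 0 I] mpoly_eval_single[of t 0 h]
          by (intro bexI[of _ "Poly_Mapping.single 0 h"]) (auto simp: mon_eval_def)
      next
        case False
        then obtain i where i: "i \<in> I" "h = t i" using incl by auto
        then show ?thesis
          using mpolys_single[OF K K'(2), of "Poly_Mapping.single i 1" I] mpoly_eval_single[of t "Poly_Mapping.single i 1" 1]
          by (intro bexI[of _ "Poly_Mapping.single (Poly_Mapping.single i 1) 1"]) (auto simp: mon_eval_def)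
      qed
      then obtain P where "P \<in> ?M" "h = ?ev P" by blast
      then show ?case using one by (intro bexI[of _ P] bexI[of _ 1]) auto
    next
      case (a_inv h)
      then obtain P Q where "P \<in> ?M" "Q \<in> ?M" "Q \<noteq> 0" "h = ?ev P / ?ev Q" by auto
      then show ?case using mpolys_closed(3)[OF K, of P]
        by (intro bexI[of _ "- P"] bexI[of _ Q]) (auto simp: ev_neg class_ring_simps)
    next
      case (m_inv h)
      then obtain P Q where "P \<in> ?M" "Q \<in> ?M" "Q \<noteq> 0" "h = ?ev P / ?ev Q" "h \<noteq> 0" by auto
      then show ?case
        by (intro bexI[of _ Q] bexI[of _ P]) (auto simp: class_ring_inv)
    next
      case (eng_add h1 h2)
      then obtain P Q P' Q' where *: "P \<in> ?M" "Q \<in> ?M" "Q \<noteq> 0" "h1 = ?ev P / ?ev Q"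
        "P' \<in> ?M" "Q' \<in> ?M" "Q' \<noteq> 0" "h2 = ?ev P' / ?ev Q'" by auto
      from this have "?ev Q \<noteq> 0" "?ev Q' \<noteq> 0" using ev0 by blast+
      then have "h1 + h2 = ?ev (P * Q' + P' * Q) / ?ev (Q * Q')"
        by (simp add: *(4,8) add_frac_eq mpoly_eval_add mpoly_eval_mult)
      moreover have "Q * Q' \<noteq> 0" using mtop_mult(1)[OF ix] * by blast
      moreover have "P * Q' + P' * Q \<in> ?M" "Q * Q' \<in> ?M" using * mpolys_closed[OF K] by blast+
      ultimately show ?case by auto
    next
      case (eng_mult h1 h2)
      then obtain P Q P' Q' where *: "P \<in> ?M" "Q \<in> ?M" "Q \<noteq> 0" "h1 = ?ev P / ?ev Q"
        "P' \<in> ?M" "Q' \<in> ?M" "Q' \<noteq> 0" "h2 = ?ev P' / ?ev Q'" by auto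
      then show ?case using mtop_mult(1)[OF ix, of Q K Q'] mpolys_closed[OF K]
        by (intro bexI[of _ "P * P'"] bexI[of _ "Q * Q'"]) (auto simp: mpoly_eval_mult)
    qed
  qed
  define v where "v = (\<lambda>x. SOME g. \<exists>P\<in>?M. \<exists>Q\<in>?M. P \<noteq> 0 \<and> Q \<noteq> 0 \<and> x = ?ev P / ?ev Q \<and> g = mtop ix P - mtop ix Q)"
  have v: "v (?ev P / ?ev Q) = mtop ix P - mtop ix Q" if "P \<in> ?M" "Q \<in> ?M" "P \<noteq> 0" "Q \<noteq> 0" for P Q
    unfolding v_def
  proof (rule some_equality)
    fix g assume "\<exists>P'\<in>?M. \<exists>Q'\<in>?M. P' \<noteq> 0 \<and> Q' \<noteq> 0 \<and> ?ev P / ?ev Q = ?ev P' / ?ev Q' \<and> g = mtop ix P' - mtop ix Q'"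
    then obtain P' Q' where *: "P' \<in> ?M" "Q' \<in> ?M" "P' \<noteq> 0" "Q' \<noteq> 0" "?ev P / ?ev Q = ?ev P' / ?ev Q'"
      "g = mtop ix P' - mtop ix Q'" by blast
    have "?ev Q \<noteq> 0" "?ev Q' \<noteq> 0" using * that ev0 by blast+
    then have "?ev (P * Q') = ?ev (P' * Q)"
      using *(5) by (simp add: mpoly_eval_mult field_simps)
    then have "P * Q' = P' * Q"
      using ev_eq mpolys_closed(2)[OF K] that * by metis
    then have "mtop ix P + mtop ix Q' = mtop ix P' + mtop ix Q"
      using mtop_mult(2)[OF ix] that * by metis
    then show "g = mtop ix P - mtop ix Q"
      unfolding *(6) by (simp add: algebra_simps)
  qed (use that in blast)
  have fracnz: "\<exists>P\<in>?M. \<exists>Q\<in>?M. P \<noteq> 0 \<and> Q \<noteq> 0 \<and> x = ?ev P / ?ev Q" if "x \<noteq> 0" for x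
  proof -
    obtain P Q where PQ: "P \<in> ?M" "Q \<in> ?M" "Q \<noteq> 0" "x = ?ev P / ?ev Q" using frac[of x] by blast
    moreover from this have "P \<noteq> 0" using that by auto
    ultimately show ?thesis by blast
  qed
  have "valuation v"
  proof
    fix x y :: 'f assume x: "x \<noteq> 0" and y: "y \<noteq> 0"
    obtain P Q where P: "P \<in> ?M" "Q \<in> ?M" "P \<noteq> 0" "Q \<noteq> 0" "x = ?ev P / ?ev Q" using fracnz[OF x] by blast
    obtain P' Q' where P': "P' \<in> ?M" "Q' \<in> ?M" "P' \<noteq> 0" "Q' \<noteq> 0" "y = ?ev P' / ?ev Q'" using fracnz[OF y] by blast
    have PQ: "P * P' \<noteq> 0" "P * Q' \<noteq> 0" "P' * Q \<noteq> 0" "Q * Q' \<noteq> 0"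
      "mtop ix (P * P') = mtop ix P + mtop ix P'" "mtop ix (P * Q') = mtop ix P + mtop ix Q'"
      "mtop ix (P' * Q) = mtop ix P' + mtop ix Q" "mtop ix (Q * Q') = mtop ix Q + mtop ix Q'"
      using P P' mtop_mult[OF ix] by blast+
    have M: "P * P' \<in> ?M" "P * Q' \<in> ?M" "P' * Q \<in> ?M" "Q * Q' \<in> ?M"
      using P P' mpolys_closed[OF K] by blast+
    have "x * y = ?ev (P * P') / ?ev (Q * Q')" by (simp add: P P' mpoly_eval_mult)
    then show "v (x * y) = v x + v y"
      using v[OF M(1,4) PQ(1,4)] v[OF P(1-4)] v[OF P'(1-4)] PQ P(5) P'(5) by simp
    assume xy: "x + y \<noteq> 0"
    have evQ: "?ev Q \<noteq> 0" "?ev Q' \<noteq> 0" using P P' ev0 by blast+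
    then have e: "x + y = ?ev (P * Q' + P' * Q) / ?ev (Q * Q')"
      by (simp add: P(5) P'(5) add_frac_eq mpoly_eval_mult mpoly_eval_add)
    then have nz: "P * Q' + P' * Q \<noteq> 0" using xy by auto
    have "v (x + y) = mtop ix (P * Q' + P' * Q) - mtop ix (Q * Q')"
      unfolding e by (rule v) (use M mpolys_closed[OF K] nz PQ in blast)+
    also have "\<dots> \<le> max (mtop ix (P * Q')) (mtop ix (P' * Q)) - mtop ix (Q * Q')"
      using mtop_add[OF PQ(2,3) nz, of ix] by (rule diff_right_mono)
    also have "\<dots> = max (v x) (v y)"
      unfolding max_diff_distrib_left using v[OF P(1-4)] v[OF P'(1-4)] P(5) P'(5) PQ by simp
    finally show "v (x + y) \<le> max (v x) (v y)" .
  qed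
  moreover have "v c = 0" if "c \<in> K" "c \<noteq> 0" for c
  proof -
    have "?ev (Poly_Mapping.single 0 c) / ?ev 1 = c"
      using mpoly_eval_single[of t 0 c] one by (simp add: mon_eval_def)
    then show ?thesis
      using v[of "Poly_Mapping.single 0 c" 1] mpolys_single[OF K that(1), of 0 I] one that
      by (simp add: mtop_def) (metis lookup_single_eq lookup_zero)
  qed
  moreover have "t i \<noteq> 0 \<and> v (t i) = Poly_Mapping.single (ix i) 1" if i: "i \<in> I" for i
  proof -
    let ?P = "Poly_Mapping.single (Poly_Mapping.single i (1::nat)) (1::'f)"
    have P: "?P \<in> ?M" "?P \<noteq> 0" "?ev ?P = t i"
      using mpolys_single[OF K K'(2), of "Poly_Mapping.single i 1" I] i mpoly_eval_single[of t "Poly_Mapping.single i 1" 1]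
      by (auto simp: mon_eval_def) (metis lookup_single_eq lookup_zero one_neq_zero)
    then have "t i \<noteq> 0" using ev0 by metis
    moreover have "mtop ix ?P = Poly_Mapping.single (ix i) 1" "mtop ix (1 :: ('i \<Rightarrow>\<^sub>0 nat) \<Rightarrow>\<^sub>0 'f) = 0"
      by (simp_all add: mtop_def exp_int_def)
    ultimately show ?thesis using v[OF P(1) one(1) P(2)] P(3) one(2) by simp
  qed
  ultimately show thesis by (rule that)
qed

section \<open>Iterated Laurent series fields\<close>

lemma single_less:
  fixes a b :: "nat \<Rightarrow>\<^sub>0 int"
  assumes "\<And>j. j \<le> n \<Longrightarrow> Poly_Mapping.lookup a j = 0" "\<And>j. j \<le> n \<Longrightarrow> Poly_Mapping.lookup b j = 0" "s < s'"
  shows "Poly_Mapping.single n s + a < Poly_Mapping.single n s' + b"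
  unfolding less_poly_mapping.rep_eq less_fun_def using assms
  by (intro exI[of _ n]) (auto simp: lookup_add lookup_single when_def)

text \<open>The intermediate fields of the iteration are subsets of one type, so valuations are
  relativised to a set.\<close>

definition val_on :: "'f::field set \<Rightarrow> ('f \<Rightarrow> 'g::linordered_ab_group_add) \<Rightarrow> bool" where
  "val_on K v \<longleftrightarrow> 0 \<in> K \<and> 1 \<in> K \<and> (\<forall>x\<in>K. \<forall>y\<in>K. x + y \<in> K \<and> x * y \<in> K \<and>
     (x \<noteq> 0 \<longrightarrow> y \<noteq> 0 \<longrightarrow> v (x * y) = v x + v y \<and> (x + y \<noteq> 0 \<longrightarrow> v (x + y) \<le> max (v x) (v y))))"

text \<open>The new valuation puts minus the order in \<open>t\<close> at position \<open>n\<close>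
  and adds the value of the lowest coefficient. The old values vanish up to position
  \<open>n\<close>, so the order in \<open>t\<close> decides first. As \<open>t\<close> is the
  inverse of a variable, it gets the degree -1.\<close>

lemma laurent_step:
  fixes v :: "'f::field \<Rightarrow> (nat \<Rightarrow>\<^sub>0 int)"
  assumes K: "val_on K v" and low: "\<And>x j. x \<in> K \<Longrightarrow> x \<noteq> 0 \<Longrightarrow> j \<le> n \<Longrightarrow> Poly_Mapping.lookup (v x) j = 0"
    and L: "laurent_series_field K t L"
  obtains v' :: "'f \<Rightarrow> (nat \<Rightarrow>\<^sub>0 int)" where "val_on L v'"
    "K \<subseteq> L" "t \<in> L" "t \<noteq> 0" "\<And>x. x \<in> K \<Longrightarrow> x \<noteq> 0 \<Longrightarrow> v' x = v x" "v' t = Poly_Mapping.single n (- 1)"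
    "\<And>x j. x \<in> L \<Longrightarrow> x \<noteq> 0 \<Longrightarrow> j < n \<Longrightarrow> Poly_Mapping.lookup (v' x) j = 0"
proof -
  note K' = K[unfolded val_on_def]
  define S where "S = {g. \<forall>n. fls_nth g n \<in> K}"
  obtain \<phi> where bij: "bij_betw \<phi> S L"
    and hom: "\<And>g h. g \<in> S \<Longrightarrow> h \<in> S \<Longrightarrow> \<phi> (g + h) = \<phi> g + \<phi> h \<and> \<phi> (g * h) = \<phi> g * \<phi> h"
    and const: "\<And>c. c \<in> K \<Longrightarrow> \<phi> (fls_const c) = c" and X: "\<phi> fls_X = t"
    using L unfolding laurent_series_field_def S_def by blast
  have S_add: "g + h \<in> S" if "g \<in> S" "h \<in> S" for g h using that K' by (auto simp: S_def)
  have sum_K: "sum f A \<in> K" if "\<And>a. a \<in> A \<Longrightarrow> f a \<in> K" for f and A :: "int set"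
    using that K' by (induction A rule: infinite_finite_induct) auto
  have S_mult: "g * h \<in> S" if "g \<in> S" "h \<in> S" for g h
    using that K' unfolding S_def by (auto simp: fls_times_nth(1) intro!: sum_K)
  have S_const: "fls_const c \<in> S" if "c \<in> K" for c using that K' by (auto simp: S_def)
  have S_X: "fls_X \<in> S" using K' by (auto simp: S_def)
  have phi0: "\<phi> 0 = 0" using const[of 0] K' by simp
  have inj: "\<phi> g = \<phi> h \<longleftrightarrow> g = h" if "g \<in> S" "h \<in> S" for g h
    using bij that by (auto simp: bij_betw_def inj_on_def)
  have phi0_iff: "\<phi> g = 0 \<longleftrightarrow> g = 0" if "g \<in> S" for g
    using inj[OF that S_const[of 0]] const[of 0] K' by simp
  define w where "w = (\<lambda>g :: 'f fls. Poly_Mapping.single n (- fls_subdegree g) + v (fls_nth g (fls_subdegree g)))"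
  define v' where "v' = (\<lambda>x. w (inv_into S \<phi> x))"
  have v': "v' (\<phi> g) = w g" if "g \<in> S" for g
    using bij that by (simp add: v'_def bij_betw_def inv_into_f_f)
  have lc: "fls_nth g (fls_subdegree g) \<in> K" if "g \<in> S" for g using that by (auto simp: S_def)
  have w_mult: "w (g * h) = w g + w h" if "g \<in> S" "h \<in> S" "g \<noteq> 0" "h \<noteq> 0" for g h
    using that K' lc[of g] lc[of h]
    by (simp add: w_def fls_times_base single_diff single_uminus single_add)
  have w_add: "w (g + h) \<le> max (w g) (w h)" if gh: "g \<in> S" "h \<in> S" "g \<noteq> 0" "h \<noteq> 0" "g + h \<noteq> 0"
    and le: "fls_subdegree g \<le> fls_subdegree h" for g h
  proof (cases "fls_subdegree g = fls_subdegree h")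
    case False
    then have lt: "fls_subdegree g < fls_subdegree h" using le by simp
    have "fls_subdegree (g + h) = fls_subdegree g"
      using lt gh by (intro fls_subdegree_eqI) auto
    then have "w (g + h) = w g" using lt by (simp add: w_def)
    then show ?thesis by simp
  next
    case True
    define s where "s = fls_subdegree h"
    have sub: "fls_subdegree g = s" "fls_subdegree h = s" using True by (auto simp: s_def)
    have nz: "fls_nth g s \<noteq> 0" "fls_nth h s \<noteq> 0" using gh sub by (metis nth_fls_subdegree_nonzero)+
    have inK: "fls_nth g s \<in> K" "fls_nth h s \<in> K" using gh by (auto simp: S_def)
    show ?thesis
    proof (cases "fls_nth g s + fls_nth h s = 0")
      case False
      then have "fls_subdegree (g + h) = s"
        using sub by (intro fls_subdegree_eqI) auto
      then have "w (g + h) = Poly_Mapping.single n (- s) + v (fls_nth g s + fls_nth h s)" by (simp add: w_def)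
      also have "\<dots> \<le> Poly_Mapping.single n (- s) + max (v (fls_nth g s)) (v (fls_nth h s))"
        using K' inK nz False by (intro add_left_mono) blast
      also have "\<dots> = max (w g) (w h)" by (simp add: w_def sub max_def)
      finally show ?thesis .
    next
      \<comment> \<open>The lowest coefficients cancel, so the order of the sum rises and the entry
        at position \<open>n\<close> falls.\<close>
      case True
      have "fls_subdegree (g + h) > s"
        using gh(5) True sub by (intro fls_subdegree_greaterI) (auto simp: le_less)
      then have "w (g + h) < w g"
        unfolding w_def sub
        using low[OF lc[OF S_add[OF gh(1,2)]] nth_fls_subdegree_nonzero[OF gh(5)]] low[OF inK(1) nz(1)]
        by (intro single_less) auto
      then show ?thesis using less_imp_le le_max_iff_disj by blast
    qed
  qed
  have w_add': "w (g + h) \<le> max (w g) (w h)" if gh: "g \<in> S" "h \<in> S" "g \<noteq> 0" "h \<noteq> 0" "g + h \<noteq> 0" for g h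
  proof (cases "fls_subdegree g \<le> fls_subdegree h")
    case False
    then show ?thesis using w_add[of h g] gh by (simp add: add.commute max.commute)
  qed (use w_add gh in blast)
  have rep: "\<exists>g\<in>S. x = \<phi> g" if "x \<in> L" for x using bij that by (auto simp: bij_betw_def)
  have inL: "\<phi> g \<in> L" if "g \<in> S" for g using bij that by (auto simp: bij_betw_def)
  have KL: "K \<subseteq> L" using S_const inL const by (metis subsetI)
  show thesis
  proof
    show "K \<subseteq> L" by fact
    show "val_on L v'"
      unfolding val_on_def
    proof (intro conjI ballI impI)
      show "0 \<in> L" "1 \<in> L" using KL K' by auto
      fix x y assume "x \<in> L" "y \<in> L"
      then obtain g h where g: "g \<in> S" "h \<in> S" and x: "x = \<phi> g" and y: "y = \<phi> h" using rep by blast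
      have gh: "x + y = \<phi> (g + h)" "x * y = \<phi> (g * h)" using hom g x y by auto
      show "x + y \<in> L" "x * y \<in> L" unfolding gh using g S_add S_mult inL by auto
      assume "x \<noteq> 0" "y \<noteq> 0"
      then have nz: "g \<noteq> 0" "h \<noteq> 0" using x y phi0 by auto
      show "v' (x * y) = v' x + v' y"
        unfolding gh(2) unfolding x y using g S_mult by (simp add: v' w_mult nz)
      assume "x + y \<noteq> 0"
      then have "g + h \<noteq> 0" using gh(1) phi0 by auto
      then show "v' (x + y) \<le> max (v' x) (v' y)"
        unfolding gh(1) unfolding x y using g S_add by (simp add: v' w_add' nz)
    qed
    show "t \<in> L" using inL[OF S_X] X by simp
    have "(fls_X :: 'f fls) \<noteq> 0"
      using fls_X_subdegree[where 'a = 'f] fls_zero_subdegree by (metis zero_neq_one)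
    then show "t \<noteq> 0" using phi0_iff[OF S_X] unfolding X by blast
    have v1: "v 1 = 0"
    proof -
      have "v (1 * 1) = v 1 + v 1" using K' one_neq_zero by blast
      then show ?thesis by simp
    qed
    show "v' t = Poly_Mapping.single n (- 1)" using v'[OF S_X] X v1 by (simp add: w_def)
    show "v' x = v x" if "x \<in> K" "x \<noteq> 0" for x
      using v'[OF S_const[OF that(1)]] const[OF that(1)] by (simp add: w_def)
    show "Poly_Mapping.lookup (v' x) j = 0" if x: "x \<in> L" "x \<noteq> 0" "j < n" for x j
    proof -
      obtain g where g: "g \<in> S" "x = \<phi> g" using rep x by blast
      then have "g \<noteq> 0" using x phi0 by auto
      then show ?thesis using low[OF lc[OF g(1)], of j] x v'[OF g(1)] g
        by (simp add: w_def lookup_add lookup_single when_def)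
    qed
  qed
qed

text \<open>An outer variable has to dominate the inner ones, so the positions decrease from
  \<open>length ts - 1\<close> for the innermost variable to 0 for the outermost.\<close>

lemma iterated_laurent_val:
  fixes v :: "'f::field \<Rightarrow> (nat \<Rightarrow>\<^sub>0 int)"
  assumes "val_on K v" "\<And>x j. x \<in> K \<Longrightarrow> x \<noteq> 0 \<Longrightarrow> j < length ts \<Longrightarrow> Poly_Mapping.lookup (v x) j = 0"
    and "iterated_laurent_series_field K ts L"
  shows "\<exists>v' :: 'f \<Rightarrow> (nat \<Rightarrow>\<^sub>0 int). val_on L v' \<and> K \<subseteq> L \<and> (\<forall>x\<in>K. x \<noteq> 0 \<longrightarrow> v' x = v x) \<and>
    (\<forall>i<length ts. ts ! i \<noteq> 0 \<and> v' (ts ! i) = Poly_Mapping.single (length ts - 1 - i) (- 1))"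
  using assms
proof (induction ts arbitrary: K v)
  case Nil
  then show ?case by auto
next
  case (Cons t ts)
  obtain M where M: "laurent_series_field K t M" "iterated_laurent_series_field M ts L"
    using Cons.prems(3) by auto
  obtain v1 :: "'f \<Rightarrow> (nat \<Rightarrow>\<^sub>0 int)" where v1: "val_on M v1"
    "K \<subseteq> M" "t \<in> M" "t \<noteq> 0" "\<And>x. x \<in> K \<Longrightarrow> x \<noteq> 0 \<Longrightarrow> v1 x = v x" "v1 t = Poly_Mapping.single (length ts) (- 1)"
    "\<And>x j. x \<in> M \<Longrightarrow> x \<noteq> 0 \<Longrightarrow> j < length ts \<Longrightarrow> Poly_Mapping.lookup (v1 x) j = 0"
    using laurent_step[OF Cons.prems(1) _ M(1), of "length ts"] Cons.prems(2) by (auto simp: less_Suc_eq_le)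
  obtain v' :: "'f \<Rightarrow> (nat \<Rightarrow>\<^sub>0 int)" where v': "val_on L v'" "M \<subseteq> L" "\<forall>x\<in>M. x \<noteq> 0 \<longrightarrow> v' x = v1 x"
    "\<forall>i<length ts. ts ! i \<noteq> 0 \<and> v' (ts ! i) = Poly_Mapping.single (length ts - 1 - i) (- 1)"
    using Cons.IH[OF v1(1) v1(7) M(2)] by blast
  have "(t # ts) ! i \<noteq> 0 \<and> v' ((t # ts) ! i) = Poly_Mapping.single (length (t # ts) - 1 - i) (- 1)"
    if "i < length (t # ts)" for i
    using that v' v1 by (cases i) auto
  then show ?case using v' v1 by (intro exI[of _ v']) auto
qed

lemma nth_concat_pairs:
  assumes "i \<in> {1..m}"
  shows "concat (map (\<lambda>i. [f i, g i]) [1..<Suc m]) ! (2 * (i - 1)) = f i"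
    "concat (map (\<lambda>i. [f i, g i]) [1..<Suc m]) ! (2 * (i - 1) + 1) = g i"
    "length (concat (map (\<lambda>i. [f i, g i]) [1..<Suc m])) = 2 * m"
proof -
  let ?c = "\<lambda>m. concat (map (\<lambda>i. [f i, g i]) [1..<Suc m])"
  have len: "length (?c m) = 2 * m" for m by (induction m) auto
  have "?c m ! (2 * (i - 1)) = f i \<and> ?c m ! (2 * (i - 1) + 1) = g i"
    using assms
  proof (induction m)
    case (Suc m)
    show ?case
    proof (cases "i = Suc m")
      case True
      then show ?thesis using len[of m] by (simp add: nth_append)
    next
      case False
      then have "i \<in> {1..m}" using Suc.prems by auto
      then show ?thesis using Suc.IH len[of m] by (auto simp: nth_append)
    qed
  qed simp
  then show "?c m ! (2 * (i - 1)) = f i" "?c m ! (2 * (i - 1) + 1) = g i" "length (?c m) = 2 * m"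
    using len by auto
qed

theorem laurent_valuation:
  fixes \<alpha> \<beta> :: "nat \<Rightarrow> 'f::field"
  assumes K: "0 \<in> K" "1 \<in> K" "\<And>x y. x \<in> K \<Longrightarrow> y \<in> K \<Longrightarrow> x + y \<in> K" "\<And>x y. x \<in> K \<Longrightarrow> y \<in> K \<Longrightarrow> x * y \<in> K"
    and L: "iterated_laurent_series_field K
           (concat (map (\<lambda>i. [inverse (\<alpha> i), inverse (\<beta> i)]) [1..<Suc m])) (UNIV :: 'f set)"
  obtains v :: "'f \<Rightarrow> (nat \<Rightarrow>\<^sub>0 int)" and ix :: "nat + nat \<Rightarrow> nat"
  where "valuation v" "\<And>c. c \<in> K \<Longrightarrow> c \<noteq> 0 \<Longrightarrow> v c = 0" "inj_on ix ({1..m} <+> {1..m})"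
    "\<And>i. i \<in> {1..m} <+> {1..m} \<Longrightarrow> case_sum \<alpha> \<beta> i \<noteq> 0 \<and> v (case_sum \<alpha> \<beta> i) = Poly_Mapping.single (ix i) 1"
proof -
  define ts where "ts = concat (map (\<lambda>i. [inverse (\<alpha> i), inverse (\<beta> i)]) [1..<Suc m])"
  have "val_on K (\<lambda>_. 0 :: nat \<Rightarrow>\<^sub>0 int)" using K by (auto simp: val_on_def)
  from iterated_laurent_val[OF this _ L[folded ts_def]] obtain v :: "'f \<Rightarrow> (nat \<Rightarrow>\<^sub>0 int)"
    where v: "val_on UNIV v" "\<forall>x\<in>K. x \<noteq> 0 \<longrightarrow> v x = 0"
      "\<forall>i<length ts. ts ! i \<noteq> 0 \<and> v (ts ! i) = Poly_Mapping.single (length ts - 1 - i) (- 1)" by auto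
  interpret valuation v using v(1) by unfold_locales (auto simp: val_on_def)
  \<comment> \<open>Positions run backwards through the list, where \<open>\<alpha> i\<close> has
    the index \<open>2 * (i - 1)\<close> and \<open>\<beta> i\<close> the next one. The list holds
    the inverses, which turns the degrees -1 into 1.\<close>
  define ix where "ix = case_sum (\<lambda>i. 2 * m - 1 - 2 * (i - 1)) (\<lambda>i. 2 * m - 1 - (2 * (i - 1) + 1))"
  have inv: "x \<noteq> 0 \<and> v x = - v (inverse x)" if "inverse x \<noteq> 0" for x
    using val_mult[of x "inverse x"] that by (simp add: eq_neg_iff_add_eq_0)
  have "inj_on ix ({1..m} <+> {1..m})"
    unfolding inj_on_def ix_def by (auto simp: Plus_def) presburger+
  moreover have "case_sum \<alpha> \<beta> i \<noteq> 0 \<and> v (case_sum \<alpha> \<beta> i) = Poly_Mapping.single (ix i) 1"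
    if i: "i \<in> {1..m} <+> {1..m}" for i
    using i
  proof (rule PlusE)
    fix j assume j: "j \<in> {1..m}" "i = Inl j"
    then have "ts ! (2 * (j - 1)) = inverse (\<alpha> j)" "2 * (j - 1) < length ts" "length ts = 2 * m"
      using nth_concat_pairs[OF j(1), where f = "\<lambda>i. inverse (\<alpha> i)" and g = "\<lambda>i. inverse (\<beta> i)"] j(1)
      unfolding ts_def by auto
    then show ?thesis using v(3)[rule_format, of "2 * (j - 1)"] inv[of "\<alpha> j"] j by (auto simp: ix_def single_uminus)
  next
    fix j assume j: "j \<in> {1..m}" "i = Inr j"
    then have "ts ! (2 * (j - 1) + 1) = inverse (\<beta> j)" "2 * (j - 1) + 1 < length ts" "length ts = 2 * m"
      using nth_concat_pairs[OF j(1), where f = "\<lambda>i. inverse (\<alpha> i)" and g = "\<lambda>i. inverse (\<beta> i)"] j(1)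
      unfolding ts_def by auto
    then show ?thesis using v(3)[rule_format, of "2 * (j - 1) + 1"] inv[of "\<beta> j"] j by (auto simp: ix_def single_uminus)
  qed
  ultimately show thesis using that[OF valuation_axioms] v(2) by blast
qed

section \<open>Trace functions on matrix algebras\<close>

lemma sum_swap3:
  "(\<Sum>a\<in>A. \<Sum>b\<in>B. \<Sum>c\<in>C. f a b c) = (\<Sum>c\<in>C. \<Sum>a\<in>A. \<Sum>b\<in>B. f a b c)"
proof -
  have "(\<Sum>a\<in>A. \<Sum>b\<in>B. \<Sum>c\<in>C. f a b c) = (\<Sum>a\<in>A. \<Sum>c\<in>C. \<Sum>b\<in>B. f a b c)"
    by (intro sum.cong refl sum.swap)
  then show ?thesis by (subst (asm) sum.swap)
qed

text \<open>
  A basis \<open>T\<close> of the matrix algebra with index set \<open>G\<close>, its dual basis \<open>D\<close>, and its structure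
  constants \<open>\<gamma>\<close>.
\<close>

locale matrix_basis =
  fixes W :: "'w set" and G :: "'g set" and T D :: "'w \<Rightarrow> 'g \<Rightarrow> 'g \<Rightarrow> 'e::field"
    and \<gamma> :: "'w \<Rightarrow> 'w \<Rightarrow> 'w \<Rightarrow> 'e"
  assumes finite_W: "finite W" and finite_G: "finite G"
    and dual1: "w \<in> W \<Longrightarrow> w' \<in> W \<Longrightarrow> (\<Sum>g\<in>G. \<Sum>h\<in>G. D w g h * T w' g h) = (if w = w' then 1 else 0)"
    and dual2: "g \<in> G \<Longrightarrow> h \<in> G \<Longrightarrow> g' \<in> G \<Longrightarrow> h' \<in> G \<Longrightarrow>
      (\<Sum>w\<in>W. D w g h * T w g' h') = (if g = g' \<and> h = h' then 1 else 0)"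
    and T_mult: "w \<in> W \<Longrightarrow> w' \<in> W \<Longrightarrow> g \<in> G \<Longrightarrow> h \<in> G \<Longrightarrow>
      (\<Sum>l\<in>G. T w g l * T w' l h) = (\<Sum>w''\<in>W. \<gamma> w w' w'' * T w'' g h)"
begin

lemma sum_delta_mult: "finite A \<Longrightarrow> a \<in> A \<Longrightarrow> (\<Sum>x\<in>A. (if a = x then 1 else 0) * f x) = (f a :: 'e)"
  by (simp add: if_distrib if_distribR cong: if_cong)

lemma coordinate_eq:
  assumes "w \<in> W"
  shows "(\<Sum>g\<in>G. \<Sum>h\<in>G. D w g h * (\<Sum>w'\<in>W. c w' * T w' g h)) = c w"
proof -
  have "(\<Sum>g\<in>G. \<Sum>h\<in>G. D w g h * (\<Sum>w'\<in>W. c w' * T w' g h)) =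
      (\<Sum>g\<in>G. \<Sum>h\<in>G. \<Sum>w'\<in>W. c w' * (D w g h * T w' g h))"
    by (simp add: sum_distrib_left mult_ac)
  also have "\<dots> = (\<Sum>g\<in>G. \<Sum>w'\<in>W. \<Sum>h\<in>G. c w' * (D w g h * T w' g h))"
    by (intro sum.cong refl sum.swap)
  also have "\<dots> = (\<Sum>w'\<in>W. \<Sum>g\<in>G. \<Sum>h\<in>G. c w' * (D w g h * T w' g h))"
    by (rule sum.swap)
  also have "\<dots> = (\<Sum>w'\<in>W. c w' * (if w = w' then 1 else 0))"
    by (simp add: sum_distrib_left[symmetric] dual1 assms)
  also have "\<dots> = c w"
    using finite_W assms sum_delta_mult[of W w c] by (simp add: mult.commute)
  finally show ?thesis .
qed

lemma coordinates_unique: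
  assumes "\<And>g h. g \<in> G \<Longrightarrow> h \<in> G \<Longrightarrow> (\<Sum>w\<in>W. c w * T w g h) = (\<Sum>w\<in>W. c' w * T w g h)" "w \<in> W"
  shows "c w = c' w"
  using coordinate_eq[OF assms(2), of c] coordinate_eq[OF assms(2), of c'] assms(1)
  by simp

lemma spanning:
  assumes "g \<in> G" "h \<in> G"
  shows "(\<Sum>w\<in>W. (\<Sum>g\<in>G. \<Sum>h\<in>G. D w g h * Z g h) * T w g h) = Z g h"
proof -
  have "(\<Sum>w\<in>W. (\<Sum>a\<in>G. \<Sum>b\<in>G. D w a b * Z a b) * T w g h) =
      (\<Sum>w\<in>W. \<Sum>a\<in>G. \<Sum>b\<in>G. Z a b * (D w a b * T w g h))"
    by (simp add: sum_distrib_left sum_distrib_right mult_ac)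
  also have "\<dots> = (\<Sum>a\<in>G. \<Sum>w\<in>W. \<Sum>b\<in>G. Z a b * (D w a b * T w g h))"
    by (rule sum.swap)
  also have "\<dots> = (\<Sum>a\<in>G. \<Sum>b\<in>G. \<Sum>w\<in>W. Z a b * (D w a b * T w g h))"
    by (intro sum.cong refl sum.swap)
  also have "\<dots> = (\<Sum>a\<in>G. \<Sum>b\<in>G. Z a b * (if a = g \<and> b = h then 1 else 0))"
    by (simp add: sum_distrib_left[symmetric] dual2 assms)
  also have "\<dots> = (\<Sum>a\<in>G. if a = g then Z g h else 0)"
  proof (intro sum.cong refl)
    fix a
    have "(\<Sum>b\<in>G. Z a b * (if a = g \<and> b = h then 1 else 0)) = (\<Sum>b\<in>G. if b = h then (if a = g then Z g h else 0) else 0)"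
      by (intro sum.cong) auto
    then show "(\<Sum>b\<in>G. Z a b * (if a = g \<and> b = h then 1 else 0)) = (if a = g then Z g h else 0)"
      using finite_G assms by simp
  qed
  finally show ?thesis using finite_G assms by simp
qed

lemma gamma_eq:
  assumes "w \<in> W" "w' \<in> W" "w'' \<in> W"
  shows "\<gamma> w w' w'' = (\<Sum>g\<in>G. \<Sum>h\<in>G. D w'' g h * (\<Sum>l\<in>G. T w g l * T w' l h))"
  using coordinate_eq[OF assms(3), of "\<gamma> w w'"] T_mult[OF assms(1,2)] by simp

text \<open>The matrix unit at \<open>(a, b)\<close> has the coordinates \<open>D w a b\<close>;
  this is the multiplication rule of matrix units.\<close>

lemma dual_gamma:
  assumes "w'' \<in> W" "a \<in> G" "b \<in> G" "c \<in> G" "d \<in> G"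
  shows "(\<Sum>w\<in>W. \<Sum>w'\<in>W. D w a b * D w' c d * \<gamma> w w' w'') = (if b = c then D w'' a d else 0)"
proof -
  have "(\<Sum>w\<in>W. \<Sum>w'\<in>W. D w a b * D w' c d * \<gamma> w w' w'') =
    (\<Sum>w\<in>W. \<Sum>w'\<in>W. \<Sum>g\<in>G. \<Sum>h\<in>G. \<Sum>l\<in>G. D w'' g h * (D w a b * T w g l * (D w' c d * T w' l h)))"
    using assms(1) by (simp add: gamma_eq sum_distrib_left mult_ac)
  also have "\<dots> = (\<Sum>g\<in>G. \<Sum>w\<in>W. \<Sum>w'\<in>W. \<Sum>h\<in>G. \<Sum>l\<in>G. D w'' g h * (D w a b * T w g l * (D w' c d * T w' l h)))"
    by (rule sum_swap3)
  also have "\<dots> = (\<Sum>g\<in>G. \<Sum>h\<in>G. \<Sum>w\<in>W. \<Sum>w'\<in>W. \<Sum>l\<in>G. D w'' g h * (D w a b * T w g l * (D w' c d * T w' l h)))"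
    by (intro sum.cong refl sum_swap3)
  also have "\<dots> = (\<Sum>g\<in>G. \<Sum>h\<in>G. \<Sum>l\<in>G. \<Sum>w\<in>W. \<Sum>w'\<in>W. D w'' g h * (D w a b * T w g l * (D w' c d * T w' l h)))"
    by (intro sum.cong refl sum_swap3)
  also have "\<dots> = (\<Sum>g\<in>G. \<Sum>h\<in>G. \<Sum>l\<in>G. D w'' g h * ((\<Sum>w\<in>W. D w a b * T w g l) * (\<Sum>w'\<in>W. D w' c d * T w' l h)))"
    unfolding sum_product by (simp only: sum_distrib_left)
  also have "\<dots> = (\<Sum>g\<in>G. \<Sum>h\<in>G. \<Sum>l\<in>G. if b = l then (if a = g then if c = l then if d = h then D w'' g h else 0 else 0 else 0) else 0)"
    by (intro sum.cong refl) (simp add: dual2 assms)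
  also have "\<dots> = (\<Sum>g\<in>G. \<Sum>h\<in>G. if d = h then (if a = g then if b = c then D w'' g h else 0 else 0) else 0)"
    using finite_G assms by (intro sum.cong refl) auto
  also have "\<dots> = (\<Sum>g\<in>G. if a = g then if b = c then D w'' g d else 0 else 0)"
    using finite_G assms by (intro sum.cong refl) auto
  also have "\<dots> = (if b = c then D w'' a d else 0)"
    using finite_G assms by simp
  finally show ?thesis .
qed

text \<open>
  \<open>\<theta> (T w) = N w\<close> defines an isomorphism onto the matrix algebra with index set \<open>H\<close>; it maps the
  matrix units to the family \<open>U\<close>.  A trace function on a matrix algebra is unique up to a factor
  \<open>s\<close>, and \<open>s\<close> is the trace of the idempotent \<open>P = U a\<^sub>0 a\<^sub>0\<close>.  As \<open>P M P\<close> is a multiple of \<open>P\<close> for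
  all matrices \<open>M\<close>, \<open>s\<^sup>2 = 1\<close>.
\<close>

theorem trace_unique:
  fixes N :: "'w \<Rightarrow> 'h \<Rightarrow> 'h \<Rightarrow> 'e"
  assumes H: "finite H" "H \<noteq> {}"
    and N_mult: "\<And>w w' i j. w \<in> W \<Longrightarrow> w' \<in> W \<Longrightarrow> i \<in> H \<Longrightarrow> j \<in> H \<Longrightarrow>
      (\<Sum>l\<in>H. N w i l * N w' l j) = (\<Sum>w''\<in>W. \<gamma> w w' w'' * N w'' i j)"
    and N_span: "\<And>Z. \<exists>c. \<forall>i\<in>H. \<forall>j\<in>H. Z i j = (\<Sum>w\<in>W. c w * N w i j)"
  obtains s :: 'e where "s * s = 1" "\<And>w. w \<in> W \<Longrightarrow> (\<Sum>i\<in>H. N w i i) = s * (\<Sum>g\<in>G. T w g g)"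
proof -
  define U where "U = (\<lambda>a b i j. \<Sum>w\<in>W. D w a b * N w i j)"
  have U_mult: "(\<Sum>l\<in>H. U a b i l * U c d l j) = (if b = c then U a d i j else 0)"
    if "a \<in> G" "b \<in> G" "c \<in> G" "d \<in> G" "i \<in> H" "j \<in> H" for a b c d i j
  proof -
    have "(\<Sum>l\<in>H. U a b i l * U c d l j) =
      (\<Sum>l\<in>H. \<Sum>w\<in>W. \<Sum>w'\<in>W. D w a b * D w' c d * (N w i l * N w' l j))"
      by (simp add: U_def sum_product mult_ac)
    also have "\<dots> = (\<Sum>w\<in>W. \<Sum>w'\<in>W. \<Sum>l\<in>H. D w a b * D w' c d * (N w i l * N w' l j))"
      by (rule sum_swap3[symmetric])
    also have "\<dots> = (\<Sum>w\<in>W. \<Sum>w'\<in>W. \<Sum>w''\<in>W. D w a b * D w' c d * \<gamma> w w' w'' * N w'' i j)"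
      using that by (simp add: sum_distrib_left[symmetric] N_mult mult.assoc)
    also have "\<dots> = (\<Sum>w''\<in>W. \<Sum>w\<in>W. \<Sum>w'\<in>W. D w a b * D w' c d * \<gamma> w w' w'' * N w'' i j)"
      by (rule sum_swap3)
    also have "\<dots> = (\<Sum>w''\<in>W. (if b = c then D w'' a d else 0) * N w'' i j)"
      using that by (intro sum.cong refl) (simp add: sum_distrib_right[symmetric] dual_gamma)
    finally show ?thesis by (simp add: U_def)
  qed
  have N_U: "N w i j = (\<Sum>a\<in>G. \<Sum>b\<in>G. T w a b * U a b i j)" if "w \<in> W" for w i j
  proof -
    have "(\<Sum>a\<in>G. \<Sum>b\<in>G. T w a b * U a b i j) = (\<Sum>a\<in>G. \<Sum>b\<in>G. \<Sum>w'\<in>W. D w' a b * T w a b * N w' i j)"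
      by (simp add: U_def sum_distrib_left mult_ac)
    also have "\<dots> = (\<Sum>w'\<in>W. \<Sum>a\<in>G. \<Sum>b\<in>G. D w' a b * T w a b * N w' i j)"
      by (rule sum_swap3)
    also have "\<dots> = (\<Sum>w'\<in>W. (if w' = w then 1 else 0) * N w' i j)"
      using that by (intro sum.cong refl) (simp add: sum_distrib_right[symmetric] dual1)
    also have "\<dots> = (\<Sum>w'\<in>W. if w' = w then N w i j else 0)" by (intro sum.cong) auto
    also have "\<dots> = N w i j" using that finite_W by simp
    finally show ?thesis by simp
  qed
  have U_span: "\<exists>x. \<forall>i\<in>H. \<forall>j\<in>H. Z i j = (\<Sum>a\<in>G. \<Sum>b\<in>G. x a b * U a b i j)" for Z
  proof -
    obtain c where c: "\<And>i j. i \<in> H \<Longrightarrow> j \<in> H \<Longrightarrow> Z i j = (\<Sum>w\<in>W. c w * N w i j)"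
      using N_span[of Z] by blast
    have "(\<Sum>w\<in>W. c w * N w i j) = (\<Sum>a\<in>G. \<Sum>b\<in>G. (\<Sum>w\<in>W. c w * T w a b) * U a b i j)" for i j
    proof -
      have "(\<Sum>w\<in>W. c w * N w i j) = (\<Sum>w\<in>W. \<Sum>a\<in>G. \<Sum>b\<in>G. c w * T w a b * U a b i j)"
        by (intro sum.cong refl) (simp add: N_U sum_distrib_left mult.assoc)
      also have "\<dots> = (\<Sum>a\<in>G. \<Sum>b\<in>G. \<Sum>w\<in>W. c w * T w a b * U a b i j)"
        by (rule sum_swap3[symmetric])
      finally show ?thesis by (simp add: sum_distrib_right)
    qed
    then show ?thesis using c by (intro exI[of _ "\<lambda>a b. \<Sum>w\<in>W. c w * T w a b"]) simp
  qed
  define t where "t = (\<lambda>a b. \<Sum>i\<in>H. U a b i i)"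
  \<comment> \<open>The trace of a product of two matrices does not depend on their order. On the
    images of the matrix units this determines \<open>t\<close> up to the single value
    \<open>s\<close>.\<close>
  have t_mult: "(if b = c then t a d else 0) = (if d = a then t c b else 0)"
    if "a \<in> G" "b \<in> G" "c \<in> G" "d \<in> G" for a b c d
  proof -
    have "(\<Sum>i\<in>H. \<Sum>l\<in>H. U a b i l * U c d l i) = (\<Sum>l\<in>H. \<Sum>i\<in>H. U c d l i * U a b i l)"
      by (subst sum.swap) (simp add: mult.commute)
    then show ?thesis using that by (cases "b = c"; cases "d = a"; simp add: U_mult t_def)
  qed
  obtain i0 where i0: "i0 \<in> H" using H by blast
  have "G \<noteq> {}"
  proof
    assume "G = {}"
    then show False using U_span[of "\<lambda>_ _. 1"] i0 by auto
  qed
  then obtain a0 where a0: "a0 \<in> G" by blast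
  define s where "s = t a0 a0"
  define P where "P = U a0 a0"
  have t: "t a b = (if a = b then s else 0)" if "a \<in> G" "b \<in> G" for a b
    using t_mult[of a b b b] t_mult[of a a0 a0 a] that a0 by (auto simp: s_def split: if_splits)
  have tr: "(\<Sum>i\<in>H. N w i i) = s * (\<Sum>g\<in>G. T w g g)" if "w \<in> W" for w
  proof -
    have "(\<Sum>i\<in>H. N w i i) = (\<Sum>i\<in>H. \<Sum>a\<in>G. \<Sum>b\<in>G. T w a b * U a b i i)"
      using that by (simp add: N_U)
    also have "\<dots> = (\<Sum>a\<in>G. \<Sum>b\<in>G. \<Sum>i\<in>H. T w a b * U a b i i)"
      by (rule sum_swap3[symmetric])
    also have "\<dots> = (\<Sum>a\<in>G. \<Sum>b\<in>G. if a = b then T w a a * s else 0)"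
      by (intro sum.cong refl) (simp add: sum_distrib_left[symmetric] t[unfolded t_def])
    also have "\<dots> = (\<Sum>a\<in>G. T w a a * s)"
      using finite_G by (intro sum.cong refl) simp
    finally show ?thesis by (simp add: sum_distrib_left mult.commute)
  qed
  have P_M_P: "\<exists>f. \<forall>i\<in>H. \<forall>j\<in>H. (\<Sum>k\<in>H. \<Sum>l\<in>H. P i k * Z k l * P l j) = f * P i j" for Z
  proof -
    obtain x where x: "\<And>i j. i \<in> H \<Longrightarrow> j \<in> H \<Longrightarrow> Z i j = (\<Sum>a\<in>G. \<Sum>b\<in>G. x a b * U a b i j)"
      using U_span[of Z] by blast
    have "(\<Sum>k\<in>H. \<Sum>l\<in>H. P i k * Z k l * P l j) = x a0 a0 * P i j" if ij: "i \<in> H" "j \<in> H" for i j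
    proof -
      have 1: "(\<Sum>k\<in>H. P i k * Z k l) = (\<Sum>b\<in>G. x a0 b * U a0 b i l)" if "l \<in> H" for l
      proof -
        have "(\<Sum>k\<in>H. P i k * Z k l) = (\<Sum>k\<in>H. \<Sum>a\<in>G. \<Sum>b\<in>G. x a b * (U a0 a0 i k * U a b k l))"
          using that by (simp add: x P_def sum_distrib_left mult_ac)
        also have "\<dots> = (\<Sum>a\<in>G. \<Sum>b\<in>G. \<Sum>k\<in>H. x a b * (U a0 a0 i k * U a b k l))"
          by (rule sum_swap3[symmetric])
        also have "\<dots> = (\<Sum>a\<in>G. if a0 = a then \<Sum>b\<in>G. x a b * U a0 b i l else 0)"
          using that ij a0 by (intro sum.cong refl) (simp add: sum_distrib_left[symmetric] U_mult)
        finally show ?thesis using a0 finite_G by simp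
      qed
      have "(\<Sum>k\<in>H. \<Sum>l\<in>H. P i k * Z k l * P l j) = (\<Sum>l\<in>H. (\<Sum>k\<in>H. P i k * Z k l) * P l j)"
        by (subst sum.swap) (simp add: sum_distrib_right)
      also have "\<dots> = (\<Sum>l\<in>H. \<Sum>b\<in>G. x a0 b * (U a0 b i l * U a0 a0 l j))"
        by (simp add: 1) (simp add: P_def sum_distrib_right mult.assoc)
      also have "\<dots> = (\<Sum>b\<in>G. \<Sum>l\<in>H. x a0 b * (U a0 b i l * U a0 a0 l j))" by (rule sum.swap)
      also have "\<dots> = (\<Sum>b\<in>G. if b = a0 then x a0 b * P i j else 0)"
        using ij a0 by (intro sum.cong refl) (simp add: sum_distrib_left[symmetric] U_mult P_def)
      finally show ?thesis using a0 finite_G by simp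
    qed
    then show ?thesis by blast
  qed
  \<comment> \<open>A matrix unit in place of \<open>Z\<close> turns \<open>P_M_P\<close> into a
    rank-one condition on the entries of \<open>P\<close>.\<close>
  have "\<exists>f. \<forall>k\<in>H. \<forall>l\<in>H. P k i * P j l = f * P k l" if "i \<in> H" "j \<in> H" for i j
  proof -
    obtain f where f: "\<And>k l. k \<in> H \<Longrightarrow> l \<in> H \<Longrightarrow>
      (\<Sum>k'\<in>H. \<Sum>l'\<in>H. P k k' * (if k' = i then if l' = j then 1 else 0 else 0) * P l' l) = f * P k l"
      using P_M_P[of "\<lambda>k' l'. if k' = i then if l' = j then 1 else 0 else 0"] by blast
    have "(\<Sum>k'\<in>H. \<Sum>l'\<in>H. P k k' * (if k' = i then if l' = j then 1 else 0 else 0) * P l' l) = P k i * P j l"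
      for k l
    proof -
      have "(\<Sum>k'\<in>H. \<Sum>l'\<in>H. P k k' * (if k' = i then if l' = j then 1 else 0 else 0) * P l' l) =
        (\<Sum>k'\<in>H. if k' = i then (\<Sum>l'\<in>H. if l' = j then P k i * P j l else 0) else 0)"
        by (intro sum.cong refl) (auto intro!: sum.cong)
      then show ?thesis using that H by simp
    qed
    with f show ?thesis by metis
  qed
  then obtain f where f: "\<And>i j k l. i \<in> H \<Longrightarrow> j \<in> H \<Longrightarrow> k \<in> H \<Longrightarrow> l \<in> H \<Longrightarrow> P k i * P j l = f i j * P k l"
    by metis
  have idem: "(\<Sum>l\<in>H. P i l * P l j) = P i j" if "i \<in> H" "j \<in> H" for i j
    using U_mult[OF a0 a0 a0 a0 that] by (simp add: P_def)
  have sP: "s = (\<Sum>k\<in>H. P k k)" by (simp add: s_def t_def P_def)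
  have fs: "P j i = f i j * s" if ij: "i \<in> H" "j \<in> H" for i j
  proof -
    have "P j i = (\<Sum>k\<in>H. P k i * P j k)" using idem[OF ij(2,1)] by (simp add: mult.commute)
    also have "\<dots> = (\<Sum>k\<in>H. f i j * P k k)" using ij by (intro sum.cong refl f)
    finally show ?thesis by (simp add: sP sum_distrib_left)
  qed
  \<comment> \<open>Both \<open>P k k * P l l * s\<close> and \<open>P k l * P l k\<close> are equal
    to \<open>f k l * P k l * s\<close>, and the products \<open>P k l * P l k\<close> sum to the
    trace of the square of \<open>P\<close>, which is \<open>s\<close>.\<close>
  have "s * s * s = s"
  proof -
    have "s * s * s = (\<Sum>k\<in>H. \<Sum>l\<in>H. P k k * P l l * s)"
    proof -
      have "s * s = (\<Sum>k\<in>H. \<Sum>l\<in>H. P k k * P l l)" by (simp only: sP sum_product)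
      then show ?thesis by (simp only: sum_distrib_right)
    qed
    also have "\<dots> = (\<Sum>k\<in>H. \<Sum>l\<in>H. P k l * P l k)"
    proof (intro sum.cong refl)
      fix k l assume kl: "k \<in> H" "l \<in> H"
      have "P k k * P l l * s = f k l * P k l * s" using f[OF kl(1,2) kl(1,2)] by simp
      then show "P k k * P l l * s = P k l * P l k" using fs[OF kl] by (simp add: mult_ac)
    qed
    also have "\<dots> = (\<Sum>k\<in>H. P k k)" by (simp add: idem)
    finally show ?thesis by (simp add: sP)
  qed
  \<comment> \<open>\<open>s = 0\<close> would give \<open>P = 0\<close> by \<open>fs\<close>. As
    every \<open>U a b\<close> factors through \<open>P\<close>, the span of the family would then
    be zero.\<close>
  moreover have "s \<noteq> 0"
  proof
    assume "s = 0"
    then have P0: "P i j = 0" if "i \<in> H" "j \<in> H" for i j using fs that by simp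
    have U0: "U a b i j = 0" if "a \<in> G" "b \<in> G" "i \<in> H" "j \<in> H" for a b i j
    proof -
      have "U a0 b l j = 0" if "l \<in> H" for l
        using U_mult[OF a0 a0 a0 \<open>b \<in> G\<close> that \<open>j \<in> H\<close>] P0 that by (simp add: P_def)
      then show ?thesis
        using U_mult[OF that(1) a0 a0 that(2-4)] by simp
    qed
    obtain x where "\<forall>i\<in>H. \<forall>j\<in>H. 1 = (\<Sum>a\<in>G. \<Sum>b\<in>G. x a b * U a b i j)"
      using U_span[of "\<lambda>_ _. 1"] by blast
    then show False using U0 i0 by auto
  qed
  ultimately have "s * s = 1" by simp
  then show thesis using that tr by blast
qed

end

section \<open>Symbol algebras in coordinates\<close>

text \<open>
  The two kinds of symbol algebras are treated together: the relations are
  \<open>x\<^sup>p = \<alpha> + \<delta> x\<close>, \<open>y\<^sup>p = \<beta>\<close> and \<open>y x = (\<rho> x + \<delta>) y\<close>, where either \<open>\<delta> = 0\<close> and \<open>\<rho>\<close> is a primitive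
  \<open>p\<close>-th root of unity, or \<open>\<delta> = \<rho> = 1\<close> and the characteristic is \<open>p\<close>.
\<close>

definition symbol_parameters :: "nat \<Rightarrow> 'f::field \<Rightarrow> 'f \<Rightarrow> bool" where
  "symbol_parameters p \<rho> \<delta> \<longleftrightarrow> prime p \<and>
     (\<delta> = 0 \<and> \<rho> ^ p = 1 \<and> (\<forall>k. 0 < k \<and> k < p \<longrightarrow> \<rho> ^ k \<noteq> 1) \<and> of_nat p \<noteq> (0 :: 'f) \<or>
      \<delta> = 1 \<and> \<rho> = 1 \<and> CHAR('f) = p)"

text \<open>The coordinates of \<open>x\<^sup>a\<close> in the basis \<open>1, x, \<dots>, x\<^sup>p\<^sup>-\<^sup>1\<close>, and the constant \<open>c\<close> in \<open>y\<^sup>j x = (\<rho>\<^sup>j x + c) y\<^sup>j\<close>.\<close>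

function red :: "nat \<Rightarrow> 'f::field \<Rightarrow> 'f \<Rightarrow> nat \<Rightarrow> nat \<Rightarrow> 'f" where
  "red p \<delta> a n i = (if n < p \<or> p \<le> 1 then (if i = n then 1 else 0)
     else a * red p \<delta> a (n - p) i + \<delta> * red p \<delta> a (Suc (n - p)) i)"
  by pat_completeness auto
termination
  \<comment> \<open>The case \<open>p \<le> 1\<close> is cut off in the definition, so that
    \<open>Suc (n - p) < n\<close> in the recursive call.\<close>
  by (relation "measure (\<lambda>(p, \<delta>, a, n, i). n)") auto

declare red.simps [simp del]

definition shift_const :: "'f::field \<Rightarrow> 'f \<Rightarrow> nat \<Rightarrow> 'f" where
  "shift_const \<rho> \<delta> j = \<delta> * (\<Sum>l<j. \<rho> ^ l)"

lemma shift_const_Suc: "shift_const \<rho> \<delta> (Suc j) = \<rho> * shift_const \<rho> \<delta> j + \<delta>"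
  unfolding shift_const_def sum.lessThan_Suc_shift
  by (simp add: sum_distrib_left algebra_simps)

text \<open>The coordinates of \<open>x^i y^j x^i' y^j'\<close>: moving \<open>y^j\<close> past
  \<open>x^i'\<close> replaces \<open>x\<close> by \<open>\<rho>^j x + c\<close> with
  \<open>c = shift_const \<rho> \<delta> j\<close>. The power is expanded by the binomial theorem
  and reduced by \<open>red\<close>.\<close>

definition symbol_gamma1 :: "nat \<Rightarrow> 'f::field \<Rightarrow> 'f \<Rightarrow> 'f \<Rightarrow> 'f \<Rightarrow> nat \<times> nat \<Rightarrow> nat \<times> nat \<Rightarrow> nat \<times> nat \<Rightarrow> 'f" where
  "symbol_gamma1 p \<rho> \<delta> a b u u' u'' =
     (if snd u'' = (snd u + snd u') mod p then b ^ ((snd u + snd u') div p) *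
        (\<Sum>l\<le>fst u'. of_nat (fst u' choose l) * (\<rho> ^ snd u) ^ l * shift_const \<rho> \<delta> (snd u) ^ (fst u' - l) *
            red p \<delta> a (fst u + l) (fst u''))
      else 0)"

definition symbol_gamma :: "nat \<Rightarrow> 'f::field \<Rightarrow> 'f \<Rightarrow> 'i set \<Rightarrow> ('i \<Rightarrow> 'f) \<Rightarrow> ('i \<Rightarrow> 'f) \<Rightarrow>
    ('i \<Rightarrow> nat \<times> nat) \<Rightarrow> ('i \<Rightarrow> nat \<times> nat) \<Rightarrow> ('i \<Rightarrow> nat \<times> nat) \<Rightarrow> 'f" where
  "symbol_gamma p \<rho> \<delta> I \<alpha> \<beta> w w' w'' = (\<Prod>k\<in>I. symbol_gamma1 p \<rho> \<delta> (\<alpha> k) (\<beta> k) (w k) (w' k) (w'' k))"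

section \<open>Leading terms of the structure constants\<close>

context valuation
begin

text \<open>In \<open>x^p = \<alpha> + \<delta> x\<close> the second summand has the smaller value,
  since \<open>v \<alpha> > 0\<close> makes the value of \<open>x\<close> smaller than that of
  \<alpha>. So replacing \<open>x^p\<close> by \<alpha> alone yields the leading term.\<close>

lemma val_red:
  assumes p: "p > 1" and a: "a \<noteq> 0" "v a > 0" and \<delta>: "\<delta> \<noteq> 0 \<longrightarrow> v \<delta> = 0"
  shows "red p \<delta> a n i - (if i = n mod p then a ^ (n div p) else 0) \<noteq> 0 \<longrightarrow>
     v ((red p \<delta> a n i - (if i = n mod p then a ^ (n div p) else 0)) ^ p * a ^ i) < v (a ^ n)"
proof (induction n rule: less_induct)
  case (less n)
  show ?case
  proof (cases "n < p")
    case True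
    then show ?thesis by (simp add: red.simps[of p \<delta> a n])
  next
    case False
    define n' where "n' = n - p"
    have n: "n = p + n'" using False by (simp add: n'_def)
    have dm: "n div p = Suc (n' div p)" "n mod p = n' mod p" using p n by auto
    define d where "d = (\<lambda>n i. red p \<delta> a n i - (if i = n mod p then a ^ (n div p) else 0))"
    have red: "red p \<delta> a n i = a * red p \<delta> a n' i + \<delta> * red p \<delta> a (Suc n') i"
      using False p by (subst red.simps) (simp add: n'_def)
    have eq: "d n i = a * d n' i + \<delta> * red p \<delta> a (Suc n') i"
      by (simp add: d_def red dm algebra_simps)
    have vpos: "v (a ^ k) < v (a ^ (k + Suc l))" for k l
    proof -
      have "0 < v (a ^ Suc l)" using a by (induction l) (auto simp: val_mult add_pos_pos)
      then show ?thesis using a by (simp add: power_add val_mult del: power_Suc)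
    qed
    have IH: "d k i \<noteq> 0 \<longrightarrow> v (d k i ^ p * a ^ i) < v (a ^ k)" if "k < n" for k
      using less.IH[OF that] by (simp add: d_def)
    have 1: "v ((a * d n' i) ^ p * a ^ i) < v (a ^ n)" if "a * d n' i \<noteq> 0"
    proof -
      have "v ((a * d n' i) ^ p * a ^ i) = v (a ^ p) + v (d n' i ^ p * a ^ i)"
        using that a by (simp add: power_mult_distrib val_mult mult.assoc)
      also have "\<dots> < v (a ^ p) + v (a ^ n')"
        using IH[of n'] that p n by simp
      finally show ?thesis using a by (simp add: n power_add val_mult)
    qed
    have 2: "v ((\<delta> * red p \<delta> a (Suc n') i) ^ p * a ^ i) < v (a ^ n)" if "\<delta> * red p \<delta> a (Suc n') i \<noteq> 0"
    proof -
      let ?l = "if i = Suc n' mod p then a ^ (Suc n' div p) else 0"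
      have lead: "v (?l ^ p * a ^ i) = v (a ^ Suc n')" if "?l \<noteq> 0"
        using that by (auto simp: power_mult[symmetric] power_add[symmetric] split: if_splits)
      have le: "v (red p \<delta> a (Suc n') i ^ p * a ^ i) \<le> v (a ^ Suc n')"
      proof -
        have "d (Suc n') i \<noteq> 0 \<longrightarrow> v (d (Suc n') i ^ p * a ^ i) \<le> v (a ^ Suc n')"
          using IH[of "Suc n'"] p n by (auto intro: less_imp_le)
        moreover have "?l + d (Suc n') i = red p \<delta> a (Suc n') i" by (simp add: d_def)
        ultimately show ?thesis
          using val_add_le[of ?l p "a ^ i" "v (a ^ Suc n')" "d (Suc n') i"] lead that a
          by (metis mult_eq_0_iff order_refl power_not_zero)
      qed
      have "v ((\<delta> * red p \<delta> a (Suc n') i) ^ p * a ^ i) = v (\<delta> ^ p) + v (red p \<delta> a (Suc n') i ^ p * a ^ i)"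
        using that a by (simp add: power_mult_distrib val_mult mult.assoc)
      also have "\<dots> \<le> v (a ^ Suc n')"
        using le \<delta> that by (simp add: val_power_0)
      \<comment> \<open>The term with \<open>Suc n'\<close> factors \<open>x\<close> falls short of
        \<open>n\<close> factors by \<open>p - 1\<close>, and \<open>p - 1 = Suc (p - 2)\<close> is
        positive.\<close>
      also have "\<dots> < v (a ^ n)" 
      proof -
        have "n = Suc n' + Suc (p - 2)" using p n by simp
        then show ?thesis using vpos[of "Suc n'" "p - 2"] by metis
      qed
      finally show ?thesis .
    qed
    have "d n i \<noteq> 0 \<longrightarrow> v (d n i ^ p * a ^ i) < v (a ^ n)"
      unfolding eq using val_add_less[OF _ _ _ , of "a * d n' i" p "a ^ i" "v (a ^ n)" "\<delta> * red p \<delta> a (Suc n') i"]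
        1 2 a by auto
    then show ?thesis by (simp add: d_def)
  qed
qed

text \<open>\<open>K\<close> is the field of constants: its nonzero elements have value 0, so
  binomial coefficients, \<rho> and the shift constants do not affect values. Only the top term of
  the binomial expansion has the full power of \<open>x\<close>.\<close>

lemma symbol_gamma1_lower:
  assumes p: "p > 1" and a: "a \<noteq> 0" "v a > 0" and b: "b \<noteq> 0"
    and K: "0 \<in> K" "1 \<in> K" "\<And>x y. x \<in> K \<Longrightarrow> y \<in> K \<Longrightarrow> x + y \<in> K" "\<And>x y. x \<in> K \<Longrightarrow> y \<in> K \<Longrightarrow> x * y \<in> K"
      "\<And>x. x \<in> K \<Longrightarrow> x \<noteq> 0 \<Longrightarrow> v x = 0"
    and \<rho>: "\<rho> \<in> K" "\<rho> \<noteq> 0" and \<delta>: "\<delta> \<in> K"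
  defines "l \<equiv> \<lambda>u u' u''. if u'' = ((fst u + fst u') mod p, (snd u + snd u') mod p)
      then \<rho> ^ (snd u * fst u') * (a ^ ((fst u + fst u') div p) * b ^ ((snd u + snd u') div p)) else 0"
  shows "symbol_gamma1 p \<rho> \<delta> a b u u' u'' - l u u' u'' \<noteq> 0 \<longrightarrow>
    v ((symbol_gamma1 p \<rho> \<delta> a b u u' u'' - l u u' u'') ^ p * (a ^ fst u'' * b ^ snd u''))
      < v (a ^ fst u * b ^ snd u * (a ^ fst u' * b ^ snd u'))"
    and "l u u' u'' \<noteq> 0 \<longrightarrow> v (l u u' u'' ^ p * (a ^ fst u'' * b ^ snd u''))
      \<le> v (a ^ fst u * b ^ snd u * (a ^ fst u' * b ^ snd u'))"
proof -
  obtain i j i' j' i'' j'' where u [simp]: "u = (i, j)" "u' = (i', j')" "u'' = (i'', j'')"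
    by (cases u, cases u', cases u'') auto
  have K_pow: "x ^ n \<in> K" if "x \<in> K" for x n using that K by (induction n) auto
  have K_nat: "of_nat n \<in> K" for n using K by (induction n) auto
  have K_sum: "sum f A \<in> K" if "\<And>x. x \<in> A \<Longrightarrow> f x \<in> K" for f and A :: "nat set"
    using that K by (induction A rule: infinite_finite_induct) auto
  have K_shift: "shift_const \<rho> \<delta> j \<in> K" unfolding shift_const_def by (intro K(4) K_sum K_pow \<delta> \<rho>)
  have vpos: "v (a ^ k) < v (a ^ (k + Suc n))" for k n
  proof -
    have "0 < v (a ^ Suc n)" using a by (induction n) (auto simp: val_mult add_pos_pos)
    then show ?thesis using a by (simp add: power_add val_mult del: power_Suc)
  qed
  have pw: "(c ^ (n div p)) ^ p * c ^ (n mod p) = c ^ n" for c :: 'f and n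
    by (simp flip: power_mult power_add)
  have v_rho: "v ((\<rho> ^ n) ^ k) = 0" for n k using K(5)[OF \<rho>] \<rho>(2) by (simp add: val_power_0)
  show "l u u' u'' \<noteq> 0 \<longrightarrow> v (l u u' u'' ^ p * (a ^ fst u'' * b ^ snd u''))
      \<le> v (a ^ fst u * b ^ snd u * (a ^ fst u' * b ^ snd u'))"
  proof
    assume nz: "l u u' u'' \<noteq> 0"
    then have e: "i'' = (i + i') mod p" "j'' = (j + j') mod p" by (auto simp: l_def split: if_splits)
    have "l u u' u'' ^ p * (a ^ i'' * b ^ j'') = (\<rho> ^ (j * i')) ^ p *
      (((a ^ ((i + i') div p)) ^ p * a ^ ((i + i') mod p)) * ((b ^ ((j + j') div p)) ^ p * b ^ ((j + j') mod p)))"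
      by (simp add: l_def e power_mult_distrib mult_ac)
    also have "\<dots> = (\<rho> ^ (j * i')) ^ p * (a ^ i * b ^ j * (a ^ i' * b ^ j'))"
      unfolding pw by (simp add: power_add mult_ac)
    finally show "v (l u u' u'' ^ p * (a ^ fst u'' * b ^ snd u'')) \<le> v (a ^ fst u * b ^ snd u * (a ^ fst u' * b ^ snd u'))"
      using a b \<rho> by (simp add: val_mult v_rho)
  qed
  show "symbol_gamma1 p \<rho> \<delta> a b u u' u'' - l u u' u'' \<noteq> 0 \<longrightarrow>
    v ((symbol_gamma1 p \<rho> \<delta> a b u u' u'' - l u u' u'') ^ p * (a ^ fst u'' * b ^ snd u''))
      < v (a ^ fst u * b ^ snd u * (a ^ fst u' * b ^ snd u'))"
  proof (cases "j'' = (j + j') mod p")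
    case False
    then show ?thesis by (simp add: symbol_gamma1_def l_def)
  next
    case j'': True
    define c where "c = (\<lambda>k. of_nat (i' choose k) * (\<rho> ^ j) ^ k * shift_const \<rho> \<delta> j ^ (i' - k))"
    \<comment> \<open>The summands of the error: for \<open>k = i'\<close> only the deviation of
      \<open>red\<close> from its leading term, otherwise the whole term.\<close>
    define s where "s = (\<lambda>k. if k = i' then c k * (red p \<delta> a (i + k) i'' - (if i'' = (i + k) mod p then a ^ ((i + k) div p) else 0))
      else c k * red p \<delta> a (i + k) i'')"
    have cK: "c k \<in> K" for k unfolding c_def by (intro K K_pow K_nat K_shift \<rho>)
    then have vc: "c k \<noteq> 0 \<Longrightarrow> v (c k ^ p) = 0" for k using K(5) by (simp add: val_power_0)
    have vs: "s k \<noteq> 0 \<longrightarrow> v (s k ^ p * a ^ i'') < v (a ^ (i + i'))" if k: "k \<in> {..i'}" for k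
    proof
      assume nz: "s k \<noteq> 0"
      note red = val_red[OF p a, of \<delta> "i + k" i'']
      have \<delta>0: "\<delta> \<noteq> 0 \<longrightarrow> v \<delta> = 0" using K(5) \<delta> by auto
      show "v (s k ^ p * a ^ i'') < v (a ^ (i + i'))"
      proof (cases "k = i'")
        case True
        define R where "R = red p \<delta> a (i + k) i'' - (if i'' = (i + k) mod p then a ^ ((i + k) div p) else 0)"
        have sk: "s k = c k * R" unfolding s_def R_def by (subst if_P[OF True]) (rule refl)
        then have nz': "c k \<noteq> 0" "R \<noteq> 0" using nz by auto
        have "v (s k ^ p * a ^ i'') = v (R ^ p * a ^ i'')"
          using nz' vc[of k] a by (simp add: sk power_mult_distrib val_mult mult.assoc)
        also have "\<dots> < v (a ^ (i + k))" using red[OF \<delta>0] nz' unfolding R_def by blast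
        finally show ?thesis by (simp only: True)
      next
        case False
        let ?l = "if i'' = (i + k) mod p then a ^ ((i + k) div p) else 0"
        have lead: "v (?l ^ p * a ^ i'') = v (a ^ (i + k))" if "?l \<noteq> 0"
          using that pw[of a "i + k"] by (auto split: if_splits)
        have nz': "red p \<delta> a (i + k) i'' \<noteq> 0" "c k \<noteq> 0" using nz False by (auto simp: s_def)
        then have le: "v (red p \<delta> a (i + k) i'' ^ p * a ^ i'') \<le> v (a ^ (i + k))"
        proof -
          have "red p \<delta> a (i + k) i'' - ?l \<noteq> 0 \<longrightarrow> v ((red p \<delta> a (i + k) i'' - ?l) ^ p * a ^ i'') \<le> v (a ^ (i + k))"
            using red[OF \<delta>0] by (auto intro: less_imp_le)
          moreover have "?l + (red p \<delta> a (i + k) i'' - ?l) = red p \<delta> a (i + k) i''" by simp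
          ultimately show ?thesis
            using val_add_le[of ?l p "a ^ i''" "v (a ^ (i + k))" "red p \<delta> a (i + k) i'' - ?l"] lead nz' a
            by (metis order_refl power_not_zero)
        qed
        obtain n where n: "i' = k + Suc n" using False k by (metis atMost_iff le_neq_implies_less less_imp_Suc_add add_Suc_right)
        have "v (s k ^ p * a ^ i'') = v (red p \<delta> a (i + k) i'' ^ p * a ^ i'')"
          using nz' False vc[of k] a by (simp add: s_def power_mult_distrib val_mult mult.assoc)
        also have "\<dots> \<le> v (a ^ (i + k))" by (rule le)
        also have "\<dots> < v (a ^ (i + i'))" using vpos[of "i + k" n] by (simp add: n add.assoc)
        finally show ?thesis .
      qed
    qed
    let ?b = "b ^ ((j + j') div p)"
    have "(\<Sum>k\<le>i'. s k) = (\<Sum>k\<le>i'. c k * red p \<delta> a (i + k) i'') -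
      (\<Sum>k\<le>i'. if k = i' then c k * (if i'' = (i + k) mod p then a ^ ((i + k) div p) else 0) else 0)"
      unfolding sum_subtractf[symmetric] by (intro sum.cong) (auto simp: s_def algebra_simps)
    also have "(\<Sum>k\<le>i'. if k = i' then c k * (if i'' = (i + k) mod p then a ^ ((i + k) div p) else 0) else 0) =
      \<rho> ^ (j * i') * (if i'' = (i + i') mod p then a ^ ((i + i') div p) else 0)"
      by (simp add: c_def power_mult)
    finally have sums: "(\<Sum>k\<le>i'. s k) = (\<Sum>k\<le>i'. c k * red p \<delta> a (i + k) i'') -
      \<rho> ^ (j * i') * (if i'' = (i + i') mod p then a ^ ((i + i') div p) else 0)" .
    have "symbol_gamma1 p \<rho> \<delta> a b u u' u'' = ?b * (\<Sum>k\<le>i'. c k * red p \<delta> a (i + k) i'')"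
      unfolding symbol_gamma1_def c_def using j'' by simp
    moreover have "l u u' u'' = ?b * (\<rho> ^ (j * i') * (if i'' = (i + i') mod p then a ^ ((i + i') div p) else 0))"
      by (simp add: l_def j'' mult_ac)
    ultimately have eq: "symbol_gamma1 p \<rho> \<delta> a b u u' u'' - l u u' u'' = ?b * (\<Sum>k\<le>i'. s k)"
      unfolding sums by (simp only: right_diff_distrib)
    show ?thesis
    proof
      assume nz: "symbol_gamma1 p \<rho> \<delta> a b u u' u'' - l u u' u'' \<noteq> 0"
      then have nz': "(\<Sum>k\<le>i'. s k) \<noteq> 0" unfolding eq by auto
      have "(symbol_gamma1 p \<rho> \<delta> a b u u' u'' - l u u' u'') ^ p * (a ^ i'' * b ^ j'') =
        (\<Sum>k\<le>i'. s k) ^ p * a ^ i'' * (?b ^ p * b ^ ((j + j') mod p))"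
        unfolding eq by (simp add: power_mult_distrib j'' mult_ac)
      also have "\<dots> = (\<Sum>k\<le>i'. s k) ^ p * a ^ i'' * b ^ (j + j')" unfolding pw ..
      finally have "v ((symbol_gamma1 p \<rho> \<delta> a b u u' u'' - l u u' u'') ^ p * (a ^ i'' * b ^ j'')) =
        v ((\<Sum>k\<le>i'. s k) ^ p * a ^ i'') + v (b ^ (j + j'))"
        using a b nz' by (simp only:) (simp add: val_mult)
      also have "\<dots> < v (a ^ (i + i')) + v (b ^ (j + j'))"
        using val_sum_less[of "{..i'}" "a ^ i''" s p "v (a ^ (i + i'))"] vs a nz' by simp
      also have "\<dots> = v (a ^ i * b ^ j * (a ^ i' * b ^ j'))"
        using a b by (simp add: power_add val_mult algebra_simps)
      finally show "v ((symbol_gamma1 p \<rho> \<delta> a b u u' u'' - l u u' u'') ^ p * (a ^ fst u'' * b ^ snd u''))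
        < v (a ^ fst u * b ^ snd u * (a ^ fst u' * b ^ snd u'))" by simp
    qed
  qed
qed

text \<open>For a factor \<open>g\<close> with leading part \<open>l\<close> and the remaining
  product \<open>A\<close> with leading part \<open>L\<close>, the error is
  \<open>(g - l) A + l (A - L)\<close>. The second claim is carried along in the induction to bound
  \<open>A\<close> through \<open>L\<close>.\<close>

lemma val_prod_lower:
  assumes "finite I" and m: "\<And>k. k \<in> I \<Longrightarrow> m k \<noteq> 0 \<and> z k \<noteq> 0"
    and d: "\<And>k. k \<in> I \<Longrightarrow> g k - l k \<noteq> 0 \<longrightarrow> v ((g k - l k) ^ p * m k) < v (z k)"
    and l: "\<And>k. k \<in> I \<Longrightarrow> l k \<noteq> 0 \<longrightarrow> v (l k ^ p * m k) \<le> v (z k)"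
  shows "(prod g I - prod l I \<noteq> 0 \<longrightarrow> v ((prod g I - prod l I) ^ p * prod m I) < v (prod z I)) \<and>
    (prod l I \<noteq> 0 \<longrightarrow> v (prod l I ^ p * prod m I) \<le> v (prod z I))"
  using assms
proof (induction I)
  case (insert k I)
  let ?A = "prod g I" and ?L = "prod l I" and ?m = "prod m I" and ?z = "prod z I"
  have nz: "m k \<noteq> 0" "z k \<noteq> 0" "?m \<noteq> 0" "?z \<noteq> 0" using insert.prems(1) insert.hyps by auto
  have IH: "?A - ?L \<noteq> 0 \<longrightarrow> v ((?A - ?L) ^ p * ?m) < v ?z" "?L \<noteq> 0 \<longrightarrow> v (?L ^ p * ?m) \<le> v ?z"
    using insert by auto
  have A: "?A \<noteq> 0 \<longrightarrow> v (?A ^ p * ?m) \<le> v ?z"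
    using val_add_le[of ?L p ?m "v ?z" "?A - ?L"] IH nz by (auto intro: less_imp_le)
  have mult: "v ((x * y) ^ p * (m k * ?m)) = v (x ^ p * m k) + v (y ^ p * ?m)" if "x \<noteq> 0" "y \<noteq> 0" for x y
    using that nz by (simp add: power_mult_distrib val_mult algebra_simps)
  have eq: "g k * ?A - l k * ?L = (g k - l k) * ?A + l k * (?A - ?L)" by (simp add: algebra_simps)
  have d: "g k - l k \<noteq> 0 \<longrightarrow> v ((g k - l k) ^ p * m k) < v (z k)"
    and l: "l k \<noteq> 0 \<longrightarrow> v (l k ^ p * m k) \<le> v (z k)" using insert.prems by auto
  have 1: "v (((g k - l k) * ?A) ^ p * (m k * ?m)) < v (z k) + v ?z" if "(g k - l k) * ?A \<noteq> 0"
    using mult[of "g k - l k" ?A] that d A by (auto intro: add_less_le_mono)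
  have 2: "v ((l k * (?A - ?L)) ^ p * (m k * ?m)) < v (z k) + v ?z" if "l k * (?A - ?L) \<noteq> 0"
    using mult[of "l k" "?A - ?L"] that l IH by (auto intro: add_le_less_mono)
  have 3: "v ((l k * ?L) ^ p * (m k * ?m)) \<le> v (z k) + v ?z" if "l k * ?L \<noteq> 0"
    using mult[of "l k" ?L] that l IH by (auto intro: add_mono)
  have "v ((g k * ?A - l k * ?L) ^ p * (m k * ?m)) < v (z k) + v ?z" if "g k * ?A - l k * ?L \<noteq> 0"
    using that 1 2 nz unfolding eq by (intro val_add_less) auto
  then show ?case using 3 insert.hyps nz by (simp add: val_mult)
qed simp

end

text \<open>Leading parts are multiplicative over the tensor factors, so
  \<open>val_prod_lower\<close> reduces the claim on the structure constants to a single symbol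
  algebra.\<close>

theorem (in valuation) symbol_leading_algebra:
  fixes I :: "'i set"
  assumes p: "p > 1" and I: "finite I"
    and ab: "\<And>k. k \<in> I \<Longrightarrow> \<alpha> k \<noteq> 0 \<and> v (\<alpha> k) > 0 \<and> \<beta> k \<noteq> 0"
    and K: "0 \<in> K" "1 \<in> K" "\<And>x y. x \<in> K \<Longrightarrow> y \<in> K \<Longrightarrow> x + y \<in> K" "\<And>x y. x \<in> K \<Longrightarrow> y \<in> K \<Longrightarrow> x * y \<in> K"
      "\<And>x. x \<in> K \<Longrightarrow> x \<noteq> 0 \<Longrightarrow> v x = 0"
    and \<rho>: "\<rho> \<in> K" "\<rho> ^ p = 1" and \<delta>: "\<delta> \<in> K"
    and inj: "\<And>c c' w w'. c \<noteq> 0 \<Longrightarrow> c' \<noteq> 0 \<Longrightarrow> w \<in> exp_set p I \<Longrightarrow> w' \<in> exp_set p I \<Longrightarrow>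
        v (c ^ p * exp_mon I \<alpha> \<beta> w) = v (c' ^ p * exp_mon I \<alpha> \<beta> w') \<Longrightarrow> w = w'"
  shows "leading_algebra v p (exp_set p I) (exp_mon I \<alpha> \<beta>) (symbol_gamma p \<rho> \<delta> I \<alpha> \<beta>)
    (exp_add p I) (carry p \<rho> I \<alpha> \<beta>) (exp_zero I)"
proof
  have \<rho>0: "\<rho> \<noteq> 0" using \<rho>(2) p by (auto simp: power_0_left)
  show "finite (exp_set p I)" using I by (simp add: exp_set_def finite_PiE)
  show "exp_mon I \<alpha> \<beta> w \<noteq> 0" for w using ab I by (simp add: exp_mon_def)
  show "exp_add p I w w' \<in> exp_set p I" for w w' using p by (auto simp: exp_add_def exp_set_def)
  show "carry p \<rho> I \<alpha> \<beta> w w' \<noteq> 0" for w w' using ab I \<rho>0 by (simp add: carry_def)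
  show "carry p \<rho> I \<alpha> \<beta> w w' ^ p * exp_mon I \<alpha> \<beta> (exp_add p I w w') = exp_mon I \<alpha> \<beta> w * exp_mon I \<alpha> \<beta> w'"
    for w w' by (rule carry_mon[OF \<rho>(2)])
  show "exp_zero I \<in> exp_set p I" using p by (auto simp: exp_zero_def exp_set_def)
  show "exp_mon I \<alpha> \<beta> (exp_zero I) = 1" by (simp add: exp_mon_def exp_zero_def)
  show "w = w'" if "c \<noteq> 0" "c' \<noteq> 0" "w \<in> exp_set p I" "w' \<in> exp_set p I"
    "v (c ^ p * exp_mon I \<alpha> \<beta> w) = v (c' ^ p * exp_mon I \<alpha> \<beta> w')" for c c' w w'
    using inj[OF that] .
  fix w w' w''
  assume w: "w \<in> exp_set p I" "w' \<in> exp_set p I" "w'' \<in> exp_set p I"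
    and nz: "symbol_gamma p \<rho> \<delta> I \<alpha> \<beta> w w' w'' - (if w'' = exp_add p I w w' then carry p \<rho> I \<alpha> \<beta> w w' else 0) \<noteq> 0"
  define l where "l = (\<lambda>k. if w'' k = ((fst (w k) + fst (w' k)) mod p, (snd (w k) + snd (w' k)) mod p)
      then \<rho> ^ (snd (w k) * fst (w' k)) * (\<alpha> k ^ ((fst (w k) + fst (w' k)) div p) * \<beta> k ^ ((snd (w k) + snd (w' k)) div p)) else 0)"
  have l: "prod l I = (if w'' = exp_add p I w w' then carry p \<rho> I \<alpha> \<beta> w w' else 0)"
  proof (cases "w'' = exp_add p I w w'")
    case True
    then show ?thesis
      by (simp add: l_def exp_add_def carry_def exp_form_def prod.distrib power_sum)
  next
    case False
    have "\<exists>k\<in>I. w'' k \<noteq> exp_add p I w w' k"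
    proof (rule ccontr)
      assume "\<not> ?thesis"
      then have "w'' = exp_add p I w w'"
        using w(3) by (intro PiE_ext[of w'' I "\<lambda>_. {..<p} \<times> {..<p}"]) (use p in \<open>auto simp: exp_set_def exp_add_def\<close>)
      with False show False by simp
    qed
    then have "\<exists>k\<in>I. l k = 0" by (auto simp: l_def exp_add_def)
    then show ?thesis using False I by (simp add: prod_zero)
  qed
  let ?m = "\<lambda>k. \<alpha> k ^ fst (w'' k) * \<beta> k ^ snd (w'' k)"
  let ?z = "\<lambda>k. \<alpha> k ^ fst (w k) * \<beta> k ^ snd (w k) * (\<alpha> k ^ fst (w' k) * \<beta> k ^ snd (w' k))"
  have "v ((symbol_gamma p \<rho> \<delta> I \<alpha> \<beta> w w' w'' - prod l I) ^ p * prod ?m I) < v (prod ?z I)"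
    using nz unfolding l[symmetric] symbol_gamma_def
  proof (rule val_prod_lower[THEN conjunct1, rule_format, OF I, rotated 3])
    fix k assume k: "k \<in> I"
    note lw = symbol_gamma1_lower[OF p _ _ _ K \<rho>(1) \<rho>0 \<delta>,
      where a = "\<alpha> k" and b = "\<beta> k" and u = "w k" and u' = "w' k" and u'' = "w'' k"]
    show "?m k \<noteq> 0 \<and> ?z k \<noteq> 0" using ab[OF k] by simp
    show "v ((symbol_gamma1 p \<rho> \<delta> (\<alpha> k) (\<beta> k) (w k) (w' k) (w'' k) - l k) ^ p * ?m k) < v (?z k)"
      if "symbol_gamma1 p \<rho> \<delta> (\<alpha> k) (\<beta> k) (w k) (w' k) (w'' k) - l k \<noteq> 0"
      using lw(1) ab[OF k] that unfolding l_def by blast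
    show "v (l k ^ p * ?m k) \<le> v (?z k)" if "l k \<noteq> 0"
      using lw(2) ab[OF k] that unfolding l_def by blast
  qed
  moreover have "prod ?z I = exp_mon I \<alpha> \<beta> w * exp_mon I \<alpha> \<beta> w'"
    by (simp only: exp_mon_def prod.distrib)
  ultimately show "v ((symbol_gamma p \<rho> \<delta> I \<alpha> \<beta> w w' w'' - (if w'' = exp_add p I w w' then carry p \<rho> I \<alpha> \<beta> w w' else 0)) ^ p *
    exp_mon I \<alpha> \<beta> w'') < v (exp_mon I \<alpha> \<beta> w * exp_mon I \<alpha> \<beta> w')"
    unfolding l by (simp only: exp_mon_def)
qed

text \<open>
  Over a field containing the roots \<open>ev l\<close> of \<open>X\<^sup>p - \<delta> X - \<alpha>\<close> and a root \<open>s\<close> of \<open>X\<^sup>p - \<beta>\<close>, the symbol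
  algebra acts by \<open>p \<times> p\<close> matrices: \<open>x\<close> is the diagonal matrix of the \<open>ev l\<close>, and \<open>y\<close> is \<open>s\<close> times
  the cyclic shift.
\<close>

locale split_symbol =
  fixes p :: nat and \<rho> \<delta> a b :: "'f::field" and ev :: "nat \<Rightarrow> 'f alg_closure" and s :: "'f alg_closure"
  assumes p: "p > 1" and ev_inj: "inj_on ev {..<p}"
    and ev_root: "l < p \<Longrightarrow> ev l ^ p = to_ac a + to_ac \<delta> * ev l"
    and ev_shift: "l < p \<Longrightarrow> ev (Suc l mod p) = to_ac \<rho> * ev l + to_ac \<delta>"
    and s_root: "s ^ p = to_ac b" and s_nz: "s \<noteq> 0"
begin

definition smat :: "nat \<times> nat \<Rightarrow> nat \<Rightarrow> nat \<Rightarrow> 'f alg_closure" where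
  "smat u g h = (if h = (g + snd u) mod p then ev g ^ fst u * s ^ snd u else 0)"

lemma ev_red: "l < p \<Longrightarrow> ev l ^ n = (\<Sum>i<p. to_ac (red p \<delta> a n i) * ev l ^ i)"
proof (induction n rule: less_induct)
  case (less n)
  show ?case
  proof (cases "n < p")
    case True
    then have "(\<Sum>i<p. to_ac (red p \<delta> a n i) * ev l ^ i) = (\<Sum>i<p. if i = n then ev l ^ n else 0)"
      by (intro sum.cong refl) (simp add: red.simps[of p \<delta> a n])
    then show ?thesis using True by simp
  next
    case False
    define n' where "n' = n - p"
    have n: "n = p + n'" using False by (simp add: n'_def)
    have red: "red p \<delta> a n i = a * red p \<delta> a n' i + \<delta> * red p \<delta> a (Suc n') i" for i
      using False p by (subst red.simps) (simp add: n'_def)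
    have "ev l ^ n = to_ac a * ev l ^ n' + to_ac \<delta> * ev l ^ Suc n'"
      using ev_root[OF less.prems] by (simp add: n power_add algebra_simps)
    also have "\<dots> = to_ac a * (\<Sum>i<p. to_ac (red p \<delta> a n' i) * ev l ^ i) +
        to_ac \<delta> * (\<Sum>i<p. to_ac (red p \<delta> a (Suc n') i) * ev l ^ i)"
      using less.IH[of n'] less.IH[of "Suc n'"] less.prems p n by simp
    also have "\<dots> = (\<Sum>i<p. to_ac (red p \<delta> a n i) * ev l ^ i)"
      by (simp add: red sum_distrib_left algebra_simps sum.distrib)
    finally show ?thesis .
  qed
qed

lemma ev_shift_n: "l < p \<Longrightarrow> ev ((l + j) mod p) = to_ac \<rho> ^ j * ev l + to_ac (shift_const \<rho> \<delta> j)"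
proof (induction j)
  case 0
  then show ?case by (simp add: shift_const_def)
next
  case (Suc j)
  have "ev ((l + Suc j) mod p) = ev (Suc ((l + j) mod p) mod p)" by (simp add: mod_Suc_eq)
  also have "\<dots> = to_ac \<rho> * (to_ac \<rho> ^ j * ev l + to_ac (shift_const \<rho> \<delta> j)) + to_ac \<delta>"
    using p Suc by (simp add: ev_shift)
  finally show ?case by (simp add: shift_const_Suc algebra_simps)
qed

lemma s_mod: "s ^ n = to_ac (b ^ (n div p)) * s ^ (n mod p)"
proof -
  have "s ^ n = s ^ (p * (n div p) + n mod p)" by simp
  then show ?thesis by (simp only: power_add power_mult s_root to_ac_power)
qed

text \<open>Row \<open>g\<close> of \<open>y^j\<close> points to row \<open>g + j\<close>, where the
  eigenvalue of \<open>x\<close> is \<open>\<rho>^j ev g + c\<close> by \<open>ev_shift_n\<close>.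
  What remains is the expansion of powers of the one number \<open>ev g\<close> by
  \<open>ev_red\<close>.\<close>

lemma smat_mult:
  assumes "g < p" "h < p"
  shows "(\<Sum>l<p. smat u g l * smat u' l h) =
    (\<Sum>u''\<in>{..<p} \<times> {..<p}. to_ac (symbol_gamma1 p \<rho> \<delta> a b u u' u'') * smat u'' g h)"
proof -
  obtain i j i' j' where u [simp]: "u = (i, j)" "u' = (i', j')" by (cases u, cases u') auto
  let ?l = "(g + j) mod p"
  let ?J = "(j + j') mod p"
  have lp: "?l < p" using p by simp
  define r where "r = (\<lambda>i''. \<Sum>k\<le>i'. of_nat (i' choose k) * (\<rho> ^ j) ^ k * shift_const \<rho> \<delta> j ^ (i' - k) * red p \<delta> a (i + k) i'')"
  have "ev g ^ i * ev ?l ^ i' = ev g ^ i * (to_ac (\<rho> ^ j) * ev g + to_ac (shift_const \<rho> \<delta> j)) ^ i'"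
    using assms by (simp add: ev_shift_n)
  also have "\<dots> = (\<Sum>k\<le>i'. to_ac (of_nat (i' choose k) * (\<rho> ^ j) ^ k * shift_const \<rho> \<delta> j ^ (i' - k)) * ev g ^ (i + k))"
    unfolding binomial_ring by (simp add: sum_distrib_left power_mult_distrib power_add mult_ac)
  also have "\<dots> = (\<Sum>k\<le>i'. \<Sum>i''<p. to_ac (of_nat (i' choose k) * (\<rho> ^ j) ^ k * shift_const \<rho> \<delta> j ^ (i' - k) * red p \<delta> a (i + k) i'') * ev g ^ i'')"
    by (intro sum.cong refl) (simp only: ev_red[OF assms(1), of "i + _"] sum_distrib_left to_ac_mult mult.assoc)
  also have "\<dots> = (\<Sum>i''<p. to_ac (r i'') * ev g ^ i'')"
    by (subst sum.swap) (simp add: r_def to_ac_sum sum_distrib_right)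
  finally have evr: "ev g ^ i * ev ?l ^ i' = (\<Sum>i''<p. to_ac (r i'') * ev g ^ i'')" .
  have "(\<Sum>l<p. smat u g l * smat u' l h) =
      (\<Sum>l<p. if l = ?l then (if h = (?l + j') mod p then ev g ^ i * s ^ j * (ev ?l ^ i' * s ^ j') else 0) else 0)"
    by (intro sum.cong refl) (auto simp: smat_def)
  also have "\<dots> = (if h = (?l + j') mod p then ev g ^ i * s ^ j * (ev ?l ^ i' * s ^ j') else 0)"
    using lp by simp
  also have "(?l + j') mod p = (g + ?J) mod p" by (simp add: mod_simps add.assoc)
  also have "ev g ^ i * s ^ j * (ev ?l ^ i' * s ^ j') = (\<Sum>i''<p. to_ac (r i'') * ev g ^ i'') * s ^ (j + j')"
    unfolding evr[symmetric] by (simp add: power_add mult_ac)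
  also have "\<dots> = (\<Sum>i''<p. to_ac (b ^ ((j + j') div p) * r i'') * (ev g ^ i'' * s ^ ?J))"
    by (subst s_mod) (simp add: sum_distrib_right sum_distrib_left mult_ac)
  finally have lhs: "(\<Sum>l<p. smat u g l * smat u' l h) =
    (\<Sum>i''<p. if h = (g + ?J) mod p then to_ac (b ^ ((j + j') div p) * r i'') * (ev g ^ i'' * s ^ ?J) else 0)"
    by auto
  have "(\<Sum>u''\<in>{..<p} \<times> {..<p}. to_ac (symbol_gamma1 p \<rho> \<delta> a b u u' u'') * smat u'' g h) =
    (\<Sum>i''<p. \<Sum>j''<p. to_ac (symbol_gamma1 p \<rho> \<delta> a b u u' (i'', j'')) * smat (i'', j'') g h)"
    by (simp add: sum.cartesian_product)
  also have "\<dots> = (\<Sum>i''<p. \<Sum>j''<p. if j'' = ?J then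
      (if h = (g + ?J) mod p then to_ac (b ^ ((j + j') div p) * r i'') * (ev g ^ i'' * s ^ ?J) else 0) else 0)"
    by (intro sum.cong refl) (auto simp: symbol_gamma1_def smat_def r_def)
  also have "\<dots> = (\<Sum>i''<p. if h = (g + ?J) mod p then to_ac (b ^ ((j + j') div p) * r i'') * (ev g ^ i'' * s ^ ?J) else 0)"
    using p by (intro sum.cong refl) simp
  finally show ?thesis using lhs by simp
qed

text \<open>The coefficients of these interpolation polynomials form the inverse of the Vandermonde
  matrix of the eigenvalues \<open>ev l\<close>.\<close>

definition lagrange :: "nat \<Rightarrow> 'f alg_closure poly" where
  "lagrange l = smult (inverse (\<Prod>l'\<in>{..<p} - {l}. ev l - ev l')) (\<Prod>l'\<in>{..<p} - {l}. [:- ev l', 1:])"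

lemma lagrange_degree: "l < p \<Longrightarrow> degree (lagrange l) < p"
proof -
  assume l: "l < p"
  have "degree (lagrange l) \<le> (\<Sum>l'\<in>{..<p} - {l}. 1)"
    unfolding lagrange_def
    by (rule order_trans[OF degree_smult_le], rule order_trans[OF degree_prod_sum_le]) auto
  also have "\<dots> = p - 1" using l by (simp add: card_Diff_singleton)
  finally show ?thesis using p by simp
qed

lemma lagrange_eval:
  assumes "l < p" "l' < p"
  shows "poly (lagrange l) (ev l') = (if l = l' then 1 else 0)"
proof (cases "l = l'")
  case True
  have "ev l - ev m \<noteq> 0" if "m \<in> {..<p} - {l}" for m
    using ev_inj that assms by (auto simp: inj_on_def)
  then show ?thesis using True by (simp add: lagrange_def poly_prod)
next
  case False
  then have "l' \<in> {..<p} - {l}" using assms by auto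
  then have "(\<Prod>m\<in>{..<p} - {l}. ev l' - ev m) = 0"
    by (intro prod_zero) auto
  then show ?thesis using False by (simp add: lagrange_def poly_prod)
qed

lemma poly_lessThan: "degree (q :: 'e::field poly) < p \<Longrightarrow> poly q x = (\<Sum>i<p. coeff q i * x ^ i)"
  unfolding Polynomial.poly_altdef
  by (rule sum.mono_neutral_left) (auto simp: coeff_eq_0)

lemma lagrange_dual1: "l < p \<Longrightarrow> l' < p \<Longrightarrow> (\<Sum>i<p. coeff (lagrange l) i * ev l' ^ i) = (if l = l' then 1 else 0)"
  using poly_lessThan[OF lagrange_degree] lagrange_eval by metis

text \<open>Interpolating \<open>X^i'\<close> at the \<open>p\<close> eigenvalues returns it, as its
  degree is below \<open>p\<close>. Together with \<open>lagrange_dual1\<close> this gives a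
  two-sided inverse.\<close>

lemma lagrange_dual2:
  assumes "i < p" "i' < p"
  shows "(\<Sum>l<p. coeff (lagrange l) i * ev l ^ i') = (if i = i' then 1 else 0)"
proof -
  define Q where "Q = (\<Sum>l<p. smult (ev l ^ i') (lagrange l))"
  have deg: "degree Q < p"
    unfolding Q_def using p by (intro degree_sum_less) (auto intro: le_less_trans[OF degree_smult_le] lagrange_degree)
  have "poly Q (ev l) = poly (monom 1 i') (ev l)" if "l < p" for l
  proof -
    have "poly Q (ev l) = (\<Sum>l'<p. if l' = l then ev l ^ i' else 0)"
      unfolding Q_def poly_sum using that by (intro sum.cong refl) (simp add: lagrange_eval)
    then show ?thesis using that by (simp add: poly_monom)
  qed
  then have "Q = monom 1 i'"
    using poly_eqI_degree[of "ev ` {..<p}" Q "monom 1 i'"] deg ev_inj assms degree_monom_le[of "1 :: 'f alg_closure" i']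
    by (auto simp: card_image)
  then have "coeff Q i = (if i = i' then 1 else 0)" by simp
  then show ?thesis by (simp add: Q_def coeff_sum mult.commute)
qed

text \<open>Dual to \<open>smat\<close> under the entrywise pairing, without transposition: the same
  cyclic support, the inverse Vandermonde matrix for the powers of \<open>ev g\<close>, and the
  inverse power of \<open>s\<close>.\<close>

definition dmat :: "nat \<times> nat \<Rightarrow> nat \<Rightarrow> nat \<Rightarrow> 'f alg_closure" where
  "dmat u g h = (if h = (g + snd u) mod p then coeff (lagrange g) (fst u) / s ^ snd u else 0)"

lemma mod_add_cancel: "g < p \<Longrightarrow> j < p \<Longrightarrow> j' < p \<Longrightarrow> (g + j) mod p = (g + j') mod p \<longleftrightarrow> j = j'"
proof
  assume *: "g < p" "j < p" "j' < p" "(g + j) mod p = (g + j') mod p"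
  then have "[g + j = g + j'] (mod p)" by (simp add: cong_def)
  then have "[j = j'] (mod p)" by (simp add: cong_add_lcancel_nat)
  then show "j = j'" using * by (simp add: cong_def)
qed simp

lemma smat_dual1:
  assumes "u \<in> {..<p} \<times> {..<p}" "u' \<in> {..<p} \<times> {..<p}"
  shows "(\<Sum>g<p. \<Sum>h<p. dmat u g h * smat u' g h) = (if u = u' then 1 else 0)"
proof -
  obtain i j i' j' where u [simp]: "u = (i, j)" "u' = (i', j')" by (cases u, cases u') auto
  have "(\<Sum>g<p. \<Sum>h<p. dmat u g h * smat u' g h) =
    (\<Sum>g<p. \<Sum>h<p. if h = (g + j) mod p then (if j = j' then coeff (lagrange g) i * ev g ^ i' else 0) else 0)"
    using assms s_nz by (intro sum.cong refl) (auto simp: dmat_def smat_def mod_add_cancel)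
  also have "\<dots> = (\<Sum>g<p. if j = j' then coeff (lagrange g) i * ev g ^ i' else 0)"
    using p by (intro sum.cong refl) simp
  also have "\<dots> = (if j = j' then \<Sum>g<p. coeff (lagrange g) i * ev g ^ i' else 0)" by auto
  finally show ?thesis using assms by (auto simp: lagrange_dual2)
qed

lemma smat_dual2:
  assumes "g < p" "h < p" "g' < p" "h' < p"
  shows "(\<Sum>u\<in>{..<p} \<times> {..<p}. dmat u g h * smat u g' h') = (if g = g' \<and> h = h' then 1 else 0)"
proof -
  have ex: "\<exists>j<p. h = (g + j) mod p"
    using assms by (intro exI[of _ "(h + (p - g)) mod p"]) (simp add: mod_simps)
  then obtain j where j: "j < p" "h = (g + j) mod p" by blast
  have "(\<Sum>u\<in>{..<p} \<times> {..<p}. dmat u g h * smat u g' h') = (\<Sum>i<p. \<Sum>j'<p. dmat (i, j') g h * smat (i, j') g' h')"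
    by (simp add: sum.cartesian_product)
  also have "\<dots> = (\<Sum>i<p. \<Sum>j'<p. if j' = j then (if h' = (g' + j) mod p then coeff (lagrange g) i * ev g' ^ i else 0) else 0)"
    using j s_nz assms by (intro sum.cong refl) (auto simp: dmat_def smat_def mod_add_cancel)
  also have "\<dots> = (\<Sum>i<p. if h' = (g' + j) mod p then coeff (lagrange g) i * ev g' ^ i else 0)"
    using j by (intro sum.cong refl) simp
  also have "\<dots> = (if h' = (g' + j) mod p then \<Sum>i<p. coeff (lagrange g) i * ev g' ^ i else 0)" by auto
  finally show ?thesis using assms j by (auto simp: lagrange_dual1)
qed

lemma smat_trace:
  assumes "u \<in> {..<p} \<times> {..<p}"
  shows "(\<Sum>g<p. smat u g g) = (if snd u = 0 then \<Sum>g<p. ev g ^ fst u else 0)"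
proof -
  have "g = (g + snd u) mod p \<longleftrightarrow> snd u = 0" if "g < p" for g
    using mod_add_cancel[of g 0 "snd u"] that assms by auto
  then have "(\<Sum>g<p. smat u g g) = (\<Sum>g<p. if snd u = 0 then ev g ^ fst u else 0)"
    by (intro sum.cong refl) (auto simp: smat_def)
  then show ?thesis by auto
qed

end

section \<open>Eigenvalues of x and traces of monomials\<close>

lemma of_nat_power_CHAR:
  fixes p :: nat
  assumes "prime p" "CHAR('e::field) = p"
  shows "(of_nat g :: 'e) ^ p = of_nat g"
proof (induction g)
  case 0
  then show ?case using prime_gt_0_nat[OF assms(1)] by simp
next
  case (Suc g)
  have "(1 + of_nat g :: 'e) ^ p = 1 ^ p + of_nat g ^ p"
    by (rule freshmans_dream) (simp_all only: assms)
  then show ?case using Suc by simp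
qed

text \<open>The eigenvalues of \<open>x\<close> are the \<open>\<theta> \<rho>^l\<close> for a
  \<open>p\<close>-th root \<theta> of \<open>a\<close>, or the \<open>\<theta> + l\<close> for a
  root \<theta> of \<open>X^p - X - a\<close> in characteristic \<open>p\<close>. In the first case
  \<open>a \<noteq> 0\<close> makes them distinct.\<close>

lemma exists_split_symbol:
  fixes a b \<rho> \<delta> :: "'f::field"
  assumes par: "symbol_parameters p \<rho> \<delta>" and a: "a \<noteq> 0" and b: "b \<noteq> 0"
  shows "\<exists>ev s. split_symbol p \<rho> \<delta> a b ev s"
proof -
  have p: "prime p" using par by (simp add: symbol_parameters_def)
  then have p1: "p > 1" by (rule prime_gt_1_nat)
  obtain s :: "'f alg_closure" where s: "s ^ p = to_ac b" using nth_root_exists[of p "to_ac b"] p1 by auto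
  then have s0: "s \<noteq> 0" using b p1 by (auto simp: power_0_left)
  have Sucmod: "Suc l mod p = (if Suc l = p then 0 else Suc l)" if "l < p" for l using that by auto
  from par consider (prim) "\<delta> = 0" "\<rho> ^ p = 1" "\<And>k. 0 < k \<Longrightarrow> k < p \<Longrightarrow> \<rho> ^ k \<noteq> 1"
    | (charp) "\<delta> = 1" "\<rho> = 1" "CHAR('f) = p" by (auto simp: symbol_parameters_def)
  then show ?thesis
  proof cases
    case prim
    obtain \<theta> :: "'f alg_closure" where \<theta>: "\<theta> ^ p = to_ac a" using nth_root_exists[of p "to_ac a"] p1 by auto
    then have \<theta>0: "\<theta> \<noteq> 0" using a p1 by (auto simp: power_0_left)
    have \<rho>0: "\<rho> \<noteq> 0" using prim(2) p1 by (auto simp: power_0_left)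
    have "split_symbol p \<rho> \<delta> a b (\<lambda>l. \<theta> * to_ac (\<rho> ^ l)) s"
    proof
      show "inj_on (\<lambda>l. \<theta> * to_ac (\<rho> ^ l)) {..<p}"
      proof (rule linorder_inj_onI')
        fix i j assume ij: "i \<in> {..<p}" "j \<in> {..<p}" "i < j"
        have "\<rho> ^ j = \<rho> ^ i * \<rho> ^ (j - i)" using ij by (simp flip: power_add)
        moreover have "\<rho> ^ (j - i) \<noteq> 1" using prim(3)[of "j - i"] ij by auto
        ultimately have "\<rho> ^ i \<noteq> \<rho> ^ j" using \<rho>0 by simp
        then show "\<theta> * to_ac (\<rho> ^ i) \<noteq> \<theta> * to_ac (\<rho> ^ j)" using \<theta>0 to_ac_eq_iff by (metis mult_left_cancel)
      qed
      fix l assume l: "l < p"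
      have "(\<theta> * to_ac (\<rho> ^ l)) ^ p = to_ac (a * (\<rho> ^ p) ^ l)"
        by (simp add: power_mult_distrib \<theta> mult.commute flip: power_mult)
      then show "(\<theta> * to_ac (\<rho> ^ l)) ^ p = to_ac a + to_ac \<delta> * (\<theta> * to_ac (\<rho> ^ l))"
        by (simp add: prim)
      have "\<rho> ^ (Suc l mod p) = \<rho> ^ Suc l" using l prim(2) by (auto simp: Sucmod)
      then show "\<theta> * to_ac (\<rho> ^ (Suc l mod p)) = to_ac \<rho> * (\<theta> * to_ac (\<rho> ^ l)) + to_ac \<delta>"
        by (simp add: prim)
    qed (use p1 s s0 in auto)
    then show ?thesis by blast
  next
    case charp
    define q where "q = [:- to_ac a, - 1:] + monom (1 :: 'f alg_closure) p"
    have "degree q = p" unfolding q_def using p1 by (subst degree_add_eq_right) (auto simp: degree_monom_eq)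
    then obtain \<theta> where "poly q \<theta> = 0" using alg_closed_imp_poly_has_root[of q] p1 by auto
    then have \<theta>: "\<theta> ^ p = to_ac a + \<theta>" by (simp add: q_def poly_monom algebra_simps)
    have ch: "CHAR('f alg_closure) = p" using charp by simp
    have "split_symbol p \<rho> \<delta> a b (\<lambda>l. \<theta> + of_nat l) s"
    proof
      show "inj_on (\<lambda>l. \<theta> + of_nat l) {..<p}"
      proof (rule linorder_inj_onI')
        fix i j assume ij: "i \<in> {..<p}" "j \<in> {..<p}" "i < j"
        have "of_nat (j - i) \<noteq> (0 :: 'f alg_closure)"
          using ij unfolding of_nat_eq_0_iff_char_dvd ch by (auto dest: dvd_imp_le)
        then show "\<theta> + of_nat i \<noteq> \<theta> + of_nat j" using ij by (auto simp: of_nat_diff)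
      qed
      fix l assume l: "l < p"
      show "(\<theta> + of_nat l) ^ p = to_ac a + to_ac \<delta> * (\<theta> + of_nat l)"
      proof -
        have "(\<theta> + of_nat l) ^ p = \<theta> ^ p + of_nat l ^ p"
          by (rule freshmans_dream) (simp_all only: ch p)
        then show ?thesis by (simp add: \<theta> of_nat_power_CHAR[OF p ch] charp)
      qed
      have "of_nat (Suc l mod p) = (of_nat (Suc l) :: 'f alg_closure)"
        using l of_nat_CHAR[where 'a = "'f alg_closure"] unfolding ch by (auto simp: Sucmod)
      then show "\<theta> + of_nat (Suc l mod p) = to_ac \<rho> * (\<theta> + of_nat l) + to_ac \<delta>"
        by (simp add: charp)
    qed (use p1 s s0 in auto)
    then show ?thesis by blast
  qed
qed

lemma sum_shift_mod:
  assumes "p > 0"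
  shows "(\<Sum>l<p. f (Suc l mod p)) = (\<Sum>l<p. f l :: 'e::comm_monoid_add)"
proof -
  have "inj_on (\<lambda>l. Suc l mod p) {..<p}"
    by (auto simp: inj_on_def mod_Suc split: if_splits)
  moreover from this have "(\<lambda>l. Suc l mod p) ` {..<p} = {..<p}"
    using assms by (intro endo_inj_surj) auto
  ultimately have "bij_betw (\<lambda>l. Suc l mod p) {..<p} {..<p}" by (simp add: bij_betw_def)
  then show ?thesis by (rule sum.reindex_bij_betw)
qed

text \<open>The shift leaves the sum of the powers with exponent \<open>i + 1\<close> unchanged.
  Expanding \<open>(e l + 1)^(i + 1)\<close>, where the lower power sums vanish by induction, leaves
  \<open>(i + 1)\<close> times the sum in question, and \<open>i + 1 < p\<close> is
  invertible.\<close>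

lemma power_sum_shift_0:
  fixes e :: "nat \<Rightarrow> 'e::field"
  assumes p: "p > 0" and ch: "CHAR('e) = p" and e: "\<And>l. l < p \<Longrightarrow> e (Suc l mod p) = e l + 1" and "i < p - 1"
  shows "(\<Sum>l<p. e l ^ i) = 0"
  using \<open>i < p - 1\<close>
proof (induction i rule: less_induct)
  case (less i)
  have "(\<Sum>l<p. e l ^ Suc i) = (\<Sum>l<p. (e l + 1) ^ Suc i)"
    using sum_shift_mod[OF p, of "\<lambda>l. e l ^ Suc i"] e by simp
  also have "\<dots> = (\<Sum>l<p. \<Sum>q\<le>Suc i. of_nat (Suc i choose q) * e l ^ q)"
    by (simp only: binomial_ring power_one mult_1_right)
  also have "\<dots> = (\<Sum>q\<le>Suc i. of_nat (Suc i choose q) * (\<Sum>l<p. e l ^ q))"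
    by (subst sum.swap) (simp only: sum_distrib_left)
  also have "\<dots> = (\<Sum>q\<le>i. of_nat (Suc i choose q) * (\<Sum>l<p. e l ^ q)) + (\<Sum>l<p. e l ^ Suc i)"
    by (simp only: sum.atMost_Suc binomial_n_n of_nat_1 mult_1)
  also have "(\<Sum>q\<le>i. of_nat (Suc i choose q) * (\<Sum>l<p. e l ^ q)) =
      (\<Sum>q\<le>i. if q = i then of_nat (Suc i) * (\<Sum>l<p. e l ^ i) else 0)"
    using less by (intro sum.cong refl) (auto simp: binomial_Suc_n)
  also have "\<dots> = of_nat (Suc i) * (\<Sum>l<p. e l ^ i)" by simp
  finally have "of_nat (Suc i) * (\<Sum>l<p. e l ^ i) = 0" by simp
  moreover have "of_nat (Suc i) \<noteq> (0 :: 'e)"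
    using less.prems unfolding of_nat_eq_0_iff_char_dvd ch by (auto dest: dvd_imp_le)
  ultimately show ?case by simp
qed

text \<open>This is the origin of the class \<open>e\<close>. If \<open>\<delta> = 0\<close>, the
  shift multiplies the sum by \<open>\<rho>^i\<close>, which differs from 1 unless
  \<open>i = 0\<close>. If \<open>\<delta> = 1\<close> and \<open>i = p - 1\<close>, expanding
  \<open>ev l = l + ev 0\<close> leaves only the sum of the \<open>l^(p - 1)\<close>, which is
  \<open>p - 1 = -1\<close> by Fermat.\<close>

lemma (in split_symbol) power_sum:
  assumes par: "symbol_parameters p \<rho> \<delta>" and i: "i < p"
  shows "(\<Sum>l<p. ev l ^ i) = (if i = (if \<delta> = 0 then 0 else p - 1)
     then to_ac (if \<delta> = 0 then of_nat p else - 1) else 0)"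
proof -
  from par consider (prim) "\<delta> = 0" "\<And>k. 0 < k \<Longrightarrow> k < p \<Longrightarrow> \<rho> ^ k \<noteq> 1"
    | (charp) "\<delta> = 1" "\<rho> = 1" "CHAR('f) = p" "prime p" by (auto simp: symbol_parameters_def)
  then show ?thesis
  proof cases
    case prim
    show ?thesis
    proof (cases "i = 0")
      case False
      have "(\<Sum>l<p. ev l ^ i) = (\<Sum>l<p. ev (Suc l mod p) ^ i)"
        using sum_shift_mod[of p "\<lambda>l. ev l ^ i"] p by simp
      also have "\<dots> = to_ac (\<rho> ^ i) * (\<Sum>l<p. ev l ^ i)"
        by (simp add: ev_shift prim power_mult_distrib sum_distrib_left)
      finally have "(to_ac (\<rho> ^ i) - 1) * (\<Sum>l<p. ev l ^ i) = 0" by (simp add: algebra_simps)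
      moreover have "to_ac (\<rho> ^ i) \<noteq> 1" using prim(2)[of i] False i to_ac_eq_1_iff by blast
      ultimately show ?thesis using False prim by simp
    qed (simp add: prim)
  next
    case charp
    have ch: "CHAR('f alg_closure) = p" using charp by simp
    have e: "ev (Suc l mod p) = ev l + 1" if "l < p" for l
      using ev_shift[OF that] charp by simp
    have Sucmod: "Suc l mod p = (if Suc l = p then 0 else Suc l)" if "l < p" for l using that by auto
    have n: "of_nat (Suc l mod p) = (of_nat l + 1 :: 'f alg_closure)" if "l < p" for l
    proof -
      have "of_nat (Suc l mod p) = (of_nat (Suc l) :: 'f alg_closure)"
        using that of_nat_CHAR[where 'a = "'f alg_closure"] unfolding ch by (auto simp: Sucmod)
      then show ?thesis by (simp add: add.commute)
    qed
    show ?thesis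
    proof (cases "i = p - 1")
      case False
      then show ?thesis using power_sum_shift_0[where e = ev, OF _ ch e, of i] i p charp by simp
    next
      case True
      have ev: "ev l = of_nat l + ev 0" if "l < p" for l
        using ev_shift_n[of 0 l] that p charp by (simp add: shift_const_def to_ac_of_nat)
      have "(\<Sum>l<p. ev l ^ i) = (\<Sum>l<p. \<Sum>q\<le>i. of_nat (i choose q) * of_nat l ^ q * ev 0 ^ (i - q))"
      proof (rule sum.cong)
        fix l assume "l \<in> {..<p}"
        then have "ev l ^ i = (of_nat l + ev 0) ^ i" using ev[of l] by simp
        then show "ev l ^ i = (\<Sum>q\<le>i. of_nat (i choose q) * of_nat l ^ q * ev 0 ^ (i - q))"
          by (simp only: binomial_ring)
      qed simp
      also have "\<dots> = (\<Sum>q\<le>i. of_nat (i choose q) * ev 0 ^ (i - q) * (\<Sum>l<p. of_nat l ^ q))"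
        by (subst sum.swap) (simp add: sum_distrib_left mult_ac)
      also have "\<dots> = (\<Sum>q\<le>i. if q = i then (\<Sum>l<p. of_nat l ^ i) else 0)"
        using power_sum_shift_0[where e = of_nat, OF _ ch n] p True by (intro sum.cong refl) auto
      also have "\<dots> = (\<Sum>l<p. of_nat l ^ i)" by simp
      also have "\<dots> = (\<Sum>l<p. if l = 0 then 0 else 1)"
      proof (rule sum.cong)
        fix l assume l: "l \<in> {..<p}"
        have psuc: "p = Suc i" using True p by simp
        have "of_nat l ^ i * of_nat l = (of_nat l :: 'f alg_closure) ^ p"
          unfolding psuc by simp
        then have "of_nat l ^ i * of_nat l = (of_nat l :: 'f alg_closure)"
          by (simp only: of_nat_power_CHAR[OF charp(4) ch])
        moreover have "l \<noteq> 0 \<Longrightarrow> of_nat l \<noteq> (0 :: 'f alg_closure)"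
          using l unfolding of_nat_eq_0_iff_char_dvd ch by (auto dest: dvd_imp_le)
        ultimately show "of_nat l ^ i = (if l = 0 then 0 else 1 :: 'f alg_closure)"
          using True p by (auto simp: power_0_left)
      qed simp
      also have "\<dots> = of_nat (card ({..<p} - {0}))"
        by (subst sum.If_cases) (auto simp: Int_def set_diff_eq)
      also have "card ({..<p} - {0}) = p - 1" using p by (simp add: card_Diff_singleton)
      also have "of_nat (p - 1) = (- 1 :: 'f alg_closure)"
        using of_nat_CHAR[where 'a = "'f alg_closure"] p unfolding ch by (simp add: of_nat_diff)
      finally show ?thesis using True charp by simp
    qed
  qed
qed

text \<open>A Kronecker product with rows and columns indexed by functions on \<open>I\<close>, so
  that sums over indices factor by \<open>sum_PiE_prod\<close>.\<close>

definition tensor_mat :: "nat \<Rightarrow> 'i set \<Rightarrow> ('i \<Rightarrow> nat \<Rightarrow> 'f::field alg_closure) \<Rightarrow> ('i \<Rightarrow> 'f alg_closure) \<Rightarrow>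
    ('i \<Rightarrow> nat \<times> nat) \<Rightarrow> ('i \<Rightarrow> nat) \<Rightarrow> ('i \<Rightarrow> nat) \<Rightarrow> 'f alg_closure" where
  "tensor_mat p I ev s w g h = (\<Prod>k\<in>I. split_symbol.smat p (ev k) (s k) (w k) (g k) (h k))"

definition tensor_dmat :: "nat \<Rightarrow> 'i set \<Rightarrow> ('i \<Rightarrow> nat \<Rightarrow> 'f::field alg_closure) \<Rightarrow> ('i \<Rightarrow> 'f alg_closure) \<Rightarrow>
    ('i \<Rightarrow> nat \<times> nat) \<Rightarrow> ('i \<Rightarrow> nat) \<Rightarrow> ('i \<Rightarrow> nat) \<Rightarrow> 'f alg_closure" where
  "tensor_dmat p I ev s w g h = (\<Prod>k\<in>I. split_symbol.dmat p (ev k) (s k) (w k) (g k) (h k))"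

lemma prod_delta:
  assumes "finite I" "x \<in> PiE I A" "y \<in> PiE I A"
  shows "(\<Prod>k\<in>I. if x k = y k then 1 else 0) = (if x = y then 1 else 0 :: 'e::field)"
proof (cases "x = y")
  case False
  then have "\<exists>k\<in>I. x k \<noteq> y k" using assms by (meson PiE_ext)
  then show ?thesis using False assms(1) by (auto simp: prod_zero)
qed simp

lemma sum_PiE_prod:
  fixes f :: "'i \<Rightarrow> 'b \<Rightarrow> 'e::comm_semiring_1"
  shows "finite I \<Longrightarrow> finite B \<Longrightarrow> (\<Sum>g\<in>PiE I (\<lambda>_. B). \<Prod>k\<in>I. f k (g k)) = (\<Prod>k\<in>I. \<Sum>x\<in>B. f k x)"
  by (simp add: prod_sum_PiE)

theorem tensor_matrix_basis:
  fixes I :: "'i set" and \<alpha> \<beta> :: "'i \<Rightarrow> 'f::field"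
  assumes I: "finite I" and sp: "\<And>k. k \<in> I \<Longrightarrow> split_symbol p \<rho> \<delta> (\<alpha> k) (\<beta> k) (ev k) (s k)"
  shows "matrix_basis (exp_set p I) (\<Pi>\<^sub>E k\<in>I. {..<p}) (tensor_mat p I ev s) (tensor_dmat p I ev s)
    (\<lambda>w w' w''. to_ac (symbol_gamma p \<rho> \<delta> I \<alpha> \<beta> w w' w''))"
proof
  let ?M = "\<lambda>k. split_symbol.smat p (ev k) (s k)" and ?D = "\<lambda>k. split_symbol.dmat p (ev k) (s k)"
  let ?G = "\<Pi>\<^sub>E k\<in>I. {..<p}"
  show "finite (exp_set p I)" "finite ?G" using I by (simp_all add: exp_set_def finite_PiE)
  have mem: "w k \<in> {..<p} \<times> {..<p}" if "w \<in> exp_set p I" "k \<in> I" for w k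
    using that unfolding exp_set_def by (rule PiE_mem)
  have memG: "g k < p" if "g \<in> ?G" "k \<in> I" for g k using that by auto
  show "(\<Sum>g\<in>?G. \<Sum>h\<in>?G. tensor_dmat p I ev s w g h * tensor_mat p I ev s w' g h) = (if w = w' then 1 else 0)"
    if w: "w \<in> exp_set p I" "w' \<in> exp_set p I" for w w'
  proof -
    have "(\<Sum>g\<in>?G. \<Sum>h\<in>?G. tensor_dmat p I ev s w g h * tensor_mat p I ev s w' g h) =
      (\<Sum>g\<in>?G. \<Prod>k\<in>I. \<Sum>h<p. ?D k (w k) (g k) h * ?M k (w' k) (g k) h)"
      unfolding tensor_dmat_def tensor_mat_def prod.distrib[symmetric]
      by (intro sum.cong refl sum_PiE_prod[OF I finite_lessThan, of "\<lambda>k x. ?D k (w k) (_ k) x * ?M k (w' k) (_ k) x"])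
    also have "\<dots> = (\<Prod>k\<in>I. \<Sum>g<p. \<Sum>h<p. ?D k (w k) g h * ?M k (w' k) g h)"
      by (rule sum_PiE_prod[OF I finite_lessThan])
    also have "\<dots> = (\<Prod>k\<in>I. if w k = w' k then 1 else 0)"
      using w mem by (intro prod.cong refl split_symbol.smat_dual1[OF sp]) auto
    finally show ?thesis using prod_delta[OF I] w unfolding exp_set_def by metis
  qed
  show "(\<Sum>w\<in>exp_set p I. tensor_dmat p I ev s w g h * tensor_mat p I ev s w g' h') =
      (if g = g' \<and> h = h' then 1 else 0)"
    if g: "g \<in> ?G" "h \<in> ?G" "g' \<in> ?G" "h' \<in> ?G" for g h g' h'
  proof -
    have "(\<Sum>w\<in>exp_set p I. tensor_dmat p I ev s w g h * tensor_mat p I ev s w g' h') =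
      (\<Prod>k\<in>I. \<Sum>u\<in>{..<p} \<times> {..<p}. ?D k u (g k) (h k) * ?M k u (g' k) (h' k))"
      unfolding exp_set_def tensor_dmat_def tensor_mat_def prod.distrib[symmetric]
      by (rule sum_PiE_prod[OF I, of _ "\<lambda>k u. ?D k u (g k) (h k) * ?M k u (g' k) (h' k)"]) simp
    also have "\<dots> = (\<Prod>k\<in>I. if g k = g' k \<and> h k = h' k then 1 else 0)"
      using g memG by (intro prod.cong refl split_symbol.smat_dual2[OF sp]) auto
    also have "\<dots> = (\<Prod>k\<in>I. (if g k = g' k then 1 else 0) * (if h k = h' k then 1 else 0))"
      by (intro prod.cong) auto
    also have "\<dots> = (if g = g' then 1 else 0) * (if h = h' then 1 else 0)"
      by (simp only: prod.distrib prod_delta[OF I g(1,3)] prod_delta[OF I g(2,4)])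
    finally show ?thesis by auto
  qed
  show "(\<Sum>l\<in>?G. tensor_mat p I ev s w g l * tensor_mat p I ev s w' l h) =
      (\<Sum>w''\<in>exp_set p I. to_ac (symbol_gamma p \<rho> \<delta> I \<alpha> \<beta> w w' w'') * tensor_mat p I ev s w'' g h)"
    if g: "g \<in> ?G" "h \<in> ?G" for w w' g h
  proof -
    have "(\<Sum>l\<in>?G. tensor_mat p I ev s w g l * tensor_mat p I ev s w' l h) =
      (\<Prod>k\<in>I. \<Sum>l<p. ?M k (w k) (g k) l * ?M k (w' k) l (h k))"
      unfolding tensor_mat_def prod.distrib[symmetric]
      by (rule sum_PiE_prod[OF I, of _ "\<lambda>k l. ?M k (w k) (g k) l * ?M k (w' k) l (h k)"]) simp
    also have "\<dots> = (\<Prod>k\<in>I. \<Sum>u''\<in>{..<p} \<times> {..<p}.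
        to_ac (symbol_gamma1 p \<rho> \<delta> (\<alpha> k) (\<beta> k) (w k) (w' k) u'') * ?M k u'' (g k) (h k))"
      using memG g by (intro prod.cong refl split_symbol.smat_mult[OF sp]) auto
    also have "\<dots> = (\<Sum>w''\<in>exp_set p I. to_ac (symbol_gamma p \<rho> \<delta> I \<alpha> \<beta> w w' w'') * tensor_mat p I ev s w'' g h)"
      unfolding exp_set_def tensor_mat_def symbol_gamma_def to_ac_prod prod.distrib[symmetric]
      by (rule sum_PiE_prod[OF I, symmetric,
          of _ "\<lambda>k u''. to_ac (symbol_gamma1 p \<rho> \<delta> (\<alpha> k) (\<beta> k) (w k) (w' k) u'') * ?M k u'' (g k) (h k)"]) simp
    finally show ?thesis .
  qed
qed

definition trace_exp :: "nat \<Rightarrow> 'f::field \<Rightarrow> 'i set \<Rightarrow> ('i \<Rightarrow> nat \<times> nat)" where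
  "trace_exp p \<delta> I = (\<lambda>k\<in>I. (if \<delta> = 0 then 0 else p - 1, 0))"

lemma tensor_mat_trace:
  fixes I :: "'i set" and \<alpha> \<beta> :: "'i \<Rightarrow> 'f::field"
  assumes I: "finite I" and sp: "\<And>k. k \<in> I \<Longrightarrow> split_symbol p \<rho> \<delta> (\<alpha> k) (\<beta> k) (ev k) (s k)"
    and par: "symbol_parameters p \<rho> \<delta>" and w: "w \<in> exp_set p I"
  shows "(\<Sum>g\<in>(\<Pi>\<^sub>E k\<in>I. {..<p}). tensor_mat p I ev s w g g) =
    (if w = trace_exp p \<delta> I then to_ac ((if \<delta> = 0 then of_nat p else - 1) ^ card I) else 0)"
proof -
  let ?e = "(if \<delta> = 0 then 0 else p - 1, 0 :: nat)"
  let ?t = "if \<delta> = 0 then of_nat p else - 1 :: 'f"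
  have p: "p > 0" using par prime_gt_0_nat by (auto simp: symbol_parameters_def)
  have mem: "w k \<in> {..<p} \<times> {..<p}" if "k \<in> I" for k
    using that w unfolding exp_set_def by (auto dest: PiE_mem)
  have "(\<Sum>g\<in>(\<Pi>\<^sub>E k\<in>I. {..<p}). tensor_mat p I ev s w g g) =
      (\<Prod>k\<in>I. \<Sum>g<p. split_symbol.smat p (ev k) (s k) (w k) g g)"
    unfolding tensor_mat_def
    by (rule sum_PiE_prod[OF I, of _ "\<lambda>k g. split_symbol.smat p (ev k) (s k) (w k) g g"]) simp
  also have "\<dots> = (\<Prod>k\<in>I. to_ac ?t * (if w k = trace_exp p \<delta> I k then 1 else 0))"
  proof (intro prod.cong refl)
    fix k assume k: "k \<in> I"
    have "(\<Sum>g<p. split_symbol.smat p (ev k) (s k) (w k) g g) = (if snd (w k) = 0 then \<Sum>g<p. ev k g ^ fst (w k) else 0)"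
      by (rule split_symbol.smat_trace[OF sp[OF k] mem[OF k]])
    also have "\<dots> = to_ac ?t * (if w k = trace_exp p \<delta> I k then 1 else 0)"
      using split_symbol.power_sum[OF sp[OF k] par, of "fst (w k)"] mem[OF k] k
      by (auto simp: trace_exp_def prod_eq_iff)
    finally show "(\<Sum>g<p. split_symbol.smat p (ev k) (s k) (w k) g g) = to_ac ?t * (if w k = trace_exp p \<delta> I k then 1 else 0)" .
  qed
  also have "\<dots> = to_ac (?t ^ card I) * (\<Prod>k\<in>I. if w k = trace_exp p \<delta> I k then 1 else 0)"
    by (simp add: prod.distrib)
  also have "(\<Prod>k\<in>I. if w k = trace_exp p \<delta> I k then 1 else 0) = (if w = trace_exp p \<delta> I then 1 else 0 :: 'f alg_closure)"
  proof (rule prod_delta[OF I])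
    show "w \<in> PiE I (\<lambda>_. {..<p} \<times> {..<p})" using w by (simp add: exp_set_def)
    show "trace_exp p \<delta> I \<in> PiE I (\<lambda>_. {..<p} \<times> {..<p})" using p by (auto simp: trace_exp_def)
  qed
  finally show ?thesis by auto
qed

section \<open>Algebras, quotients and matrix representations\<close>

locale assoc_algebra = ring A for A :: "('f::field, 'a) module" (structure) +
  assumes smult_closed: "a \<in> carrier A \<Longrightarrow> c \<odot> a \<in> carrier A"
    and smult_l_distr: "a \<in> carrier A \<Longrightarrow> (c + d) \<odot> a = c \<odot> a \<oplus> d \<odot> a"
    and smult_r_distr: "a \<in> carrier A \<Longrightarrow> b \<in> carrier A \<Longrightarrow> c \<odot> (a \<oplus> b) = c \<odot> a \<oplus> c \<odot> b"
    and smult_assoc: "a \<in> carrier A \<Longrightarrow> (c * d) \<odot> a = c \<odot> (d \<odot> a)"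
    and smult_one: "a \<in> carrier A \<Longrightarrow> 1 \<odot> a = a"
    and smult_mult_l: "a \<in> carrier A \<Longrightarrow> b \<in> carrier A \<Longrightarrow> (c \<odot> a) \<otimes> b = c \<odot> (a \<otimes> b)"
    and smult_mult_r: "a \<in> carrier A \<Longrightarrow> b \<in> carrier A \<Longrightarrow> a \<otimes> (c \<odot> b) = c \<odot> (a \<otimes> b)"
begin

lemma vectorspace: "vectorspace class_ring A"
proof -
  have "module class_ring A"
    by (rule moduleI)
      (use class_field abelian_group_axioms smult_closed smult_l_distr smult_r_distr smult_assoc smult_one in
        \<open>auto simp: field_def domain_def\<close>)
  then show ?thesis using class_field by (simp add: vectorspace_def)
qed

lemma smult_zero: "a \<in> carrier A \<Longrightarrow> 0 \<odot> a = \<zero>"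
  using smult_l_distr[of a 0 0] smult_closed[of a 0] by (simp add: local.add.l_cancel_one)

text \<open>The scalar \<open>c\<close> acts as multiplication by
  \<open>c \<odot> \<one>\<close>.\<close>

lemma ideal_smult: "ideal I A \<Longrightarrow> i \<in> I \<Longrightarrow> c \<odot> i \<in> I"
  using ideal.I_l_closed[of I A i "c \<odot> \<one>"] smult_closed[of \<one> c] smult_mult_l[of \<one> i c]
    additive_subgroup.a_Hcarr[OF ideal.axioms(1), of I A i] by simp

end

text \<open>The linear span in a form suited to inductions along homomorphisms and multiplications;
  \<open>lspan_subset_span\<close> connects it with \<open>module.span\<close>.\<close>

inductive_set lspan :: "('f::field, 'a) module \<Rightarrow> 'a set \<Rightarrow> 'a set" for A B where
  zero: "\<zero>\<^bsub>A\<^esub> \<in> lspan A B"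
| base: "b \<in> B \<Longrightarrow> b \<in> lspan A B"
| add: "a \<in> lspan A B \<Longrightarrow> a' \<in> lspan A B \<Longrightarrow> a \<oplus>\<^bsub>A\<^esub> a' \<in> lspan A B"
| smult: "a \<in> lspan A B \<Longrightarrow> c \<odot>\<^bsub>A\<^esub> a \<in> lspan A B"

context assoc_algebra
begin

lemma lspan_carrier:
  assumes "B \<subseteq> carrier A" "a \<in> lspan A B"
  shows "a \<in> carrier A"
  using assms(2) by (induction rule: lspan.induct) (use assms(1) in \<open>auto simp: smult_closed\<close>)

lemma lspan_trans: "a \<in> lspan A B \<Longrightarrow> (\<And>b. b \<in> B \<Longrightarrow> b \<in> lspan A C) \<Longrightarrow> a \<in> lspan A C"
  by (induction rule: lspan.induct) (auto intro: lspan.intros)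

lemma lspan_mult_left:
  assumes "a \<in> lspan A B" "B \<subseteq> carrier A" "z \<in> carrier A" "\<And>b. b \<in> B \<Longrightarrow> z \<otimes> b \<in> lspan A C"
  shows "z \<otimes> a \<in> lspan A C"
  using assms(1)
proof induction
  case zero
  then show ?case using assms(3) by (simp add: lspan.zero)
next
  case (add a a')
  then show ?case using lspan_carrier[OF assms(2)] assms(3) by (simp add: r_distr lspan.add)
next
  case (smult a c)
  then show ?case using lspan_carrier[OF assms(2)] assms(3) by (simp add: smult_mult_r lspan.smult)
qed (use assms in auto)

end

text \<open>\<open>quotient_algebra\<close> repeats the operations of \<open>A Quot I\<close> in a
  record of a different type, to which the ring axioms have to be transported.\<close>

lemma ring_record_cong:
  assumes "ring R" "carrier S = carrier R" "monoid.mult S = monoid.mult R" "one S = one R" "zero S = zero R" "add S = add R"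
  shows "ring S"
proof -
  interpret ring R by fact
  show ?thesis
  proof (rule ringI)
    show "abelian_group S"
    proof (rule abelian_groupI, unfold assms)
      show "\<exists>y\<in>carrier R. y \<oplus>\<^bsub>R\<^esub> x = \<zero>\<^bsub>R\<^esub>" if "x \<in> carrier R" for x
        using that l_neg by blast
    qed (auto simp: a_ac)
    show "Group.monoid S"
      by (rule monoidI, unfold assms) (auto simp: m_assoc)
  qed (unfold assms, auto simp: l_distr r_distr)
qed

locale algebra_ideal = assoc_algebra A + ideal I A
  for A :: "('f::field, 'a) module" (structure) and I
begin

definition proj :: "'a \<Rightarrow> 'a set" where "proj a = I +> a"

abbreviation "Q \<equiv> quotient_algebra A I"

lemma carrier_Q: "carrier Q = proj ` carrier A"
  by (auto simp: quotient_algebra_def FactRing_def A_RCOSETS_def' proj_def)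

lemma proj_closed: "a \<in> carrier A \<Longrightarrow> proj a \<in> carrier Q"
  by (simp add: carrier_Q)

lemma proj_hom: "proj \<in> Ring.ring_hom A (A Quot I)"
  using rcos_ring_hom by (simp add: proj_def[abs_def])

lemma proj_mult: "a \<in> carrier A \<Longrightarrow> b \<in> carrier A \<Longrightarrow> proj (a \<otimes> b) = proj a \<otimes>\<^bsub>Q\<^esub> proj b"
  using ring_hom_mult[OF proj_hom] by (simp add: quotient_algebra_def)

lemma proj_add: "a \<in> carrier A \<Longrightarrow> b \<in> carrier A \<Longrightarrow> proj (a \<oplus> b) = proj a \<oplus>\<^bsub>Q\<^esub> proj b"
  using ring_hom_add[OF proj_hom] by (simp add: quotient_algebra_def)

lemma proj_one: "proj \<one> = \<one>\<^bsub>Q\<^esub>"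
  using ring_hom_one[OF proj_hom] by (simp add: quotient_algebra_def)

lemma proj_eq_iff: "a \<in> carrier A \<Longrightarrow> b \<in> carrier A \<Longrightarrow> proj a = proj b \<longleftrightarrow> a \<ominus> b \<in> I"
  unfolding proj_def using quotient_eq_iff_same_a_r_cos[OF is_ideal] by blast

lemma proj_zero: "proj \<zero> = \<zero>\<^bsub>Q\<^esub>"
  using a_rcos_zero[OF is_ideal additive_subgroup.zero_closed[OF is_additive_subgroup]] by (simp add: proj_def quotient_algebra_def FactRing_def)

text \<open>The union in \<open>quotient_algebra\<close> runs over all representatives; its members
  are one and the same coset because \<open>I\<close> is closed under scalars.\<close>

lemma proj_smult:
  assumes "a \<in> carrier A"
  shows "proj (c \<odot> a) = c \<odot>\<^bsub>Q\<^esub> proj a"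
proof -
  have *: "I +> (c \<odot> x) = I +> (c \<odot> a)" if x: "x \<in> I +> a" for x
  proof -
    obtain i where i: "i \<in> I" "x = i \<oplus> a" using x by (auto simp: a_r_coset_def')
    have ic: "i \<in> carrier A" using i(1) a_Hcarr by blast
    have ci: "c \<odot> i \<in> I" using ideal_smult[OF is_ideal i(1)] .
    have "c \<odot> x \<ominus> c \<odot> a = c \<odot> i"
      using ic assms by (simp add: i(2) smult_r_distr smult_closed a_minus_def a_assoc r_neg)
    then have "proj (c \<odot> x) = proj (c \<odot> a)"
      using ci ic assms by (subst proj_eq_iff) (auto simp: i(2) smult_closed)
    then show ?thesis by (simp add: proj_def)
  qed
  have "I +> a \<noteq> {}" using assms a_rcos_self by blast
  have "(\<Union>x\<in>I +> a. I +> (c \<odot> x)) = (\<Union>x\<in>I +> a. I +> (c \<odot> a))"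
    by (intro SUP_cong refl *)
  also have "\<dots> = I +> (c \<odot> a)" using \<open>I +> a \<noteq> {}\<close> by (simp only: UN_constant if_False)
  finally show ?thesis by (simp add: quotient_algebra_def proj_def)
qed

sublocale quot: assoc_algebra Q
proof -
  have "ring Q"
    by (rule ring_record_cong[OF quotient_is_ring]) (simp_all add: quotient_algebra_def)
  then interpret Q: ring Q .
  show "assoc_algebra Q"
  proof
    fix x y c d assume "x \<in> carrier Q"
    then obtain a where a: "a \<in> carrier A" and x: "x = proj a" by (auto simp: carrier_Q)
    show "c \<odot>\<^bsub>Q\<^esub> x \<in> carrier Q" "(c + d) \<odot>\<^bsub>Q\<^esub> x = c \<odot>\<^bsub>Q\<^esub> x \<oplus>\<^bsub>Q\<^esub> d \<odot>\<^bsub>Q\<^esub> x"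
      "(c * d) \<odot>\<^bsub>Q\<^esub> x = c \<odot>\<^bsub>Q\<^esub> (d \<odot>\<^bsub>Q\<^esub> x)" "1 \<odot>\<^bsub>Q\<^esub> x = x"
      using a by (simp_all add: x proj_smult[symmetric] proj_add[symmetric] smult_closed proj_closed smult_l_distr smult_assoc smult_one)
    assume "y \<in> carrier Q"
    then obtain b where b: "b \<in> carrier A" and y: "y = proj b" by (auto simp: carrier_Q)
    show "c \<odot>\<^bsub>Q\<^esub> (x \<oplus>\<^bsub>Q\<^esub> y) = c \<odot>\<^bsub>Q\<^esub> x \<oplus>\<^bsub>Q\<^esub> c \<odot>\<^bsub>Q\<^esub> y"
      "(c \<odot>\<^bsub>Q\<^esub> x) \<otimes>\<^bsub>Q\<^esub> y = c \<odot>\<^bsub>Q\<^esub> (x \<otimes>\<^bsub>Q\<^esub> y)" "x \<otimes>\<^bsub>Q\<^esub> (c \<odot>\<^bsub>Q\<^esub> y) = c \<odot>\<^bsub>Q\<^esub> (x \<otimes>\<^bsub>Q\<^esub> y)"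
      using a b by (simp_all add: x y proj_smult[symmetric] proj_add[symmetric] proj_mult[symmetric] smult_closed
          smult_r_distr smult_mult_l smult_mult_r)
  qed
qed

lemma proj_lspan:
  assumes "B \<subseteq> carrier A" "a \<in> lspan A B"
  shows "proj a \<in> lspan Q (proj ` B)"
  using assms(2)
proof induction
  case (add a a')
  then show ?case using lspan_carrier[OF assms(1)] by (simp add: proj_add lspan.add)
next
  case (smult a c)
  then show ?case using lspan_carrier[OF assms(1)] by (simp add: proj_smult lspan.smult)
qed (auto simp: proj_zero intro: lspan.zero lspan.base)

lemma proj_pow: "a \<in> carrier A \<Longrightarrow> proj (a [^] (n :: nat)) = proj a [^]\<^bsub>Q\<^esub> n"
  by (induction n) (simp_all add: proj_one proj_mult)

end

locale matrix_rep = assoc_algebra A for A :: "('f::field, 'a) module" (structure) +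
  fixes G :: "'g set" and \<psi> :: "'a \<Rightarrow> 'g \<Rightarrow> 'g \<Rightarrow> 'f alg_closure"
  assumes rep_add: "a \<in> carrier A \<Longrightarrow> b \<in> carrier A \<Longrightarrow> g \<in> G \<Longrightarrow> h \<in> G \<Longrightarrow> \<psi> (a \<oplus> b) g h = \<psi> a g h + \<psi> b g h"
    and rep_mult: "a \<in> carrier A \<Longrightarrow> b \<in> carrier A \<Longrightarrow> g \<in> G \<Longrightarrow> h \<in> G \<Longrightarrow>
      \<psi> (a \<otimes> b) g h = (\<Sum>l\<in>G. \<psi> a g l * \<psi> b l h)"
    and rep_one: "g \<in> G \<Longrightarrow> h \<in> G \<Longrightarrow> \<psi> \<one> g h = (if g = h then 1 else 0)"
    and rep_smult: "a \<in> carrier A \<Longrightarrow> g \<in> G \<Longrightarrow> h \<in> G \<Longrightarrow> \<psi> (c \<odot> a) g h = to_ac c * \<psi> a g h"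
begin

lemma rep_zero: "g \<in> G \<Longrightarrow> h \<in> G \<Longrightarrow> \<psi> \<zero> g h = 0"
  using rep_add[of \<zero> \<zero> g h] by (metis add_0_right add_left_cancel r_zero zero_closed)

lemma rep_minus: "a \<in> carrier A \<Longrightarrow> b \<in> carrier A \<Longrightarrow> g \<in> G \<Longrightarrow> h \<in> G \<Longrightarrow> \<psi> (a \<ominus> b) g h = \<psi> a g h - \<psi> b g h"
proof -
  assume *: "a \<in> carrier A" "b \<in> carrier A" "g \<in> G" "h \<in> G"
  have "(a \<ominus> b) \<oplus> b = a" using * by (simp add: a_minus_def a_assoc l_neg)
  then show ?thesis using rep_add[of "a \<ominus> b" b g h] * by simp
qed

definition rep_kernel :: "'a set" where
  "rep_kernel = {a \<in> carrier A. \<forall>g\<in>G. \<forall>h\<in>G. \<psi> a g h = 0}"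

lemma rep_kernel_ideal: "ideal rep_kernel A"
proof (rule idealI)
  show "subgroup rep_kernel (add_monoid A)"
  proof (rule subgroup.intro)
    show "inv\<^bsub>add_monoid A\<^esub> x \<in> rep_kernel" if "x \<in> rep_kernel" for x
      using that rep_minus[of \<zero> x] rep_zero unfolding rep_kernel_def
      by (auto simp: a_inv_def[symmetric] a_minus_def)
  qed (auto simp: rep_kernel_def rep_add rep_zero)
qed (auto simp: rep_kernel_def rep_mult ring_axioms)

text \<open>A representation that kills the relations passes to the presented algebra, evaluated at
  a chosen representative of each coset. This bounds presented algebras from below: monomials with
  independent matrices stay independent in the quotient.\<close>

lemma rep_quotient:
  assumes "S \<subseteq> rep_kernel"
  defines "\<psi>' \<equiv> \<lambda>x. \<psi> (SOME a. a \<in> carrier A \<and> Idl S +> a = x)"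
  shows "algebra_ideal A (Idl S)"
    and "matrix_rep (quotient_algebra A (Idl S)) G \<psi>'"
    and "\<And>a g h. a \<in> carrier A \<Longrightarrow> g \<in> G \<Longrightarrow> h \<in> G \<Longrightarrow> \<psi>' (Idl S +> a) g h = \<psi> a g h"
    and "\<And>a. a \<in> S \<Longrightarrow> a \<in> Idl S"
proof -
  have S: "S \<subseteq> carrier A" using assms by (auto simp: rep_kernel_def)
  have idl: "ideal (Idl S) A" by (rule genideal_ideal[OF S])
  show AI: "algebra_ideal A (Idl S)" using idl assoc_algebra_axioms by (simp add: algebra_ideal_def)
  interpret AI: algebra_ideal A "Idl S" by (rule AI)
  show "a \<in> Idl S" if "a \<in> S" for a using genideal_self[OF S] that by blast
  have ker: "Idl S \<subseteq> rep_kernel" using genideal_minimal[OF rep_kernel_ideal assms(1)] .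
  have eq: "\<psi>' (AI.proj a) g h = \<psi> a g h" if a: "a \<in> carrier A" and gh: "g \<in> G" "h \<in> G" for a g h
  proof -
    define b where "b = (SOME b. b \<in> carrier A \<and> AI.proj b = AI.proj a)"
    have b: "b \<in> carrier A" "AI.proj b = AI.proj a"
      using someI[of "\<lambda>b. b \<in> carrier A \<and> AI.proj b = AI.proj a" a] a by (auto simp: b_def)
    then have "b \<ominus> a \<in> rep_kernel" using ker AI.proj_eq_iff a by blast
    then have "\<psi> b g h = \<psi> a g h" using rep_minus[OF b(1) a gh] gh by (auto simp: rep_kernel_def)
    moreover have "\<psi>' (AI.proj a) = \<psi> b" by (simp add: \<psi>'_def b_def AI.proj_def)
    ultimately show ?thesis by simp
  qed
  then show "\<psi>' (Idl S +> a) g h = \<psi> a g h" if "a \<in> carrier A" "g \<in> G" "h \<in> G" for a g h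
    using that by (simp add: AI.proj_def)
  show "matrix_rep (quotient_algebra A (Idl S)) G \<psi>'"
  proof
    fix g h assume gh: "g \<in> G" "h \<in> G"
    show "\<psi>' \<one>\<^bsub>AI.Q\<^esub> g h = (if g = h then 1 else 0)"
      using eq[OF one_closed gh] rep_one[OF gh] by (simp add: AI.proj_one)
    fix x assume "x \<in> carrier AI.Q"
    then obtain a where a: "a \<in> carrier A" and x: "x = AI.proj a" by (auto simp: AI.carrier_Q)
    show "\<psi>' (c \<odot>\<^bsub>AI.Q\<^esub> x) g h = to_ac c * \<psi>' x g h" for c
      using a gh by (simp add: x AI.proj_smult[symmetric] eq smult_closed rep_smult)
    fix y assume "y \<in> carrier AI.Q"
    then obtain b where b: "b \<in> carrier A" and y: "y = AI.proj b" by (auto simp: AI.carrier_Q)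
    show "\<psi>' (x \<oplus>\<^bsub>AI.Q\<^esub> y) g h = \<psi>' x g h + \<psi>' y g h"
      using a b gh by (simp add: x y AI.proj_add[symmetric] eq rep_add)
    show "\<psi>' (x \<otimes>\<^bsub>AI.Q\<^esub> y) g h = (\<Sum>l\<in>G. \<psi>' x g l * \<psi>' y l h)"
      using a b gh by (simp add: x y AI.proj_mult[symmetric] eq rep_mult cong: sum.cong)
  qed
qed

end

section \<open>Monoid algebras and linear extension\<close>

definition lin_ext :: "('f::field \<Rightarrow> 'e::field) \<Rightarrow> ('m \<Rightarrow> 'f) \<Rightarrow> ('m \<Rightarrow> 'e) \<Rightarrow> 'e" where
  "lin_ext \<iota> f H = (\<Sum>u\<in>{u. f u \<noteq> 0}. \<iota> (f u) * H u)"

locale field_embedding =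
  fixes \<iota> :: "'f::field \<Rightarrow> 'e::field"
  assumes emb_0: "\<iota> 0 = 0" and emb_1: "\<iota> 1 = 1"
    and emb_add: "\<iota> (x + y) = \<iota> x + \<iota> y" and emb_mult: "\<iota> (x * y) = \<iota> x * \<iota> y"
begin

lemma emb_sum: "\<iota> (sum f S) = (\<Sum>s\<in>S. \<iota> (f s))"
  by (induction S rule: infinite_finite_induct) (auto simp: emb_0 emb_add)

lemma lin_ext_superset:
  "finite S \<Longrightarrow> {u. f u \<noteq> 0} \<subseteq> S \<Longrightarrow> lin_ext \<iota> f H = (\<Sum>u\<in>S. \<iota> (f u) * H u)"
  unfolding lin_ext_def by (rule sum.mono_neutral_left) (auto simp: emb_0)

lemma lin_ext_add:
  assumes "finite {u. f u \<noteq> 0}" "finite {u. g u \<noteq> 0}"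
  shows "lin_ext \<iota> (\<lambda>u. f u + g u) H = lin_ext \<iota> f H + lin_ext \<iota> g H"
proof -
  let ?S = "{u. f u \<noteq> 0} \<union> {u. g u \<noteq> 0}"
  have "finite ?S" using assms by simp
  then show ?thesis
    by (subst (1 2 3) lin_ext_superset[of ?S]) (auto simp: emb_add algebra_simps sum.distrib)
qed

lemma lin_ext_smult:
  assumes "finite {u. f u \<noteq> 0}"
  shows "lin_ext \<iota> (\<lambda>u. c * f u) H = \<iota> c * lin_ext \<iota> f H"
  by (subst (1 2) lin_ext_superset[OF assms]) (auto simp: emb_mult sum_distrib_left mult.assoc)

lemma lin_ext_cong: "(\<And>u. f u \<noteq> 0 \<Longrightarrow> H u = H' u) \<Longrightarrow> lin_ext \<iota> f H = lin_ext \<iota> f H'"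
  unfolding lin_ext_def by (intro sum.cong) auto

lemma lin_ext_monomial: "lin_ext \<iota> (monomial u) H = H u"
  by (subst lin_ext_superset[of "{u}"]) (auto simp: monomial_def emb_1)

text \<open>Pairs of support elements are grouped by their product. Since the functionals
  \<open>lin_ext\<close> separate the elements of a monoid algebra (\<open>lin_ext_unit\<close>),
  its ring laws reduce to the laws of \<open>M\<close>.\<close>

lemma lin_ext_mult:
  assumes f: "f \<in> carrier (monoid_algebra M)" and g: "g \<in> carrier (monoid_algebra M)"
  shows "lin_ext \<iota> (f \<otimes>\<^bsub>monoid_algebra M\<^esub> g) H = lin_ext \<iota> f (\<lambda>u. lin_ext \<iota> g (\<lambda>w. H (u \<otimes>\<^bsub>M\<^esub> w)))"
    and "finite {w. (f \<otimes>\<^bsub>monoid_algebra M\<^esub> g) w \<noteq> 0}"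
    and "(f \<otimes>\<^bsub>monoid_algebra M\<^esub> g) w \<noteq> 0 \<Longrightarrow> \<exists>u v. f u \<noteq> 0 \<and> g v \<noteq> 0 \<and> w = u \<otimes>\<^bsub>M\<^esub> v"
proof -
  let ?F = "{u. f u \<noteq> 0}" and ?G = "{u. g u \<noteq> 0}"
  let ?m = "\<lambda>(u, v). u \<otimes>\<^bsub>M\<^esub> v"
  have fin: "finite ?F" "finite ?G" using f g by (auto simp: monoid_algebra_def)
  have eq: "(f \<otimes>\<^bsub>monoid_algebra M\<^esub> g) w = (\<Sum>(u, v)\<in>{x \<in> ?F \<times> ?G. ?m x = w}. f u * g v)" for w
    by (auto simp: monoid_algebra_def intro!: sum.cong)
  show *: "\<exists>u v. f u \<noteq> 0 \<and> g v \<noteq> 0 \<and> w = u \<otimes>\<^bsub>M\<^esub> v" if "(f \<otimes>\<^bsub>monoid_algebra M\<^esub> g) w \<noteq> 0" for w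
  proof -
    have "{x \<in> ?F \<times> ?G. ?m x = w} \<noteq> {}" using that unfolding eq by (metis (no_types, lifting) sum.empty)
    then show ?thesis by auto
  qed
  have sub: "{w. (f \<otimes>\<^bsub>monoid_algebra M\<^esub> g) w \<noteq> 0} \<subseteq> ?m ` (?F \<times> ?G)"
    using * by fastforce
  then show "finite {w. (f \<otimes>\<^bsub>monoid_algebra M\<^esub> g) w \<noteq> 0}" by (rule finite_subset) (use fin in auto)
  have "lin_ext \<iota> (f \<otimes>\<^bsub>monoid_algebra M\<^esub> g) H =
    (\<Sum>w\<in>?m ` (?F \<times> ?G). \<iota> ((f \<otimes>\<^bsub>monoid_algebra M\<^esub> g) w) * H w)"
    by (rule lin_ext_superset[OF _ sub]) (use fin in auto)
  also have "\<dots> = (\<Sum>w\<in>?m ` (?F \<times> ?G). \<Sum>x\<in>{x \<in> ?F \<times> ?G. ?m x = w}. \<iota> (f (fst x) * g (snd x)) * H (?m x))"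
    unfolding eq emb_sum sum_distrib_right by (intro sum.cong refl) (auto simp: case_prod_beta)
  also have "\<dots> = (\<Sum>x\<in>?F \<times> ?G. \<iota> (f (fst x) * g (snd x)) * H (?m x))"
    by (rule sum.group) (use fin in auto)
  also have "\<dots> = (\<Sum>u\<in>?F. \<Sum>v\<in>?G. \<iota> (f u * g v) * H (u \<otimes>\<^bsub>M\<^esub> v))"
    by (simp add: sum.cartesian_product case_prod_beta)
  also have "\<dots> = lin_ext \<iota> f (\<lambda>u. lin_ext \<iota> g (\<lambda>w. H (u \<otimes>\<^bsub>M\<^esub> w)))"
    by (simp add: lin_ext_def sum_distrib_left emb_mult mult.assoc)
  finally show "lin_ext \<iota> (f \<otimes>\<^bsub>monoid_algebra M\<^esub> g) H = lin_ext \<iota> f (\<lambda>u. lin_ext \<iota> g (\<lambda>w. H (u \<otimes>\<^bsub>M\<^esub> w)))" .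
qed

end

lemma emb_id: "field_embedding (\<lambda>x. x)"
  by unfold_locales auto

lemma emb_to_ac: "field_embedding to_ac"
  by unfold_locales auto

lemma lin_ext_unit:
  assumes "finite {u. f u \<noteq> 0}"
  shows "lin_ext (\<lambda>x. x) f (\<lambda>u. if u = w then 1 else 0) = (f w :: 'f::field)"
proof -
  have "lin_ext (\<lambda>x. x) f (\<lambda>u. if u = w then 1 else 0) =
      (\<Sum>u\<in>insert w {u. f u \<noteq> 0}. f u * (if u = w then 1 else 0))"
    by (rule field_embedding.lin_ext_superset[OF emb_id]) (use assms in auto)
  also have "\<dots> = (\<Sum>u\<in>insert w {u. f u \<noteq> 0}. if u = w then f w else 0)"
    by (intro sum.cong) auto
  finally show ?thesis using assms by simp
qed

lemma monoid_algebra_simps: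
  "f \<in> carrier (monoid_algebra M) \<longleftrightarrow> finite {u. f u \<noteq> 0} \<and> {u. f u \<noteq> 0} \<subseteq> carrier M"
  "f \<oplus>\<^bsub>monoid_algebra M\<^esub> g = (\<lambda>u. f u + g u)"
  "c \<odot>\<^bsub>monoid_algebra M\<^esub> f = (\<lambda>u. c * f u)"
  "\<zero>\<^bsub>monoid_algebra M\<^esub> = (\<lambda>_. 0)"
  "\<one>\<^bsub>monoid_algebra M\<^esub> = monomial \<one>\<^bsub>M\<^esub>"
  by (auto simp: monoid_algebra_def monomial_def)

lemma monomial_closed: "u \<in> carrier M \<Longrightarrow> monomial u \<in> carrier (monoid_algebra M)"
  by (auto simp: monoid_algebra_simps monomial_def)

theorem monoid_algebra_assoc_algebra:
  fixes M :: "('m, 'b) monoid_scheme"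
  assumes "Group.monoid M"
  shows "assoc_algebra (monoid_algebra M :: ('f::field, 'm \<Rightarrow> 'f) module)"
proof -
  interpret M: Group.monoid M by fact
  interpret E: field_embedding "\<lambda>x :: 'f. x" by (rule emb_id)
  let ?R = "monoid_algebra M :: ('f, 'm \<Rightarrow> 'f) module"
  have add_cl: "f \<oplus>\<^bsub>?R\<^esub> g \<in> carrier ?R" if "f \<in> carrier ?R" "g \<in> carrier ?R" for f g
  proof -
    have "{u. f u + g u \<noteq> 0} \<subseteq> {u. f u \<noteq> 0} \<union> {u. g u \<noteq> 0}" by auto
    then show ?thesis using that by (auto simp: monoid_algebra_simps intro: finite_subset)
  qed
  have smult_cl: "c \<odot>\<^bsub>?R\<^esub> f \<in> carrier ?R" if "f \<in> carrier ?R" for c f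
  proof -
    have "{u. c * f u \<noteq> 0} \<subseteq> {u. f u \<noteq> 0}" by auto
    then show ?thesis using that by (auto simp: monoid_algebra_simps intro: finite_subset)
  qed
  have mult_cl: "f \<otimes>\<^bsub>?R\<^esub> g \<in> carrier ?R" if fg: "f \<in> carrier ?R" "g \<in> carrier ?R" for f g
    unfolding monoid_algebra_simps(1)
  proof
    show "finite {u. (f \<otimes>\<^bsub>?R\<^esub> g) u \<noteq> 0}" by (rule E.lin_ext_mult(2)[OF fg])
    show "{u. (f \<otimes>\<^bsub>?R\<^esub> g) u \<noteq> 0} \<subseteq> carrier M"
    proof
      fix w assume "w \<in> {u. (f \<otimes>\<^bsub>?R\<^esub> g) u \<noteq> 0}"
      then obtain u v where "f u \<noteq> 0" "g v \<noteq> 0" "w = u \<otimes>\<^bsub>M\<^esub> v"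
        using E.lin_ext_mult(3)[OF fg, of w] by auto
      then show "w \<in> carrier M" using fg by (auto simp: monoid_algebra_simps)
    qed
  qed
  have fin: "finite {u. f u \<noteq> 0}" if "f \<in> carrier ?R" for f using that by (simp add: monoid_algebra_simps)
  have inM: "u \<in> carrier M" if "f \<in> carrier ?R" "f u \<noteq> 0" for f u using that by (auto simp: monoid_algebra_simps)
  have ext: "f = g" if "f \<in> carrier ?R" "g \<in> carrier ?R" "\<And>H. lin_ext (\<lambda>x. x) f H = lin_ext (\<lambda>x. x) g H" for f g
    using lin_ext_unit[OF fin[OF that(1)]] lin_ext_unit[OF fin[OF that(2)]] that(3) by (intro HOL.ext) metis
  have one_cl: "\<one>\<^bsub>?R\<^esub> \<in> carrier ?R" by (simp add: monoid_algebra_simps(5) monomial_closed)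
  show ?thesis
  proof (intro assoc_algebra.intro ringI assoc_algebra_axioms.intro)
    show "abelian_group ?R"
    proof (rule abelian_groupI)
      fix f assume f: "f \<in> carrier ?R"
      show "\<exists>g\<in>carrier ?R. g \<oplus>\<^bsub>?R\<^esub> f = \<zero>\<^bsub>?R\<^esub>"
        using smult_cl[OF f, of "- 1"] by (intro bexI[of _ "- 1 \<odot>\<^bsub>?R\<^esub> f"]) (auto simp: monoid_algebra_simps)
    qed (auto simp: add_cl, auto simp: monoid_algebra_simps algebra_simps)
    show "Group.monoid ?R"
    proof (rule monoidI)
      fix f assume f: "f \<in> carrier ?R"
      show "\<one>\<^bsub>?R\<^esub> \<otimes>\<^bsub>?R\<^esub> f = f"
      proof (rule ext[OF mult_cl[OF one_cl f] f])
        fix H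
        show "lin_ext (\<lambda>x. x) (\<one>\<^bsub>?R\<^esub> \<otimes>\<^bsub>?R\<^esub> f) H = lin_ext (\<lambda>x. x) f H"
          unfolding E.lin_ext_mult(1)[OF one_cl f] unfolding monoid_algebra_simps(5) E.lin_ext_monomial
          by (rule E.lin_ext_cong) (use inM[OF f] in simp)
      qed
      show "f \<otimes>\<^bsub>?R\<^esub> \<one>\<^bsub>?R\<^esub> = f"
      proof (rule ext[OF mult_cl[OF f one_cl] f])
        fix H
        show "lin_ext (\<lambda>x. x) (f \<otimes>\<^bsub>?R\<^esub> \<one>\<^bsub>?R\<^esub>) H = lin_ext (\<lambda>x. x) f H"
          unfolding E.lin_ext_mult(1)[OF f one_cl] unfolding monoid_algebra_simps(5) E.lin_ext_monomial
          by (rule E.lin_ext_cong) (use inM[OF f] in simp)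
      qed
      fix g h assume g: "g \<in> carrier ?R" and h: "h \<in> carrier ?R"
      show "f \<otimes>\<^bsub>?R\<^esub> g \<otimes>\<^bsub>?R\<^esub> h = f \<otimes>\<^bsub>?R\<^esub> (g \<otimes>\<^bsub>?R\<^esub> h)"
      proof (rule ext[OF mult_cl[OF mult_cl[OF f g] h] mult_cl[OF f mult_cl[OF g h]]])
        fix H
        show "lin_ext (\<lambda>x. x) (f \<otimes>\<^bsub>?R\<^esub> g \<otimes>\<^bsub>?R\<^esub> h) H = lin_ext (\<lambda>x. x) (f \<otimes>\<^bsub>?R\<^esub> (g \<otimes>\<^bsub>?R\<^esub> h)) H"
          unfolding E.lin_ext_mult(1)[OF mult_cl[OF f g] h] E.lin_ext_mult(1)[OF f g]
            E.lin_ext_mult(1)[OF f mult_cl[OF g h]] E.lin_ext_mult(1)[OF g h]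
          by (intro E.lin_ext_cong) (use inM[OF f] inM[OF g] inM[OF h] in \<open>simp add: M.m_assoc\<close>)
      qed
    qed (auto simp: mult_cl one_cl)
    fix f g h :: "'m \<Rightarrow> 'f" and c d :: 'f assume f: "f \<in> carrier ?R"
    show "c \<odot>\<^bsub>?R\<^esub> f \<in> carrier ?R" by (rule smult_cl[OF f])
    show "(c + d) \<odot>\<^bsub>?R\<^esub> f = c \<odot>\<^bsub>?R\<^esub> f \<oplus>\<^bsub>?R\<^esub> d \<odot>\<^bsub>?R\<^esub> f" "(c * d) \<odot>\<^bsub>?R\<^esub> f = c \<odot>\<^bsub>?R\<^esub> (d \<odot>\<^bsub>?R\<^esub> f)" "1 \<odot>\<^bsub>?R\<^esub> f = f"
      by (simp_all add: monoid_algebra_simps algebra_simps)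
    assume g: "g \<in> carrier ?R"
    show "c \<odot>\<^bsub>?R\<^esub> (f \<oplus>\<^bsub>?R\<^esub> g) = c \<odot>\<^bsub>?R\<^esub> f \<oplus>\<^bsub>?R\<^esub> c \<odot>\<^bsub>?R\<^esub> g"
      by (simp add: monoid_algebra_simps algebra_simps)
    have lin_smult: "lin_ext (\<lambda>x. x) (c \<odot>\<^bsub>?R\<^esub> f) H = c * lin_ext (\<lambda>x. x) f H" if "f \<in> carrier ?R" for f H
      using E.lin_ext_smult[OF fin[OF that]] by (simp add: monoid_algebra_simps)
    have mult_const: "lin_ext (\<lambda>x. x) f (\<lambda>u. c * H u) = c * lin_ext (\<lambda>x. x) f H" for f :: "'m \<Rightarrow> 'f" and H
      by (simp add: lin_ext_def sum_distrib_left mult_ac)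
    show "(c \<odot>\<^bsub>?R\<^esub> f) \<otimes>\<^bsub>?R\<^esub> g = c \<odot>\<^bsub>?R\<^esub> (f \<otimes>\<^bsub>?R\<^esub> g)"
      by (rule ext) (use f g in \<open>auto simp: E.lin_ext_mult mult_cl smult_cl lin_smult\<close>)
    show "f \<otimes>\<^bsub>?R\<^esub> (c \<odot>\<^bsub>?R\<^esub> g) = c \<odot>\<^bsub>?R\<^esub> (f \<otimes>\<^bsub>?R\<^esub> g)"
      by (rule ext) (use f g in \<open>auto simp: E.lin_ext_mult mult_cl smult_cl lin_smult mult_const\<close>)
    assume h: "h \<in> carrier ?R"
    have lin_add: "lin_ext (\<lambda>x. x) (f \<oplus>\<^bsub>?R\<^esub> g) H = lin_ext (\<lambda>x. x) f H + lin_ext (\<lambda>x. x) g H"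
      if "f \<in> carrier ?R" "g \<in> carrier ?R" for f g H
      using E.lin_ext_add[OF fin[OF that(1)] fin[OF that(2)]] by (simp add: monoid_algebra_simps)
    have add_fun: "lin_ext (\<lambda>x. x) f (\<lambda>u. H u + H' u) = lin_ext (\<lambda>x. x) f H + lin_ext (\<lambda>x. x) f H'" for f :: "'m \<Rightarrow> 'f" and H H'
      by (simp add: lin_ext_def algebra_simps sum.distrib)
    show "(f \<oplus>\<^bsub>?R\<^esub> g) \<otimes>\<^bsub>?R\<^esub> h = f \<otimes>\<^bsub>?R\<^esub> h \<oplus>\<^bsub>?R\<^esub> g \<otimes>\<^bsub>?R\<^esub> h"
      by (rule ext) (use f g h in \<open>auto simp: E.lin_ext_mult mult_cl add_cl lin_add\<close>)
    show "h \<otimes>\<^bsub>?R\<^esub> (f \<oplus>\<^bsub>?R\<^esub> g) = h \<otimes>\<^bsub>?R\<^esub> f \<oplus>\<^bsub>?R\<^esub> h \<otimes>\<^bsub>?R\<^esub> g"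
      by (rule ext) (use f g h in \<open>auto simp: E.lin_ext_mult mult_cl add_cl lin_add add_fun\<close>)
  qed
qed

lemma monomial_mult:
  fixes M :: "('m, 'b) monoid_scheme"
  assumes "Group.monoid M" "u \<in> carrier M" "w \<in> carrier M"
  shows "monomial u \<otimes>\<^bsub>monoid_algebra M\<^esub> monomial w = (monomial (u \<otimes>\<^bsub>M\<^esub> w) :: 'm \<Rightarrow> 'f::field)"
proof -
  interpret M: Group.monoid M by fact
  interpret E: field_embedding "\<lambda>x :: 'f. x" by (rule emb_id)
  have cl: "(monomial u :: 'm \<Rightarrow> 'f) \<in> carrier (monoid_algebra M)" "(monomial w :: 'm \<Rightarrow> 'f) \<in> carrier (monoid_algebra M)"
    using assms by (simp_all add: monomial_closed)
  show ?thesis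
  proof
    fix x
    have "lin_ext (\<lambda>x. x) (monomial u \<otimes>\<^bsub>monoid_algebra M\<^esub> monomial w :: 'm \<Rightarrow> 'f) (\<lambda>y. if y = x then 1 else 0) =
      (if u \<otimes>\<^bsub>M\<^esub> w = x then 1 else 0)"
      by (simp only: E.lin_ext_mult(1)[OF cl] E.lin_ext_monomial)
    then have "(monomial u \<otimes>\<^bsub>monoid_algebra M\<^esub> monomial w) x = (if u \<otimes>\<^bsub>M\<^esub> w = x then 1 else 0 :: 'f)"
      using lin_ext_unit[OF E.lin_ext_mult(2)[OF cl]] by (simp only:)
    also have "\<dots> = monomial (u \<otimes>\<^bsub>M\<^esub> w) x" by (auto simp: monomial_def)
    finally show "(monomial u \<otimes>\<^bsub>monoid_algebra M\<^esub> monomial w) x = (monomial (u \<otimes>\<^bsub>M\<^esub> w) x :: 'f)" .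
  qed
qed

lemma monoid_algebra_lspan:
  assumes "f \<in> carrier (monoid_algebra M)"
  shows "f \<in> lspan (monoid_algebra M) (monomial ` carrier M)"
proof -
  have "f \<in> lspan (monoid_algebra M) (monomial ` carrier M)"
    if "finite S" "{u. f u \<noteq> 0} \<subseteq> S" "S \<subseteq> carrier M" for S f
    using that
  proof (induction S arbitrary: f rule: finite_induct)
    case empty
    then have "f = \<zero>\<^bsub>monoid_algebra M\<^esub>" by (auto simp: monoid_algebra_simps)
    then show ?case by (simp add: lspan.zero)
  next
    case (insert u S)
    have "f(u := 0) \<in> lspan (monoid_algebra M) (monomial ` carrier M)"
      by (rule insert.IH) (use insert.prems insert.hyps in auto)
    moreover have "f u \<odot>\<^bsub>monoid_algebra M\<^esub> monomial u \<in> lspan (monoid_algebra M) (monomial ` carrier M)"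
      using insert.prems by (intro lspan.smult lspan.base) auto
    ultimately have "f u \<odot>\<^bsub>monoid_algebra M\<^esub> monomial u \<oplus>\<^bsub>monoid_algebra M\<^esub> f(u := 0) \<in> lspan (monoid_algebra M) (monomial ` carrier M)"
      by (intro lspan.add)
    moreover have "f u \<odot>\<^bsub>monoid_algebra M\<^esub> monomial u \<oplus>\<^bsub>monoid_algebra M\<^esub> f(u := 0) = f"
      by (auto simp: monoid_algebra_simps monomial_def)
    ultimately show ?case by simp
  qed
  then show ?thesis using assms by (auto simp: monoid_algebra_simps)
qed

theorem monoid_algebra_rep:
  fixes M :: "('m, 'b) monoid_scheme" and H :: "'m \<Rightarrow> 'g \<Rightarrow> 'g \<Rightarrow> 'f::field alg_closure"
  assumes M: "Group.monoid M"
    and mult: "\<And>u w g h. u \<in> carrier M \<Longrightarrow> w \<in> carrier M \<Longrightarrow> g \<in> G \<Longrightarrow> h \<in> G \<Longrightarrow>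
       H (u \<otimes>\<^bsub>M\<^esub> w) g h = (\<Sum>l\<in>G. H u g l * H w l h)"
    and one: "\<And>g h. g \<in> G \<Longrightarrow> h \<in> G \<Longrightarrow> H \<one>\<^bsub>M\<^esub> g h = (if g = h then 1 else 0)"
  shows "matrix_rep (monoid_algebra M) G (\<lambda>f g h. lin_ext to_ac f (\<lambda>u. H u g h))"
proof -
  interpret E: field_embedding "to_ac :: 'f \<Rightarrow> _" by (rule emb_to_ac)
  interpret assoc_algebra "monoid_algebra M :: ('f, 'm \<Rightarrow> 'f) module" by (rule monoid_algebra_assoc_algebra[OF M])
  show ?thesis
  proof
    fix g h assume gh: "g \<in> G" "h \<in> G"
    show "lin_ext to_ac (\<one>\<^bsub>monoid_algebra M\<^esub> :: 'm \<Rightarrow> 'f) (\<lambda>u. H u g h) = (if g = h then 1 else 0)"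
      using one[OF gh] by (simp add: monoid_algebra_simps(5) E.lin_ext_monomial)
    fix a b :: "'m \<Rightarrow> 'f" assume a: "a \<in> carrier (monoid_algebra M)"
    show "lin_ext to_ac (c \<odot>\<^bsub>monoid_algebra M\<^esub> a) (\<lambda>u. H u g h) = to_ac c * lin_ext to_ac a (\<lambda>u. H u g h)" for c
      using a by (simp add: monoid_algebra_simps E.lin_ext_smult)
    assume b: "b \<in> carrier (monoid_algebra M)"
    show "lin_ext to_ac (a \<oplus>\<^bsub>monoid_algebra M\<^esub> b) (\<lambda>u. H u g h) = lin_ext to_ac a (\<lambda>u. H u g h) + lin_ext to_ac b (\<lambda>u. H u g h)"
      using a b by (simp add: monoid_algebra_simps E.lin_ext_add)
    have "lin_ext to_ac (a \<otimes>\<^bsub>monoid_algebra M\<^esub> b) (\<lambda>u. H u g h) =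
      lin_ext to_ac a (\<lambda>u. lin_ext to_ac b (\<lambda>w. \<Sum>l\<in>G. H u g l * H w l h))"
      unfolding E.lin_ext_mult(1)[OF a b]
      using a b gh by (intro E.lin_ext_cong) (auto simp: monoid_algebra_simps intro!: mult E.lin_ext_cong)
    also have "\<dots> = (\<Sum>l\<in>G. \<Sum>u\<in>{u. a u \<noteq> 0}. \<Sum>w\<in>{w. b w \<noteq> 0}. to_ac (a u) * H u g l * (to_ac (b w) * H w l h))"
    proof -
      have "lin_ext to_ac a (\<lambda>u. lin_ext to_ac b (\<lambda>w. \<Sum>l\<in>G. H u g l * H w l h)) =
        (\<Sum>u\<in>{u. a u \<noteq> 0}. \<Sum>w\<in>{w. b w \<noteq> 0}. \<Sum>l\<in>G. to_ac (a u) * H u g l * (to_ac (b w) * H w l h))"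
        by (simp add: lin_ext_def sum_distrib_left mult_ac)
      also have "\<dots> = (\<Sum>u\<in>{u. a u \<noteq> 0}. \<Sum>l\<in>G. \<Sum>w\<in>{w. b w \<noteq> 0}. to_ac (a u) * H u g l * (to_ac (b w) * H w l h))"
        by (intro sum.cong refl sum.swap)
      finally show ?thesis by (subst (asm) sum.swap)
    qed
    also have "\<dots> = (\<Sum>l\<in>G. lin_ext to_ac a (\<lambda>u. H u g l) * lin_ext to_ac b (\<lambda>u. H u l h))"
      by (simp add: lin_ext_def sum_product)
    finally show "lin_ext to_ac (a \<otimes>\<^bsub>monoid_algebra M\<^esub> b) (\<lambda>u. H u g h) =
       (\<Sum>l\<in>G. lin_ext to_ac a (\<lambda>u. H u g l) * lin_ext to_ac b (\<lambda>u. H u l h))" .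
  qed
qed

section \<open>Symbol algebras from generators and relations\<close>

context algebra_ideal
begin

lemma proj_eqI: "a \<in> carrier A \<Longrightarrow> b \<in> carrier A \<Longrightarrow> a \<ominus> b \<in> I \<Longrightarrow> proj a = proj b"
  by (simp add: proj_eq_iff)

lemma proj_eq_addI:
  assumes "a \<in> carrier A" "b \<in> carrier A" "c \<in> carrier A" "(a \<ominus> b) \<ominus> c \<in> I"
  shows "proj a = proj b \<oplus>\<^bsub>Q\<^esub> proj c"
proof -
  have "proj (a \<ominus> b) = proj c" using assms by (intro proj_eqI) auto
  moreover have "a = b \<oplus> (a \<ominus> b)" using assms by (simp add: a_minus_def a_lcomm r_neg)
  ultimately show ?thesis using assms proj_add[of b "a \<ominus> b"] by simp
qed

end

text \<open>The upper bound for the dimension: the relations alone suffice to rewrite every word in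
  \<open>x\<close> and \<open>y\<close> in terms of \<open>p^2\<close> monomials.\<close>

locale symbol_relations = assoc_algebra Q for Q :: "('f::field, 'a) module" (structure) +
  fixes p :: nat and \<rho> \<delta> a b :: 'f and x y :: 'a
  assumes p1: "p > 1" and x: "x \<in> carrier Q" and y: "y \<in> carrier Q"
    and x_pow: "x [^] p = a \<odot> \<one> \<oplus> \<delta> \<odot> x" and y_pow: "y [^] p = b \<odot> \<one>"
    and y_x: "y \<otimes> x = \<rho> \<odot> (x \<otimes> y) \<oplus> \<delta> \<odot> y"
begin

definition pmon :: "nat \<times> nat \<Rightarrow> 'a" where
  "pmon u = x [^] fst u \<otimes> y [^] snd u"

lemma pmon_closed: "pmon u \<in> carrier Q"
  using x y by (simp add: pmon_def)

lemma x_mono: "x \<otimes> pmon (i, j) = pmon (Suc i, j)"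
  using x y nat_pow_mult[OF x, of 1 i] by (simp add: pmon_def m_assoc[symmetric])

text \<open>The relation moves \<open>y\<close> past one factor \<open>x\<close>, and the span of
  the monomials is stable under left multiplication by \<open>x\<close>.\<close>

lemma y_mono: "y \<otimes> pmon (i, j) \<in> lspan Q (range pmon)"
proof (induction i)
  case 0
  have "y \<otimes> pmon (0, j) = pmon (0, Suc j)"
    using y nat_pow_mult[OF y, of 1 j] by (simp add: pmon_def)
  then show ?case by (simp add: lspan.base)
next
  case (Suc i)
  let ?t = "pmon (i, j)"
  have t: "?t \<in> carrier Q" by (rule pmon_closed)
  have "y \<otimes> pmon (Suc i, j) = (y \<otimes> x) \<otimes> ?t"
    using x y t by (simp add: x_mono[symmetric] m_assoc)
  also have "\<dots> = \<rho> \<odot> (x \<otimes> (y \<otimes> ?t)) \<oplus> \<delta> \<odot> (y \<otimes> ?t)"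
    using x y t by (simp add: y_x l_distr smult_closed smult_mult_l m_assoc)
  finally have eq: "y \<otimes> pmon (Suc i, j) = \<rho> \<odot> (x \<otimes> (y \<otimes> ?t)) \<oplus> \<delta> \<odot> (y \<otimes> ?t)" .
  have "x \<otimes> (y \<otimes> ?t) \<in> lspan Q (range pmon)"
    by (rule lspan_mult_left[OF Suc]) (auto simp: x pmon_closed x_mono intro: lspan.base)
  then show ?case unfolding eq by (intro lspan.add lspan.smult Suc)
qed

lemma pmon_reduce: "pmon u \<in> lspan Q (pmon ` ({..<p} \<times> {..<p}))"
proof -
  have *: "pmon (i, j) \<in> lspan Q (pmon ` ({..<p} \<times> {..<p}))" if "j < p" for i j
    using that
  proof (induction i rule: less_induct)
    case (less i)
    show ?case
    proof (cases "i < p")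
      case True
      then show ?thesis using less.prems by (intro lspan.base) auto
    next
      case False
      define i' where "i' = i - p"
      have i: "i = p + i'" using False by (simp add: i'_def)
      have yj: "y [^] j \<in> carrier Q" "x [^] i' \<in> carrier Q" using x y by auto
      have "pmon (i, j) = (x [^] p \<otimes> x [^] i') \<otimes> y [^] j"
        using x by (simp add: pmon_def i nat_pow_mult)
      also have "\<dots> = a \<odot> pmon (i', j) \<oplus> \<delta> \<odot> pmon (Suc i', j)"
        using x yj unfolding x_pow
        by (simp add: l_distr smult_closed smult_mult_l m_assoc x_mono[symmetric]) (simp add: pmon_def)
      finally have "pmon (i, j) = a \<odot> pmon (i', j) \<oplus> \<delta> \<odot> pmon (Suc i', j)" .
      then show ?thesis
        using less p1 i by (auto intro!: lspan.add lspan.smult)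
    qed
  qed
  have "pmon (i, j) \<in> lspan Q (pmon ` ({..<p} \<times> {..<p}))" for i j
  proof (induction j rule: less_induct)
    case (less j)
    show ?case
    proof (cases "j < p")
      case False
      define j' where "j' = j - p"
      have j: "j = p + j'" using False by (simp add: j'_def)
      have yj: "y [^] j' \<in> carrier Q" "x [^] i \<in> carrier Q" using x y by auto
      have "y [^] j = b \<odot> y [^] j'"
        using nat_pow_mult[OF y, of p j'] yj by (simp add: j y_pow smult_mult_l)
      then have "pmon (i, j) = b \<odot> pmon (i, j')"
        using yj by (simp add: pmon_def smult_mult_r)
      then show ?thesis using less[of j'] p1 j by (auto intro: lspan.smult)
    qed (use * in blast)
  qed
  then show ?thesis by (cases u) auto
qed

definition word :: "symbol_generator list \<Rightarrow> 'a" where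
  "word ws = foldr (\<lambda>c t. (case c of Gen_x \<Rightarrow> x | Gen_y \<Rightarrow> y) \<otimes> t) ws \<one>"

lemma word_lspan: "word ws \<in> lspan Q (pmon ` ({..<p} \<times> {..<p}))"
proof -
  have "word ws \<in> lspan Q (range pmon)"
  proof (induction ws)
    case Nil
    have "pmon (0, 0) = \<one>" by (simp add: pmon_def)
    moreover have "pmon (0, 0) \<in> lspan Q (range pmon)" by (rule lspan.base) simp
    ultimately show ?case by (simp add: word_def)
  next
    case (Cons c ws)
    have "(case c of Gen_x \<Rightarrow> x | Gen_y \<Rightarrow> y) \<otimes> word ws \<in> lspan Q (range pmon)"
      by (rule lspan_mult_left[OF Cons])
        (auto simp: x y pmon_closed x_mono y_mono intro: lspan.base split: symbol_generator.split)
    then show ?case by (simp add: word_def)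
  qed
  then show ?thesis using pmon_reduce by (auto intro: lspan_trans)
qed

end

text \<open>Used twice: for the free algebra, where it places the relations in the kernel, and for
  the quotient, where it computes the matrices of the monomials.\<close>

locale symbol_rep = split_symbol p \<rho> \<delta> a b ev s + matrix_rep A "{..<p}" \<psi>
  for p :: nat and \<rho> \<delta> a b :: "'f::field" and ev s and A :: "('f, 'a) module" (structure) and \<psi> +
  fixes x y :: 'a
  assumes x: "x \<in> carrier A" and y: "y \<in> carrier A"
    and rep_x: "g < p \<Longrightarrow> h < p \<Longrightarrow> \<psi> x g h = (if h = g then ev g else 0)"
    and rep_y: "g < p \<Longrightarrow> h < p \<Longrightarrow> \<psi> y g h = (if h = Suc g mod p then s else 0)"
begin

lemma rep_x_mult: "z \<in> carrier A \<Longrightarrow> g < p \<Longrightarrow> h < p \<Longrightarrow> \<psi> (x \<otimes> z) g h = ev g * \<psi> z g h"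
proof -
  assume *: "z \<in> carrier A" "g < p" "h < p"
  have "\<psi> (x \<otimes> z) g h = (\<Sum>l<p. if l = g then ev g * \<psi> z g h else 0)"
  proof -
    have "\<psi> (x \<otimes> z) g h = (\<Sum>l<p. \<psi> x g l * \<psi> z l h)" using * x by (intro rep_mult) auto
    also have "\<dots> = (\<Sum>l<p. if l = g then ev g * \<psi> z g h else 0)"
      using * by (intro sum.cong) (auto simp: rep_x)
    finally show ?thesis .
  qed
  then show ?thesis using * by simp
qed

lemma rep_y_mult: "z \<in> carrier A \<Longrightarrow> g < p \<Longrightarrow> h < p \<Longrightarrow> \<psi> (y \<otimes> z) g h = s * \<psi> z (Suc g mod p) h"
proof -
  assume *: "z \<in> carrier A" "g < p" "h < p"
  have "\<psi> (y \<otimes> z) g h = (\<Sum>l<p. if l = Suc g mod p then s * \<psi> z (Suc g mod p) h else 0)"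
  proof -
    have "\<psi> (y \<otimes> z) g h = (\<Sum>l<p. \<psi> y g l * \<psi> z l h)" using * y by (intro rep_mult) auto
    also have "\<dots> = (\<Sum>l<p. if l = Suc g mod p then s * \<psi> z (Suc g mod p) h else 0)"
      using * by (intro sum.cong) (auto simp: rep_y)
    finally show ?thesis .
  qed
  then show ?thesis using p by simp
qed

lemma rep_y_pow: "g < p \<Longrightarrow> h < p \<Longrightarrow> \<psi> (y [^] n) g h = (if h = (g + n) mod p then s ^ n else 0)"
proof (induction n arbitrary: g)
  case 0
  then show ?case by (auto simp: rep_one)
next
  case (Suc n)
  have "y [^] Suc n = y \<otimes> y [^] n" using y nat_pow_mult[OF y, of 1 n] by simp
  then show ?case using Suc y p by (simp add: rep_y_mult mod_simps)
qed

lemma rep_mono: "g < p \<Longrightarrow> h < p \<Longrightarrow> \<psi> (x [^] i \<otimes> y [^] j) g h = smat (i, j) g h"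
proof (induction i)
  case 0
  then show ?case using y by (simp add: rep_y_pow smat_def)
next
  case (Suc i)
  have "x [^] Suc i \<otimes> y [^] j = x \<otimes> (x [^] i \<otimes> y [^] j)"
    using x y nat_pow_mult[OF x, of 1 i] by (simp add: m_assoc[symmetric])
  then show ?case using Suc x y by (simp add: rep_x_mult smat_def)
qed

lemma rep_x_pow: "g < p \<Longrightarrow> h < p \<Longrightarrow> \<psi> (x [^] n) g h = (if h = g then ev g ^ n else 0)"
  using rep_mono[of g h n 0] x by (simp add: smat_def)

lemma relation_y: "y [^] p \<ominus> b \<odot> \<one> \<in> rep_kernel"
  using y by (auto simp: rep_kernel_def rep_minus rep_smult rep_one rep_y_pow smult_closed s_root)

lemma relation_yx: "\<delta> = 0 \<Longrightarrow> y \<otimes> x \<ominus> \<rho> \<odot> (x \<otimes> y) \<in> rep_kernel"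
  using x y p by (auto simp: rep_kernel_def rep_minus rep_smult rep_x_mult rep_y_mult smult_closed rep_x rep_y ev_shift)

lemma relation_x: "\<delta> = 0 \<Longrightarrow> x [^] p \<ominus> a \<odot> \<one> \<in> rep_kernel"
  using x by (auto simp: rep_kernel_def rep_minus rep_smult rep_one rep_x_pow smult_closed ev_root)

lemma relation_yx_char: "\<delta> = 1 \<Longrightarrow> \<rho> = 1 \<Longrightarrow> y \<otimes> x \<ominus> (x \<oplus> \<one>) \<otimes> y \<in> rep_kernel"
  using x y p by (auto simp: l_distr rep_kernel_def rep_minus rep_add rep_smult rep_x_mult rep_y_mult rep_x rep_y ev_shift algebra_simps)

lemma relation_x_char: "\<delta> = 1 \<Longrightarrow> (x [^] p \<ominus> x) \<ominus> a \<odot> \<one> \<in> rep_kernel"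
  using x by (auto simp: rep_kernel_def rep_minus rep_smult rep_one rep_x_pow rep_x smult_closed ev_root)

end

context split_symbol
begin

primrec wmat :: "symbol_generator list \<Rightarrow> nat \<Rightarrow> nat \<Rightarrow> 'f alg_closure" where
  "wmat [] g h = (if g = h then 1 else 0)"
| "wmat (c # ws) g h = (\<Sum>l<p. smat (case c of Gen_x \<Rightarrow> (1, 0) | Gen_y \<Rightarrow> (0, 1)) g l * wmat ws l h)"

lemma wmat_append: "g < p \<Longrightarrow> h < p \<Longrightarrow> wmat (u @ w) g h = (\<Sum>l<p. wmat u g l * wmat w l h)"
proof (induction u arbitrary: g)
  case Nil
  have "(\<Sum>l<p. wmat [] g l * wmat w l h) = (\<Sum>l<p. if l = g then wmat w g h else 0)"
    by (intro sum.cong) auto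
  then show ?case using Nil by simp
next
  case (Cons c u)
  let ?c = "smat (case c of Gen_x \<Rightarrow> (1, 0) | Gen_y \<Rightarrow> (0, 1))"
  have "wmat ((c # u) @ w) g h = (\<Sum>k<p. \<Sum>l<p. ?c g k * wmat u k l * wmat w l h)"
    using Cons by (simp add: sum_distrib_left mult.assoc)
  also have "\<dots> = (\<Sum>l<p. \<Sum>k<p. ?c g k * wmat u k l * wmat w l h)" by (rule sum.swap)
  finally show ?case by (simp add: sum_distrib_right)
qed

end

abbreviation word_monoid :: "symbol_generator list monoid" where
  "word_monoid \<equiv> \<lparr>carrier = UNIV, monoid.mult = (@), one = []\<rparr>"

lemma word_monoid: "Group.monoid word_monoid"
  by (rule monoidI) auto

lemma (in split_symbol) free_algebra_rep:
  "symbol_rep p \<rho> \<delta> a b ev s free_algebra (\<lambda>f g h. lin_ext to_ac f (\<lambda>u. wmat u g h))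
     (monomial [Gen_x]) (monomial [Gen_y])"
proof -
  interpret E: field_embedding "to_ac :: 'f \<Rightarrow> _" by (rule emb_to_ac)
  interpret matrix_rep "free_algebra :: ('f, symbol_generator list \<Rightarrow> 'f) module" "{..<p}" "\<lambda>f g h. lin_ext to_ac f (\<lambda>u. wmat u g h)"
    unfolding free_algebra_def by (rule monoid_algebra_rep[OF word_monoid]) (auto simp: wmat_append)
  have gen: "wmat [c] g h = smat (case c of Gen_x \<Rightarrow> (1, 0) | Gen_y \<Rightarrow> (0, 1)) g h" if "h < p" for c g h
  proof -
    let ?c = "smat (case c of Gen_x \<Rightarrow> (1, 0) | Gen_y \<Rightarrow> (0, 1))"
    have "wmat [c] g h = (\<Sum>l<p. if l = h then ?c g h else 0)"
      by (simp only: wmat.simps) (intro sum.cong, auto)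
    then show ?thesis using that by simp
  qed
  show ?thesis
  proof
    show "monomial [Gen_x] \<in> carrier free_algebra" "monomial [Gen_y] \<in> carrier free_algebra"
      unfolding free_algebra_def by (intro monomial_closed, simp)+
    fix g h assume gh: "g < p" "h < p"
    show "lin_ext to_ac (monomial [Gen_x]) (\<lambda>u. wmat u g h) = (if h = g then ev g else 0)"
      "lin_ext to_ac (monomial [Gen_y]) (\<lambda>u. wmat u g h) = (if h = Suc g mod p then s else 0)"
      using gh by (auto simp: E.lin_ext_monomial gen smat_def simp del: wmat.simps)
  qed
qed

definition any_symbol_algebra :: "nat \<Rightarrow> 'f::field \<Rightarrow> 'f \<Rightarrow> 'f \<Rightarrow> 'f \<Rightarrow> ('f, (symbol_generator list \<Rightarrow> 'f) set) module" where
  "any_symbol_algebra p \<rho> \<delta> a b = (if \<delta> = 0 then symbol_algebra p \<rho> a b else symbol_algebra_char_p p a b)"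

text \<open>Spanning comes from the relations and independence from the matrices: the
  \<open>smat u\<close> have the dual family \<open>dmat\<close>.\<close>

theorem (in split_symbol) symbol_algebra_basis:
  assumes par: "symbol_parameters p \<rho> \<delta>"
  obtains \<psi> B where "matrix_rep (any_symbol_algebra p \<rho> \<delta> a b) {..<p} \<psi>"
    and "\<And>u. B u \<in> carrier (any_symbol_algebra p \<rho> \<delta> a b)"
    and "\<And>u g h. g < p \<Longrightarrow> h < p \<Longrightarrow> \<psi> (B u) g h = smat u g h"
    and "B (0, 0) = \<one>\<^bsub>any_symbol_algebra p \<rho> \<delta> a b\<^esub>"
    and "carrier (any_symbol_algebra p \<rho> \<delta> a b) \<subseteq> lspan (any_symbol_algebra p \<rho> \<delta> a b) (B ` ({..<p} \<times> {..<p}))"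
proof -
  let ?x = "monomial [Gen_x] :: symbol_generator list \<Rightarrow> 'f" and ?y = "monomial [Gen_y] :: symbol_generator list \<Rightarrow> 'f"
  let ?R = "free_algebra :: ('f, symbol_generator list \<Rightarrow> 'f) module"
  interpret R: symbol_rep p \<rho> \<delta> a b ev s ?R "\<lambda>f g h. lin_ext to_ac f (\<lambda>u. wmat u g h)" ?x ?y
    by (rule free_algebra_rep)
  define S where "S = (if \<delta> = 0 then {?x [^]\<^bsub>?R\<^esub> p \<ominus>\<^bsub>?R\<^esub> a \<odot>\<^bsub>?R\<^esub> \<one>\<^bsub>?R\<^esub>,
         ?y [^]\<^bsub>?R\<^esub> p \<ominus>\<^bsub>?R\<^esub> b \<odot>\<^bsub>?R\<^esub> \<one>\<^bsub>?R\<^esub>, ?y \<otimes>\<^bsub>?R\<^esub> ?x \<ominus>\<^bsub>?R\<^esub> \<rho> \<odot>\<^bsub>?R\<^esub> (?x \<otimes>\<^bsub>?R\<^esub> ?y)}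
      else {(?x [^]\<^bsub>?R\<^esub> p \<ominus>\<^bsub>?R\<^esub> ?x) \<ominus>\<^bsub>?R\<^esub> a \<odot>\<^bsub>?R\<^esub> \<one>\<^bsub>?R\<^esub>,
         ?y [^]\<^bsub>?R\<^esub> p \<ominus>\<^bsub>?R\<^esub> b \<odot>\<^bsub>?R\<^esub> \<one>\<^bsub>?R\<^esub>, ?y \<otimes>\<^bsub>?R\<^esub> ?x \<ominus>\<^bsub>?R\<^esub> (?x \<oplus>\<^bsub>?R\<^esub> \<one>\<^bsub>?R\<^esub>) \<otimes>\<^bsub>?R\<^esub> ?y})"
  have Q: "any_symbol_algebra p \<rho> \<delta> a b = quotient_algebra ?R (Idl\<^bsub>?R\<^esub> S)"
    by (simp add: any_symbol_algebra_def S_def symbol_algebra_def symbol_algebra_char_p_def Let_def)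
  have \<delta>1: "\<delta> \<noteq> 0 \<Longrightarrow> \<delta> = 1 \<and> \<rho> = 1" using par by (auto simp: symbol_parameters_def)
  have ker: "S \<subseteq> R.rep_kernel"
    using R.relation_x R.relation_y R.relation_yx R.relation_x_char R.relation_yx_char \<delta>1 by (auto simp: S_def)
  note rq = R.rep_quotient[OF ker]
  interpret I: algebra_ideal ?R "Idl\<^bsub>?R\<^esub> S" by (rule rq(1))
  obtain \<psi> where rep: "matrix_rep I.Q {..<p} \<psi>"
    and \<psi>: "\<And>c g h. c \<in> carrier ?R \<Longrightarrow> g \<in> {..<p} \<Longrightarrow> h \<in> {..<p} \<Longrightarrow> \<psi> (I.proj c) g h = lin_ext to_ac c (\<lambda>u. wmat u g h)"
    using rq(2,3) unfolding I.proj_def by blast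
  interpret Q: matrix_rep I.Q "{..<p}" \<psi> by (rule rep)
  interpret QR: symbol_rep p \<rho> \<delta> a b ev s I.Q \<psi> "I.proj ?x" "I.proj ?y"
    by unfold_locales (auto simp: I.proj_closed R.x R.y \<psi> R.rep_x R.rep_y)
  \<comment> \<open>Both presentations are brought to the uniform relation
    \<open>x^p = a + \<delta> x\<close>; for \<open>\<delta> = 1\<close> the summand
    \<open>x\<close> moves to the other side.\<close>
  have relx: "I.proj (?x [^]\<^bsub>?R\<^esub> p) = I.proj (a \<odot>\<^bsub>?R\<^esub> \<one>\<^bsub>?R\<^esub>) \<oplus>\<^bsub>I.Q\<^esub> I.proj (\<delta> \<odot>\<^bsub>?R\<^esub> ?x)"
  proof (cases "\<delta> = 0")
    case True
    then have "I.proj (?x [^]\<^bsub>?R\<^esub> p) = I.proj (a \<odot>\<^bsub>?R\<^esub> \<one>\<^bsub>?R\<^esub>)"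
      using rq(4) R.x by (intro I.proj_eqI) (auto simp: S_def R.smult_closed)
    then show ?thesis using True R.x by (simp add: R.smult_zero I.proj_zero I.proj_closed R.smult_closed)
  next
    case False
    then have "I.proj (?x [^]\<^bsub>?R\<^esub> p) = I.proj ?x \<oplus>\<^bsub>I.Q\<^esub> I.proj (a \<odot>\<^bsub>?R\<^esub> \<one>\<^bsub>?R\<^esub>)"
      using rq(4) R.x by (intro I.proj_eq_addI) (auto simp: S_def R.smult_closed)
    then show ?thesis using \<delta>1[OF False] R.x by (simp add: R.smult_one I.quot.a_comm I.proj_closed R.smult_closed)
  qed
  have rely: "I.proj (?y [^]\<^bsub>?R\<^esub> p) = I.proj (b \<odot>\<^bsub>?R\<^esub> \<one>\<^bsub>?R\<^esub>)"
    using rq(4) R.y by (intro I.proj_eqI) (auto simp: S_def R.smult_closed)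
  have relyx: "I.proj (?y \<otimes>\<^bsub>?R\<^esub> ?x) = I.proj (\<rho> \<odot>\<^bsub>?R\<^esub> (?x \<otimes>\<^bsub>?R\<^esub> ?y)) \<oplus>\<^bsub>I.Q\<^esub> I.proj (\<delta> \<odot>\<^bsub>?R\<^esub> ?y)"
  proof (cases "\<delta> = 0")
    case True
    then have "I.proj (?y \<otimes>\<^bsub>?R\<^esub> ?x) = I.proj (\<rho> \<odot>\<^bsub>?R\<^esub> (?x \<otimes>\<^bsub>?R\<^esub> ?y))"
      using rq(4) R.x R.y by (intro I.proj_eqI) (auto simp: S_def R.smult_closed)
    then show ?thesis using True R.x R.y by (simp add: R.smult_zero I.proj_zero I.proj_closed R.smult_closed)
  next
    case False
    then have "I.proj (?y \<otimes>\<^bsub>?R\<^esub> ?x) = I.proj ((?x \<oplus>\<^bsub>?R\<^esub> \<one>\<^bsub>?R\<^esub>) \<otimes>\<^bsub>?R\<^esub> ?y)"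
      using rq(4) R.x R.y by (intro I.proj_eqI) (auto simp: S_def)
    then show ?thesis using \<delta>1[OF False] R.x R.y by (simp add: R.smult_one R.l_distr I.proj_add)
  qed
  interpret SR: symbol_relations I.Q p \<rho> \<delta> a b "I.proj ?x" "I.proj ?y"
  proof
    show "p > 1" by (rule p)
    show "I.proj ?x \<in> carrier I.Q" "I.proj ?y \<in> carrier I.Q" by (rule QR.x QR.y)+
    show "I.proj ?x [^]\<^bsub>I.Q\<^esub> p = a \<odot>\<^bsub>I.Q\<^esub> \<one>\<^bsub>I.Q\<^esub> \<oplus>\<^bsub>I.Q\<^esub> \<delta> \<odot>\<^bsub>I.Q\<^esub> I.proj ?x"
      using relx R.x by (simp add: I.proj_pow I.proj_smult I.proj_one)
    show "I.proj ?y [^]\<^bsub>I.Q\<^esub> p = b \<odot>\<^bsub>I.Q\<^esub> \<one>\<^bsub>I.Q\<^esub>"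
      using rely R.y by (simp add: I.proj_pow I.proj_smult I.proj_one)
    show "I.proj ?y \<otimes>\<^bsub>I.Q\<^esub> I.proj ?x = \<rho> \<odot>\<^bsub>I.Q\<^esub> (I.proj ?x \<otimes>\<^bsub>I.Q\<^esub> I.proj ?y) \<oplus>\<^bsub>I.Q\<^esub> \<delta> \<odot>\<^bsub>I.Q\<^esub> I.proj ?y"
      using relyx R.x R.y by (simp add: I.proj_mult I.proj_smult)
  qed
  have word: "I.proj (monomial ws) = SR.word ws" for ws
  proof (induction ws)
    case Nil
    have "monomial [] = \<one>\<^bsub>?R\<^esub>" by (simp add: free_algebra_def monoid_algebra_simps(5))
    then show ?case by (simp add: SR.word_def I.proj_one)
  next
    case (Cons c ws)
    have cl: "monomial us \<in> carrier ?R" for us unfolding free_algebra_def by (rule monomial_closed) simp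
    have "monomial (c # ws) = monomial [c] \<otimes>\<^bsub>?R\<^esub> (monomial ws :: symbol_generator list \<Rightarrow> 'f)"
      unfolding free_algebra_def by (subst monomial_mult[OF word_monoid]) auto
    then show ?case using Cons cl by (cases c) (simp_all add: I.proj_mult SR.word_def)
  qed
  have span: "carrier I.Q \<subseteq> lspan I.Q (SR.pmon ` ({..<p} \<times> {..<p}))"
  proof
    fix z assume "z \<in> carrier I.Q"
    then obtain f where f: "f \<in> carrier ?R" "z = I.proj f" by (auto simp: I.carrier_Q)
    have "f \<in> lspan ?R (monomial ` UNIV)"
      using monoid_algebra_lspan[of f word_monoid] f(1) by (simp add: free_algebra_def)
    moreover have "monomial ` UNIV \<subseteq> carrier ?R" by (auto simp: free_algebra_def intro!: monomial_closed)
    ultimately have "z \<in> lspan I.Q (I.proj ` monomial ` UNIV)"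
      unfolding f(2) by (intro I.proj_lspan)
    then show "z \<in> lspan I.Q (SR.pmon ` ({..<p} \<times> {..<p}))"
    proof (rule I.quot.lspan_trans)
      fix w assume "w \<in> I.proj ` monomial ` UNIV"
      then obtain ws where w: "w = I.proj (monomial ws)" by blast
      show "w \<in> lspan I.Q (SR.pmon ` ({..<p} \<times> {..<p}))"
        unfolding w word[of ws] by (rule SR.word_lspan)
    qed
  qed
  show thesis
  proof (rule that[of \<psi> SR.pmon, unfolded Q])
    show "matrix_rep I.Q {..<p} \<psi>" by (rule rep)
    show "SR.pmon u \<in> carrier I.Q" for u by (rule SR.pmon_closed)
    show "\<psi> (SR.pmon u) g h = smat u g h" if "g < p" "h < p" for u g h
      using QR.rep_mono[OF that, of "fst u" "snd u"] by (simp add: SR.pmon_def)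
    show "SR.pmon (0, 0) = \<one>\<^bsub>I.Q\<^esub>" by (simp add: SR.pmon_def)
    show "carrier I.Q \<subseteq> lspan I.Q (SR.pmon ` ({..<p} \<times> {..<p}))" by (rule span)
  qed
qed

section \<open>Tensor products\<close>

lemma product_monoid:
  assumes "\<And>k. k \<in> I \<Longrightarrow> Group.monoid (S k)"
  shows "Group.monoid (product_group I S)"
proof (rule monoidI)
  fix f g h
  assume f: "f \<in> carrier (product_group I S)" and g: "g \<in> carrier (product_group I S)" and h: "h \<in> carrier (product_group I S)"
  have mem: "f k \<in> carrier (S k)" "g k \<in> carrier (S k)" "h k \<in> carrier (S k)" if "k \<in> I" for k
    using f g h that by auto
  show "f \<otimes>\<^bsub>product_group I S\<^esub> g \<in> carrier (product_group I S)"
    using mem assms by (auto intro: monoid.m_closed)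
  show "f \<otimes>\<^bsub>product_group I S\<^esub> g \<otimes>\<^bsub>product_group I S\<^esub> h = f \<otimes>\<^bsub>product_group I S\<^esub> (g \<otimes>\<^bsub>product_group I S\<^esub> h)"
    using mem assms by (auto intro!: restrict_ext simp: monoid.m_assoc)
next
  show "\<one>\<^bsub>product_group I S\<^esub> \<in> carrier (product_group I S)"
    using assms by (auto intro: monoid.one_closed)
next
  fix f assume f: "f \<in> carrier (product_group I S)"
  have mem: "f k \<in> carrier (S k)" if "k \<in> I" for k using f that by auto
  have ext: "f = (\<lambda>k\<in>I. f k)" using f by (auto simp: PiE_iff extensional_restrict)
  show "\<one>\<^bsub>product_group I S\<^esub> \<otimes>\<^bsub>product_group I S\<^esub> f = f" "f \<otimes>\<^bsub>product_group I S\<^esub> \<one>\<^bsub>product_group I S\<^esub> = f"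
    by (subst (2) ext, use mem assms in \<open>auto intro!: restrict_ext simp: monoid.l_one monoid.r_one\<close>)+
qed

text \<open>Products of matrix entries are multilinear in the factors, so the Kronecker product of
  the \<open>\<psi> k\<close> kills the relations and descends. Conversely, multilinearity expands
  every pure tensor in tensors of the given spanning elements.\<close>

theorem tensor_product_basis:
  fixes I :: "'i set" and S :: "'i \<Rightarrow> ('f::field, 'a) module" and U :: "'u set"
    and \<psi> :: "'i \<Rightarrow> 'a \<Rightarrow> 'g \<Rightarrow> 'g \<Rightarrow> 'f alg_closure"
  assumes I: "finite I" and G: "finite G"
    and rep: "\<And>k. k \<in> I \<Longrightarrow> matrix_rep (S k) G (\<psi> k)"
    and B: "\<And>k u. k \<in> I \<Longrightarrow> u \<in> U \<Longrightarrow> B k u \<in> carrier (S k)"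
    and span: "\<And>k. k \<in> I \<Longrightarrow> carrier (S k) \<subseteq> lspan (S k) (B k ` U)"
  obtains \<Psi> and b :: "('i \<Rightarrow> 'u) \<Rightarrow> (('i \<Rightarrow> 'a) \<Rightarrow> 'f) set"
  where "matrix_rep (tensor_product I S) (\<Pi>\<^sub>E k\<in>I. G) \<Psi>"
    and "\<And>w. w \<in> PiE I (\<lambda>_. U) \<Longrightarrow> b w \<in> carrier (tensor_product I S)"
    and "\<And>w g h. w \<in> PiE I (\<lambda>_. U) \<Longrightarrow> g \<in> (\<Pi>\<^sub>E k\<in>I. G) \<Longrightarrow> h \<in> (\<Pi>\<^sub>E k\<in>I. G) \<Longrightarrow>
        \<Psi> (b w) g h = (\<Prod>k\<in>I. \<psi> k (B k (w k)) (g k) (h k))"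
    and "\<And>w. w \<in> PiE I (\<lambda>_. U) \<Longrightarrow> (\<And>k. k \<in> I \<Longrightarrow> B k (w k) = \<one>\<^bsub>S k\<^esub>) \<Longrightarrow> b w = \<one>\<^bsub>tensor_product I S\<^esub>"
    and "carrier (tensor_product I S) \<subseteq> lspan (tensor_product I S) (b ` PiE I (\<lambda>_. U))"
proof -
  let ?P = "product_group I S" and ?GG = "\<Pi>\<^sub>E k\<in>I. G"
  let ?R = "monoid_algebra ?P :: ('f, ('i \<Rightarrow> 'a) \<Rightarrow> 'f) module"
  define H where "H = (\<lambda>f g h. \<Prod>k\<in>I. \<psi> k (f k) (g k) (h k))"
  have ring: "ring (S k)" if "k \<in> I" for k
    using rep[OF that] by (simp add: matrix_rep_def assoc_algebra_def)
  have P: "Group.monoid ?P" by (rule product_monoid) (rule ring.is_monoid[OF ring])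
  have memG: "g k \<in> G" if "g \<in> ?GG" "k \<in> I" for g k using that by auto
  have memC: "f k \<in> carrier (S k)" if "f \<in> carrier ?P" "k \<in> I" for f k using that by auto
  interpret E: field_embedding "to_ac :: 'f \<Rightarrow> _" by (rule emb_to_ac)
  interpret R: matrix_rep ?R ?GG "\<lambda>f g h. lin_ext to_ac f (\<lambda>u. H u g h)"
  proof (rule monoid_algebra_rep[OF P])
    fix f f' g h
    assume f: "f \<in> carrier ?P" "f' \<in> carrier ?P" and g: "g \<in> ?GG" "h \<in> ?GG"
    have "H (f \<otimes>\<^bsub>?P\<^esub> f') g h = (\<Prod>k\<in>I. \<Sum>l\<in>G. \<psi> k (f k) (g k) l * \<psi> k (f' k) l (h k))"
      unfolding H_def using f g memC memG rep
      by (intro prod.cong refl) (simp add: matrix_rep.rep_mult)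
    also have "\<dots> = (\<Sum>l\<in>?GG. \<Prod>k\<in>I. \<psi> k (f k) (g k) (l k) * \<psi> k (f' k) (l k) (h k))"
      by (rule sum_PiE_prod[OF I G, symmetric, of "\<lambda>k l. \<psi> k (f k) (g k) l * \<psi> k (f' k) l (h k)"])
    finally show "H (f \<otimes>\<^bsub>?P\<^esub> f') g h = (\<Sum>l\<in>?GG. H f g l * H f' l h)"
      by (simp only: H_def prod.distrib)
  next
    fix g h assume g: "g \<in> ?GG" "h \<in> ?GG"
    have "H \<one>\<^bsub>?P\<^esub> g h = (\<Prod>k\<in>I. if g k = h k then 1 else 0)"
      unfolding H_def using g memG by (intro prod.cong refl) (simp add: matrix_rep.rep_one[OF rep])
    then show "H \<one>\<^bsub>?P\<^esub> g h = (if g = h then 1 else 0)" by (simp only: prod_delta[OF I g])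
  qed
  have upd: "f(k := a) \<in> carrier ?P" if "f \<in> carrier ?P" "k \<in> I" "a \<in> carrier (S k)" for f k a
    using that by (auto simp: PiE_iff extensional_def)
  have mon: "(monomial f :: ('i \<Rightarrow> 'a) \<Rightarrow> 'f) \<in> carrier ?R" if "f \<in> carrier ?P" for f
    using that by (rule monomial_closed)
  have Hupd: "H (f(k := a)) g h = \<psi> k a (g k) (h k) * (\<Prod>j\<in>I - {k}. \<psi> j (f j) (g j) (h j))" if "k \<in> I" for f k a g h
    unfolding H_def using that I by (simp add: prod.remove[OF I that] cong: prod.cong_simp)
  let ?rel = "multilinear_relations I S"
  have add_ker: "(monomial (f(k := a \<oplus>\<^bsub>S k\<^esub> b)) \<ominus>\<^bsub>?R\<^esub> monomial (f(k := a))) \<ominus>\<^bsub>?R\<^esub> monomial (f(k := b)) \<in> R.rep_kernel"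
    if "f \<in> carrier ?P" "k \<in> I" "a \<in> carrier (S k)" "b \<in> carrier (S k)" for f k a b
  proof -
    have ab: "a \<oplus>\<^bsub>S k\<^esub> b \<in> carrier (S k)" using ring[OF that(2)] that by (simp add: ring.ring_simprules)
    show ?thesis
      unfolding R.rep_kernel_def
      using that upd[OF that(1,2)] mon ab memG rep[OF that(2)]
      by (auto simp: R.rep_minus E.lin_ext_monomial Hupd matrix_rep.rep_add algebra_simps)
  qed
  have smult_ker: "monomial (f(k := c \<odot>\<^bsub>S k\<^esub> a)) \<ominus>\<^bsub>?R\<^esub> c \<odot>\<^bsub>?R\<^esub> monomial (f(k := a)) \<in> R.rep_kernel"
    if "f \<in> carrier ?P" "k \<in> I" "a \<in> carrier (S k)" for f k a c
  proof -
    interpret Sk: matrix_rep "S k" G "\<psi> k" by (rule rep[OF that(2)])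
    show ?thesis
      unfolding R.rep_kernel_def
      using that upd[OF that(1,2)] mon memG
      by (auto simp: R.rep_minus R.rep_smult R.smult_closed Sk.smult_closed E.lin_ext_monomial Hupd Sk.rep_smult mult.assoc)
  qed
  have ker: "?rel \<subseteq> R.rep_kernel"
    using add_ker smult_ker unfolding multilinear_relations_def Let_def by blast
  have A: "tensor_product I S = quotient_algebra ?R (Idl\<^bsub>?R\<^esub> ?rel)"
    by (simp add: tensor_product_def Let_def)
  note rq = R.rep_quotient[OF ker]
  interpret J: algebra_ideal ?R "Idl\<^bsub>?R\<^esub> ?rel" by (rule rq(1))
  obtain \<Psi> where Psi: "matrix_rep J.Q ?GG \<Psi>"
    and \<Psi>: "\<And>c g h. c \<in> carrier ?R \<Longrightarrow> g \<in> ?GG \<Longrightarrow> h \<in> ?GG \<Longrightarrow> \<Psi> (J.proj c) g h = lin_ext to_ac c (\<lambda>u. H u g h)"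
    using rq(2,3) unfolding J.proj_def by blast
  define pure where "pure = (\<lambda>f. J.proj (monomial f))"
  have pure_add: "pure (f(k := a \<oplus>\<^bsub>S k\<^esub> b)) = pure (f(k := a)) \<oplus>\<^bsub>J.Q\<^esub> pure (f(k := b))"
    if "f \<in> carrier ?P" "k \<in> I" "a \<in> carrier (S k)" "b \<in> carrier (S k)" for f k a b
    unfolding pure_def
  proof (rule J.proj_eq_addI)
    show "(monomial (f(k := a \<oplus>\<^bsub>S k\<^esub> b)) \<ominus>\<^bsub>?R\<^esub> monomial (f(k := a))) \<ominus>\<^bsub>?R\<^esub> monomial (f(k := b)) \<in> Idl\<^bsub>?R\<^esub> ?rel"
      using that by (intro rq(4)) (unfold multilinear_relations_def Let_def, blast)
    have ab: "a \<oplus>\<^bsub>S k\<^esub> b \<in> carrier (S k)" using ring[OF that(2)] that by (simp add: ring.ring_simprules)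
    show "(monomial (f(k := a \<oplus>\<^bsub>S k\<^esub> b)) :: _ \<Rightarrow> 'f) \<in> carrier ?R" "(monomial (f(k := a)) :: _ \<Rightarrow> 'f) \<in> carrier ?R"
      "(monomial (f(k := b)) :: _ \<Rightarrow> 'f) \<in> carrier ?R"
      using that ab by (blast intro: mon upd)+
  qed
  have pure_smult: "pure (f(k := c \<odot>\<^bsub>S k\<^esub> a)) = c \<odot>\<^bsub>J.Q\<^esub> pure (f(k := a))"
    if "f \<in> carrier ?P" "k \<in> I" "a \<in> carrier (S k)" for f k a c
  proof -
    interpret Sk: matrix_rep "S k" G "\<psi> k" by (rule rep[OF that(2)])
    have cl: "(monomial (f(k := c \<odot>\<^bsub>S k\<^esub> a)) :: _ \<Rightarrow> 'f) \<in> carrier ?R" "(monomial (f(k := a)) :: _ \<Rightarrow> 'f) \<in> carrier ?R"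
      using that Sk.smult_closed by (blast intro: mon upd)+
    have "J.proj (monomial (f(k := c \<odot>\<^bsub>S k\<^esub> a))) = J.proj (c \<odot>\<^bsub>?R\<^esub> monomial (f(k := a)))"
    proof (rule J.proj_eqI[OF cl(1) R.smult_closed[OF cl(2)]])
      show "monomial (f(k := c \<odot>\<^bsub>S k\<^esub> a)) \<ominus>\<^bsub>?R\<^esub> c \<odot>\<^bsub>?R\<^esub> monomial (f(k := a)) \<in> Idl\<^bsub>?R\<^esub> ?rel"
        using that by (intro rq(4)) (unfold multilinear_relations_def Let_def, blast)
    qed
    then show ?thesis using cl by (simp add: pure_def J.proj_smult)
  qed
  have pure_cl: "pure f \<in> carrier J.Q" if "f \<in> carrier ?P" for f
    using mon[OF that] by (simp add: pure_def J.proj_closed)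
  define b where "b = (\<lambda>w. pure (\<lambda>k\<in>I. B k (w k)))"
  let ?T = "lspan J.Q (b ` PiE I (\<lambda>_. U))"
  have wP: "(\<lambda>k\<in>I. B k (w k)) \<in> carrier ?P" if "w \<in> PiE I (\<lambda>_. U)" for w
    using that B by auto
  \<comment> \<open>\<open>K\<close> contains the components that are not yet spanning elements; the
    induction expands one of them while the others stay fixed.\<close>
  have pure_span: "pure f \<in> ?T" if "finite K" "K \<subseteq> I" "f \<in> carrier ?P" "\<And>k. k \<in> I - K \<Longrightarrow> f k \<in> B k ` U" for K f
    using that
  proof (induction K arbitrary: f rule: finite_induct)
    case empty
    then have "\<forall>k\<in>I. \<exists>u\<in>U. f k = B k u" by auto
    then obtain w where w: "\<And>k. k \<in> I \<Longrightarrow> w k \<in> U \<and> f k = B k (w k)" by metis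
    have "f = (\<lambda>k\<in>I. B k (restrict w I k))"
      using empty.prems(2) w by (intro ext) (auto simp: PiE_iff extensional_def)
    then have "pure f = b (restrict w I)" by (simp only: b_def)
    moreover have "restrict w I \<in> PiE I (\<lambda>_. U)" using w by auto
    ultimately show ?case by (auto intro: lspan.base)
  next
    case (insert k K)
    have k: "k \<in> I" using insert.prems by auto
    interpret Sk: matrix_rep "S k" G "\<psi> k" by (rule rep[OF k])
    have Bk: "B k ` U \<subseteq> carrier (S k)" using B k by auto
    have "pure (f(k := a)) \<in> ?T" if "a \<in> lspan (S k) (B k ` U)" for a
      using that
    proof induction
      case zero
      \<comment> \<open>A zero component is 0 times itself, so homogeneity makes the tensor
        vanish.\<close>
      have "pure (f(k := \<zero>\<^bsub>S k\<^esub>)) = 0 \<odot>\<^bsub>J.Q\<^esub> pure (f(k := \<zero>\<^bsub>S k\<^esub>))"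
        using pure_smult[OF insert.prems(2) k Sk.zero_closed, of 0] by (simp add: Sk.smult_zero)
      also have "\<dots> = \<zero>\<^bsub>J.Q\<^esub>"
        using upd[OF insert.prems(2) k Sk.zero_closed] by (intro J.quot.smult_zero pure_cl)
      finally show ?case by (simp only: lspan.zero)
    next
      case (base a)
      show ?case
      proof (rule insert.IH)
        show "f(k := a) \<in> carrier ?P" using upd[OF insert.prems(2) k] Bk base by blast
        show "(f(k := a)) j \<in> B j ` U" if "j \<in> I - K" for j
          using that insert.prems(3) base by (cases "j = k") auto
      qed (use insert.prems in auto)
    next
      case (add a a')
      then show ?case
        using pure_add[OF insert.prems(2) k, of a a'] Sk.lspan_carrier[OF Bk] by (simp only: lspan.add)
    next
      case (smult a c)
      then show ?case
        using pure_smult[OF insert.prems(2) k, of a c] Sk.lspan_carrier[OF Bk] by (simp only: lspan.smult)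
    qed
    moreover have "f k \<in> lspan (S k) (B k ` U)" using span[OF k] memC[OF insert.prems(2) k] by blast
    ultimately have "pure (f(k := f k)) \<in> ?T" by blast
    then show ?case by simp
  qed
  have spanA: "carrier J.Q \<subseteq> ?T"
  proof
    fix z assume "z \<in> carrier J.Q"
    then obtain c where c: "c \<in> carrier ?R" "z = J.proj c" by (auto simp: J.carrier_Q)
    have "z \<in> lspan J.Q (J.proj ` monomial ` carrier ?P)"
      unfolding c(2) by (rule J.proj_lspan[OF _ monoid_algebra_lspan[OF c(1)]]) (use mon in blast)
    then show "z \<in> ?T"
    proof (rule J.quot.lspan_trans)
      fix y assume "y \<in> J.proj ` monomial ` carrier ?P"
      then obtain f where f: "f \<in> carrier ?P" and y: "y = pure f" unfolding pure_def by blast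
      show "y \<in> ?T" unfolding y using pure_span[OF I _ f] by blast
    qed
  qed
  show thesis
  proof (rule that[of \<Psi> b, unfolded A])
    show "matrix_rep J.Q ?GG \<Psi>" by (rule Psi)
    show "b w \<in> carrier J.Q" if "w \<in> PiE I (\<lambda>_. U)" for w
      unfolding b_def by (rule pure_cl[OF wP[OF that]])
    show "\<Psi> (b w) g h = (\<Prod>k\<in>I. \<psi> k (B k (w k)) (g k) (h k))"
      if "w \<in> PiE I (\<lambda>_. U)" "g \<in> ?GG" "h \<in> ?GG" for w g h
      unfolding b_def pure_def \<Psi>[OF mon[OF wP[OF that(1)]] that(2,3)] E.lin_ext_monomial H_def
      by (intro prod.cong) auto
    show "b w = \<one>\<^bsub>J.Q\<^esub>" if "w \<in> PiE I (\<lambda>_. U)" "\<And>k. k \<in> I \<Longrightarrow> B k (w k) = \<one>\<^bsub>S k\<^esub>" for w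
    proof -
      have "(\<lambda>k\<in>I. B k (w k)) = \<one>\<^bsub>?P\<^esub>" using that(2) by (auto intro!: restrict_ext)
      then show ?thesis by (simp only: b_def pure_def monoid_algebra_simps(5)[symmetric] J.proj_one)
    qed
    show "carrier J.Q \<subseteq> ?T" by (rule spanA)
  qed
qed

section \<open>Coordinates, splittings and the reduced trace\<close>

text \<open>The two records share their operations but may differ in the carrier: \<open>M\<close>
  will be the subspace \<open>A\<lparr>carrier := V\<rparr>\<close>.\<close>

lemma lspan_subset_span:
  fixes M :: "('f::field, 'a, 'b) module_scheme" and A :: "('f, 'a) module"
  assumes M: "vectorspace class_ring M" and S: "S \<subseteq> carrier M"
    and ops: "\<zero>\<^bsub>A\<^esub> = \<zero>\<^bsub>M\<^esub>" "add A = add M" "module.smult A = module.smult M"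
    and "a \<in> lspan A S"
  shows "a \<in> module.span class_ring M S"
proof -
  interpret M: vectorspace class_ring M by (rule M)
  interpret sp: submodule class_ring "M.span S" M by (rule M.span_is_submodule[OF S])
  show ?thesis
    using \<open>a \<in> lspan A S\<close>
  proof induction
    case zero
    then show ?case by (simp only: ops sp.zero_closed)
  next
    case (base b)
    then show ?case using M.in_own_span[OF S] by blast
  next
    case (add a a')
    then show ?case by (simp only: ops sp.m_closed)
  next
    case (smult a c)
    then show ?case unfolding ops by (intro sp.smult_closed) auto
  qed
qed

text \<open>Gaussian elimination on the coordinates \<open>\<kappa>\<close>, one at a time.\<close>

lemma (in assoc_algebra) generators_from_coordinates:
  fixes \<kappa> :: "'a \<Rightarrow> 'w \<Rightarrow> 'f"
  assumes "finite C" "V \<subseteq> carrier A" "\<And>a a'. a \<in> V \<Longrightarrow> a' \<in> V \<Longrightarrow> a \<oplus> a' \<in> V" "\<And>c a. a \<in> V \<Longrightarrow> c \<odot> a \<in> V"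
    and k_add: "\<And>a a' w. a \<in> carrier A \<Longrightarrow> a' \<in> carrier A \<Longrightarrow> \<kappa> (a \<oplus> a') w = \<kappa> a w + \<kappa> a' w"
    and k_smult: "\<And>c a w. a \<in> carrier A \<Longrightarrow> \<kappa> (c \<odot> a) w = c * \<kappa> a w"
    and "\<And>a. a \<in> V \<Longrightarrow> (\<And>w. w \<in> C \<Longrightarrow> \<kappa> a w = 0) \<Longrightarrow> a = \<zero>"
  shows "\<exists>S. S \<subseteq> V \<and> finite S \<and> card S \<le> card C \<and> V \<subseteq> lspan A S"
  using assms(1-4,7)
proof (induction C arbitrary: V rule: finite_induct)
  case empty
  then show ?case using lspan.zero[of A "{}"] by (intro exI[of _ "{}"]) auto
next
  case (insert c C)
  note VA = insert.prems(1) and V_add = insert.prems(2) and V_smult = insert.prems(3)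
  \<comment> \<open>The kernel of the coordinate \<open>c\<close> on \<open>V\<close>; any element
    of \<open>V\<close> outside it can serve as the pivot \<open>z\<close>.\<close>
  define V' where "V' = {a\<in>V. \<kappa> a c = 0}"
  have "\<exists>S. S \<subseteq> V' \<and> finite S \<and> card S \<le> card C \<and> V' \<subseteq> lspan A S"
  proof (rule insert.IH)
    show "V' \<subseteq> carrier A" using VA by (auto simp: V'_def)
    show "a \<oplus> a' \<in> V'" if "a \<in> V'" "a' \<in> V'" for a a'
    proof -
      have "a \<in> carrier A" "a' \<in> carrier A" using that VA by (auto simp: V'_def)
      then show ?thesis using that V_add by (simp add: V'_def k_add)
    qed
    show "d \<odot> a \<in> V'" if "a \<in> V'" for d a
    proof -
      have "a \<in> carrier A" using that VA by (auto simp: V'_def)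
      then show ?thesis using that V_smult by (simp add: V'_def k_smult)
    qed
    show "a = \<zero>" if "a \<in> V'" "\<And>w. w \<in> C \<Longrightarrow> \<kappa> a w = 0" for a
      using insert.prems(4)[of a] that by (auto simp: V'_def)
  qed
  then obtain S where S: "S \<subseteq> V'" "finite S" "card S \<le> card C" "V' \<subseteq> lspan A S" by blast
  show ?case
  proof (cases "\<exists>z\<in>V. \<kappa> z c \<noteq> 0")
    case False
    then have "V' = V" by (auto simp: V'_def)
    then show ?thesis using S insert.hyps by (intro exI[of _ S]) auto
  next
    case True
    then obtain z where z: "z \<in> V" "\<kappa> z c \<noteq> 0" by blast
    have mono: "y \<in> lspan A (insert z S)" if "y \<in> lspan A S" for y
      using that by (rule lspan_trans) (auto intro: lspan.base)
    have "y \<in> lspan A (insert z S)" if y: "y \<in> V" for y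
    proof -
      define d where "d = \<kappa> y c / \<kappa> z c"
      have cl: "y \<in> carrier A" "z \<in> carrier A" using y z VA by auto
      have "y \<oplus> (- d) \<odot> z \<in> V'"
        using V_add[OF y V_smult[OF z(1)], of "- d"] cl z(2)
        by (simp add: V'_def k_add k_smult smult_closed d_def)
      then have "y \<oplus> (- d) \<odot> z \<in> lspan A (insert z S)" using S(4) mono by blast
      moreover have "d \<odot> z \<in> lspan A (insert z S)" by (intro lspan.smult lspan.base) simp
      ultimately have "(y \<oplus> (- d) \<odot> z) \<oplus> d \<odot> z \<in> lspan A (insert z S)" by (rule lspan.add)
      moreover have "(y \<oplus> (- d) \<odot> z) \<oplus> d \<odot> z = y"
        using cl smult_l_distr[of z "- d" d] by (simp add: a_assoc smult_closed smult_zero)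
      ultimately show ?thesis by simp
    qed
    moreover have "insert z S \<subseteq> V" using S(1) z by (auto simp: V'_def)
    moreover have "card (insert z S) \<le> card (insert c C)"
      using S insert.hyps by (simp add: card_insert_if)
    ultimately show ?thesis using S(2) by (intro exI[of _ "insert z S"]) auto
  qed
qed

text \<open>A bound on \<open>vectorspace.dim\<close> has content only together with
  \<open>fin_dim\<close>; both follow from one finite generating set.\<close>

theorem (in assoc_algebra) dim_le_card_coordinates:
  fixes \<kappa> :: "'a \<Rightarrow> 'w \<Rightarrow> 'f"
  assumes C: "finite C" and V: "VectorSpace.subspace class_ring V A"
    and k_add: "\<And>a a' w. a \<in> carrier A \<Longrightarrow> a' \<in> carrier A \<Longrightarrow> \<kappa> (a \<oplus> a') w = \<kappa> a w + \<kappa> a' w"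
    and k_smult: "\<And>c a w. a \<in> carrier A \<Longrightarrow> \<kappa> (c \<odot> a) w = c * \<kappa> a w"
    and k_inj: "\<And>a. a \<in> V \<Longrightarrow> (\<And>w. w \<in> C \<Longrightarrow> \<kappa> a w = 0) \<Longrightarrow> a = \<zero>"
  shows "vectorspace.fin_dim class_ring (A\<lparr>carrier := V\<rparr>) \<and>
    vectorspace.dim class_ring (A\<lparr>carrier := V\<rparr>) \<le> card C"
proof -
  interpret A: vectorspace class_ring A by (rule vectorspace)
  interpret sub: submodule class_ring V A using V by (simp add: subspace_def)
  interpret V: vectorspace class_ring "A\<lparr>carrier := V\<rparr>" by (rule A.subspace_is_vs[OF V])
  obtain S where S: "S \<subseteq> V" "finite S" "card S \<le> card C" "V \<subseteq> lspan A S"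
    using generators_from_coordinates[OF C, of V \<kappa>] sub.subset sub.m_closed sub.smult_closed k_add k_smult k_inj
    by (auto simp del: sub.m_closed sub.smult_closed)
  have SV: "S \<subseteq> carrier (A\<lparr>carrier := V\<rparr>)" using S by simp
  interpret sp: submodule class_ring "V.span S" "A\<lparr>carrier := V\<rparr>" by (rule V.span_is_submodule[OF SV])
  have "V \<subseteq> V.span S"
    using S(4) lspan_subset_span[OF V.vectorspace_axioms SV, of A] by auto
  then have gen: "V.gen_set S" using sp.subset by auto
  then have "V.fin_dim" unfolding V.fin_dim_def using S SV by blast
  then show ?thesis using V.gen_ge_dim[OF S(2) SV gen] S(3) by simp
qed

theorem family_basis:
  fixes M :: "('f::field, 'a, 'b) module_scheme"
  assumes M: "vectorspace class_ring M" and W: "finite W" and f: "f \<in> W \<rightarrow> carrier M" and inj: "inj_on f W"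
    and indep: "\<And>c w. finsum M (\<lambda>w. c w \<odot>\<^bsub>M\<^esub> f w) W = \<zero>\<^bsub>M\<^esub> \<Longrightarrow> w \<in> W \<Longrightarrow> c w = 0"
    and gen: "\<And>v. v \<in> carrier M \<Longrightarrow> \<exists>c. v = finsum M (\<lambda>w. c w \<odot>\<^bsub>M\<^esub> f w) W"
  shows "vectorspace.basis class_ring M (f ` W)"
proof -
  interpret M: vectorspace class_ring M by (rule M)
  have sub: "f ` W \<subseteq> carrier M" using f by auto
  have smult: "c \<odot>\<^bsub>M\<^esub> f w \<in> carrier M" if "w \<in> W" for c w using f that by auto
  have lc: "M.lincomb a (f ` W) = finsum M (\<lambda>w. a (f w) \<odot>\<^bsub>M\<^esub> f w) W" for a
    unfolding M.lincomb_def using inj smult by (subst M.finsum_reindex) auto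
  have "M.lin_indpt (f ` W)"
    by (rule M.finite_lin_indpt2) (use W sub indep lc in auto)
  moreover have "carrier M \<subseteq> M.span (f ` W)"
  proof
    fix v assume "v \<in> carrier M"
    then obtain c where c: "v = finsum M (\<lambda>w. c w \<odot>\<^bsub>M\<^esub> f w) W" using gen by blast
    have "v = M.lincomb (c \<circ> the_inv_into W f) (f ` W)"
      unfolding lc c using inj smult by (intro M.finsum_cong') (auto simp: the_inv_into_f_f)
    moreover have "finite (f ` W)" using W by (rule finite_imageI)
    ultimately show "v \<in> M.span (f ` W)" unfolding M.span_def mem_Collect_eq
      by (intro exI[of _ "c \<circ> the_inv_into W f"] exI[of _ "f ` W"] conjI) auto
  qed
  moreover have "M.span (f ` W) \<subseteq> carrier M"
    using M.span_is_submodule[OF sub] by (simp add: submodule_def)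
  ultimately show ?thesis unfolding M.basis_def using sub by auto
qed

lemma finsum_mat_index:
  assumes "finite S" "\<And>s. s \<in> S \<Longrightarrow> F s \<in> carrier_mat n m" "i < n" "j < m"
  shows "finsum (module_mat TYPE('e::field) n m) F S \<in> carrier_mat n m \<and>
    finsum (module_mat TYPE('e::field) n m) F S $$ (i, j) = (\<Sum>s\<in>S. F s $$ (i, j))"
  using assms(1,2)
proof (induction S)
  case empty
  interpret M: vectorspace class_ring "module_mat TYPE('e) n m" by (rule matrix_vs)
  show ?case using assms by (simp add: module_mat_simps)
next
  case (insert s S)
  interpret M: vectorspace class_ring "module_mat TYPE('e) n m" by (rule matrix_vs)
  have "finsum (module_mat TYPE('e) n m) F (insert s S) = F s + finsum (module_mat TYPE('e) n m) F S"
    using insert by (subst M.finsum_insert) (auto simp: module_mat_simps)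
  then show ?case using insert assms(3,4) by auto
qed

text \<open>\<open>T\<close> and \<open>D\<close> have entries in the algebraic closure, but
  \<gamma> takes values in the base field. So the coordinates of products stay in the base field
  although elements are compared as matrices over the closure.\<close>

locale split_algebra = matrix_rep A G \<Psi> + matrix_basis W G T D "\<lambda>w w' w''. to_ac (\<gamma> w w' w'')"
  for A :: "('f::field, 'a) module" (structure) and G :: "'g set" and \<Psi>
    and W :: "'w set" and T D and \<gamma> :: "'w \<Rightarrow> 'w \<Rightarrow> 'w \<Rightarrow> 'f" +
  fixes b :: "'w \<Rightarrow> 'a" and u :: 'w
  assumes b_closed: "w \<in> W \<Longrightarrow> b w \<in> carrier A"
    and rep_b: "w \<in> W \<Longrightarrow> g \<in> G \<Longrightarrow> h \<in> G \<Longrightarrow> \<Psi> (b w) g h = T w g h"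
    and b_span: "carrier A \<subseteq> lspan A (b ` W)"
    and u: "u \<in> W" "b u = \<one>"
begin

definition comb :: "('w \<Rightarrow> 'f) \<Rightarrow> 'a" where
  "comb c = finsum A (\<lambda>w. c w \<odot> b w) W"

text \<open>The dual basis computes coordinates over the closure. By \<open>exists_comb\<close> they
  come from the base field, so that \<open>of_ac\<close> recovers them.\<close>

definition coord :: "'a \<Rightarrow> 'w \<Rightarrow> 'f" where
  "coord a w = of_ac (\<Sum>g\<in>G. \<Sum>h\<in>G. D w g h * \<Psi> a g h)"

lemma smult_b: "w \<in> W \<Longrightarrow> c \<odot> b w \<in> carrier A"
  by (simp add: b_closed smult_closed)

lemma comb_closed: "comb c \<in> carrier A"
  unfolding comb_def by (rule finsum_closed) (auto simp: smult_b)

lemma comb_cong: "(\<And>w. w \<in> W \<Longrightarrow> c w = c' w) \<Longrightarrow> comb c = comb c'"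
  unfolding comb_def by (rule finsum_cong') (auto simp: smult_b)

lemma comb_add: "comb (\<lambda>w. c w + d w) = comb c \<oplus> comb d"
proof -
  have "comb (\<lambda>w. c w + d w) = finsum A (\<lambda>w. c w \<odot> b w \<oplus> d w \<odot> b w) W"
    unfolding comb_def by (rule finsum_cong') (auto simp: smult_b b_closed smult_l_distr)
  then show ?thesis unfolding comb_def by (subst finsum_addf[symmetric]) (auto simp: smult_b)
qed

lemma comb_smult: "comb (\<lambda>w. d * c w) = d \<odot> comb c"
proof -
  have "finsum A (\<lambda>w. (d * c w) \<odot> b w) S = d \<odot> finsum A (\<lambda>w. c w \<odot> b w) S" if "finite S" "S \<subseteq> W" for S
    using that
  proof (induction S)
    case empty
    have "d \<odot> \<zero> = \<zero>" using smult_assoc[of \<zero> d 0] smult_zero[of \<zero>] by simp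
    then show ?case by simp
  next
    case (insert s S)
    have cl: "(\<lambda>w. c w \<odot> b w) \<in> S \<rightarrow> carrier A" "(\<lambda>w. (d * c w) \<odot> b w) \<in> S \<rightarrow> carrier A"
      using insert.prems smult_b by auto
    show ?case
      using insert cl smult_b[of s] b_closed[of s]
      by (simp add: smult_r_distr smult_assoc smult_closed finsum_closed)
  qed
  then show ?thesis unfolding comb_def using finite_W by blast
qed

lemma comb_unit: "w \<in> W \<Longrightarrow> comb (\<lambda>x. if w = x then 1 else 0) = b w"
proof -
  assume w: "w \<in> W"
  have "comb (\<lambda>x. if w = x then 1 else 0) = finsum A (\<lambda>x. if w = x then b x else \<zero>) W"
    unfolding comb_def by (rule finsum_cong') (auto simp: b_closed smult_one smult_zero)
  also have "\<dots> = b w" by (rule finsum_singleton) (use w finite_W b_closed in auto)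
  finally show ?thesis .
qed

lemma exists_comb:
  assumes "a \<in> carrier A"
  shows "\<exists>c. a = comb c"
proof -
  have "a \<in> lspan A (b ` W)" using assms b_span by blast
  then show ?thesis
  proof induction
    case zero
    have "comb (\<lambda>_. 0) = 0 \<odot> comb (\<lambda>_. 0)" using comb_smult[of 0 "\<lambda>_. 0"] by simp
    then show ?case using smult_zero[OF comb_closed] by metis
  next
    case (base y)
    then obtain w where "w \<in> W" "y = b w" by blast
    then show ?case using comb_unit by metis
  next
    case (add a a')
    then show ?case using comb_add by metis
  next
    case (smult a c)
    then show ?case using comb_smult by metis
  qed
qed

lemma rep_comb:
  assumes "g \<in> G" "h \<in> G"
  shows "\<Psi> (comb c) g h = (\<Sum>w\<in>W. to_ac (c w) * T w g h)"
proof -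
  have "\<Psi> (finsum A (\<lambda>w. c w \<odot> b w) S) g h = (\<Sum>w\<in>S. to_ac (c w) * T w g h)" if "finite S" "S \<subseteq> W" for S
    using that
  proof (induction S)
    case empty
    then show ?case using assms by (simp add: rep_zero)
  next
    case (insert s S)
    have cl: "(\<lambda>w. c w \<odot> b w) \<in> S \<rightarrow> carrier A" using insert.prems smult_b by auto
    then show ?case
      using insert smult_b[of s] b_closed[of s] assms
      by (simp add: rep_add rep_smult rep_b finsum_closed)
  qed
  then show ?thesis unfolding comb_def using finite_W by blast
qed

lemma coord_comb: "w \<in> W \<Longrightarrow> coord (comb c) w = c w"
  using coordinate_eq[of w "\<lambda>w. to_ac (c w)"] by (simp add: coord_def rep_comb)

lemma comb_coord: "a \<in> carrier A \<Longrightarrow> comb (coord a) = a"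
  using exists_comb coord_comb comb_cong by metis

lemma rep_coord: "a \<in> carrier A \<Longrightarrow> g \<in> G \<Longrightarrow> h \<in> G \<Longrightarrow> \<Psi> a g h = (\<Sum>w\<in>W. to_ac (coord a w) * T w g h)"
  using rep_comb[of g h "coord a"] comb_coord[of a] by simp

lemma coord_add: "a \<in> carrier A \<Longrightarrow> a' \<in> carrier A \<Longrightarrow> w \<in> W \<Longrightarrow> coord (a \<oplus> a') w = coord a w + coord a' w"
  using comb_add[of "coord a" "coord a'"] coord_comb[of w "\<lambda>w. coord a w + coord a' w"] by (simp add: comb_coord)

lemma coord_smult: "a \<in> carrier A \<Longrightarrow> w \<in> W \<Longrightarrow> coord (c \<odot> a) w = c * coord a w"
  using comb_smult[of c "coord a"] coord_comb[of w "\<lambda>w. c * coord a w"] by (simp add: comb_coord)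

lemma coord_b: "w \<in> W \<Longrightarrow> w' \<in> W \<Longrightarrow> coord (b w) w' = (if w = w' then 1 else 0)"
  using comb_unit[of w] coord_comb[of w' "\<lambda>x. if w = x then 1 else 0"] by simp

text \<open>Both sides are compared as matrices, where \<open>T_mult\<close> gives the product;
  coordinates over the closure are unique.\<close>

lemma coord_mult:
  assumes a: "a \<in> carrier A" "a' \<in> carrier A" and w: "w'' \<in> W"
  shows "coord (a \<otimes> a') w'' = (\<Sum>w\<in>W. \<Sum>w'\<in>W. coord a w * coord a' w' * \<gamma> w w' w'')"
proof -
  let ?c = "\<lambda>w''. \<Sum>w\<in>W. \<Sum>w'\<in>W. coord a w * coord a' w' * \<gamma> w w' w''"
  have "(\<Sum>w\<in>W. to_ac (coord (a \<otimes> a') w) * T w g h) = (\<Sum>w\<in>W. to_ac (?c w) * T w g h)"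
    if gh: "g \<in> G" "h \<in> G" for g h
  proof -
    have "(\<Sum>w\<in>W. to_ac (coord (a \<otimes> a') w) * T w g h) = (\<Sum>l\<in>G. \<Psi> a g l * \<Psi> a' l h)"
      using a gh by (simp add: rep_coord[symmetric] rep_mult)
    also have "\<dots> = (\<Sum>l\<in>G. \<Sum>w\<in>W. \<Sum>w'\<in>W. to_ac (coord a w * coord a' w') * (T w g l * T w' l h))"
    proof (intro sum.cong refl)
      fix l assume l: "l \<in> G"
      show "\<Psi> a g l * \<Psi> a' l h = (\<Sum>w\<in>W. \<Sum>w'\<in>W. to_ac (coord a w * coord a' w') * (T w g l * T w' l h))"
        unfolding rep_coord[OF a(1) gh(1) l] rep_coord[OF a(2) l gh(2)] sum_product
        by (intro sum.cong refl) (simp add: mult_ac)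
    qed
    also have "\<dots> = (\<Sum>w\<in>W. \<Sum>w'\<in>W. \<Sum>l\<in>G. to_ac (coord a w * coord a' w') * (T w g l * T w' l h))"
      by (rule sum_swap3[symmetric])
    also have "\<dots> = (\<Sum>w\<in>W. \<Sum>w'\<in>W. \<Sum>w''\<in>W. to_ac (coord a w * coord a' w' * \<gamma> w w' w'') * T w'' g h)"
      using gh by (intro sum.cong refl) (simp add: sum_distrib_left[symmetric] T_mult mult.assoc)
    also have "\<dots> = (\<Sum>w''\<in>W. \<Sum>w\<in>W. \<Sum>w'\<in>W. to_ac (coord a w * coord a' w' * \<gamma> w w' w'') * T w'' g h)"
      by (rule sum_swap3)
    also have "\<dots> = (\<Sum>w\<in>W. to_ac (?c w) * T w g h)"
      by (simp only: to_ac_sum sum_distrib_right)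
    finally show ?thesis .
  qed
  then have "to_ac (coord (a \<otimes> a') w'') = to_ac (?c w'')"
    by (rule coordinates_unique[OF _ w])
  then show ?thesis by (simp only: to_ac_eq_iff)
qed

lemma coord_zero_imp: "a \<in> carrier A \<Longrightarrow> (\<And>w. w \<in> W \<Longrightarrow> coord a w = 0) \<Longrightarrow> a = \<zero>"
proof -
  assume a: "a \<in> carrier A" "\<And>w. w \<in> W \<Longrightarrow> coord a w = 0"
  have "a = comb (coord a)" using comb_coord[OF a(1)] by simp
  also have "\<dots> = comb (\<lambda>w. 0 * coord a w)" by (rule comb_cong) (simp add: a(2))
  also have "\<dots> = 0 \<odot> comb (coord a)" by (rule comb_smult)
  also have "\<dots> = \<zero>" by (rule smult_zero[OF comb_closed])
  finally show "a = \<zero>" .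
qed

lemma inj_b: "inj_on b W"
proof (rule inj_onI)
  fix w w' assume w: "w \<in> W" "w' \<in> W" "b w = b w'"
  then show "w = w'" using coord_b[of w w] coord_b[of w' w] by (metis zero_neq_one)
qed

lemma basis_b: "vectorspace.basis class_ring A (b ` W)"
proof (rule family_basis[OF vectorspace finite_W _ inj_b])
  show "b \<in> W \<rightarrow> carrier A" using b_closed by auto
  have comb_0: "coord \<zero> w = 0" if "w \<in> W" for w
    using coord_smult[of \<zero> w 0] that smult_zero[of \<zero>] by simp
  show "c w = 0" if "finsum A (\<lambda>w. c w \<odot> b w) W = \<zero>" "w \<in> W" for c w
    using coord_comb[OF that(2), of c] comb_0[OF that(2)] that(1) by (simp add: comb_def)
  show "\<exists>c. v = finsum A (\<lambda>w. c w \<odot> b w) W" if "v \<in> carrier A" for v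
    using exists_comb[OF that] by (simp add: comb_def)
qed

text \<open>\<open>reduced_trace\<close> picks a splitting by \<open>SOME\<close>, so one has to
  exist before anything can be said about the picked one.\<close>

theorem exists_splitting: "\<exists>n \<phi>. splitting A n \<phi>"
proof -
  \<comment> \<open>Matrices of type \<open>mat\<close> are indexed by numbers, so \<open>G\<close>
    is enumerated.\<close>
  obtain e where e: "bij_betw e {..<card G} G"
    using ex_bij_betw_nat_finite[OF finite_G] by (auto simp: lessThan_atLeast0)
  define n where "n = card G"
  define \<phi> where "\<phi> = (\<lambda>a. mat n n (\<lambda>(i, j). \<Psi> a (e i) (e j)))"
  have eG: "e i \<in> G" if "i < n" for i using e that by (auto simp: bij_betw_def n_def)
  have e_inj: "e i = e j \<longleftrightarrow> i = j" if "i < n" "j < n" for i j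
    using e that by (auto simp: bij_betw_def n_def inj_on_def)
  have cl: "\<phi> a \<in> carrier_mat n n" for a by (simp add: \<phi>_def)
  have idx: "\<phi> a $$ (i, j) = \<Psi> a (e i) (e j)" if "i < n" "j < n" for a i j using that by (simp add: \<phi>_def)
  have surj: "\<exists>i<n. g = e i" if "g \<in> G" for g using e that by (auto simp: bij_betw_def n_def)
  have hom: "\<phi> \<in> Ring.ring_hom A (ring_mat TYPE('f alg_closure) n ())"
  proof (rule ring_hom_memI)
    fix x y assume xy: "x \<in> carrier A" "y \<in> carrier A"
    show "\<phi> x \<in> carrier (ring_mat TYPE('f alg_closure) n ())" by (simp add: ring_mat_simps cl)
    show "\<phi> (x \<otimes> y) = \<phi> x \<otimes>\<^bsub>ring_mat TYPE('f alg_closure) n ()\<^esub> \<phi> y"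
    proof (rule eq_matI)
      fix i j assume "i < dim_row (\<phi> x \<otimes>\<^bsub>ring_mat TYPE('f alg_closure) n ()\<^esub> \<phi> y)"
        "j < dim_col (\<phi> x \<otimes>\<^bsub>ring_mat TYPE('f alg_closure) n ()\<^esub> \<phi> y)"
      then have ij: "i < n" "j < n" by (simp_all add: ring_mat_simps \<phi>_def)
      have "\<phi> (x \<otimes> y) $$ (i, j) = (\<Sum>l\<in>G. \<Psi> x (e i) l * \<Psi> y l (e j))"
        using xy ij eG by (simp add: idx rep_mult)
      also have "\<dots> = (\<Sum>k<n. \<Psi> x (e i) (e k) * \<Psi> y (e k) (e j))"
        using sum.reindex_bij_betw[OF e, of "\<lambda>l. \<Psi> x (e i) l * \<Psi> y l (e j)"] by (simp add: n_def)
      finally show "\<phi> (x \<otimes> y) $$ (i, j) = (\<phi> x \<otimes>\<^bsub>ring_mat TYPE('f alg_closure) n ()\<^esub> \<phi> y) $$ (i, j)"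
        using ij by (simp add: ring_mat_simps \<phi>_def scalar_prod_def lessThan_atLeast0)
    qed (simp_all add: ring_mat_simps \<phi>_def)
    show "\<phi> (x \<oplus> y) = \<phi> x \<oplus>\<^bsub>ring_mat TYPE('f alg_closure) n ()\<^esub> \<phi> y"
      using xy eG by (intro eq_matI) (auto simp: ring_mat_simps \<phi>_def rep_add)
  next
    show "\<phi> \<one> = \<one>\<^bsub>ring_mat TYPE('f alg_closure) n ()\<^esub>"
      using eG by (intro eq_matI) (auto simp: ring_mat_simps \<phi>_def rep_one e_inj)
  qed
  have smult: "\<phi> (c \<odot> a) = to_ac c \<cdot>\<^sub>m \<phi> a" if "a \<in> carrier A" for c a
    using that eG by (intro eq_matI) (auto simp: \<phi>_def rep_smult)
  have fin: "finsum (module_mat TYPE('f alg_closure) n n) (\<lambda>w. c w \<odot>\<^bsub>module_mat TYPE('f alg_closure) n n\<^esub> \<phi> (b w)) W $$ (i, j)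
      = (\<Sum>w\<in>W. c w * T w (e i) (e j))" if "i < n" "j < n" for c i j
  proof -
    have "finsum (module_mat TYPE('f alg_closure) n n) (\<lambda>w. c w \<odot>\<^bsub>module_mat TYPE('f alg_closure) n n\<^esub> \<phi> (b w)) W $$ (i, j) =
      (\<Sum>w\<in>W. (c w \<odot>\<^bsub>module_mat TYPE('f alg_closure) n n\<^esub> \<phi> (b w)) $$ (i, j))"
      using finsum_mat_index[OF finite_W, of "\<lambda>w. c w \<odot>\<^bsub>module_mat TYPE('f alg_closure) n n\<^esub> \<phi> (b w)" n n i j] cl that
      by (auto simp: module_mat_simps)
    also have "\<dots> = (\<Sum>w\<in>W. c w * T w (e i) (e j))"
      using that eG cl by (intro sum.cong refl) (simp add: module_mat_simps \<phi>_def rep_b)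
    finally show ?thesis .
  qed
  have indep: "c w = 0" if "finsum (module_mat TYPE('f alg_closure) n n) (\<lambda>w. c w \<odot>\<^bsub>module_mat TYPE('f alg_closure) n n\<^esub> \<phi> (b w)) W = 0\<^sub>m n n"
    "w \<in> W" for c w
  proof (rule coordinates_unique[of c "\<lambda>_. 0", OF _ that(2)])
    fix g h assume "g \<in> G" "h \<in> G"
    then obtain i j where ij: "i < n" "g = e i" "j < n" "h = e j" using surj by metis
    then show "(\<Sum>w\<in>W. c w * T w g h) = (\<Sum>w\<in>W. 0 * T w g h)"
      using fin[of i j c] that(1) by simp
  qed
  have inj: "inj_on (\<lambda>w. \<phi> (b w)) W"
  proof (rule inj_onI)
    fix w w' assume w: "w \<in> W" "w' \<in> W" "\<phi> (b w) = \<phi> (b w')"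
    have "T w g h = T w' g h" if gh: "g \<in> G" "h \<in> G" for g h
    proof -
      obtain i j where ij: "i < n" "g = e i" "j < n" "h = e j" using surj gh by metis
      then have "\<Psi> (b w) g h = \<Psi> (b w') g h" using arg_cong[OF w(3), of "\<lambda>Z. Z $$ (i, j)"] by (simp add: idx)
      then show ?thesis using w gh by (simp add: rep_b)
    qed
    then have "(\<Sum>g\<in>G. \<Sum>h\<in>G. D w g h * T w g h) = (\<Sum>g\<in>G. \<Sum>h\<in>G. D w g h * T w' g h)" by simp
    then show "w = w'" using dual1[OF w(1,1)] dual1[OF w(1,2)] by (auto split: if_splits)
  qed
  have basis: "vectorspace.basis class_ring (module_mat TYPE('f alg_closure) n n) ((\<lambda>w. \<phi> (b w)) ` W)"
  proof (rule family_basis[OF matrix_vs finite_W _ inj])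
    show "(\<lambda>w. \<phi> (b w)) \<in> W \<rightarrow> carrier (module_mat TYPE('f alg_closure) n n)" using cl by (auto simp: module_mat_simps)
    show "c w = 0" if "finsum (module_mat TYPE('f alg_closure) n n) (\<lambda>w. c w \<odot>\<^bsub>module_mat TYPE('f alg_closure) n n\<^esub> \<phi> (b w)) W =
       \<zero>\<^bsub>module_mat TYPE('f alg_closure) n n\<^esub>" "w \<in> W" for c w
      using indep[of c w] that by (simp only: module_mat_simps)
    fix Z :: "'f alg_closure mat" assume "Z \<in> carrier (module_mat TYPE('f alg_closure) n n)"
    then have Z: "Z \<in> carrier_mat n n" by (simp add: module_mat_simps)
    define Y where "Y = (\<lambda>g h. Z $$ (the_inv_into {..<n} e g, the_inv_into {..<n} e h))"
    define c where "c = (\<lambda>w. \<Sum>g\<in>G. \<Sum>h\<in>G. D w g h * Y g h)"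
    let ?s = "finsum (module_mat TYPE('f alg_closure) n n) (\<lambda>w. c w \<odot>\<^bsub>module_mat TYPE('f alg_closure) n n\<^esub> \<phi> (b w)) W"
    interpret M: vectorspace class_ring "module_mat TYPE('f alg_closure) n n" by (rule matrix_vs)
    have "?s \<in> carrier (module_mat TYPE('f alg_closure) n n)"
      by (rule M.finsum_closed) (use cl in \<open>auto simp: module_mat_simps\<close>)
    then have s: "?s \<in> carrier_mat n n" by (simp add: module_mat_simps)
    have "Z = ?s"
    proof (rule eq_matI)
      fix i j assume "i < dim_row ?s" "j < dim_col ?s"
      then have ij: "i < n" "j < n" using s by auto
      have "the_inv_into {..<n} e (e k) = k" if "k < n" for k
        using e that by (intro the_inv_into_f_f) (auto simp: bij_betw_def n_def)
      then have "Y (e i) (e j) = Z $$ (i, j)" using ij by (simp add: Y_def)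
      then show "Z $$ (i, j) = ?s $$ (i, j)"
        using fin[OF ij, of c] spanning[OF eG[OF ij(1)] eG[OF ij(2)], of Y] by (simp add: c_def)
    qed (use s Z in auto)
    then show "\<exists>c. Z = finsum (module_mat TYPE('f alg_closure) n n) (\<lambda>w. c w \<odot>\<^bsub>module_mat TYPE('f alg_closure) n n\<^esub> \<phi> (b w)) W" by blast
  qed
  have "splitting A n \<phi>"
    unfolding splitting_def
  proof (intro conjI exI[of _ "b ` W"])
    show "inj_on \<phi> (b ` W)" using inj by (auto simp: inj_on_def)
    show "vectorspace.basis class_ring (module_mat TYPE('f alg_closure) n n) (\<phi> ` b ` W)"
      using basis by (simp add: image_image)
  qed (use hom smult basis_b in auto)
  then show ?thesis by blast
qed

text \<open>The images \<open>N w\<close> of the basis elements have the structure constants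
  \<gamma> and span all matrices, so \<open>trace_unique\<close> compares the given splitting with
  \<open>T\<close>, whatever its size \<open>n\<close> is.\<close>

theorem splitting_trace:
  assumes sp: "splitting A n \<phi>"
  obtains s where "s * s = 1" "\<And>a. a \<in> carrier A \<Longrightarrow>
    mat_trace (\<phi> a) = s * (\<Sum>w\<in>W. to_ac (coord a w) * (\<Sum>g\<in>G. T w g g))"
proof -
  have hom: "\<phi> \<in> Ring.ring_hom A (ring_mat TYPE('f alg_closure) n ())"
    and smult: "\<And>c a. a \<in> carrier A \<Longrightarrow> \<phi> (c \<odot> a) = to_ac c \<cdot>\<^sub>m \<phi> a"
    using sp by (auto simp: splitting_def)
  obtain B where B: "vectorspace.basis class_ring A B"
    "vectorspace.basis class_ring (module_mat TYPE('f alg_closure) n n) (\<phi> ` B)"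
    using sp by (auto simp: splitting_def)
  interpret M: vectorspace class_ring "module_mat TYPE('f alg_closure) n n" by (rule matrix_vs)
  interpret AV: vectorspace class_ring A by (rule vectorspace)
  have cl: "\<phi> a \<in> carrier_mat n n" if "a \<in> carrier A" for a
    using ring_hom_closed[OF hom that] by (simp add: ring_mat_simps)
  have add: "\<phi> (a \<oplus> a') = \<phi> a + \<phi> a'" if "a \<in> carrier A" "a' \<in> carrier A" for a a'
    using ring_hom_add[OF hom that] by (simp add: ring_mat_simps)
  have mult: "\<phi> (a \<otimes> a') = \<phi> a * \<phi> a'" if "a \<in> carrier A" "a' \<in> carrier A" for a a'
    using ring_hom_mult[OF hom that] by (simp add: ring_mat_simps)
  define N where "N = (\<lambda>w i j. \<phi> (b w) $$ (i, j))"
  have phi_N: "\<phi> a $$ (i, j) = (\<Sum>w\<in>W. to_ac (coord a w) * N w i j)" if a: "a \<in> carrier A" and ij: "i < n" "j < n" for a i j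
  proof -
    have "\<phi> (finsum A (\<lambda>w. coord a w \<odot> b w) S) $$ (i, j) = (\<Sum>w\<in>S. to_ac (coord a w) * N w i j)" if "finite S" "S \<subseteq> W" for S
      using that
    proof (induction S)
      case empty
      have "\<phi> \<zero> = 0 \<cdot>\<^sub>m \<phi> \<zero>" using smult[of \<zero> 0] smult_zero[of \<zero>] by simp
      then have "\<phi> \<zero> $$ (i, j) = (0 \<cdot>\<^sub>m \<phi> \<zero>) $$ (i, j)" by simp
      then show ?case using cl[OF zero_closed] ij by simp
    next
      case (insert s S)
      have "finsum A (\<lambda>w. coord a w \<odot> b w) S \<in> carrier A"
        by (rule finsum_closed) (use insert.prems smult_b in auto)
      moreover have "finsum A (\<lambda>w. coord a w \<odot> b w) (insert s S) = coord a s \<odot> b s \<oplus> finsum A (\<lambda>w. coord a w \<odot> b w) S"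
        by (rule finsum_insert) (use insert smult_b in auto)
      ultimately show ?case
        using insert ij smult_b[of s] b_closed[of s] cl[of "b s"] cl[of "finsum A (\<lambda>w. coord a w \<odot> b w) S"]
        by (simp add: add smult N_def)
    qed
    from this[OF finite_W] show ?thesis using comb_coord[OF a] by (simp add: comb_def)
  qed
  \<comment> \<open>For \<open>n = 0\<close> the only matrix is zero, so \<open>B\<close> is empty
    and \<open>A\<close> is the zero algebra, whereas \<open>b u\<close> has the coordinate 1 at
    \<open>u\<close>.\<close>
  have n0: "n \<noteq> 0"
  proof
    assume n: "n = 0"
    have "B = {}"
    proof (rule ccontr)
      assume "B \<noteq> {}"
      then obtain y where y: "y \<in> B" by blast
      have "\<phi> y \<in> carrier_mat 0 0" using y B(1) cl n by (auto simp: AV.basis_def)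
      then have "\<phi> y = \<zero>\<^bsub>module_mat TYPE('f alg_closure) n n\<^esub>" by (intro eq_matI) (auto simp: module_mat_simps n)
      moreover have "UNIV \<noteq> {0 :: 'f alg_closure}" by (metis UNIV_I singletonD zero_neq_one)
      ultimately have "M.lin_dep (\<phi> ` B)"
        using M.zero_lin_dep[of "\<phi> ` B"] y by (metis class_ring_simps(1) class_ring_simps(5) imageI)
      then show False using B(2) by (simp add: M.basis_def)
    qed
    then have "carrier A = {\<zero>}" using B(1) by (auto simp: AV.basis_def AV.span_def AV.lincomb_def)
    then have "b u = \<zero>" using b_closed[OF u(1)] by simp
    moreover have "coord \<zero> u = 0" using coord_smult[of \<zero> u 0] u(1) smult_zero[of \<zero>] by simp
    ultimately show False using coord_b[OF u(1) u(1)] by simp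
  qed
  have N_mult: "(\<Sum>l<n. N w i l * N w' l j) = (\<Sum>w''\<in>W. to_ac (\<gamma> w w' w'') * N w'' i j)"
    if w: "w \<in> W" "w' \<in> W" and ij: "i < n" "j < n" for w w' i j
  proof -
    have "(\<Sum>l<n. N w i l * N w' l j) = (\<phi> (b w) * \<phi> (b w')) $$ (i, j)"
      using cl[OF b_closed[OF w(1)]] cl[OF b_closed[OF w(2)]] ij
      by (simp add: N_def scalar_prod_def lessThan_atLeast0)
    also have "\<dots> = (\<Sum>w''\<in>W. to_ac (coord (b w \<otimes> b w') w'') * N w'' i j)"
      using w ij b_closed by (simp add: mult[symmetric] phi_N)
    also have "\<dots> = (\<Sum>w''\<in>W. to_ac (\<gamma> w w' w'') * N w'' i j)"
    proof (intro sum.cong refl arg_cong2[of _ _ _ _ "(*)"] arg_cong[of _ _ to_ac])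
      fix x assume x: "x \<in> W"
      have "coord (b w \<otimes> b w') x = (\<Sum>y\<in>W. \<Sum>y'\<in>W. if w' = y' then (if w = y then \<gamma> w w' x else 0) else 0)"
        unfolding coord_mult[OF b_closed[OF w(1)] b_closed[OF w(2)] x]
        using w by (intro sum.cong refl) (auto simp: coord_b)
      also have "\<dots> = (\<Sum>y\<in>W. if w = y then \<gamma> w w' x else 0)"
        using w finite_W by (intro sum.cong refl) simp
      finally show "coord (b w \<otimes> b w') x = \<gamma> w w' x" using w finite_W by simp
    qed
    finally show ?thesis .
  qed
  \<comment> \<open>The image of \<open>B\<close> spans over the closure, and each of its elements
    is a combination of the \<open>N w\<close> by \<open>phi_N\<close>.\<close>
  have N_span: "\<exists>c. \<forall>i\<in>{..<n}. \<forall>j\<in>{..<n}. Z i j = (\<Sum>w\<in>W. c w * N w i j)" for Z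
  proof -
    have "mat n n (\<lambda>(i, j). Z i j) \<in> M.span (\<phi> ` B)"
      using B(2) by (auto simp: M.basis_def module_mat_simps)
    then obtain a F where F: "finite F" "F \<subseteq> \<phi> ` B" and eq: "mat n n (\<lambda>(i, j). Z i j) = M.lincomb a F"
      by (auto simp: M.span_def)
    have "B \<subseteq> carrier A" using B(1) by (simp add: AV.basis_def)
    then have "\<forall>v\<in>F. \<exists>y\<in>carrier A. v = \<phi> y" using F(2) by blast
    then obtain y where y: "\<And>v. v \<in> F \<Longrightarrow> y v \<in> carrier A \<and> v = \<phi> (y v)" by metis
    have "Z i j = (\<Sum>w\<in>W. (\<Sum>v\<in>F. a v * to_ac (coord (y v) w)) * N w i j)" if ij: "i < n" "j < n" for i j
    proof -
      have F_cl: "v \<in> carrier_mat n n" if "v \<in> F" for v using y[OF that] cl by metis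
      have "Z i j = M.lincomb a F $$ (i, j)" using ij by (simp add: eq[symmetric])
      also have "\<dots> = (\<Sum>v\<in>F. (a v \<cdot>\<^sub>m v) $$ (i, j))"
        unfolding M.lincomb_def
        using finsum_mat_index[OF F(1), of "\<lambda>v. a v \<cdot>\<^sub>m v" n n i j] ij F_cl by (simp add: module_mat_simps)
      also have "\<dots> = (\<Sum>v\<in>F. \<Sum>w\<in>W. a v * to_ac (coord (y v) w) * N w i j)"
      proof (intro sum.cong refl)
        fix v assume v: "v \<in> F"
        have "v $$ (i, j) = (\<Sum>w\<in>W. to_ac (coord (y v) w) * N w i j)"
          using y[OF v] phi_N[of "y v", OF _ ij] by metis
        then show "(a v \<cdot>\<^sub>m v) $$ (i, j) = (\<Sum>w\<in>W. a v * to_ac (coord (y v) w) * N w i j)"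
          using F_cl[OF v] ij by (simp add: sum_distrib_left mult.assoc)
      qed
      also have "\<dots> = (\<Sum>w\<in>W. (\<Sum>v\<in>F. a v * to_ac (coord (y v) w)) * N w i j)"
        by (subst sum.swap) (simp only: sum_distrib_right)
      finally show ?thesis .
    qed
    then show ?thesis by (intro exI[of _ "\<lambda>w. \<Sum>v\<in>F. a v * to_ac (coord (y v) w)"]) auto
  qed
  obtain s where s: "s * s = 1" "\<And>w. w \<in> W \<Longrightarrow> (\<Sum>i<n. N w i i) = s * (\<Sum>g\<in>G. T w g g)"
    using trace_unique[of "{..<n}" N] n0 N_mult N_span by auto
  have "mat_trace (\<phi> a) = s * (\<Sum>w\<in>W. to_ac (coord a w) * (\<Sum>g\<in>G. T w g g))" if a: "a \<in> carrier A" for a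
  proof -
    have "mat_trace (\<phi> a) = (\<Sum>i<n. \<Sum>w\<in>W. to_ac (coord a w) * N w i i)"
      using cl[OF a] a by (simp add: mat_trace_def phi_N)
    also have "\<dots> = (\<Sum>w\<in>W. to_ac (coord a w) * (\<Sum>i<n. N w i i))"
      by (subst sum.swap) (simp only: sum_distrib_left)
    also have "\<dots> = (\<Sum>w\<in>W. to_ac (coord a w) * (s * (\<Sum>g\<in>G. T w g g)))" by (simp add: s)
    finally show ?thesis by (simp add: sum_distrib_left mult_ac)
  qed
  then show thesis using that s(1) by blast
qed

end

section \<open>Values of monomials and the final bound\<close>

lemma (in valuation) val_power: "x \<noteq> 0 \<Longrightarrow> v (x ^ Suc n) = v (x ^ n) + v x"
  by (simp add: val_mult add.commute)

lemma (in valuation) val_prod: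
  assumes "finite S" "\<And>k. k \<in> S \<Longrightarrow> f k \<noteq> 0"
  shows "v (\<Prod>k\<in>S. f k) = (\<Sum>k\<in>S. v (f k))"
  using assms by (induction S) (auto simp: val_mult)

lemma lookup_val_power:
  fixes v :: "'f::field \<Rightarrow> (nat \<Rightarrow>\<^sub>0 int)"
  assumes "valuation v" "x \<noteq> 0"
  shows "Poly_Mapping.lookup (v (x ^ n)) i = int n * Poly_Mapping.lookup (v x) i"
proof -
  interpret valuation v by fact
  show ?thesis
  proof (induction n)
    case (Suc n)
    then show ?case unfolding val_power[OF assms(2)] lookup_add by (simp add: algebra_simps)
  qed simp
qed

lemma lookup_val_exp_mon:
  fixes v :: "'f::field \<Rightarrow> (nat \<Rightarrow>\<^sub>0 int)" and ix :: "'i + 'i \<Rightarrow> nat"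
  assumes v: "valuation v" and I: "finite I" and c: "c \<noteq> 0"
    and \<alpha>: "\<And>k. k \<in> I \<Longrightarrow> \<alpha> k \<noteq> 0 \<and> v (\<alpha> k) = Poly_Mapping.single (ix (Inl k)) 1"
    and \<beta>: "\<And>k. k \<in> I \<Longrightarrow> \<beta> k \<noteq> 0 \<and> v (\<beta> k) = Poly_Mapping.single (ix (Inr k)) 1"
  shows "Poly_Mapping.lookup (v (c ^ p * exp_mon I \<alpha> \<beta> w)) j =
    int p * Poly_Mapping.lookup (v c) j +
    (\<Sum>k\<in>I. (if ix (Inl k) = j then int (fst (w k)) else 0) + (if ix (Inr k) = j then int (snd (w k)) else 0))"
proof -
  interpret valuation v by fact
  have "exp_mon I \<alpha> \<beta> w \<noteq> 0" using \<alpha> \<beta> I by (simp add: exp_mon_def)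
  then have "v (c ^ p * exp_mon I \<alpha> \<beta> w) = v (c ^ p) + v (exp_mon I \<alpha> \<beta> w)" using c by (simp add: val_mult)
  also have "v (exp_mon I \<alpha> \<beta> w) = (\<Sum>k\<in>I. v (\<alpha> k ^ fst (w k) * \<beta> k ^ snd (w k)))"
    unfolding exp_mon_def by (rule val_prod[OF I]) (use \<alpha> \<beta> in auto)
  also have "\<dots> = (\<Sum>k\<in>I. v (\<alpha> k ^ fst (w k)) + v (\<beta> k ^ snd (w k)))"
    by (intro sum.cong refl val_mult) (use \<alpha> \<beta> in auto)
  finally have "Poly_Mapping.lookup (v (c ^ p * exp_mon I \<alpha> \<beta> w)) j =
      int p * Poly_Mapping.lookup (v c) j + (\<Sum>k\<in>I. int (fst (w k)) * Poly_Mapping.lookup (v (\<alpha> k)) j +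
        int (snd (w k)) * Poly_Mapping.lookup (v (\<beta> k)) j)"
    using c \<alpha> \<beta> by (simp add: lookup_add lookup_sum lookup_val_power[OF v])
  also have "(\<Sum>k\<in>I. int (fst (w k)) * Poly_Mapping.lookup (v (\<alpha> k)) j + int (snd (w k)) * Poly_Mapping.lookup (v (\<beta> k)) j) =
      (\<Sum>k\<in>I. (if ix (Inl k) = j then int (fst (w k)) else 0) + (if ix (Inr k) = j then int (snd (w k)) else 0))"
    by (intro sum.cong refl) (use \<alpha> \<beta> in \<open>auto simp: lookup_single when_def\<close>)
  finally show ?thesis .
qed

text \<open>At the position of a variable the value is congruent to the exponent of that variable
  modulo \<open>p\<close>, because \<open>c ^ p\<close> contributes a multiple of \<open>p\<close>.
  Exponents below \<open>p\<close> are thereby determined.\<close>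

lemma val_exp_mon_inj:
  fixes v :: "'f::field \<Rightarrow> (nat \<Rightarrow>\<^sub>0 int)" and ix :: "'i + 'i \<Rightarrow> nat"
  assumes v: "valuation v" and I: "finite I" and ix: "inj_on ix (I <+> I)"
    and \<alpha>: "\<And>k. k \<in> I \<Longrightarrow> \<alpha> k \<noteq> 0 \<and> v (\<alpha> k) = Poly_Mapping.single (ix (Inl k)) 1"
    and \<beta>: "\<And>k. k \<in> I \<Longrightarrow> \<beta> k \<noteq> 0 \<and> v (\<beta> k) = Poly_Mapping.single (ix (Inr k)) 1"
    and c: "c \<noteq> 0" "c' \<noteq> 0" and w: "w \<in> exp_set p I" "w' \<in> exp_set p I"
    and eq: "v (c ^ p * exp_mon I \<alpha> \<beta> w) = v (c' ^ p * exp_mon I \<alpha> \<beta> w')"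
  shows "w = w'"
proof -
  have mod_eq: "a = b" if "int p * x + int a = int p * y + int b" "a < p" "b < p" for x y :: int and a b
  proof -
    have "(int p * x + int a) mod int p = (int p * y + int b) mod int p" using that(1) by simp
    then show ?thesis using that(2,3) by simp
  qed
  have "w k = w' k" if k: "k \<in> I" for k
  proof (rule prod_eqI)
    have ixl: "ix (Inl k') = ix (Inl k) \<longleftrightarrow> k' = k" "ix (Inr k') \<noteq> ix (Inl k)"
      and ixr: "ix (Inr k') = ix (Inr k) \<longleftrightarrow> k' = k" "ix (Inl k') \<noteq> ix (Inr k)" if "k' \<in> I" for k'
      using inj_on_eq_iff[OF ix] k that by auto
    have bd: "w k \<in> {..<p} \<times> {..<p}" "w' k \<in> {..<p} \<times> {..<p}"
      using w k by (auto simp: exp_set_def dest!: PiE_mem)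
    have l: "Poly_Mapping.lookup (v (d ^ p * exp_mon I \<alpha> \<beta> x)) (ix (Inl k)) =
        int p * Poly_Mapping.lookup (v d) (ix (Inl k)) + int (fst (x k))" if "d \<noteq> 0" for d x
    proof -
      have "(\<Sum>k'\<in>I. (if ix (Inl k') = ix (Inl k) then int (fst (x k')) else 0) +
          (if ix (Inr k') = ix (Inl k) then int (snd (x k')) else 0)) = (\<Sum>k'\<in>I. if k' = k then int (fst (x k')) else 0)"
        by (intro sum.cong refl) (simp add: ixl)
      then show ?thesis using lookup_val_exp_mon[OF v I that \<alpha> \<beta>, of p x "ix (Inl k)"] I k by simp
    qed
    have r: "Poly_Mapping.lookup (v (d ^ p * exp_mon I \<alpha> \<beta> x)) (ix (Inr k)) =
        int p * Poly_Mapping.lookup (v d) (ix (Inr k)) + int (snd (x k))" if "d \<noteq> 0" for d x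
    proof -
      have "(\<Sum>k'\<in>I. (if ix (Inl k') = ix (Inr k) then int (fst (x k')) else 0) +
          (if ix (Inr k') = ix (Inr k) then int (snd (x k')) else 0)) = (\<Sum>k'\<in>I. if k' = k then int (snd (x k')) else 0)"
        by (intro sum.cong refl) (simp add: ixr)
      then show ?thesis using lookup_val_exp_mon[OF v I that \<alpha> \<beta>, of p x "ix (Inr k)"] I k by simp
    qed
    show "fst (w k) = fst (w' k)"
    proof (rule mod_eq)
      show "int p * Poly_Mapping.lookup (v c) (ix (Inl k)) + int (fst (w k)) =
          int p * Poly_Mapping.lookup (v c') (ix (Inl k)) + int (fst (w' k))"
        using l[OF c(1), of w] l[OF c(2), of w'] eq by simp
    qed (use bd in auto)
    show "snd (w k) = snd (w' k)"
    proof (rule mod_eq)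
      show "int p * Poly_Mapping.lookup (v c) (ix (Inr k)) + int (snd (w k)) =
          int p * Poly_Mapping.lookup (v c') (ix (Inr k)) + int (snd (w' k))"
        using r[OF c(1), of w] r[OF c(2), of w'] eq by simp
    qed (use bd in auto)
  qed
  then show ?thesis using w unfolding exp_set_def by (auto intro: PiE_ext)
qed

lemma (in split_algebra) coord_pow:
  fixes v :: "'f \<Rightarrow> 'h::linordered_ab_group_add" and n :: nat
  assumes alg: "leading_algebra v p W \<mu> \<gamma> opr lam u" and a: "a \<in> carrier A"
    and f: "\<And>w. w \<in> W \<Longrightarrow> f w = coord a w" and w: "w \<in> W"
  shows "leading_algebra.pw W \<gamma> u f n w = coord (a [^] n) w"
proof -
  interpret L: leading_algebra v p W \<mu> \<gamma> opr lam u by (rule alg)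
  show ?thesis
    using w
  proof (induction n arbitrary: w)
    case 0
    then show ?case using u coord_b[OF u(1), of w] by (simp add: unit_vec_at_def)
  next
    case (Suc n)
    have "a [^] n \<in> carrier A" using a by simp
    then show ?case using Suc a by (simp add: L.star_def coord_mult f)
  qed
qed

text \<open>From \<open>s * s = 1\<close> the unknown factor is a sign. It keeps the trace in the
  base field, where \<open>of_ac\<close> inverts \<open>to_ac\<close>, and does not affect whether
  it vanishes.\<close>

lemma (in split_algebra) reduced_trace_zeroD:
  assumes T: "\<And>w. w \<in> W \<Longrightarrow> (\<Sum>g\<in>G. T w g g) = (if w = e then to_ac \<tau> else 0)"
    and e: "e \<in> W" and \<tau>: "\<tau> \<noteq> 0" and a: "a \<in> carrier A" and tr: "reduced_trace A a = 0"
  shows "coord a e = 0"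
proof -
  have "\<exists>n. splitting A n (SOME \<phi>. \<exists>n. splitting A n \<phi>)"
    by (rule someI_ex[of "\<lambda>\<phi>. \<exists>n. splitting A n \<phi>"]) (use exists_splitting in blast)
  then obtain n where n: "splitting A n (SOME \<phi>. \<exists>n. splitting A n \<phi>)" ..
  obtain s where s: "s * s = 1" and *: "\<And>a. a \<in> carrier A \<Longrightarrow>
      mat_trace ((SOME \<phi>. \<exists>n. splitting A n \<phi>) a) = s * (\<Sum>w\<in>W. to_ac (coord a w) * (\<Sum>g\<in>G. T w g g))"
    by (rule splitting_trace[OF n]) (rule that)
  have "(\<Sum>w\<in>W. to_ac (coord a w) * (\<Sum>g\<in>G. T w g g)) = (\<Sum>w\<in>W. if w = e then to_ac (coord a w * \<tau>) else 0)"
    by (intro sum.cong refl) (simp add: T)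
  also have "\<dots> = to_ac (coord a e * \<tau>)" using e finite_W by simp
  finally have "mat_trace ((SOME \<phi>. \<exists>n. splitting A n \<phi>) a) = s * to_ac (coord a e * \<tau>)" using *[OF a] by simp
  moreover have "s = 1 \<or> s = - 1" using s by (simp add: square_eq_1_iff)
  ultimately have "mat_trace ((SOME \<phi>. \<exists>n. splitting A n \<phi>) a) = to_ac (coord a e * \<tau>) \<or>
      mat_trace ((SOME \<phi>. \<exists>n. splitting A n \<phi>) a) = to_ac (- (coord a e * \<tau>))"
    by (auto simp: to_ac_minus)
  then have "reduced_trace A a = coord a e * \<tau> \<or> reduced_trace A a = - (coord a e * \<tau>)"
    unfolding reduced_trace_def by (metis of_ac_to_ac)
  then show ?thesis using tr \<tau> by auto
qed

text \<open>The common core of both base fields and both kinds of symbols: the field enters only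
  through a valuation that is trivial on the constants and sends the variables to distinct unit
  vectors.\<close>

theorem symbol_subspace_bound:
  fixes v :: "'f::field \<Rightarrow> (nat \<Rightarrow>\<^sub>0 int)" and I :: "'i set" and ix :: "'i + 'i \<Rightarrow> nat"
  defines "A \<equiv> \<lambda>p \<rho> \<delta> I \<alpha> \<beta>. tensor_product I (\<lambda>k. any_symbol_algebra p \<rho> \<delta> (\<alpha> k) (\<beta> k))"
  assumes par: "symbol_parameters p \<rho> \<delta>" and I: "finite I" and v: "valuation v"
    and K: "0 \<in> K" "1 \<in> K" "\<And>x y. x \<in> K \<Longrightarrow> y \<in> K \<Longrightarrow> x + y \<in> K" "\<And>x y. x \<in> K \<Longrightarrow> y \<in> K \<Longrightarrow> x * y \<in> K"
      "\<And>x. x \<in> K \<Longrightarrow> x \<noteq> 0 \<Longrightarrow> v x = 0"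
    and \<rho>: "\<rho> \<in> K" and ix: "inj_on ix (I <+> I)"
    and \<alpha>: "\<And>k. k \<in> I \<Longrightarrow> \<alpha> k \<noteq> 0 \<and> v (\<alpha> k) = Poly_Mapping.single (ix (Inl k)) 1"
    and \<beta>: "\<And>k. k \<in> I \<Longrightarrow> \<beta> k \<noteq> 0 \<and> v (\<beta> k) = Poly_Mapping.single (ix (Inr k)) 1"
    and int_nz: "\<And>n. 0 < n \<Longrightarrow> n < p \<Longrightarrow> of_nat n \<noteq> (0 :: 'f)"
    and V: "VectorSpace.subspace class_ring V (A p \<rho> \<delta> I \<alpha> \<beta>)"
    and tr: "\<And>a. a \<in> V \<Longrightarrow> reduced_trace (A p \<rho> \<delta> I \<alpha> \<beta>) (a [^]\<^bsub>A p \<rho> \<delta> I \<alpha> \<beta>\<^esub> (p - 1)) = 0"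
  shows "vectorspace.fin_dim class_ring ((A p \<rho> \<delta> I \<alpha> \<beta>)\<lparr>carrier := V\<rparr>) \<and>
    vectorspace.dim class_ring ((A p \<rho> \<delta> I \<alpha> \<beta>)\<lparr>carrier := V\<rparr>) \<le> (p ^ (2 * card I) - 1) div (p - 1)"
proof -
  let ?S = "\<lambda>k. any_symbol_algebra p \<rho> \<delta> (\<alpha> k) (\<beta> k)"
  let ?U = "{..<p} \<times> {..<p}" and ?W = "exp_set p I"
  have p: "prime p" using par by (simp add: symbol_parameters_def)
  then have p1: "p > 1" by (rule prime_gt_1_nat)
  have A: "A p \<rho> \<delta> I \<alpha> \<beta> = tensor_product I ?S" by (simp add: A_def)
  have "\<exists>ev s. split_symbol p \<rho> \<delta> (\<alpha> k) (\<beta> k) ev s" if "k \<in> I" for k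
    using exists_split_symbol[OF par] \<alpha>[OF that] \<beta>[OF that] by blast
  then obtain ev s where sp: "\<And>k. k \<in> I \<Longrightarrow> split_symbol p \<rho> \<delta> (\<alpha> k) (\<beta> k) (ev k) (s k)" by metis
  define good where "good = (\<lambda>k \<psi> B. matrix_rep (?S k) {..<p} \<psi> \<and> (\<forall>u. B u \<in> carrier (?S k)) \<and>
    (\<forall>u g h. g < p \<longrightarrow> h < p \<longrightarrow> \<psi> (B u) g h = split_symbol.smat p (ev k) (s k) u g h) \<and>
    B (0, 0) = \<one>\<^bsub>?S k\<^esub> \<and> carrier (?S k) \<subseteq> lspan (?S k) (B ` ?U))"
  have "\<exists>\<psi> B. good k \<psi> B" if k: "k \<in> I" for k
  proof -
    obtain \<psi> B where "matrix_rep (?S k) {..<p} \<psi>" "\<And>u. B u \<in> carrier (?S k)"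
      "\<And>u g h. g < p \<Longrightarrow> h < p \<Longrightarrow> \<psi> (B u) g h = split_symbol.smat p (ev k) (s k) u g h"
      "B (0, 0) = \<one>\<^bsub>?S k\<^esub>" "carrier (?S k) \<subseteq> lspan (?S k) (B ` ?U)"
      using split_symbol.symbol_algebra_basis[OF sp[OF k] par] by blast
    then show ?thesis unfolding good_def by blast
  qed
  then obtain \<psi> B where good: "\<And>k. k \<in> I \<Longrightarrow> good k (\<psi> k) (B k)" by metis
  obtain \<Psi> b where rep: "matrix_rep (tensor_product I ?S) (\<Pi>\<^sub>E k\<in>I. {..<p}) \<Psi>"
    and b_cl: "\<And>w. w \<in> ?W \<Longrightarrow> b w \<in> carrier (tensor_product I ?S)"
    and rep_b: "\<And>w g h. w \<in> ?W \<Longrightarrow> g \<in> (\<Pi>\<^sub>E k\<in>I. {..<p}) \<Longrightarrow> h \<in> (\<Pi>\<^sub>E k\<in>I. {..<p}) \<Longrightarrow>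
        \<Psi> (b w) g h = (\<Prod>k\<in>I. \<psi> k (B k (w k)) (g k) (h k))"
    and b_one: "\<And>w. w \<in> ?W \<Longrightarrow> (\<And>k. k \<in> I \<Longrightarrow> B k (w k) = \<one>\<^bsub>?S k\<^esub>) \<Longrightarrow> b w = \<one>\<^bsub>tensor_product I ?S\<^esub>"
    and b_span: "carrier (tensor_product I ?S) \<subseteq> lspan (tensor_product I ?S) (b ` ?W)"
  proof (rule tensor_product_basis[OF I, of "{..<p}" ?S \<psi> ?U B])
    show "finite {..<p}" by simp
    show "matrix_rep (?S k) {..<p} (\<psi> k)" if "k \<in> I" for k using good[OF that] unfolding good_def by blast
    show "B k u \<in> carrier (?S k)" if "k \<in> I" for k u using good[OF that] unfolding good_def by blast
    show "carrier (?S k) \<subseteq> lspan (?S k) (B k ` ?U)" if "k \<in> I" for k using good[OF that] unfolding good_def by blast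
  qed (auto simp: exp_set_def)
  have smat: "\<psi> k (B k u) g h = split_symbol.smat p (ev k) (s k) u g h" if "k \<in> I" "g < p" "h < p" for k u g h
    using good[OF that(1)] that(2,3) unfolding good_def by blast
  have zero_in: "exp_zero I \<in> ?W" using p1 by (auto simp: exp_zero_def exp_set_def)
  interpret MB: matrix_basis ?W "\<Pi>\<^sub>E k\<in>I. {..<p}" "tensor_mat p I ev s" "tensor_dmat p I ev s"
    "\<lambda>w w' w''. to_ac (symbol_gamma p \<rho> \<delta> I \<alpha> \<beta> w w' w'')"
    by (rule tensor_matrix_basis[OF I sp])
  interpret R: matrix_rep "A p \<rho> \<delta> I \<alpha> \<beta>" "\<Pi>\<^sub>E k\<in>I. {..<p}" \<Psi> unfolding A by (rule rep)
  interpret SA: split_algebra "A p \<rho> \<delta> I \<alpha> \<beta>" "\<Pi>\<^sub>E k\<in>I. {..<p}" \<Psi> ?W "tensor_mat p I ev s" "tensor_dmat p I ev s"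
    "symbol_gamma p \<rho> \<delta> I \<alpha> \<beta>" b "exp_zero I"
  proof
    show "b w \<in> carrier (A p \<rho> \<delta> I \<alpha> \<beta>)" if "w \<in> ?W" for w unfolding A by (rule b_cl[OF that])
    show "\<Psi> (b w) g h = tensor_mat p I ev s w g h"
      if "w \<in> ?W" "g \<in> (\<Pi>\<^sub>E k\<in>I. {..<p})" "h \<in> (\<Pi>\<^sub>E k\<in>I. {..<p})" for w g h
      unfolding rep_b[OF that] tensor_mat_def
      by (intro prod.cong refl smat) (use that in \<open>auto dest: PiE_mem\<close>)
    show "carrier (A p \<rho> \<delta> I \<alpha> \<beta>) \<subseteq> lspan (A p \<rho> \<delta> I \<alpha> \<beta>) (b ` ?W)" unfolding A by (rule b_span)
    show "b (exp_zero I) = \<one>\<^bsub>A p \<rho> \<delta> I \<alpha> \<beta>\<^esub>"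
      unfolding A using good by (intro b_one zero_in) (simp add: exp_zero_def good_def)
  qed (rule zero_in)
  let ?e = "trace_exp p \<delta> I"
  \<comment> \<open>The trace of the basis element at \<open>?e\<close>: a power of
    \<open>p\<close>, which is nonzero in the field if \<open>\<delta> = 0\<close>, or a
    sign.\<close>
  define \<tau> where "\<tau> = (if \<delta> = 0 then of_nat p else - 1 :: 'f) ^ card I"
  have e: "?e \<in> ?W" using p1 by (auto simp: trace_exp_def exp_set_def)
  have \<tau>: "\<tau> \<noteq> 0" using par by (auto simp: \<tau>_def symbol_parameters_def)
  have \<rho>p: "\<rho> ^ p = 1" using par by (auto simp: symbol_parameters_def)
  have alg: "leading_algebra v p ?W (exp_mon I \<alpha> \<beta>) (symbol_gamma p \<rho> \<delta> I \<alpha> \<beta>)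
    (exp_add p I) (carry p \<rho> I \<alpha> \<beta>) (exp_zero I)"
  proof (rule valuation.symbol_leading_algebra[OF v p1 I, where K = K])
    show "\<alpha> k \<noteq> 0 \<and> v (\<alpha> k) > 0 \<and> \<beta> k \<noteq> 0" if "k \<in> I" for k
      using \<alpha>[OF that] \<beta>[OF that] single_less[of "ix (Inl k)" 0 0 0 1] by simp
    show "\<delta> \<in> K" using par K by (auto simp: symbol_parameters_def)
    show "w = w'" if "c \<noteq> 0" "c' \<noteq> 0" "w \<in> ?W" "w' \<in> ?W"
      "v (c ^ p * exp_mon I \<alpha> \<beta> w) = v (c' ^ p * exp_mon I \<alpha> \<beta> w')" for c c' w w'
      by (rule val_exp_mon_inj[OF v I ix \<alpha> \<beta> that])
  qed (use K \<rho> \<rho>p in auto)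
  interpret sub: submodule class_ring V "A p \<rho> \<delta> I \<alpha> \<beta>" using V by (simp add: subspace_def)
  have V_carrier: "a \<in> carrier (A p \<rho> \<delta> I \<alpha> \<beta>)" if "a \<in> V" for a using sub.subset that by blast
  \<comment> \<open>The functions are prescribed on \<open>exp_set p I\<close> only, as this is
    where coordinates are known to be linear.\<close>
  define V' where "V' = {f. \<exists>a\<in>V. \<forall>w\<in>?W. f w = SA.coord a w}"
  have of_nat_K: "of_nat n \<in> K" for n using K by (induction n) auto
  obtain C where C: "C \<subseteq> ?W" "card C \<le> (p ^ (2 * card I) - 1) div (p - 1)"
    and C_inj: "\<And>f w. f \<in> V' \<Longrightarrow> (\<And>w. w \<in> C \<Longrightarrow> f w = 0) \<Longrightarrow> w \<in> ?W \<Longrightarrow> f w = 0"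
  proof (rule leading_class_bound[OF alg p I e \<rho>p, of V'])
    show "\<rho> = 1 \<or> ?e = exp_zero I"
      using par by (auto simp: symbol_parameters_def trace_exp_def exp_zero_def)
    show "v (of_nat n) = 0" if "of_nat n \<noteq> (0 :: 'f)" for n using K(5) of_nat_K that by blast
    show "(\<lambda>x. f x + g x) \<in> V'" if fg: "f \<in> V'" "g \<in> V'" for f g
    proof -
      obtain a a' where a: "a \<in> V" "a' \<in> V" "\<forall>w\<in>?W. f w = SA.coord a w" "\<forall>w\<in>?W. g w = SA.coord a' w"
        using fg by (auto simp: V'_def)
      then show ?thesis unfolding V'_def
        by (auto simp: SA.coord_add V_carrier intro!: bexI[of _ "a \<oplus>\<^bsub>A p \<rho> \<delta> I \<alpha> \<beta>\<^esub> a'"] sub.m_closed)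
    qed
    show "(\<lambda>x. c * f x) \<in> V'" if f: "f \<in> V'" for c f
    proof -
      obtain a where a: "a \<in> V" "\<forall>w\<in>?W. f w = SA.coord a w" using f by (auto simp: V'_def)
      then show ?thesis unfolding V'_def
        by (auto simp: SA.coord_smult V_carrier intro!: bexI[of _ "c \<odot>\<^bsub>A p \<rho> \<delta> I \<alpha> \<beta>\<^esub> a"] sub.smult_closed)
    qed
    show "leading_algebra.pw ?W (symbol_gamma p \<rho> \<delta> I \<alpha> \<beta>) (exp_zero I) f (p - 1) ?e = 0" if f: "f \<in> V'" for f
    proof -
      obtain a where a: "a \<in> V" "\<And>w. w \<in> ?W \<Longrightarrow> f w = SA.coord a w" using f by (auto simp: V'_def)
      have "SA.coord (a [^]\<^bsub>A p \<rho> \<delta> I \<alpha> \<beta>\<^esub> (p - 1)) ?e = 0"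
      proof (rule SA.reduced_trace_zeroD[OF _ e \<tau> _ tr[OF a(1)]])
        show "(\<Sum>g\<in>(\<Pi>\<^sub>E k\<in>I. {..<p}). tensor_mat p I ev s w g g) = (if w = ?e then to_ac \<tau> else 0)" if "w \<in> ?W" for w
          using tensor_mat_trace[OF I sp par that] unfolding \<tau>_def by simp
        show "a [^]\<^bsub>A p \<rho> \<delta> I \<alpha> \<beta>\<^esub> (p - 1) \<in> carrier (A p \<rho> \<delta> I \<alpha> \<beta>)"
          using V_carrier[OF a(1)] by (rule R.nat_pow_closed)
      qed
      then show ?thesis using SA.coord_pow[OF alg V_carrier[OF a(1)] a(2) e] by simp
    qed
  qed (use int_nz in auto)
  \<comment> \<open>The value 0 outside \<open>exp_set p I\<close> gives linearity at every
    \<open>w\<close>, as \<open>dim_le_card_coordinates\<close> asks.\<close>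
  define \<kappa> where "\<kappa> = (\<lambda>a w. if w \<in> ?W then SA.coord a w else 0)"
  have "finite C" using C(1) MB.finite_W by (rule finite_subset)
  then have "vectorspace.fin_dim class_ring ((A p \<rho> \<delta> I \<alpha> \<beta>)\<lparr>carrier := V\<rparr>) \<and>
    vectorspace.dim class_ring ((A p \<rho> \<delta> I \<alpha> \<beta>)\<lparr>carrier := V\<rparr>) \<le> card C"
  proof (rule R.dim_le_card_coordinates[of C V \<kappa>, OF _ V])
    show "a = \<zero>\<^bsub>A p \<rho> \<delta> I \<alpha> \<beta>\<^esub>" if a: "a \<in> V" "\<And>w. w \<in> C \<Longrightarrow> \<kappa> a w = 0" for a
    proof (rule SA.coord_zero_imp[OF V_carrier[OF a(1)]])
      fix w assume "w \<in> ?W"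
      moreover have "SA.coord a \<in> V'" using a(1) by (auto simp: V'_def)
      moreover have "SA.coord a x = 0" if "x \<in> C" for x using a(2)[OF that] C(1) that by (auto simp: \<kappa>_def)
      ultimately show "SA.coord a w = 0" using C_inj by blast
    qed
  qed (simp_all add: \<kappa>_def SA.coord_add SA.coord_smult)
  then show ?thesis using C(2) by linarith
qed

theorem theorem5p1:
  fixes p m :: nat
    and F\<^sub>0 :: "'f::field set"
    and \<rho> :: 'f
    and \<alpha> \<beta> :: "nat \<Rightarrow> 'f"
    and V :: "((nat \<Rightarrow> (symbol_generator list \<Rightarrow> 'f) set) \<Rightarrow> 'f) set set"
  assumes "prime p"
    and "m \<ge> 1"
    and "subfield F\<^sub>0 class_ring"
    and "CHAR('f) = 0 \<or> CHAR('f) \<ge> p"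
    and "CHAR('f) \<noteq> p \<Longrightarrow> \<rho> \<in> F\<^sub>0 \<and> primitive_root_of_unity p \<rho>"
    and "algebraically_independent F\<^sub>0 ({1..m} <+> {1..m}) (case_sum \<alpha> \<beta>)"
    and "generate_field class_ring (F\<^sub>0 \<union> \<alpha> ` {1..m} \<union> \<beta> ` {1..m}) = (UNIV :: 'f set) \<or>
         iterated_laurent_series_field F\<^sub>0
           (concat (map (\<lambda>i. [inverse (\<alpha> i), inverse (\<beta> i)]) [1..<Suc m])) (UNIV :: 'f set)"
    and "VectorSpace.subspace class_ring V (tensor_of_symbols p \<rho> m \<alpha> \<beta>)"
    and "\<And>v. v \<in> V \<Longrightarrow> reduced_trace (tensor_of_symbols p \<rho> m \<alpha> \<beta>)
                          (v [^]\<^bsub>tensor_of_symbols p \<rho> m \<alpha> \<beta>\<^esub> (p - 1)) = 0"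
  shows "vectorspace.fin_dim class_ring ((tensor_of_symbols p \<rho> m \<alpha> \<beta>)\<lparr>carrier := V\<rparr>) \<and>
         vectorspace.dim class_ring ((tensor_of_symbols p \<rho> m \<alpha> \<beta>)\<lparr>carrier := V\<rparr>)
           \<le> (p ^ (2 * m) - 1) div (p - 1)"
proof -
  let ?I = "{1..m} :: nat set"
  define \<delta> where "\<delta> = (if CHAR('f) = p then 1 else 0 :: 'f)"
  \<comment> \<open>In characteristic \<open>p\<close> the given \<rho> is arbitrary; the value 1
    brings the relations into the uniform shape.\<close>
  define \<rho>' where "\<rho>' = (if CHAR('f) = p then 1 else \<rho>)"
  have p1: "p > 1" using assms(1) by (rule prime_gt_1_nat)
  have int_nz: "of_nat n \<noteq> (0 :: 'f)" if "0 < n" "n < p" for n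
  proof
    assume "of_nat n = (0 :: 'f)"
    then have "CHAR('f) dvd n" by (simp only: of_nat_eq_0_iff_char_dvd)
    then have "CHAR('f) \<noteq> 0" "CHAR('f) \<le> n" using that(1) by (auto dest: dvd_imp_le)
    then show False using assms(4) that by linarith
  qed
  have "of_nat p \<noteq> (0 :: 'f)" if "CHAR('f) \<noteq> p"
  proof
    assume "of_nat p = (0 :: 'f)"
    then have "CHAR('f) dvd p" by (simp only: of_nat_eq_0_iff_char_dvd)
    \<comment> \<open>A proper divisor of the prime \<open>p\<close> is 1, which is neither 0 nor at
      least \<open>p\<close>.\<close>
    then have "CHAR('f) = 1" using that assms(1) by (auto simp: prime_nat_iff)
    then show False using assms(4) p1 by linarith
  qed
  then have par: "symbol_parameters p \<rho>' \<delta>"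
    using assms(1,5) by (auto simp: symbol_parameters_def \<rho>'_def \<delta>_def primitive_root_of_unity_def)
  have A: "tensor_of_symbols p \<rho> m \<alpha> \<beta> = tensor_product ?I (\<lambda>k. any_symbol_algebra p \<rho>' \<delta> (\<alpha> k) (\<beta> k))"
    by (simp add: tensor_of_symbols_def any_symbol_algebra_def \<rho>'_def \<delta>_def)
  note K = subfield_class_ringD[OF assms(3)]
  obtain v :: "'f \<Rightarrow> (nat \<Rightarrow>\<^sub>0 int)" and ix :: "nat + nat \<Rightarrow> nat" where v: "valuation v"
    and v_K: "\<And>c. c \<in> F\<^sub>0 \<Longrightarrow> c \<noteq> 0 \<Longrightarrow> v c = 0" and ix: "inj_on ix (?I <+> ?I)"
    and v_t: "\<And>i. i \<in> ?I <+> ?I \<Longrightarrow> case_sum \<alpha> \<beta> i \<noteq> 0 \<and> v (case_sum \<alpha> \<beta> i) = Poly_Mapping.single (ix i) 1"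
  proof (cases "generate_field class_ring (F\<^sub>0 \<union> \<alpha> ` ?I \<union> \<beta> ` ?I) = (UNIV :: 'f set)")
    case True
    \<comment> \<open>Even and odd positions keep the two families apart; in a rational function
      field any numbering of the variables will do.\<close>
    define ix :: "nat + nat \<Rightarrow> nat" where "ix = case_sum (\<lambda>i. 2 * i) (\<lambda>i. 2 * i + 1)"
    have ix: "inj_on ix (?I <+> ?I)"
    proof (rule inj_onI)
      fix i j assume "ix i = ix j"
      then show "i = j" unfolding ix_def by (cases i; cases j; simp; presburger)
    qed
    have "case_sum \<alpha> \<beta> ` (?I <+> ?I) = \<alpha> ` ?I \<union> \<beta> ` ?I"
      by (simp add: Plus_def image_Un image_image)
    then have "generate_field class_ring (F\<^sub>0 \<union> case_sum \<alpha> \<beta> ` (?I <+> ?I)) = (UNIV :: 'f set)"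
      using True by (simp only: Un_assoc)
    from rational_valuation[OF assms(3,6) this ix] obtain v' :: "'f \<Rightarrow> (nat \<Rightarrow>\<^sub>0 int)" where
      "valuation v'" "\<And>c. c \<in> F\<^sub>0 \<Longrightarrow> c \<noteq> 0 \<Longrightarrow> v' c = 0"
      "\<And>i. i \<in> ?I <+> ?I \<Longrightarrow> case_sum \<alpha> \<beta> i \<noteq> 0 \<and> v' (case_sum \<alpha> \<beta> i) = Poly_Mapping.single (ix i) 1" by blast
    then show ?thesis using that ix by blast
  next
    case False
    then have L: "iterated_laurent_series_field F\<^sub>0
        (concat (map (\<lambda>i. [inverse (\<alpha> i), inverse (\<beta> i)]) [1..<Suc m])) (UNIV :: 'f set)"
      using assms(7) by blast
    show ?thesis
    proof (rule laurent_valuation[OF K(1,2) _ _ L])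
    qed (fact K(3), fact K(4), rule that)
  qed
  have "vectorspace.fin_dim class_ring ((tensor_product ?I (\<lambda>k. any_symbol_algebra p \<rho>' \<delta> (\<alpha> k) (\<beta> k)))\<lparr>carrier := V\<rparr>) \<and>
    vectorspace.dim class_ring ((tensor_product ?I (\<lambda>k. any_symbol_algebra p \<rho>' \<delta> (\<alpha> k) (\<beta> k)))\<lparr>carrier := V\<rparr>)
      \<le> (p ^ (2 * card ?I) - 1) div (p - 1)"
  proof (rule symbol_subspace_bound[OF par _ v K(1-4) v_K _ ix])
    show "\<rho>' \<in> F\<^sub>0" using assms(5) K(2) by (simp add: \<rho>'_def)
    show "\<alpha> k \<noteq> 0 \<and> v (\<alpha> k) = Poly_Mapping.single (ix (Inl k)) 1" if "k \<in> ?I" for k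
      using v_t[OF InlI[OF that]] by simp
    show "\<beta> k \<noteq> 0 \<and> v (\<beta> k) = Poly_Mapping.single (ix (Inr k)) 1" if "k \<in> ?I" for k
      using v_t[OF InrI[OF that]] by simp
  qed (use int_nz assms(8,9) in \<open>simp_all add: A\<close>)
  then show ?thesis unfolding A by simp
qed

end
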